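(* Let $\mathcal G=(\mathcal B\cup\mathcal W,\mathcal E)$ be a reduced planar bipartite graph in the disk of type $(k,n)$ with black boundary vertices $b_1,\dots,b_n$ and irreducible positroid $\mathcal M$, and let $\sigma$ be a Kasteleyn signature on it. Let $t_{bw}:\mathcal E\to\mathbb C^*$ be edge weights, let $f$ be the corresponding face weights, and let $[A]\in\Pi_{\mathcal M}\subset Gr(k,n)$ be the point represented by the network $(\mathcal G,t_{bw})$. Let $v=\{v_b\in\mathbb C^{n-k}: b\in\mathcal B\}$ be vectors such that $v_{b_1},\dots,v_{b_n}$ span $\mathbb C^{n-k}$ and $$\sum_{b\in\mathcal B:\ \overline{bw}\in\mathcal E}\sigma(\overline{bw})\,t_{bw}\,v_b=0\qquad\text{for all } w\in\mathcal W .$$ Then the $(n-k)\times n$ matrix $\bar A^{o}=(v_{b_1},v_{b_2},\dots,v_{b_n})$, whose columns are the vectors at the boundary vertices, is orthogonal to $[A]$: if $A=(A^i_j)$ is a representative matrix of $[A]$, then $A\,(\bar A^{o})^T=\big(\sum_{j=1}^nA^i_j(\bar A^o)^l_j\big)_{i\in[k],\,l\in[n-k]}=0$. Moreover, if $u=\{u_b\}$ is another such family of vectors for the same edge weights, then the matrix $(u_{b_1},\dots,u_{b_n})$ represents the same point $[\bar A^o]\in Gr(n-k,n)$. Finally, $[\bar A^o]$ is the point in the dual positroid variety $\Pi_{\overline{\mathcal M}}$ represented by the dual network $(\overline{\mathcal G},\bar f')$, where $\overline{\mathcal G}$ is obtained from $\mathcal G$ by changing the color of all vertices, boundary vertices included,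 and $\bar f'$ is the face weighting with $$\bar f'_i=\begin{cases} f_i^{-1},&\text{if }\Omega_i\text{ is an internal face},\\ (-1)^{b_{\Omega_i}}f_i^{-1},&\text{if }\Omega_i\text{ is a finite external face},\end{cases}\qquad b_{\Omega_i}=\tfrac12\,\#\{\text{boundary vertices } b_j\in\partial\Omega_i\}.$$
   Context: A planar bipartite graph in the disk is a finite undirected planar graph $\mathcal G=(\mathcal V=\mathcal B\cup\mathcal W,\mathcal E)$ drawn in a closed disk such that: internal vertices lie strictly inside the disk and are black or white; there are $n>0$ boundary vertices on the boundary circle, labeled $b_1,\dots,b_n$ clockwise, all of the same color and of degree one; every edge joins vertices of different colors; and $\mathcal G$ has a perfect orientation, i.e. a choice of directions of edges such that each internal black vertex has exactly one outgoing edge and each internal white vertex exactly one incoming edge. $\mathcal B,\mathcal W$ denote all black, resp. white, vertices, boundary ones included. The source set $I(\mathcal O)\subset[n]$ of a perfect orientation is the set of indices of the boundary sources; all source sets have the same cardinality $k$ (type $(k,n)$), and $\mathcal M=\{I(\mathcal O)\}$ is a positroid. It is irreducible if for each $j\in[n]$ there are $I,J\in\mathcal M$ with $j\in I$, $j\notin J$. $\mathcal G$ is reduced if: every component contains a boundary vertex; every internal vertex of degree 1 is adjacent to a boundary vertex; at most one edge joins any given pair of vertices; the number of faces is minimal among graphs with the same positroid. $\Pi_{\mathcal M}=\{[A]\in Gr(k,n):\Delta_I(A)=0\text{ if }I\notin\mathcal M\}$ is the positroid variety, and the dual positroid is $\overline{\mathcal M}=\{[n]\setminus I: I\in\mathcal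 M\}$. Faces are the connected components of the complement of $\mathcal G$ in the disk; $\Omega_0$, the infinite face, is the one containing the boundary arc going clockwise from $b_n$ to $b_1$; the others, $\Omega_i$, are finite. A face is internal if its boundary does not meet the boundary of the disk, otherwise external. $|\Omega|$ is the number of edges of $\mathcal G$ bounding $\Omega$. A Kasteleyn signature is $\sigma:\mathcal E\to\{\pm1\}$ with $\prod_{e\in\partial\Omega}\sigma(e)=(-1)^{|\Omega|/2+1}$ for every finite face $\Omega$. Face weights: given edge weights $t_{bw}$, traverse the boundary of $\Omega$ clockwise; the face weight $f_\Omega$ is the product of the weights of the edges traversed from black to white divided by the product of the weights of those traversed from white to black. A network is the graph with nonzero face weights $f_i$ on the finite faces (and weight $(\prod f_i)^{-1}$ on $\Omega_0$). Represented point: an almost perfect matching $M$ is a set of edges covering each internal vertex exactly once and each boundary vertex at most once; $\partial M=\{i: b_i\text{ black and used by }M\}\cup\{i:b_i\text{ white and not used by }M\}$. The network with edge weights $t$ represents the point of the Grassmannian with Plücker coordinates $D_I=\sum_{M:\partial M=I}\prod_{e\in M}t_e$; this point depends only on the face weights. *)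

theory Defs
  imports
    "HOL-Complex_Analysis.Complex_Analysis"
    "Jordan_Normal_Form.DL_Rank"
    "Jordan_Normal_Form.DL_Submatrix"
begin

section \<open>Planar bipartite graphs in the disk\<close>

text \<open>
  A graph is identified with its drawing in the closed unit disk of the complex plane.  Vertices
  are points; an edge is the image of an arc joining two vertices (so parallel edges
  are different subsets of the disk, and \<open>x \<in> e\<close> is the incidence of the vertex \<open>x\<close> with the
  edge \<open>e\<close>).  The boundary vertices form a list that is numbered from 0: the entry
  \<open>bdry G ! j\<close> is the boundary vertex with the label \<open>j + 1\<close>, and the index set \<open>[n]\<close> is
  \<open>{..<n}\<close>.
\<close>

record disk_graph =
  black :: "complex set"
  white :: "complex set"
  edges :: "complex set set"
  bdry  :: "complex list"

definition verts :: "disk_graph \<Rightarrow> complex set" where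
  "verts G = black G \<union> white G"

definition internal_verts :: "disk_graph \<Rightarrow> complex set" where
  "internal_verts G = verts G - set (bdry G)"

definition edges_at :: "disk_graph \<Rightarrow> complex \<Rightarrow> complex set set" where
  "edges_at G x = {e \<in> edges G. x \<in> e}"

definition drawing :: "disk_graph \<Rightarrow> complex set" where
  "drawing G = \<Union> (edges G) \<union> verts G"

definition clockwise_on_circle :: "complex list \<Rightarrow> bool" where
  "clockwise_on_circle ps \<longleftrightarrow>
     (\<exists>\<theta> :: nat \<Rightarrow> real.
        (\<forall>j < length ps. ps ! j = cis (\<theta> j)) \<and>
        (\<forall>i j. i < j \<and> j < length ps \<longrightarrow> \<theta> j < \<theta> i) \<and>
        (\<forall>j < length ps. \<theta> 0 - 2 * pi < \<theta> j))"

text \<open>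
  An orientation assigns to every edge its tail.
\<close>

definition orientation :: "disk_graph \<Rightarrow> (complex set \<Rightarrow> complex) \<Rightarrow> bool" where
  "orientation G tail \<longleftrightarrow> (\<forall>e \<in> edges G. tail e \<in> e \<inter> verts G)"

definition perfect_orientation :: "disk_graph \<Rightarrow> (complex set \<Rightarrow> complex) \<Rightarrow> bool" where
  "perfect_orientation G tail \<longleftrightarrow>
     orientation G tail \<and>
     (\<forall>x \<in> internal_verts G \<inter> black G. card {e \<in> edges_at G x. tail e = x} = 1) \<and>
     (\<forall>x \<in> internal_verts G \<inter> white G. card {e \<in> edges_at G x. tail e \<noteq> x} = 1)"

definition planar_bipartite_disk_graph :: "disk_graph \<Rightarrow> bool" where
  "planar_bipartite_disk_graph G \<longleftrightarrow>
     finite (verts G) \<and> finite (edges G) \<and> black G \<inter> white G = {} \<and>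
     bdry G \<noteq> [] \<and> clockwise_on_circle (bdry G) \<and>
     (set (bdry G) \<subseteq> black G \<or> set (bdry G) \<subseteq> white G) \<and>
     internal_verts G \<subseteq> ball 0 1 \<and>
     (\<forall>e \<in> edges G. \<exists>\<gamma>. arc \<gamma> \<and> path_image \<gamma> = e \<and>
        pathstart \<gamma> \<in> black G \<and> pathfinish \<gamma> \<in> white G \<and>
        e \<inter> verts G = {pathstart \<gamma>, pathfinish \<gamma>} \<and>
        e - {pathstart \<gamma>, pathfinish \<gamma>} \<subseteq> ball 0 1) \<and>
     (\<forall>e \<in> edges G. \<forall>e' \<in> edges G. e \<noteq> e' \<longrightarrow> e \<inter> e' \<subseteq> verts G) \<and>
     (\<forall>b \<in> set (bdry G). card (edges_at G b) = 1) \<and>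
     (\<exists>tail. perfect_orientation G tail)"


section \<open>Positroids\<close>

definition source_set :: "disk_graph \<Rightarrow> (complex set \<Rightarrow> complex) \<Rightarrow> nat set" where
  "source_set G tail = {j. j < length (bdry G) \<and> (\<exists>e \<in> edges_at G (bdry G ! j). tail e = bdry G ! j)}"

definition positroid :: "disk_graph \<Rightarrow> nat set set" where
  "positroid G = {source_set G tail | tail. perfect_orientation G tail}"

definition has_type :: "disk_graph \<Rightarrow> nat \<Rightarrow> nat \<Rightarrow> bool" where
  "has_type G k n \<longleftrightarrow> length (bdry G) = n \<and> (\<forall>I \<in> positroid G. card I = k)"

definition irreducible_positroid :: "nat \<Rightarrow> nat set set \<Rightarrow> bool" where
  "irreducible_positroid n M \<longleftrightarrow> (\<forall>j < n. (\<exists>I \<in> M. j \<in> I) \<and> (\<exists>J \<in> M. j \<notin> J))"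

definition dual_positroid :: "nat \<Rightarrow> nat set set \<Rightarrow> nat set set" where
  "dual_positroid n M = {{..<n} - I | I. I \<in> M}"


section \<open>Faces\<close>

definition faces :: "disk_graph \<Rightarrow> complex set set" where
  "faces G = components (cball 0 1 - drawing G)"

text \<open>
  The open arc of the unit circle run through when going clockwise from \<open>p\<close> to \<open>q\<close>; for \<open>p = q\<close>
  this is the circle without \<open>p\<close>.
\<close>

definition clockwise_arc :: "complex \<Rightarrow> complex \<Rightarrow> complex set" where
  "clockwise_arc p q =
     {cis \<phi> | \<phi> \<alpha> \<beta>. p = cis \<alpha> \<and> q = cis \<beta> \<and> \<beta> < \<phi> \<and> \<phi> < \<alpha> \<and> \<alpha> - \<beta> \<le> 2 * pi}"

definition infinite_face :: "disk_graph \<Rightarrow> complex set \<Rightarrow> bool" where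
  "infinite_face G \<Omega> \<longleftrightarrow> \<Omega> \<in> faces G \<and> clockwise_arc (last (bdry G)) (hd (bdry G)) \<subseteq> \<Omega>"

definition finite_faces :: "disk_graph \<Rightarrow> complex set set" where
  "finite_faces G = {\<Omega> \<in> faces G. \<not> infinite_face G \<Omega>}"

definition internal_face :: "complex set \<Rightarrow> bool" where
  "internal_face \<Omega> \<longleftrightarrow> frontier \<Omega> \<inter> sphere 0 1 = {}"

definition face_edges :: "disk_graph \<Rightarrow> complex set \<Rightarrow> complex set set" where
  "face_edges G \<Omega> = {e \<in> edges G. e \<subseteq> frontier \<Omega>}"

text \<open>
  The number \<open>b\<close> of a face.  The boundary vertices of an external face of a reduced graph with
  irreducible positroid are the end points of its pairwise disjoint arcs on the
  circle, so the division by 2 is exact.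
\<close>

definition face_b :: "disk_graph \<Rightarrow> complex set \<Rightarrow> nat" where
  "face_b G \<Omega> = card {j. j < length (bdry G) \<and> bdry G ! j \<in> frontier \<Omega>} div 2"

definition reduced :: "disk_graph \<Rightarrow> bool" where
  "reduced G \<longleftrightarrow>
     (\<forall>C \<in> components (drawing G). C \<inter> set (bdry G) \<noteq> {}) \<and>
     (\<forall>x \<in> internal_verts G. card (edges_at G x) = 1 \<longrightarrow>
        (\<exists>e \<in> edges_at G x. \<exists>b \<in> set (bdry G). b \<in> e)) \<and>
     (\<forall>e \<in> edges G. \<forall>e' \<in> edges G. e \<inter> verts G = e' \<inter> verts G \<longrightarrow> e = e') \<and>
     (\<forall>G'. planar_bipartite_disk_graph G' \<and> length (bdry G') = length (bdry G) \<and>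
           positroid G' = positroid G \<longrightarrow> card (faces G) \<le> card (faces G'))"

text \<open>
  All boundary vertices having the same color, the number of edges of a face is even in the
  Kasteleyn condition.
\<close>

definition kasteleyn_signature :: "disk_graph \<Rightarrow> (complex set \<Rightarrow> int) \<Rightarrow> bool" where
  "kasteleyn_signature G \<sigma> \<longleftrightarrow>
     (\<forall>e \<in> edges G. \<sigma> e \<in> {1, -1}) \<and>
     (\<forall>\<Omega> \<in> finite_faces G.
        (\<Prod>e \<in> face_edges G \<Omega>. \<sigma> e) = (-1) ^ (card (face_edges G \<Omega>) div 2 + 1))"


section \<open>Face weights\<close>

text \<open>
  \<open>traversed_clockwise \<Omega> e p q\<close>: the clockwise traversal of the boundary of \<open>\<Omega>\<close> runs through
  \<open>e\<close> from \<open>p\<close> to \<open>q\<close>, that is, with \<open>\<Omega>\<close> on its right.  This is expressed by a simple loop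
  that starts with \<open>e\<close>, run through from \<open>p\<close> to \<open>q\<close>, and that encloses clockwise a
  region belonging to \<open>\<Omega>\<close>.  When the boundary of \<open>\<Omega>\<close> is a simple closed curve, the
  loop can be taken to be that curve; in general the loop may cut through \<open>\<Omega>\<close>, and an
  edge with \<open>\<Omega>\<close> on both sides is traversed once in each direction.
\<close>

definition traversed_clockwise ::
    "complex set \<Rightarrow> complex set \<Rightarrow> complex \<Rightarrow> complex \<Rightarrow> bool" where
  "traversed_clockwise \<Omega> e p q \<longleftrightarrow>
     (\<exists>\<gamma> \<delta>. arc \<gamma> \<and> path_image \<gamma> = e \<and> pathstart \<gamma> = p \<and> pathfinish \<gamma> = q \<and>
        arc \<delta> \<and> pathstart \<delta> = q \<and> pathfinish \<delta> = p \<and>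
        simple_path (\<gamma> +++ \<delta>) \<and>
        (\<forall>z \<in> inside (path_image (\<gamma> +++ \<delta>)). z \<in> \<Omega> \<and> winding_number (\<gamma> +++ \<delta>) z = -1))"

definition face_weight ::
    "disk_graph \<Rightarrow> (complex set \<Rightarrow> complex) \<Rightarrow> complex set \<Rightarrow> complex" where
  "face_weight G t \<Omega> =
     (\<Prod>e | e \<in> edges G \<and> (\<exists>b \<in> black G. \<exists>w \<in> white G. traversed_clockwise \<Omega> e b w). t e) /
     (\<Prod>e | e \<in> edges G \<and> (\<exists>b \<in> black G. \<exists>w \<in> white G. traversed_clockwise \<Omega> e w b). t e)"


section \<open>Points of the Grassmannian represented by networks\<close>

text \<open>
  A point of \<open>Gr(k,n)\<close> is given by a representative matrix: a \<open>k \<times> n\<close> matrix of rank \<open>k\<close>, up to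
  multiplication by an invertible matrix from the left.
\<close>

definition gr_rep :: "nat \<Rightarrow> nat \<Rightarrow> complex mat \<Rightarrow> bool" where
  "gr_rep k n A \<longleftrightarrow> A \<in> carrier_mat k n \<and> vec_space.rank k A = k"

definition same_gr_point :: "nat \<Rightarrow> complex mat \<Rightarrow> complex mat \<Rightarrow> bool" where
  "same_gr_point k A B \<longleftrightarrow> (\<exists>C. C \<in> carrier_mat k k \<and> invertible_mat C \<and> B = C * A)"

definition pluecker :: "complex mat \<Rightarrow> nat set \<Rightarrow> complex" where
  "pluecker A I = Determinant.det (submatrix A UNIV I)"

definition positroid_variety :: "nat \<Rightarrow> nat \<Rightarrow> nat set set \<Rightarrow> complex mat set" where
  "positroid_variety k n M =
     {A. gr_rep k n A \<and>
         (\<forall>I. I \<subseteq> {..<n} \<and> card I = k \<and> I \<notin> M \<longrightarrow> pluecker A I = 0)}"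

definition almost_perfect_matching :: "disk_graph \<Rightarrow> complex set set \<Rightarrow> bool" where
  "almost_perfect_matching G M \<longleftrightarrow>
     M \<subseteq> edges G \<and>
     (\<forall>x \<in> internal_verts G. card {e \<in> M. x \<in> e} = 1) \<and>
     (\<forall>b \<in> set (bdry G). card {e \<in> M. b \<in> e} \<le> 1)"

definition matching_boundary :: "disk_graph \<Rightarrow> complex set set \<Rightarrow> nat set" where
  "matching_boundary G M =
     {j. j < length (bdry G) \<and> bdry G ! j \<in> black G \<and> (\<exists>e \<in> M. bdry G ! j \<in> e)} \<union>
     {j. j < length (bdry G) \<and> bdry G ! j \<in> white G \<and> \<not> (\<exists>e \<in> M. bdry G ! j \<in> e)}"

definition boundary_measurement ::
    "disk_graph \<Rightarrow> (complex set \<Rightarrow> complex) \<Rightarrow> nat set \<Rightarrow> complex" where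
  "boundary_measurement G t I =
     (\<Sum>M | almost_perfect_matching G M \<and> matching_boundary G M = I. \<Prod>e \<in> M. t e)"

text \<open>
  The coordinates of a point of the Grassmannian are determined up to a common factor \<open>c\<close>.
\<close>

definition represents ::
    "disk_graph \<Rightarrow> (complex set \<Rightarrow> complex) \<Rightarrow> nat \<Rightarrow> complex mat \<Rightarrow> bool" where
  "represents G t k A \<longleftrightarrow>
     gr_rep k (length (bdry G)) A \<and>
     (\<exists>c. c \<noteq> 0 \<and> (\<forall>I. I \<subseteq> {..<length (bdry G)} \<and> card I = k \<longrightarrow>
        pluecker A I = c * boundary_measurement G t I))"

text \<open>
  The point represented by a network that is given by its face weights is the one represented
  by edge weights with these face weights; it does not depend on their choice.  The weight of
  the infinite face is the inverse of the product of the others and is not part of the data.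
\<close>

definition network_represents ::
    "disk_graph \<Rightarrow> (complex set \<Rightarrow> complex) \<Rightarrow> nat \<Rightarrow> complex mat \<Rightarrow> bool" where
  "network_represents G f k A \<longleftrightarrow>
     (\<forall>\<Omega> \<in> finite_faces G. f \<Omega> \<noteq> 0) \<and>
     (\<exists>t. (\<forall>e \<in> edges G. t e \<noteq> 0) \<and>
          (\<forall>\<Omega> \<in> finite_faces G. face_weight G t \<Omega> = f \<Omega>) \<and>
          represents G t k A)"


section \<open>Vector relation configurations and the dual network\<close>

definition black_end :: "disk_graph \<Rightarrow> complex set \<Rightarrow> complex" where
  "black_end G e = (THE b. b \<in> e \<inter> black G)"

definition boundary_matrix :: "disk_graph \<Rightarrow> nat \<Rightarrow> (complex \<Rightarrow> complex vec) \<Rightarrow> complex mat" where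
  "boundary_matrix G d v = mat_of_cols d (map v (bdry G))"

definition vector_configuration ::
    "disk_graph \<Rightarrow> (complex set \<Rightarrow> int) \<Rightarrow> (complex set \<Rightarrow> complex) \<Rightarrow> nat \<Rightarrow>
     (complex \<Rightarrow> complex vec) \<Rightarrow> bool" where
  "vector_configuration G \<sigma> t d v \<longleftrightarrow>
     (\<forall>b \<in> black G. v b \<in> carrier_vec d) \<and>
     LinearCombinations.module.span class_ring (module_vec TYPE(complex) d) (v ` set (bdry G))
       = carrier_vec d \<and>
     (\<forall>w \<in> white G.
        finsum_vec TYPE(complex) d (\<lambda>e. (of_int (\<sigma> e) * t e) \<cdot>\<^sub>v v (black_end G e)) (edges_at G w)
          = 0\<^sub>v d)"

definition dual_graph :: "disk_graph \<Rightarrow> disk_graph" where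
  "dual_graph G = G\<lparr>black := white G, white := black G\<rparr>"

definition dual_face_weight ::
    "disk_graph \<Rightarrow> (complex set \<Rightarrow> complex) \<Rightarrow> complex set \<Rightarrow> complex" where
  "dual_face_weight G f \<Omega> =
     (if internal_face \<Omega> then inverse (f \<Omega>) else (-1) ^ face_b G \<Omega> * inverse (f \<Omega>))"

end

theory Submission
  imports Defs
begin

text \<open>The proof rests on Kasteleyn's theorem for graphs in a disk. Let \<open>K\<close> be the matrix with a row for each
  white vertex \<open>w\<close>, a column for each black vertex \<open>b\<close>, and the entries \<open>\<sigma>(bw) t\<^bsub>bw\<^esub>\<close>. A vector
  configuration consists of solutions of \<open>K v = 0\<close>, one for each coordinate. The minor of \<open>K\<close>
  that contains all inner columns and the boundary columns of a \<open>k\<close>-element set \<open>I\<close> is a signed sum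
  over the almost perfect matchings with the boundary \<open>I\<close>. By \<open>kasteleyn_minors\<close> all these signs
  are equal, for all \<open>I\<close> together, so the minors are proportional to the
  boundary measurements, that is, to the Pluecker coordinates of \<open>A\<close>. Cramer's rule now shows that \<open>A\<close>
  annihilates the boundary values of the solutions (\<open>kernel_orthogonal\<close>).

  The remaining assertions follow by linear algebra. The matrix of boundary vectors has rank \<open>n - k\<close>, so
  its rows span the kernel of \<open>A\<close>. This determines it up to a change of basis
  (\<open>same_kernel_same_point\<close>), and its maximal minors are, up to a common factor, the
  complementary minors of \<open>A\<close> with the signs \<open>(-1)^(\<Sum>I)\<close> (\<open>complementary_minors\<close>). These are the
  boundary measurements of the dual graph if the weight of the edge at the boundary vertex with the
  number \<open>j\<close> is multiplied by \<open>(-1)^j\<close>. The face weights change as asserted, since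
  exchanging the colors inverts them and the boundary vertices of a finite face come in pairs
  of neighbours (\<open>dual_face_weight_signed\<close>).

  The signs of two matchings are compared as follows. One matching arises from the other by exchanges along
  alternating cycles and along alternating paths between boundary vertices (\<open>exists_exchange\<close>). A path
  is closed along the circle. The product of the Kasteleyn signs along the resulting closed curve depends only
  on its length and on the number of vertices inside it (\<open>kasteleyn_cycle\<close>), and the
  parity of the latter is that of the number of used boundary vertices on the closing arc
  (\<open>exch_parity\<close>). This is compensated by the signs of the permutations of rows and columns
  (\<open>exch_cycle_sign\<close>, \<open>exch_path_sign\<close>).

  Kasteleyn's condition is about faces. To pass to arbitrary cycles of the graph that is augmented by the boundary
  circle, a cycle is cut repeatedly by paths through its inside (\<open>cycle_split_induct\<close>); in the same way
  it is seen that the boundary of every face is a cycle (\<open>face_boundary_cycle\<close>,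
  \<open>face_of_cycle\<close>). Such paths exist because no set of inner vertices is
  attached to the rest of the graph at a single vertex (\<open>inner_verts_two_nbrs\<close>). This is
  where the graph has to be reduced and the positroid irreducible: a part attached at one vertex, possibly
  together with that vertex, is matched in itself by all matchings, so it can be deleted without changing
  the positroid; but it contains a cycle, so the number of faces would decrease.\<close>

section \<open>Arcs and closed sets in the plane\<close>

text \<open>An arc has empty interior, because removing one point disconnects it, but not a disk.\<close>

lemma interior_arc_empty:
  fixes g :: "real \<Rightarrow> complex"
  assumes "arc g"
  shows "interior (path_image g) = {}"
proof (rule ccontr)
  assume "interior (path_image g) \<noteq> {}"
  then obtain z r where r: "r > 0" "ball z r \<subseteq> path_image g"
    using mem_interior by blast
  let ?T = "{t \<in> {0..1}. g t \<in> ball z r}"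
  have img: "g ` ?T = ball z r"
    using r unfolding path_image_def by blast
  have inf: "infinite (ball z r)"
    using r uncountable_ball[of r z] countable_finite by blast
  then have "infinite ?T"
    using img finite_imageI by metis
  then obtain F where F: "F \<subseteq> ?T" "card F = 3" "finite F"
    by (meson infinite_arbitrarily_large)
  define s1 where "s1 = Min F"
  define s3 where "s3 = Max F"
  have nonempty: "F \<noteq> {}" using F by auto
  have "\<not> F \<subseteq> {s1, s3}"
  proof
    assume "F \<subseteq> {s1, s3}"
    then have "card F \<le> card {s1, s3}" by (intro card_mono) auto
    also have "\<dots> \<le> 2" by (simp add: card_insert_if)
    finally show False using F by simp
  qed
  then obtain s2 where s2: "s2 \<in> F" "s2 \<noteq> s1" "s2 \<noteq> s3" by auto
  have s13: "s1 \<in> F" "s3 \<in> F" "s1 < s2" "s2 < s3"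
    using s2 nonempty F(3) unfolding s1_def s3_def
    by (auto simp: order_less_le)
  have inT: "s1 \<in> ?T" "s2 \<in> ?T" "s3 \<in> ?T" using s13 s2 F by auto
  have inj: "inj_on g {0..1}" using assms by (simp add: arc_def)
  have cont: "continuous_on {0..1} g" using assms by (simp add: arc_def path_def)
  define A where "A = g ` {0..s2}"
  define B where "B = g ` {s2..1}"
  have cl: "closed A" "closed B"
    unfolding A_def B_def using inT
    by (auto intro!: compact_imp_closed compact_continuous_image continuous_on_subset[OF cont])
  have conn: "connected (ball z r - {g s2})"
    by (rule connected_open_delete) auto
  have cov: "ball z r - {g s2} \<subseteq> A \<union> B"
  proof
    fix y assume y: "y \<in> ball z r - {g s2}"
    then obtain t where "t \<in> {0..1}" "y = g t" using img by blast
    then show "y \<in> A \<union> B" unfolding A_def B_def by (cases "t \<le> s2") auto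
  qed
  have disj: "A \<inter> B \<inter> (ball z r - {g s2}) = {}"
  proof -
    have "y = g s2" if yA: "y \<in> A" and yB: "y \<in> B" for y
    proof -
      obtain t where t: "t \<in> {0..s2}" "y = g t" using yA unfolding A_def by blast
      obtain u where u: "u \<in> {s2..1}" "y = g u" using yB unfolding B_def by blast
      note tu = t(1) u(1) t(2) u(2)
      then have "t = u" using inj inT by (auto simp: inj_on_def)
      then show ?thesis using tu by force
    qed
    then show ?thesis by blast
  qed
  have "g s1 \<noteq> g s2" "g s3 \<noteq> g s2"
    using inj inT s13 by (auto dest: inj_onD)
  moreover have "g s1 \<in> A" "g s3 \<in> B"
    using inT s13 unfolding A_def B_def by auto
  ultimately have "A \<inter> (ball z r - {g s2}) \<noteq> {}" "B \<inter> (ball z r - {g s2}) \<noteq> {}"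
    using inT by auto
  then show False
    using conn cl cov disj unfolding connected_closed by blast
qed

lemma interior_Union_arcs_empty:
  fixes E :: "complex set set"
  assumes "finite E" "\<And>e. e \<in> E \<Longrightarrow> \<exists>g. arc g \<and> path_image g = e"
  shows "interior (\<Union>E) = {} \<and> compact (\<Union>E)"
  using assms
proof (induction E rule: finite_induct)
  case empty
  then show ?case by simp
next
  case (insert e E)
  obtain g where g: "arc g" "path_image g = e" using insert.prems by auto
  have "interior (e \<union> \<Union>E) = {}"
    using insert g interior_arc_empty[OF g(1)] compact_arc_image[OF g(1)]
    by (metis compact_imp_closed insertCI interior_closed_Un_empty_interior)
  then show ?case
    using insert g compact_arc_image[OF g(1)] by auto
qed

text \<open>By Janiszewski's theorem an arc that meets a closed set in at most one point does not
  separate any points that the closed set does not separate.\<close>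

lemma arc_touching_once_nonseparating:
  fixes a b :: complex
  assumes "closed T" "arc g" "path_image g \<inter> T \<subseteq> {p}"
    and "connected_component (- T) a b" "a \<notin> path_image g" "b \<notin> path_image g"
  shows "connected_component (- (T \<union> path_image g)) a b"
proof -
  have "connected (- path_image g)"
    using connected_arc_complement[OF assms(2)] by simp
  then have "connected_component (- path_image g) a b"
    using assms by (meson ComplI connected_component_of_subset connected_iff_connected_component)
  moreover have "connected (path_image g \<inter> T)"
    using assms(3) by (metis connected_empty connected_sing subset_singletonD)
  ultimately show ?thesis
    using Janiszewski[of "path_image g" T a b] assms compact_arc_image
    by (metis Un_commute)
qed

text \<open>A crosscut of a complementary component from which an inner piece is removed does not separate: each
  of the two remaining pieces meets the closed set at one end only.\<close>

lemma arc_subarc_nonseparating: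
  fixes g :: "real \<Rightarrow> complex"
  assumes "closed T" "arc g" "path_image g \<inter> T \<subseteq> {pathstart g, pathfinish g}"
    and st: "0 < s" "s < t" "t < 1"
    and ab: "connected_component (- T) a b" "a \<notin> path_image g" "b \<notin> path_image g"
  shows "connected_component (- (T \<union> g ` {0..s} \<union> g ` {t..1})) a b"
proof -
  have inj: "inj_on g {0..1}" using assms by (simp add: arc_def)
  have im1: "path_image (subpath 0 s g) = g ` {0..s}" and im2: "path_image (subpath t 1 g) = g ` {t..1}"
    using st by (auto simp: path_image_subpath)
  have arcs: "arc (subpath 0 s g)" "arc (subpath t 1 g)"
    using st assms(2) by (auto intro!: arc_subpath_arc)
  have sub: "g ` {0..s} \<subseteq> path_image g" "g ` {t..1} \<subseteq> path_image g"
    using st by (auto simp: path_image_def)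
  have e0: "x = 0 \<or> x = 1" if "x \<in> {0..1}" "g x \<in> T" for x
  proof -
    have "g x \<in> path_image g \<inter> T" using that by (simp add: path_image_def)
    then have "g x \<in> {pathstart g, pathfinish g}" using assms(3) by blast
    then have "g x = g 0 \<or> g x = g 1" by (simp add: pathstart_def pathfinish_def)
    then show ?thesis using inj that by (auto dest: inj_onD)
  qed
  have "g ` {0..s} \<inter> T \<subseteq> {g 0}"
  proof
    fix y assume "y \<in> g ` {0..s} \<inter> T"
    then obtain x where "x \<in> {0..s}" "y = g x" "g x \<in> T" by blast
    then show "y \<in> {g 0}" using e0[of x] st by auto
  qed
  then have 1: "connected_component (- (T \<union> g ` {0..s})) a b"
    using arc_touching_once_nonseparating[OF assms(1) arcs(1), of "g 0" a b] ab im1 sub by auto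
  have "closed (T \<union> g ` {0..s})"
    using assms(1) compact_arc_image[OF arcs(1)] im1 by (metis closed_Un compact_imp_closed)
  moreover have "g ` {t..1} \<inter> (T \<union> g ` {0..s}) \<subseteq> {g 1}"
  proof
    fix y assume "y \<in> g ` {t..1} \<inter> (T \<union> g ` {0..s})"
    then obtain x where x: "x \<in> {t..1}" "y = g x" "g x \<in> T \<union> g ` {0..s}" by blast
    have "g x \<notin> g ` {0..s}"
    proof
      assume "g x \<in> g ` {0..s}"
      then obtain u where "u \<in> {0..s}" "g x = g u" by blast
      then have "x = u" using inj x st by (auto dest: inj_onD)
      then show False using x st \<open>u \<in> {0..s}\<close> by auto
    qed
    then show "y \<in> {g 1}" using e0[of x] st x by auto
  qed
  moreover have "a \<notin> g ` {t..1}" "b \<notin> g ` {t..1}" using ab sub by auto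
  ultimately show ?thesis
    using arc_touching_once_nonseparating[OF _ arcs(2), of "T \<union> g ` {0..s}" "g 1" a b] im2 1
    by metis
qed

text \<open>If a crosscut separates \<open>a\<close> from \<open>b\<close>, the whole crosscut is on the boundary of the component
  of \<open>a\<close>: near a point off its closure, a piece of the crosscut could be removed
  without joining \<open>a\<close> to \<open>b\<close>.\<close>

lemma crosscut_component_closure:
  fixes g :: "real \<Rightarrow> complex"
  assumes T: "closed T" "arc g" "path_image g \<inter> T \<subseteq> {pathstart g, pathfinish g}"
    and V: "V \<in> components (- (T \<union> path_image g))"
    and ab: "connected_component (- T) a b" "a \<in> V" "b \<notin> V" "b \<notin> path_image g"
    and t0: "0 < t0" "t0 < 1"
  shows "g t0 \<in> closure V"
proof (rule ccontr)
  assume "g t0 \<notin> closure V"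
  then obtain r where r: "r > 0" "ball (g t0) r \<inter> closure V = {}"
    by (metis closed_closure open_Compl open_contains_ball ComplI disjoint_eq_subset_Compl)
  have "continuous_on {0..1} g" using T by (simp add: arc_def path_def)
  then obtain d where d: "d > 0" "\<And>x. x \<in> {0..1} \<Longrightarrow> dist x t0 < d \<Longrightarrow> dist (g x) (g t0) < r"
    using t0 r unfolding continuous_on_iff by (metis atLeastAtMost_iff less_imp_le)
  define s where "s = max (t0 - d/2) (t0/2)"
  define t where "t = min (t0 + d/2) ((1+t0)/2)"
  have st: "0 < s" "s < t0" "t0 < t" "t < 1" "t0 - d < s" "t < t0 + d"
    using d t0 unfolding s_def t_def by (auto simp: max_def min_def)
  have clT: "closed (T \<union> path_image g)"
    using T compact_arc_image[OF T(2)] by (simp add: closed_Un compact_imp_closed)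
  have anV: "a \<notin> path_image g" "frontier V \<subseteq> T \<union> path_image g"
    using ab in_components_subset[OF V] frontier_of_components_closed_complement[OF clT V] by auto
  have "connected_component (- (T \<union> g ` {0..s} \<union> g ` {t..1})) a b"
    using arc_subarc_nonseparating[OF T, of s t a b] st ab anV by auto
  then obtain C where C: "connected C" "C \<subseteq> - (T \<union> g ` {0..s} \<union> g ` {t..1})" "a \<in> C" "b \<in> C"
    unfolding connected_component_def by auto
  have "C \<inter> frontier V = {}"
  proof -
    have "y \<in> ball (g t0) r" if "y \<in> C" "y \<in> frontier V" for y
    proof -
      have "y \<in> path_image g" "y \<notin> g ` {0..s}" "y \<notin> g ` {t..1}" using that anV C by auto
      then obtain x where x: "x \<in> {0..1}" "y = g x" "x \<notin> {0..s}" "x \<notin> {t..1}"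
        unfolding path_image_def by blast
      then have "dist x t0 < d" using st by (auto simp: dist_real_def)
      then show ?thesis using d(2)[OF x(1)] x(2) by (simp add: dist_commute)
    qed
    moreover have "frontier V \<subseteq> closure V" by (auto simp: frontier_def)
    ultimately show ?thesis using r by blast
  qed
  then have "C \<subseteq> V"
    using connected_Int_frontier[of C V] C ab by blast
  then show False using C ab by auto
qed

text \<open>An arc with end points on a closed set cuts a complementary component into at most three
  parts (the bound 2 holds but is not needed): if there were four, then a crosscut through one of them,
  closed up along the arc, would be a closed curve that has two of the others on the same side,
  and these could be joined.\<close>

lemma crosscut_at_most_three_components:
  fixes g :: "real \<Rightarrow> complex"
  assumes T: "closed T" "arc g" "path_image g \<inter> T \<subseteq> {pathstart g, pathfinish g}"
    and V: "\<And>i. i < (4::nat) \<Longrightarrow> V i \<in> components (- (T \<union> path_image g))" "inj_on V {..<4}"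
    and a: "\<And>i. i < 4 \<Longrightarrow> a i \<in> V i" "\<And>i. i < 4 \<Longrightarrow> connected_component (- T) (a 0) (a i)"
  shows False
proof -
  let ?e = "path_image g"
  have cl: "closed (T \<union> ?e)" using T compact_arc_image[OF T(2)] by (simp add: closed_Un compact_imp_closed)
  have inj: "inj_on g {0..1}" using T by (simp add: arc_def)
  have Vsub: "V i \<subseteq> - (T \<union> ?e)" "open (V i)" "connected (V i)" "frontier (V i) \<subseteq> T \<union> ?e" if "i < 4" for i
    using in_components_subset[OF V(1)[OF that]] in_components_connected[OF V(1)[OF that]]
      open_components[OF open_Compl[OF cl] V(1)[OF that]] frontier_of_components_closed_complement[OF cl V(1)[OF that]]
    by blast+
  have disj: "V i \<inter> V j = {}" if "i < 4" "j < 4" "i \<noteq> j" for i j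
    using V that by (metis components_nonoverlap inj_onD lessThan_iff)
  have conn: "connected_component (- T) (a i) (a j)" if "i < 4" "j < 4" for i j
    using a(2) that by (meson connected_component_sym connected_component_trans)
  have clos: "g x \<in> closure (V i)" if i: "i < 4" and x: "0 < x" "x < 1" for i x
  proof -
    obtain j :: nat where j: "j < 4" "j \<noteq> i"
      by (metis zero_less_numeral one_less_numeral_iff semiring_norm(76) zero_neq_one)
    show ?thesis
      using crosscut_component_closure[OF T V(1)[OF i] conn[OF i j(1)] a(1)[OF i] _ _ x]
        disj[OF i j(1)] a(1)[OF j(1)] Vsub(1)[OF j(1)] j by blast
  qed
  have front: "g x \<in> frontier (V 0)" if "0 < x" "x < 1" for x
    using clos[of 0 x] Vsub[of 0] that unfolding frontier_def
    by (auto simp: interior_open path_image_def)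
  \<comment> \<open>The end points of the crosscut are taken in two disjoint parts of the arc.\<close>
  define U where "U x = frontier (V 0) \<inter> (- (T \<union> {g 0, g 1}) \<inter> ball (g x) (dist (g (1/3)) (g (2/3)) / 2))" for x
  have opU: "openin (top_of_set (frontier (V 0))) (U x)" for x
    unfolding U_def using T(1) by (intro openin_open_Int open_Int) (auto simp: closed_insert intro!: open_Compl closed_Un)
  have gne: "g (1/3) \<noteq> g (2/3)" using inj_onD[OF inj, of "1/3" "2/3"] by auto
  have notT: "g x \<notin> T" "g x \<noteq> g 0" "g x \<noteq> g 1" if "0 < x" "x < 1" for x
  proof -
    show 1: "g x \<noteq> g 0" "g x \<noteq> g 1" using that inj_onD[OF inj, of x 0] inj_onD[OF inj, of x 1] by auto
    have "g x \<in> path_image g" using that by (auto simp: path_image_def)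
    then show "g x \<notin> T" using T(3) 1 unfolding pathstart_def pathfinish_def by blast
  qed
  have inU: "g (1/3) \<in> U (1/3)" "g (2/3) \<in> U (2/3)"
    unfolding U_def using front notT gne by auto
  have "U (1/3) \<inter> U (2/3) = {}"
  proof -
    have "ball (g (1/3)) (dist (g (1/3)) (g (2/3)) / 2) \<inter> ball (g (2/3)) (dist (g (1/3)) (g (2/3)) / 2) = {}"
      by (rule disjoint_ballI) simp
    then show ?thesis unfolding U_def by blast
  qed
  then obtain h where h: "arc h" "pathstart h \<in> U (1/3)" "pathfinish h \<in> U (2/3)" "h ` {0<..<1} \<subseteq> V 0"
    using dense_accessible_frontier_point_pairs[OF Vsub(2,3)[of 0] opU[of "1/3"] opU[of "2/3"]] inU
    by (metis Int_absorb empty_iff zero_less_numeral)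
  have onE: "\<exists>x. 0 < x \<and> x < 1 \<and> y = g x" if "y \<in> U z" for y z
  proof -
    have "y \<in> ?e" "y \<noteq> g 0" "y \<noteq> g 1" using that Vsub(4)[of 0] unfolding U_def by auto
    then obtain x where "x \<in> {0..1}" "y = g x" "x \<noteq> 0" "x \<noteq> 1" unfolding path_image_def by blast
    then show ?thesis by (intro exI[of _ x]) auto
  qed
  obtain s0 where s0: "0 < s0" "s0 < 1" "pathstart h = g s0" using onE[OF h(2)] by blast
  obtain t0 where t0: "0 < t0" "t0 < 1" "pathfinish h = g t0" using onE[OF h(3)] by blast
  have "s0 \<noteq> t0" using s0 t0 h(1) by (metis arc_distinct_ends)
  have "\<exists>k s t. arc k \<and> k ` {0<..<1} \<subseteq> V 0 \<and> 0 < s \<and> s < t \<and> t < 1 \<and> pathstart k = g s \<and> pathfinish k = g t"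
  proof (cases "s0 < t0")
    case True then show ?thesis using h s0 t0 by blast
  next
    case False
    have "reversepath h ` {0<..<1} \<subseteq> V 0"
      using h(4) by (auto simp: reversepath_def)
    then show ?thesis using h s0 t0 False \<open>s0 \<noteq> t0\<close>
      by (intro exI[of _ "reversepath h"] exI[of _ t0] exI[of _ s0]) (auto simp: arc_reversepath)
  qed
  then obtain k s t where k: "arc k" "k ` {0<..<1} \<subseteq> V 0" "0 < s" "s < t" "t < 1"
    "pathstart k = g s" "pathfinish k = g t" by blast
  have kimg: "path_image k \<subseteq> V 0 \<union> {g s, g t}"
  proof
    fix y assume "y \<in> path_image k"
    then obtain x where x: "x \<in> {0..1}" "y = k x" by (auto simp: path_image_def)
    then have "x = 0 \<or> x = 1 \<or> x \<in> {0<..<1}" by auto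
    then show "y \<in> V 0 \<union> {g s, g t}"
      using k(2,6,7) x by (force simp: pathstart_def pathfinish_def)
  qed
  let ?sub = "subpath s t g"
  have subimg: "path_image ?sub = g ` {s..t}" using k by (simp add: path_image_subpath)
  have subarc: "arc ?sub" using k T(2) by (intro arc_subpath_arc) auto
  have sube: "g ` {s..t} \<subseteq> ?e" using k by (auto simp: path_image_def)
  have kst: "{g s, g t} \<subseteq> path_image k" using k by (metis insert_subset empty_subsetI pathfinish_in_path_image pathstart_in_path_image)
  have "V 0 \<inter> ?e = {}" using Vsub(1)[of 0] by auto
  moreover have "{g s, g t} \<subseteq> g ` {s..t}" using k by auto
  ultimately have kint: "path_image k \<inter> g ` {s..t} = {g s, g t}"
    using kimg kst sube by blast
  let ?l = "k +++ reversepath ?sub"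
  have simp: "simple_path ?l" "pathfinish ?l = pathstart ?l"
    using k subarc kint subimg by (auto intro!: simple_path_join_loop simp: arc_reversepath)
  have limg: "path_image ?l = path_image k \<union> g ` {s..t}"
    using k subimg by (subst path_image_join) auto
  let ?J = "path_image ?l"
  note jordan = Jordan_inside_outside[OF simp]
  have ke: "path_image k \<subseteq> V 0 \<union> ?e" using kimg sube k by (auto simp: path_image_def)
  have aJ: "a i \<in> - ?J" if "i < 4" "i \<noteq> 0" for i
  proof -
    have "V i \<inter> V 0 = {}" using disj[of i 0] that by auto
    moreover have "V i \<inter> ?e = {}" using Vsub(1)[OF that(1)] by auto
    ultimately show ?thesis using a(1)[OF that(1)] ke limg sube by blast
  qed
  \<comment> \<open>Two of the remaining components on the same side of the closed curve \<open>?J\<close> can be joined near a point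
    \<open>g m\<close> of the arc without meeting \<open>?S\<close>, and by Janiszewski's theorem also without meeting \<open>?J\<close>.\<close>
  have same: False if ij: "i < 4" "j < 4" "i \<noteq> 0" "j \<noteq> 0" "i \<noteq> j" and c: "connected_component (- ?J) (a i) (a j)" for i j
  proof -
    let ?S = "T \<union> g ` {0..s} \<union> g ` {t..1} \<union> path_image k"
    have clS: "closed ?S"
    proof -
      have "continuous_on {0..1} g" using T(2) by (simp add: arc_def path_def)
      then have "compact (g ` {0..s})" "compact (g ` {t..1})"
        using k by (auto intro!: compact_continuous_image elim: continuous_on_subset)
      then show ?thesis using T(1) compact_arc_image[OF k(1)] by (simp add: closed_Un compact_imp_closed)
    qed
    define m where "m = (s + t) / 2"
    have m: "s < m" "m < t" "0 < m" "m < 1" using k unfolding m_def by auto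
    have mk: "g m \<notin> g ` {0..s}" "g m \<notin> g ` {t..1}" "g m \<noteq> g s" "g m \<noteq> g t"
    proof -
      have "g m \<noteq> g x" if "x \<in> {0..1}" "x \<noteq> m" for x
        using inj_onD[OF inj, of m x] that m by auto
      note ne = this
      show "g m \<notin> g ` {0..s}"
        using ne m k(3,4,5) by fastforce
      show "g m \<notin> g ` {t..1}"
      proof
        assume "g m \<in> g ` {t..1}"
        then obtain x where "x \<in> {t..1}" "g m = g x" by blast
        then show False using ne[of x] m by auto
      qed
      show "g m \<noteq> g s" "g m \<noteq> g t"
        using ne[of s] ne[of t] m k(3,4,5) by auto
    qed
    have "g m \<in> ?e" using m by (auto simp: path_image_def)
    then have "g m \<notin> V 0" using Vsub(1)[of 0] by auto
    then have mS: "g m \<notin> ?S"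
      using mk notT(1)[OF m(3,4)] kimg by blast
    then obtain r where r: "r > 0" "ball (g m) r \<subseteq> - ?S"
      using clS by (metis ComplI open_Compl open_contains_ball)
    have VS: "V l \<subseteq> - ?S" if "l < 4" "l \<noteq> 0" for l
    proof -
      have "g ` {0..s} \<subseteq> ?e" "g ` {t..1} \<subseteq> ?e" using k by (auto simp: path_image_def)
      moreover have "V l \<inter> V 0 = {}" using disj[of l 0] that by auto
      moreover have "V l \<inter> (T \<union> ?e) = {}" using Vsub(1)[OF that(1)] by auto
      ultimately show ?thesis using ke by blast
    qed
    have meet: "V l \<inter> ball (g m) r \<noteq> {}" if "l < 4" for l
      using clos[OF that m(3,4)] r(1) by (metis Int_commute centre_in_ball open_Int_closure_eq_empty open_ball disjoint_iff)
    have "connected (V i \<union> ball (g m) r \<union> V j)"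
      using meet[OF ij(1)] meet[OF ij(2)] Vsub(3)[OF ij(1)] Vsub(3)[OF ij(2)]
      by (intro connected_Un) auto
    then have "connected_component (- ?S) (a i) (a j)"
      unfolding connected_component_def using VS ij r a(1)[OF ij(1)] a(1)[OF ij(2)]
      by (intro exI[of _ "V i \<union> ball (g m) r \<union> V j"]) auto
    moreover have "?J \<inter> ?S = path_image k"
    proof -
      have "y \<in> path_image k" if y: "y \<in> g ` {s..t}" "y \<in> T \<union> g ` {0..s} \<union> g ` {t..1}" for y
      proof -
        obtain x where x: "x \<in> {s..t}" "y = g x" using y by blast
        have "g x \<notin> T" using x k notT[of x] by auto
        then have "g x \<in> g ` ({0..s} \<union> {t..1})" using y x by (auto simp: image_Un)
        then obtain u where u: "u \<in> {0..s} \<union> {t..1}" "g x = g u" by blast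
        then have "x = u" using inj_onD[OF inj u(2)] k x by auto
        then have "x = s \<or> x = t" using u x by auto
        then show ?thesis using x kst by auto
      qed
      then show ?thesis using limg by auto
    qed
    moreover have "compact ?J" by (rule compact_path_image) (rule simple_path_imp_path[OF simp(1)])
    ultimately have "connected_component (- (?J \<union> ?S)) (a i) (a j)"
      using Janiszewski[OF _ clS _ c] connected_arc_image[OF k(1)] by auto
    moreover have "T \<union> ?e \<subseteq> ?J \<union> ?S"
    proof -
      have "?e \<subseteq> g ` {0..s} \<union> g ` {s..t} \<union> g ` {t..1}"
      proof
        fix y assume "y \<in> ?e"
        then obtain x where "x \<in> {0..1}" "y = g x" by (auto simp: path_image_def)
        then show "y \<in> g ` {0..s} \<union> g ` {s..t} \<union> g ` {t..1}"
          by (cases "x \<le> s"; cases "x \<le> t") auto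
      qed
      then show ?thesis using limg by auto
    qed
    ultimately have "connected_component (- (T \<union> ?e)) (a i) (a j)"
      by (meson Compl_subset_Compl_iff connected_component_of_subset)
    then have "a j \<in> V i"
      using V(1)[OF ij(1)] a(1)[OF ij(1)] by (metis components_iff connected_component_eq mem_Collect_eq)
    then show False using a(1)[OF ij(2)] disj ij by blast
  qed
  have side: "connected_component (- ?J) x y" if "x \<in> S" "y \<in> S" "S = inside ?J \<or> S = outside ?J" for x y S
  proof -
    have "connected S" "S \<subseteq> - ?J" using jordan that(3) by blast+
    then show ?thesis unfolding connected_component_def using that by blast
  qed
  have "a i \<in> inside ?J \<or> a i \<in> outside ?J" if "i < 4" "i \<noteq> 0" for i
  proof -
    have "a i \<in> inside ?J \<union> outside ?J" using aJ[OF that] jordan by blast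
    then show ?thesis by blast
  qed
  from this[of 1] this[of 2] this[of 3]
  have "a 1 \<in> inside ?J \<or> a 1 \<in> outside ?J" "a 2 \<in> inside ?J \<or> a 2 \<in> outside ?J"
    "a 3 \<in> inside ?J \<or> a 3 \<in> outside ?J"
    by simp_all
  moreover have "\<not> connected_component (- ?J) (a 1) (a 2)" using same[of 1 2] by fastforce
  moreover have "\<not> connected_component (- ?J) (a 1) (a 3)" using same[of 1 3] by fastforce
  moreover have "\<not> connected_component (- ?J) (a 2) (a 3)" using same[of 2 3] by fastforce
  ultimately show False using side by metis
qed

lemma finite_components_add_arc:
  fixes g :: "real \<Rightarrow> complex"
  assumes T: "closed T" "arc g" "path_image g \<inter> T \<subseteq> {pathstart g, pathfinish g}"
    and fin: "finite (components (- T))"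
  shows "finite (components (- (T \<union> path_image g)))"
proof (rule ccontr)
  let ?C = "components (- (T \<union> path_image g))"
  assume inf: "infinite ?C"
  have "\<exists>K \<in> components (- T). V \<subseteq> K" if "V \<in> ?C" for V
  proof -
    have "V \<subseteq> - T" "connected V" "V \<noteq> {}"
      using in_components_subset[OF that] in_components_connected[OF that] in_components_nonempty[OF that] by auto
    then show ?thesis using exists_component_superset by blast
  qed
  then obtain K where K: "\<And>V. V \<in> ?C \<Longrightarrow> K V \<in> components (- T) \<and> V \<subseteq> K V" by metis
  have "finite (K ` ?C)" using K fin by (meson finite_subset image_subsetI)
  then obtain W where W: "W \<in> ?C" "infinite {V \<in> ?C. K V = K W}"
    using pigeonhole_infinite[OF inf] by blast
  obtain F where F: "F \<subseteq> {V \<in> ?C. K V = K W}" "card F = 4" "finite F"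
    using infinite_arbitrarily_large[OF W(2)] by meson
  obtain f where f: "bij_betw f {..<4::nat} F"
    using ex_bij_betw_nat_finite[OF F(3)] F(2) by (auto simp: lessThan_atLeast0)
  have fV: "f i \<in> ?C" "K (f i) = K W" if "i < 4" for i
    using f F that unfolding bij_betw_def by auto
  define a where "a i = (SOME x. x \<in> f i)" for i
  have a: "a i \<in> f i" if "i < 4" for i
    unfolding a_def using in_components_nonempty[OF fV(1)[OF that]] by (simp add: some_in_eq)
  show False
  proof (rule crosscut_at_most_three_components[OF T fV(1) _ a])
    show "inj_on f {..<4}" using f by (simp add: bij_betw_def)
    fix i :: nat assume i: "i < 4"
    have "a 0 \<in> K W" "a i \<in> K W" "K W \<in> components (- T)"
      using a[of 0] a[OF i] K[OF fV(1)[of 0]] K[OF fV(1)[OF i]] fV(2)[of 0] fV(2)[OF i] by auto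
    then show "connected_component (- T) (a 0) (a i)"
      by (meson connected_component_def in_components_connected in_components_subset)
  qed
qed

section \<open>Simple plane graphs\<close>

text \<open>A simple plane graph: every edge is an arc that contains exactly two vertices, its end points,
  and different edges meet in vertices only and have different pairs of end points.\<close>

locale plane_graph =
  fixes V :: "complex set" and E :: "complex set set"
  assumes finV: "finite V" and finE: "finite E"
    and edge: "e \<in> E \<Longrightarrow> \<exists>g. arc g \<and> path_image g = e \<and> e \<inter> V = {pathstart g, pathfinish g}"
    and meet: "\<lbrakk>e \<in> E; e' \<in> E; e \<noteq> e'\<rbrakk> \<Longrightarrow> e \<inter> e' \<subseteq> V"
    and simple: "\<lbrakk>e \<in> E; e' \<in> E; e \<inter> V = e' \<inter> V\<rbrakk> \<Longrightarrow> e = e'"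
begin

text \<open>Adjacency; the edge that joins two adjacent vertices (unique, the graph being simple) is \<open>ed x y\<close>.\<close>

definition adj :: "complex \<Rightarrow> complex \<Rightarrow> bool" where
  "adj x y \<longleftrightarrow> x \<noteq> y \<and> (\<exists>e \<in> E. e \<inter> V = {x, y})"

definition ed :: "complex \<Rightarrow> complex \<Rightarrow> complex set" where
  "ed x y = (THE e. e \<in> E \<and> e \<inter> V = {x, y})"

lemma adj_sym: "adj x y \<longleftrightarrow> adj y x"
  unfolding adj_def by (auto simp: insert_commute)

lemma ed_sym: "ed x y = ed y x"
  unfolding ed_def by (simp add: insert_commute)

lemma ed_props:
  assumes "adj x y"
  shows "ed x y \<in> E" "ed x y \<inter> V = {x, y}"
proof -
  have "\<exists>!e. e \<in> E \<and> e \<inter> V = {x, y}"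
    using assms simple unfolding adj_def by metis
  then have "ed x y \<in> E \<and> ed x y \<inter> V = {x, y}"
    unfolding ed_def by (rule theI')
  then show "ed x y \<in> E" "ed x y \<inter> V = {x, y}" by auto
qed

lemma ed_eqI:
  assumes "e \<in> E" "e \<inter> V = {x, y}"
  shows "ed x y = e"
  unfolding ed_def
proof (rule the_equality)
  fix e' assume "e' \<in> E \<and> e' \<inter> V = {x, y}"
  then show "e' = e" using simple[of e' e] assms by simp
qed (use assms in simp)

lemma adj_in_V: "adj x y \<Longrightarrow> x \<in> V \<and> y \<in> V"
  using ed_props(2) by blast

lemma adj_neq: "adj x y \<Longrightarrow> x \<noteq> y"
  by (simp add: adj_def)

lemma ed_eq_iff: "adj x y \<Longrightarrow> adj a b \<Longrightarrow> ed x y = ed a b \<longleftrightarrow> {x, y} = {a, b}"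
  using simple[OF ed_props(1) ed_props(1), of x y a b] ed_props(2)[of x y] ed_props(2)[of a b] by auto

lemma edge_adj:
  assumes "e \<in> E"
  obtains x y where "adj x y" "e = ed x y"
proof -
  obtain g where g: "arc g" "path_image g = e" "e \<inter> V = {pathstart g, pathfinish g}"
    using edge[OF assms] by blast
  then have "adj (pathstart g) (pathfinish g)" "e = ed (pathstart g) (pathfinish g)"
    using assms arc_distinct_ends[OF g(1)] ed_eqI[OF assms] unfolding adj_def by auto
  then show ?thesis using that by blast
qed

lemma ed_arc:
  assumes "adj x y"
  obtains g where "arc g" "path_image g = ed x y" "pathstart g = x" "pathfinish g = y"
proof -
  obtain g where g: "arc g" "path_image g = ed x y" "ed x y \<inter> V = {pathstart g, pathfinish g}"
    using edge[OF ed_props(1)[OF assms]] by blast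
  then have "{pathstart g, pathfinish g} = {x, y}" using ed_props(2)[OF assms] by simp
  then consider "pathstart g = x" "pathfinish g = y" | "pathstart g = y" "pathfinish g = x"
    by (auto simp: doubleton_eq_iff)
  then show ?thesis
  proof cases
    case 1 then show ?thesis using that g by blast
  next
    case 2
    then show ?thesis using that[of "reversepath g"] g by (simp add: arc_reversepath)
  qed
qed

subsection \<open>Walks\<close>

abbreviation walk :: "complex list \<Rightarrow> bool" where
  "walk xs \<equiv> successively adj xs"

text \<open>The edges of a walk.\<close>

fun eds :: "complex list \<Rightarrow> complex set set" where
  "eds (x # y # zs) = insert (ed x y) (eds (y # zs))"
| "eds _ = {}"

lemma eds_append: "eds (xs @ q # ys) = eds (xs @ [q]) \<union> eds (q # ys)"
proof (induction xs rule: eds.induct)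
  case (1 x y zs)
  then show ?case by simp
next
  case "2_1"
  then show ?case by simp
next
  case ("2_2" v)
  then show ?case by simp
qed

lemma eds_rev: "eds (rev xs) = eds xs"
proof (induction xs rule: eds.induct)
  case (1 x y zs)
  have "eds (rev (x # y # zs)) = eds (rev zs @ [y]) \<union> eds [y, x]"
    using eds_append[of "rev zs" y "[x]"] by simp
  then show ?case using 1 by (auto simp: ed_sym)
qed auto

lemma finite_eds [simp]: "finite (eds xs)"
  by (induction xs rule: eds.induct) auto

lemma walk_append: "walk (xs @ q # ys) \<longleftrightarrow> walk (xs @ [q]) \<and> walk (q # ys)"
  unfolding successively_append_iff by auto

lemma walk_rev: "walk (rev xs) \<longleftrightarrow> walk xs"
  using adj_sym by (simp add: successively_rev)

lemma eds_in_E: "walk xs \<Longrightarrow> eds xs \<subseteq> E"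
  by (induction xs rule: eds.induct) (auto simp: ed_props)

lemma eds_obtain:
  assumes "walk xs" "e \<in> eds xs"
  obtains x y as bs where "xs = as @ x # y # bs" "e = ed x y" "adj x y"
  using assms
proof (induction xs arbitrary: thesis rule: eds.induct)
  case (1 x y zs)
  show ?case
  proof (cases "e = ed x y")
    case True
    then show ?thesis using 1(2)[of "[]" x y zs] 1(3) by auto
  next
    case False
    then have e: "e \<in> eds (y # zs)" "walk (y # zs)" using 1 by auto
    obtain as a b bs where "y # zs = as @ a # b # bs" "e = ed a b" "adj a b"
      using 1(1)[OF _ e(2,1)] by blast
    then show ?thesis using 1(2)[of "x # as" a b bs] by simp
  qed
qed auto

lemma eds_V_subset: "walk xs \<Longrightarrow> e \<in> eds xs \<Longrightarrow> e \<inter> V \<subseteq> set xs"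
  by (erule eds_obtain) (use ed_props(2) in auto)

lemma Union_eds_V:
  assumes "walk xs" "length xs \<ge> 2"
  shows "\<Union> (eds xs) \<inter> V = set xs"
  using assms
proof (induction xs rule: eds.induct)
  case (1 x y zs)
  then have a: "adj x y" by simp
  show ?case
  proof (cases zs)
    case Nil then show ?thesis using ed_props(2)[OF a] by simp
  next
    case (Cons z zs')
    then have "\<Union> (eds (y # zs)) \<inter> V = set (y # zs)" using 1 by auto
    then show ?thesis using ed_props(2)[OF a] by auto
  qed
qed auto

lemma eds_disjointI:
  assumes "walk xs" "walk ys" "\<And>x y. adj x y \<Longrightarrow> x \<in> set xs \<inter> set ys \<Longrightarrow> y \<in> set xs \<inter> set ys \<Longrightarrow> ed x y \<in> eds xs \<Longrightarrow> ed x y \<notin> eds ys"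
  shows "eds xs \<inter> eds ys = {}"
proof -
  have False if e: "e \<in> eds xs" "e \<in> eds ys" for e
  proof -
    obtain x y where xy: "adj x y" "e = ed x y" using eds_in_E[OF assms(1)] e edge_adj by blast
    then have "{x, y} \<subseteq> set xs \<inter> set ys"
      using eds_V_subset[OF assms(1) e(1)] eds_V_subset[OF assms(2) e(2)] ed_props(2)[OF xy(1)] by blast
    then show False using assms(3)[of x y] xy e by auto
  qed
  then show ?thesis by blast
qed

lemma Union_eds_Int:
  assumes "walk xs" "walk ys" "eds xs \<inter> eds ys = {}"
  shows "\<Union> (eds xs) \<inter> \<Union> (eds ys) \<subseteq> set xs \<inter> set ys"
proof
  fix z assume "z \<in> \<Union> (eds xs) \<inter> \<Union> (eds ys)"
  then obtain e e' where e: "e \<in> eds xs" "e' \<in> eds ys" "z \<in> e" "z \<in> e'" by blast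
  then have "e \<noteq> e'" using assms(3) by blast
  then have "z \<in> V" using meet[of e e'] e eds_in_E assms by blast
  then show "z \<in> set xs \<inter> set ys"
    using eds_V_subset[OF assms(1) e(1)] eds_V_subset[OF assms(2) e(2)] e by blast
qed

text \<open>A walk without repeated vertices runs through an arc.\<close>

lemma arc_of_walk:
  assumes "walk xs" "distinct xs" "length xs \<ge> 2"
  shows "\<exists>g. arc g \<and> path_image g = \<Union> (eds xs) \<and> pathstart g = hd xs \<and> pathfinish g = last xs"
  using assms
proof (induction xs rule: eds.induct)
  case (1 x y zs)
  then have a: "adj x y" by simp
  obtain f where f: "arc f" "path_image f = ed x y" "pathstart f = x" "pathfinish f = y"
    using ed_arc[OF a] by blast
  show ?case
  proof (cases zs)
    case Nil then show ?thesis using f by auto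
  next
    case (Cons z zs')
    then obtain g where g: "arc g" "path_image g = \<Union> (eds (y # zs))" "pathstart g = y" "pathfinish g = last (y # zs)"
      using 1 by auto
    have w: "walk (y # zs)" "walk [x, y]" using 1 by auto
    have "eds [x, y] \<inter> eds (y # zs) = {}"
      by (rule eds_disjointI[OF w(2,1)]) (use 1 adj_neq in auto)
    from Union_eds_Int[OF w(2,1) this]
    have "path_image f \<inter> path_image g \<subseteq> {pathstart g}"
      using f g 1 by auto
    then have "arc (f +++ g)" using f g by (intro arc_join) auto
    then show ?thesis using f g
      by (intro exI[of _ "f +++ g"]) (auto simp: path_image_join)
  qed
qed auto

text \<open>If an edge of a path joins the two ends of the path, the path consists of this edge.\<close>

lemma eds_ends:
  assumes "distinct (p # as @ [q])" "walk (p # as @ [q])" "ed p q \<in> eds (p # as @ [q])" "adj p q"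
  shows "as = []"
proof -
  obtain x y us vs where xy: "p # as @ [q] = us @ x # y # vs" "ed p q = ed x y" "adj x y"
    using eds_obtain[OF assms(2,3)] by metis
  then have "{p, q} = {x, y}" using ed_eq_iff[OF assms(4) xy(3)] by simp
  then have "(x = p \<and> y = q) \<or> (x = q \<and> y = p)" by (auto simp: doubleton_eq_iff)
  then show ?thesis
  proof
    assume a: "x = p \<and> y = q"
    have "us = []"
    proof (rule ccontr)
      assume "us \<noteq> []"
      then have "hd us = p" "p \<in> set us" using xy(1) by (cases us; auto)+
      then show False using assms(1) xy(1) a by auto
    qed
    then have "as @ [q] = q # vs" using xy(1) a by auto
    then show ?thesis using assms(1) by (cases as) auto
  next
    assume a: "x = q \<and> y = p"
    have "distinct (us @ x # y # vs)" using assms(1) xy(1) by metis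
    moreover have "p \<in> set us" if "us \<noteq> []" using xy(1) that by (cases us) auto
    ultimately have "us = []" using a by auto
    then have "x = p" using xy(1) by auto
    then show ?thesis using a assms(1) by auto
  qed
qed

lemma theta_eds_disjoint:
  assumes "walk (p # as @ [q])" "walk (p # cs @ [q])" "distinct (p # as @ q # cs)" "as \<noteq> [] \<or> cs \<noteq> []"
  shows "eds (p # as @ [q]) \<inter> eds (p # cs @ [q]) = {}"
proof (rule eds_disjointI[OF assms(1,2)])
  fix x y assume a: "adj x y" "x \<in> set (p # as @ [q]) \<inter> set (p # cs @ [q])"
    "y \<in> set (p # as @ [q]) \<inter> set (p # cs @ [q])" "ed x y \<in> eds (p # as @ [q])"
  have "x \<in> {p, q}" "y \<in> {p, q}" using a(2,3) assms(3) by auto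
  then have pq: "ed p q = ed x y" "adj p q"
    using a(1) adj_neq[OF a(1)] by (auto simp: ed_sym adj_sym)
  then have "as = []" using eds_ends[of p as q] assms a by auto
  then have "cs \<noteq> []" using assms by auto
  then show "ed x y \<notin> eds (p # cs @ [q])" using eds_ends[of p cs q] assms pq by auto
qed

lemma theta_arcs_Int:
  assumes "walk (p # as @ [q])" "walk (p # cs @ [q])" "distinct (p # as @ q # cs)" "as \<noteq> [] \<or> cs \<noteq> []"
  shows "\<Union> (eds (p # as @ [q])) \<inter> \<Union> (eds (p # cs @ [q])) = {p, q}"
proof
  show "\<Union> (eds (p # as @ [q])) \<inter> \<Union> (eds (p # cs @ [q])) \<subseteq> {p, q}"
    using Union_eds_Int[OF assms(1,2) theta_eds_disjoint[OF assms]] assms(3) by auto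
  show "{p, q} \<subseteq> \<Union> (eds (p # as @ [q])) \<inter> \<Union> (eds (p # cs @ [q]))"
    using Union_eds_V[OF assms(1)] Union_eds_V[OF assms(2)] by auto
qed

subsection \<open>Cycles and the curves that they run through\<close>

text \<open>Cycles, given by the list of their vertices without repetition of the first one; the edges of a cycle;
  and the closed curve that they form, as a subset of the plane.\<close>

definition cyc :: "complex list \<Rightarrow> bool" where
  "cyc xs \<longleftrightarrow> distinct xs \<and> length xs \<ge> 3 \<and> walk (xs @ [hd xs])"

definition ceds :: "complex list \<Rightarrow> complex set set" where
  "ceds xs = eds (xs @ [hd xs])"

definition crv :: "complex list \<Rightarrow> complex set" where
  "crv xs = \<Union> (ceds xs)"

lemma cyc_rotate1:
  assumes "cyc xs"
  shows "cyc (rotate1 xs)" "ceds (rotate1 xs) = ceds xs" "crv (rotate1 xs) = crv xs"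
proof -
  obtain x y zs where xs: "xs = x # y # zs" using assms unfolding cyc_def
    by (metis One_nat_def Suc_1 Suc_le_length_iff numeral_3_eq_3)
  show "cyc (rotate1 xs)" using assms walk_append[of "y # zs" x "[y]"] unfolding cyc_def xs by auto
  show c: "ceds (rotate1 xs) = ceds xs"
    using eds_append[of "y # zs" x "[y]"] unfolding ceds_def xs by auto
  then show "crv (rotate1 xs) = crv xs" by (simp add: crv_def)
qed

lemma cyc_rotate:
  assumes "cyc xs"
  shows "cyc (rotate k xs) \<and> ceds (rotate k xs) = ceds xs \<and> crv (rotate k xs) = crv xs"
  using assms by (induction k) (auto simp: cyc_rotate1)

lemma cyc_start_at:
  assumes "cyc xs" "p \<in> set xs"
  obtains ys where "cyc (p # ys)" "set (p # ys) = set xs" "ceds (p # ys) = ceds xs" "crv (p # ys) = crv xs"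
proof -
  obtain as bs where xs: "xs = as @ p # bs" using assms(2) split_list by metis
  have "rotate (length as) xs = p # bs @ as" unfolding xs by (simp add: rotate_append)
  then show ?thesis using that[of "bs @ as"] cyc_rotate[OF assms(1), of "length as"] xs by auto
qed

lemma cyc_split_at:
  assumes "cyc xs" "p \<in> set xs" "q \<in> set xs" "p \<noteq> q"
  obtains as bs where "cyc (p # as @ q # bs)" "set (p # as @ q # bs) = set xs"
    "ceds (p # as @ q # bs) = ceds xs" "crv (p # as @ q # bs) = crv xs"
proof -
  obtain ys where ys: "cyc (p # ys)" "set (p # ys) = set xs" "ceds (p # ys) = ceds xs" "crv (p # ys) = crv xs"
    using cyc_start_at[OF assms(1,2)] by blast
  then have "q \<in> set ys" using assms by auto
  then obtain as bs where "ys = as @ q # bs" using split_list by metis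
  then show ?thesis using that ys by metis
qed

lemma cyc_two_paths:
  "cyc (p # as @ q # bs) \<longleftrightarrow> distinct (p # as @ q # bs) \<and> (as \<noteq> [] \<or> bs \<noteq> []) \<and>
     walk (p # as @ [q]) \<and> walk (p # rev bs @ [q])"
proof -
  have "walk (p # rev bs @ [q]) \<longleftrightarrow> walk (q # bs @ [p])"
    using walk_rev[of "q # bs @ [p]"] by simp
  then show ?thesis
    using walk_append[of "p # as" q "bs @ [p]"] unfolding cyc_def by (auto simp: Suc_le_eq)
qed

lemma ceds_two_paths:
  "ceds (p # as @ q # bs) = eds (p # as @ [q]) \<union> eds (p # rev bs @ [q])"
  using eds_append[of "p # as" q "bs @ [p]"] eds_rev[of "q # bs @ [p]"]
  unfolding ceds_def by simp

lemma ceds_in_E: "cyc xs \<Longrightarrow> ceds xs \<subseteq> E"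
  unfolding cyc_def ceds_def using eds_in_E by blast

lemma finite_ceds [simp]: "finite (ceds xs)"
  by (simp add: ceds_def)

lemma crv_V: "cyc xs \<Longrightarrow> crv xs \<inter> V = set xs"
  unfolding cyc_def crv_def ceds_def by (subst Union_eds_V) (auto intro: hd_in_set)

lemma cyc_hd_last:
  assumes "cyc xs"
  obtains x ys y where "xs = x # ys @ [y]" "ys \<noteq> []"
proof -
  obtain x zs where "xs = x # zs" "length zs \<ge> 2" using assms unfolding cyc_def
    by (metis Suc_le_length_iff Suc_le_mono numeral_2_eq_2 numeral_3_eq_3)
  moreover from this obtain ys y where "zs = ys @ [y]" by (cases zs rule: rev_cases) auto
  ultimately show ?thesis using that[of x ys y] by (cases ys) auto
qed

lemma cyc_curve:
  assumes "cyc xs"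
  obtains g where "simple_path g" "pathfinish g = pathstart g" "path_image g = crv xs"
proof -
  obtain x ys y where xs: "xs = x # ys @ [y]" "ys \<noteq> []" using cyc_hd_last[OF assms] by blast
  have c: "distinct (x # ys @ y # [])" "walk (x # ys @ [y])" "walk (x # [] @ [y])"
    using assms cyc_two_paths[of x ys y "[]"] xs by auto
  obtain g where g: "arc g" "path_image g = \<Union> (eds (x # ys @ [y]))" "pathstart g = x" "pathfinish g = y"
    using arc_of_walk[of "x # ys @ [y]"] c by auto
  have "adj y x" using c adj_sym by simp
  then obtain f where f: "arc f" "path_image f = ed y x" "pathstart f = y" "pathfinish f = x"
    using ed_arc by blast
  have "path_image g \<inter> path_image f = {x, y}"
    using theta_arcs_Int[OF c(2,3)] c xs g f by (auto simp: ed_sym)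
  then have "simple_path (g +++ f)" using g f by (intro simple_path_join_loop) auto
  moreover have "path_image (g +++ f) = crv xs"
    using g f ceds_two_paths[of x ys y "[]"] unfolding crv_def xs by (auto simp: path_image_join ed_sym)
  ultimately show ?thesis using that[of "g +++ f"] g f by auto
qed

text \<open>The Jordan curve theorem for the curve of a cycle.\<close>

lemma cyc_jordan:
  assumes "cyc xs"
  shows "inside (crv xs) \<noteq> {}" "open (inside (crv xs))" "connected (inside (crv xs))"
    "open (outside (crv xs))" "connected (outside (crv xs))" "bounded (inside (crv xs))"
    "\<not> bounded (outside (crv xs))"
    "inside (crv xs) \<inter> outside (crv xs) = {}" "inside (crv xs) \<union> outside (crv xs) = - crv xs"
    "frontier (inside (crv xs)) = crv xs" "frontier (outside (crv xs)) = crv xs" "compact (crv xs)"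
    "closure (inside (crv xs)) = inside (crv xs) \<union> crv xs"
proof -
  obtain g where g: "simple_path g" "pathfinish g = pathstart g" "path_image g = crv xs"
    using cyc_curve[OF assms] by blast
  show "inside (crv xs) \<noteq> {}" "open (inside (crv xs))" "connected (inside (crv xs))"
    "open (outside (crv xs))" "connected (outside (crv xs))" "bounded (inside (crv xs))"
    "\<not> bounded (outside (crv xs))"
    "inside (crv xs) \<inter> outside (crv xs) = {}" "inside (crv xs) \<union> outside (crv xs) = - crv xs"
    and f: "frontier (inside (crv xs)) = crv xs" and "frontier (outside (crv xs)) = crv xs"
    using Jordan_inside_outside[OF g(1,2)] unfolding g(3) by - (elim conjE, assumption)+
  show "compact (crv xs)" using g compact_simple_path_image by metis
  show "closure (inside (crv xs)) = inside (crv xs) \<union> crv xs"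
    using f closure_Un_frontier by metis
qed

text \<open>An edge that meets the inside of a cycle runs in the inside, except for its ends.\<close>

lemma edge_inside:
  assumes "cyc xs" "e \<in> E" "e \<inter> inside (crv xs) \<noteq> {}"
  shows "e - V \<subseteq> inside (crv xs)" "e \<subseteq> inside (crv xs) \<union> crv xs" "e - V \<noteq> {}"
proof -
  obtain g where g: "arc g" "path_image g = e" "e \<inter> V = {pathstart g, pathfinish g}"
    using edge[OF assms(2)] by blast
  have sp: "simple_path g" using g(1) arc_imp_simple_path by blast
  have eV: "e - V = path_image g - {pathstart g, pathfinish g}" using g by auto
  have conn: "connected (e - V)" unfolding eV by (rule connected_simple_path_endless[OF sp])
  show ne: "e - V \<noteq> {}" unfolding eV using simple_path_endless[OF sp] by simp
  note J = cyc_jordan[OF assms(1)]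
  have inf: "infinite e" using arc_image_uncountable[OF g(1)] g(2) countable_finite by blast
  have meets: "(e - V) \<inter> S \<noteq> {}" if "open S" "e \<inter> S \<noteq> {}" for S
  proof
    assume "(e - V) \<inter> S = {}"
    then have fin: "finite (e \<inter> S)" using finV by (rule_tac finite_subset[OF _ finV]) blast
    have "connected e" using connected_arc_image[OF g(1)] g(2) by simp
    moreover have "openin (top_of_set e) (e \<inter> S)" using that(1) by (rule openin_open_Int)
    moreover have "closedin (top_of_set e) (e \<inter> S)"
      using fin by (simp add: closed_subset finite_imp_closed)
    ultimately have "e \<inter> S = e" using that(2) unfolding connected_clopen by blast
    then show False using fin inf by simp
  qed
  have clo: "e \<subseteq> closure (e - V)"
  proof
    fix x assume x: "x \<in> e"
    show "x \<in> closure (e - V)"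
    proof (rule ccontr)
      assume "x \<notin> closure (e - V)"
      then have "(e - V) \<inter> - closure (e - V) \<noteq> {}" using meets[of "- closure (e - V)"] x by blast
      then show False using closure_subset[of "e - V"] by auto
    qed
  qed
  have "e \<notin> ceds xs" using assms(3) J(9) unfolding crv_def by blast
  then have "(e - V) \<inter> crv xs = {}"
    using meet[OF assms(2)] ceds_in_E[OF assms(1)] unfolding crv_def by blast
  moreover have "(e - V) \<inter> inside (crv xs) \<noteq> {}"
    using assms(3) J(2) meets by blast
  ultimately show 1: "e - V \<subseteq> inside (crv xs)"
    using connected_Int_frontier[OF conn, of "inside (crv xs)"] J(10) by blast
  show "e \<subseteq> inside (crv xs) \<union> crv xs"
    using closure_mono[OF 1] clo J(13) by blast
qed

subsection \<open>Splitting a cycle by a path through its inside\<close>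

text \<open>The cycle with the vertices \<open>p, as, q, bs\<close> is cut in two by the path \<open>p, cs, q\<close> through its
  inside.\<close>

definition theta :: "complex \<Rightarrow> complex list \<Rightarrow> complex \<Rightarrow> complex list \<Rightarrow> complex list \<Rightarrow> bool" where
  "theta p as q bs cs \<longleftrightarrow>
     cyc (p # as @ q # bs) \<and> cyc (p # as @ q # rev cs) \<and> cyc (p # cs @ q # bs) \<and>
     distinct (p # q # as @ bs @ cs) \<and> walk (p # cs @ [q]) \<and>
     eds (p # as @ [q]) \<inter> eds (p # rev bs @ [q]) = {} \<and>
     eds (p # as @ [q]) \<inter> eds (p # cs @ [q]) = {} \<and>
     eds (p # rev bs @ [q]) \<inter> eds (p # cs @ [q]) = {} \<and>
     \<Union> (eds (p # cs @ [q])) - {p, q} \<subseteq> inside (crv (p # as @ q # bs)) \<and>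
     inside (crv (p # as @ q # rev cs)) \<inter> inside (crv (p # cs @ q # bs)) = {} \<and>
     inside (crv (p # as @ q # rev cs)) \<union> inside (crv (p # cs @ q # bs)) \<union> (\<Union> (eds (p # cs @ [q])) - {p, q})
       = inside (crv (p # as @ q # bs))"

lemma thetaI:
  assumes c: "cyc (p # as @ q # bs)" and w: "walk (p # cs @ [q])" and d: "distinct (p # q # as @ bs @ cs)"
    and ins: "\<Union> (eds (p # cs @ [q])) - {p, q} \<subseteq> inside (crv (p # as @ q # bs))"
  shows "theta p as q bs cs"
proof -
  define A where "A = \<Union> (eds (p # as @ [q]))"
  define B where "B = \<Union> (eds (p # rev bs @ [q]))"
  define C where "C = \<Union> (eds (p # cs @ [q]))"
  have w2: "walk (p # as @ [q])" "walk (p # rev bs @ [q])" "as \<noteq> [] \<or> bs \<noteq> []"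
    using c cyc_two_paths by auto
  have crvs: "crv (p # as @ q # bs) = A \<union> B"
    unfolding crv_def ceds_two_paths A_def B_def by (rule Union_Un_distrib)
  have insC: "C - {p, q} \<subseteq> inside (A \<union> B)" using ins unfolding crvs C_def .
  obtain h where h: "arc h" "path_image h = C" "pathstart h = p" "pathfinish h = q"
    using arc_of_walk[OF w] d unfolding C_def by auto
  obtain z where z: "z \<in> C - {p, q}"
    using nonempty_simple_path_endless[OF arc_imp_simple_path[OF h(1)]] h by auto
  have zin: "z \<in> inside (A \<union> B)" "z \<notin> A \<union> B"
    using z insC inside_no_overlap[of "A \<union> B"] by blast+
  have "cs \<noteq> []" if "as = [] \<or> bs = []"
  proof
    assume "cs = []"
    then have "C = ed p q" by (simp add: C_def)
    then have "C \<subseteq> A \<union> B" using that by (auto simp: A_def B_def)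
    then show False using z zin by blast
  qed
  then have ne: "as \<noteq> [] \<or> cs \<noteq> []" "rev bs \<noteq> [] \<or> cs \<noteq> []" "as \<noteq> [] \<or> rev bs \<noteq> []" using w2 by auto
  have d3: "distinct (p # as @ q # cs)" "distinct (p # rev bs @ q # cs)" "distinct (p # as @ q # rev bs)" using d by auto
  have cs: "cyc (p # as @ q # rev cs)" "cyc (p # cs @ q # bs)"
    unfolding cyc_two_paths using w w2 d ne by auto
  obtain f where f: "arc f" "path_image f = A" "pathstart f = p" "pathfinish f = q"
    using arc_of_walk[OF w2(1)] d unfolding A_def by auto
  obtain g where g: "arc g" "path_image g = B" "pathstart g = p" "pathfinish g = q"
    using arc_of_walk[OF w2(2)] d unfolding B_def by auto
  have Int: "A \<inter> B = {p, q}" "A \<inter> C = {p, q}" "B \<inter> C = {p, q}"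
    unfolding A_def B_def C_def
    by (rule theta_arcs_Int[OF w2(1,2) d3(3) ne(3)] theta_arcs_Int[OF w2(1) w d3(1) ne(1)] theta_arcs_Int[OF w2(2) w d3(2) ne(2)])+
  have pq: "p \<noteq> q" using d by auto
  have meet: "C \<inter> inside (A \<union> B) \<noteq> {}" using z zin by blast
  have "inside (A \<union> C) \<inter> inside (B \<union> C) = {} \<and>
      inside (A \<union> C) \<union> inside (B \<union> C) \<union> (C - {p, q}) = inside (A \<union> B)"
    using split_inside_simple_closed_curve[OF arc_imp_simple_path[OF f(1)] f(3,4) arc_imp_simple_path[OF g(1)] g(3,4)
      arc_imp_simple_path[OF h(1)] h(3,4) pq, unfolded f(2) g(2) h(2), OF Int meet] by metis
  moreover have "crv (p # as @ q # rev cs) = A \<union> C" "crv (p # cs @ q # bs) = C \<union> B"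
    unfolding crv_def ceds_two_paths A_def B_def C_def rev_rev_ident by (rule Union_Un_distrib)+
  ultimately show ?thesis
    unfolding theta_def C_def[symmetric] crvs Un_commute[of C B]
    using cs c w d insC theta_eds_disjoint[OF w2(1,2) d3(3) ne(3)] theta_eds_disjoint[OF w2(1) w d3(1) ne(1)] theta_eds_disjoint[OF w2(2) w d3(2) ne(2)]
    by - (elim conjE, intro conjI, (simp only: Un_commute)+)
qed

lemma rtrancl_path:
  assumes "(a, b) \<in> {(x, y). adj x y \<and> x \<in> I \<and> y \<in> I}\<^sup>*" "a \<in> I"
  shows "\<exists>cs. cs \<noteq> [] \<and> hd cs = a \<and> last cs = b \<and> distinct cs \<and> walk cs \<and> set cs \<subseteq> I"
  using assms(1)
proof (induction rule: rtrancl_induct)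
  case base
  then show ?case using assms(2) by (intro exI[of _ "[a]"]) auto
next
  case (step y z)
  then obtain cs where cs: "cs \<noteq> []" "hd cs = a" "last cs = y" "distinct cs" "walk cs" "set cs \<subseteq> I" by blast
  show ?case
  proof (cases "z \<in> set cs")
    case False
    then show ?thesis using cs step
      by (intro exI[of _ "cs @ [z]"]) (auto simp: successively_append_iff)
  next
    case True
    then obtain us vs where uv: "cs = us @ z # vs" using split_list by metis
    then have "hd (us @ [z]) = a" using cs(2) by (cases us) auto
    then show ?thesis using cs uv walk_append[of us z vs]
      by (intro exI[of _ "us @ [z]"]) auto
  qed
qed

text \<open>The set \<open>H\<close> of vertices is joined to at least two vertices outside \<open>H\<close>.\<close>

definition two_nbrs :: "complex set \<Rightarrow> bool" where
  "two_nbrs H \<longleftrightarrow> (\<exists>p q. p \<noteq> q \<and> p \<notin> H \<and> q \<notin> H \<and> (\<exists>h \<in> H. adj p h) \<and> (\<exists>h \<in> H. adj q h))"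

text \<open>If no set of inner vertices is attached to the rest of the graph at a single vertex, then a
  cycle with an edge in its inside has a path through its inside.\<close>

lemma exists_path_across:
  assumes c: "cyc xs" and e: "e \<in> E" "e \<inter> inside (crv xs) \<noteq> {}"
    and two: "\<And>H. H \<subseteq> V \<inter> inside (crv xs) \<Longrightarrow> H \<noteq> {} \<Longrightarrow> two_nbrs H"
  obtains p q cs where "p \<noteq> q" "p \<in> set xs" "q \<in> set xs" "walk (p # cs @ [q])" "distinct (p # q # cs)"
    "set cs \<subseteq> V \<inter> inside (crv xs)" "\<Union> (eds (p # cs @ [q])) - {p, q} \<subseteq> inside (crv xs)"
proof -
  define I where "I = V \<inter> inside (crv xs)"
  note J = cyc_jordan[OF c]
  have crvI: "x \<in> set xs \<or> x \<in> I" if "x \<in> V" "x \<in> inside (crv xs) \<union> crv xs" for x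
    using that crv_V[OF c] unfolding I_def by auto
  have disj: "set xs \<inter> I = {}" using crv_V[OF c] J(9) unfolding I_def by blast
  obtain x y where xy: "adj x y" "e = ed x y" using edge_adj[OF e(1)] by blast
  have exy: "e \<inter> V = {x, y}" using ed_props[OF xy(1)] xy by simp
  note ei = edge_inside[OF c e]
  show ?thesis
  proof (cases "e \<inter> V \<subseteq> set xs")
    case True
    have "walk (x # [] @ [y])" "\<Union> (eds (x # [] @ [y])) - {x, y} \<subseteq> inside (crv xs)"
      using ei(1) xy exy by auto
    then show ?thesis using that[of x y "[]"] True exy adj_neq[OF xy(1)] by auto
  next
    case False
    then obtain h0 where h0: "h0 \<in> I" using crvI ei(2) by blast
    define R where "R = {(a, b). adj a b \<and> a \<in> I \<and> b \<in> I}"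
    define H where "H = {h. (h0, h) \<in> R\<^sup>*}"
    have HI: "H \<subseteq> I"
    proof
      fix h assume "h \<in> H"
      then have "(h0, h) \<in> R\<^sup>*" by (simp add: H_def)
      then show "h \<in> I" by (induction rule: rtrancl_induct) (use h0 in \<open>auto simp: R_def\<close>)
    qed
    have "h0 \<in> H" by (simp add: H_def)
    then obtain p q h1 h2 where pq: "p \<noteq> q" "p \<notin> H" "q \<notin> H" "h1 \<in> H" "adj p h1" "h2 \<in> H" "adj q h2"
      using two[of H] HI unfolding I_def two_nbrs_def by blast
    have nbr: "r \<in> set xs" if r: "r \<notin> H" "h \<in> H" "adj r h" for r h
    proof -
      have "h \<in> I" using HI r by blast
      have "r \<notin> I"
      proof
        assume "r \<in> I"
        then have "(h, r) \<in> R" using r \<open>h \<in> I\<close> by (simp add: R_def adj_sym)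
        then have "r \<in> H" using r(2) unfolding H_def by (auto intro: rtrancl_into_rtrancl)
        then show False using r by blast
      qed
      have "ed r h \<inter> inside (crv xs) \<noteq> {}" using ed_props(2)[OF r(3)] \<open>h \<in> I\<close> unfolding I_def by blast
      then have "ed r h \<subseteq> inside (crv xs) \<union> crv xs" using edge_inside[OF c ed_props(1)[OF r(3)]] by blast
      then show ?thesis using crvI[of r] ed_props(2)[OF r(3)] \<open>r \<notin> I\<close> by blast
    qed
    have p: "p \<in> set xs" using nbr pq by blast
    have q: "q \<in> set xs" using nbr pq by blast
    have "sym R" unfolding R_def sym_def using adj_sym by auto
    have "(h1, h0) \<in> R\<^sup>*" using pq(4) \<open>sym R\<close> unfolding H_def by (simp add: sym_rtrancl symD)
    then have "(h1, h2) \<in> R\<^sup>*" using pq(6) unfolding H_def by (auto intro: rtrancl_trans)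
    then obtain cs where cs: "cs \<noteq> []" "hd cs = h1" "last cs = h2" "distinct cs" "walk cs" "set cs \<subseteq> I"
      using rtrancl_path[of h1 h2 I] HI pq(4) unfolding R_def by blast
    have w: "walk (p # cs @ [q])"
      using cs pq adj_sym by (auto simp: successively_append_iff successively_Cons)
    have d: "distinct (p # q # cs)" using cs p q disj pq by auto
    have "z \<in> inside (crv xs)" if z: "z \<in> \<Union> (eds (p # cs @ [q])) - {p, q}" for z
    proof -
      obtain f where f: "f \<in> eds (p # cs @ [q])" "z \<in> f" using z by blast
      obtain a b us vs where ab: "p # cs @ [q] = us @ a # b # vs" "f = ed a b" "adj a b"
        using eds_obtain[OF w f(1)] by metis
      have "a \<in> set cs \<or> b \<in> set cs"
      proof (cases us)
        case Nil
        then have "cs @ [q] = b # vs" using ab by auto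
        then show ?thesis using cs(1) by (cases cs) auto
      next
        case (Cons u us')
        then have "cs @ [q] = us' @ a # b # vs" using ab by auto
        then have "cs = us' @ a # butlast (b # vs)"
          by (metis append_butlast_last_id butlast_append butlast_snoc list.distinct(1) butlast.simps(2))
        then show ?thesis by auto
      qed
      then have "f \<inter> inside (crv xs) \<noteq> {}"
        using cs(6) ed_props(2)[OF ab(3)] ab(2) unfolding I_def by blast
      then have "f - V \<subseteq> inside (crv xs)"
        using edge_inside(1)[OF c] ab ed_props by blast
      moreover have "z \<in> inside (crv xs)" if "z \<in> V"
      proof -
        have "z \<in> set (p # cs @ [q])" using eds_V_subset[OF w f(1)] f(2) that by blast
        then show ?thesis using z cs(6) unfolding I_def by auto
      qed
      ultimately show ?thesis using f by blast
    qed
    then show ?thesis using that[OF pq(1) p q w d] cs(6) unfolding I_def by blast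
  qed
qed

text \<open>Induction on the number of edges that meet the inside of a cycle. If no edge does, the inside belongs to
  a face; otherwise the cycle is cut in two by a path through its inside.\<close>

theorem cycle_split_induct:
  assumes "cyc xs"
    and two: "\<And>H. H \<subseteq> V \<inter> inside (crv xs) \<Longrightarrow> H \<noteq> {} \<Longrightarrow> two_nbrs H"
    and base: "\<And>ys. cyc ys \<Longrightarrow> inside (crv ys) \<subseteq> inside (crv xs) \<Longrightarrow> inside (crv ys) \<inter> \<Union>E = {} \<Longrightarrow> Q ys"
    and step: "\<And>ys p as q bs cs. cyc ys \<Longrightarrow> inside (crv ys) \<subseteq> inside (crv xs) \<Longrightarrow>
      set ys = set (p # as @ q # bs) \<Longrightarrow> ceds ys = ceds (p # as @ q # bs) \<Longrightarrow> theta p as q bs cs \<Longrightarrow>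
      set cs \<subseteq> V \<inter> inside (crv ys) \<Longrightarrow>
      Q (p # as @ q # rev cs) \<Longrightarrow> Q (p # cs @ q # bs) \<Longrightarrow> Q ys"
  shows "Q xs"
proof -
  have "Q ys" if "cyc ys" "inside (crv ys) \<subseteq> inside (crv xs)" for ys
    using that
  proof (induction "card {e \<in> E. e \<inter> inside (crv ys) \<noteq> {}}" arbitrary: ys rule: less_induct)
    case less
    show ?case
    proof (cases "inside (crv ys) \<inter> \<Union>E = {}")
      case True
      then show ?thesis using base less by blast
    next
      case False
      then obtain e where e: "e \<in> E" "e \<inter> inside (crv ys) \<noteq> {}" by blast
      have "\<And>H. H \<subseteq> V \<inter> inside (crv ys) \<Longrightarrow> H \<noteq> {} \<Longrightarrow> two_nbrs H"
        using two less(3) by blast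
      then obtain p q cs where cs: "p \<noteq> q" "p \<in> set ys" "q \<in> set ys" "walk (p # cs @ [q])" "distinct (p # q # cs)"
        "set cs \<subseteq> V \<inter> inside (crv ys)" "\<Union> (eds (p # cs @ [q])) - {p, q} \<subseteq> inside (crv ys)"
        using exists_path_across[OF less(2) e] by metis
      obtain as bs where ab: "cyc (p # as @ q # bs)" "set (p # as @ q # bs) = set ys"
        "ceds (p # as @ q # bs) = ceds ys" "crv (p # as @ q # bs) = crv ys"
        using cyc_split_at[OF less(2) cs(2,3,1)] by metis
      have "set ys \<inter> inside (crv ys) = {}" using crv_V[OF less(2)] cyc_jordan(9)[OF less(2)] by blast
      then have "set cs \<inter> set (p # as @ q # bs) = {}" using cs(6) ab(2) by blast
      then have "distinct (p # q # as @ bs @ cs)"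
        using ab(1) cs(5) unfolding cyc_def by auto
      then have th: "theta p as q bs cs" using thetaI ab cs by metis
      let ?P = "\<Union> (eds (p # cs @ [q]))"
      have sub: "inside (crv zs) \<subseteq> inside (crv ys) \<and> inside (crv zs) \<inter> ?P = {} \<and> cyc zs" if "zs = p # as @ q # rev cs \<or> zs = p # cs @ q # bs" for zs
      proof -
        have c: "cyc zs" using th that unfolding theta_def by auto
        have "eds (p # cs @ [q]) \<subseteq> ceds zs"
          using that ceds_two_paths[of p as q "rev cs"] ceds_two_paths[of p cs q bs] by auto
        then have "?P \<subseteq> crv zs" unfolding crv_def by blast
        then show ?thesis using th that c cyc_jordan(9)[OF c] unfolding theta_def ab(4) by blast
      qed
      have lt: "card {e \<in> E. e \<inter> inside (crv zs) \<noteq> {}} < card {e \<in> E. e \<inter> inside (crv ys) \<noteq> {}}"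
        if "zs = p # as @ q # rev cs \<or> zs = p # cs @ q # bs" for zs
      proof (rule psubset_card_mono)
        show "finite {e \<in> E. e \<inter> inside (crv ys) \<noteq> {}}" using finE by simp
        obtain f where f: "f \<in> eds (p # cs @ [q])" by (cases cs) auto
        then have fE: "f \<in> E" using eds_in_E[OF cs(4)] by blast
        obtain g where "arc g" "path_image g = f" using edge[OF fE] by blast
        then have "infinite f" using arc_image_uncountable countable_finite by metis
        then have "f - {p, q} \<noteq> {}" by (metis Diff_eq_empty_iff finite.emptyI finite.insertI finite_subset)
        then have "f \<inter> inside (crv ys) \<noteq> {}" using cs(7) f by blast
        moreover have "f \<inter> inside (crv zs) = {}" using sub[OF that] f by blast
        ultimately show "{e \<in> E. e \<inter> inside (crv zs) \<noteq> {}} \<subset> {e \<in> E. e \<inter> inside (crv ys) \<noteq> {}}"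
          using sub[OF that] fE by blast
      qed
      have "Q zs" if z: "zs = p # as @ q # rev cs \<or> zs = p # cs @ q # bs" for zs
      proof (rule less(1)[OF lt[OF z]])
        show "cyc zs" using sub[OF z] by simp
        show "inside (crv zs) \<subseteq> inside (crv xs)" using sub[OF z] less(3) by (meson order_trans)
      qed
      then have "Q (p # as @ q # rev cs)" "Q (p # cs @ q # bs)" by simp_all
      then show ?thesis using step[OF less(2,3) _ _ th cs(6)] ab by simp
    qed
  qed
  then show ?thesis using assms(1) by blast
qed

text \<open>Every vertex of a cycle is on exactly two of its edges.\<close>

lemma cyc_two_edges:
  assumes "cyc xs" "x \<in> set xs"
  obtains y z where "y \<noteq> z" "adj x y" "adj x z" "y \<in> set xs" "z \<in> set xs" "{e \<in> ceds xs. x \<in> e} = {ed x y, ed x z}"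
proof -
  obtain ws where ws: "cyc (x # ws)" "set (x # ws) = set xs" "ceds (x # ws) = ceds xs"
    using cyc_start_at[OF assms] by metis
  obtain y us z where yz: "x # ws = x # y # us @ [z]"
    using cyc_hd_last[OF ws(1)] by (metis list.exhaust append_Cons list.inject)
  have c: "distinct (x # y # us @ [z])" "walk (x # y # us @ [z, x])" using ws(1) yz unfolding cyc_def by auto
  have a: "adj x y" "adj x z" "walk (y # us @ [z])"
    using c walk_append[of "x # y # us" z "[x]"] adj_sym by auto
  have "ceds xs = {ed x y, ed x z} \<union> eds (y # us @ [z])"
    using ws(3) yz eds_append[of "x # y # us" z "[x]"] unfolding ceds_def by (auto simp: ed_sym)
  moreover have "x \<notin> e" if "e \<in> eds (y # us @ [z])" for e
    using eds_V_subset[OF a(3) that] adj_in_V[OF a(1)] c by auto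
  moreover have "x \<in> ed x y" "x \<in> ed x z" using ed_props(2)[OF a(1)] ed_props(2)[OF a(2)] by blast+
  ultimately have "{e \<in> ceds xs. x \<in> e} = {ed x y, ed x z}" by blast
  moreover have "y \<in> set xs" "z \<in> set xs" "y \<noteq> z" using ws(2) yz c by auto
  ultimately show ?thesis using that a by blast
qed

lemma cyc_degree:
  assumes "cyc xs" "x \<in> set xs"
  shows "card {e \<in> ceds xs. x \<in> e} = 2"
proof -
  obtain y z where yz: "y \<noteq> z" "adj x y" "adj x z" "{e \<in> ceds xs. x \<in> e} = {ed x y, ed x z}"
    using cyc_two_edges[OF assms] by metis
  have "ed x y \<noteq> ed x z" using ed_eq_iff[OF yz(2,3)] yz(1) by (auto simp: doubleton_eq_iff)
  then show ?thesis using yz by simp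
qed

end

section \<open>Bipartite graphs in the disk with black boundary\<close>

locale disk_bip =
  fixes G :: disk_graph
  assumes planar: "planar_bipartite_disk_graph G"
    and bdry_black: "set (bdry G) \<subseteq> black G"
begin

lemma finite_verts: "finite (verts G)" and finite_edges: "finite (edges G)"
  and bw_disjoint: "black G \<inter> white G = {}" and bdry_nonempty: "bdry G \<noteq> []"
  and bdry_clockwise: "clockwise_on_circle (bdry G)"
  and internal_in_ball: "internal_verts G \<subseteq> ball 0 1"
  and edges_meet: "\<lbrakk>e \<in> edges G; e' \<in> edges G; e \<noteq> e'\<rbrakk> \<Longrightarrow> e \<inter> e' \<subseteq> verts G"
  and bdry_degree: "b \<in> set (bdry G) \<Longrightarrow> card (edges_at G b) = 1"
  and has_orientation: "\<exists>tail. perfect_orientation G tail"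
  using planar unfolding planar_bipartite_disk_graph_def by simp_all

lemma edge_arc_ends:
  assumes "e \<in> edges G"
  obtains g where "arc g" "path_image g = e" "pathstart g \<in> black G" "pathfinish g \<in> white G"
    "e \<inter> verts G = {pathstart g, pathfinish g}" "e - {pathstart g, pathfinish g} \<subseteq> ball 0 1"
proof -
  have "\<forall>e \<in> edges G. \<exists>\<gamma>. arc \<gamma> \<and> path_image \<gamma> = e \<and>
        pathstart \<gamma> \<in> black G \<and> pathfinish \<gamma> \<in> white G \<and>
        e \<inter> verts G = {pathstart \<gamma>, pathfinish \<gamma>} \<and>
        e - {pathstart \<gamma>, pathfinish \<gamma>} \<subseteq> ball 0 1"
    using planar unfolding planar_bipartite_disk_graph_def by (elim conjE) assumption
  then show ?thesis using assms that by metis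
qed

text \<open>The white end point of an edge; \<open>bl\<close> is the black one.\<close>

definition wh :: "complex set \<Rightarrow> complex" where
  "wh e = (THE w. w \<in> e \<inter> white G)"

abbreviation bl :: "complex set \<Rightarrow> complex" where
  "bl e \<equiv> black_end G e"

lemma edge_ends:
  assumes "e \<in> edges G"
  shows "bl e \<in> black G" "wh e \<in> white G" "e \<inter> black G = {bl e}" "e \<inter> white G = {wh e}"
    "e \<inter> verts G = {bl e, wh e}" "bl e \<noteq> wh e"
proof -
  obtain g where g: "arc g" "path_image g = e" "pathstart g \<in> black G" "pathfinish g \<in> white G"
    "e \<inter> verts G = {pathstart g, pathfinish g}"
    using edge_arc_ends[OF assms] by metis
  have 1: "e \<inter> black G = {pathstart g}" "e \<inter> white G = {pathfinish g}"
    using g(3-5) bw_disjoint unfolding verts_def by blast+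
  then have 2: "bl e = pathstart g" "wh e = pathfinish g"
    unfolding black_end_def wh_def by simp_all
  show "bl e \<in> black G" "wh e \<in> white G" "e \<inter> black G = {bl e}" "e \<inter> white G = {wh e}"
    "e \<inter> verts G = {bl e, wh e}" "bl e \<noteq> wh e"
    using g 1 2 bw_disjoint by auto
qed

lemma black_in_edge: "e \<in> edges G \<Longrightarrow> x \<in> black G \<Longrightarrow> x \<in> e \<longleftrightarrow> x = bl e"
  and white_in_edge: "e \<in> edges G \<Longrightarrow> x \<in> white G \<Longrightarrow> x \<in> e \<longleftrightarrow> x = wh e"
  using edge_ends(3,4) by blast+

lemma white_internal: "white G \<subseteq> internal_verts G"
  using bw_disjoint bdry_black unfolding internal_verts_def verts_def by blast

lemma edge_in_cball: "e \<in> edges G \<Longrightarrow> e - set (bdry G) \<subseteq> ball 0 1"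
proof -
  assume e: "e \<in> edges G"
  obtain g where g: "e \<inter> verts G = {pathstart g, pathfinish g}" "e - {pathstart g, pathfinish g} \<subseteq> ball 0 1"
    using edge_arc_ends[OF e] by metis
  have "e \<subseteq> (e \<inter> verts G) \<union> ball 0 1" using g by blast
  moreover have "verts G \<subseteq> set (bdry G) \<union> ball 0 1"
    using internal_in_ball unfolding internal_verts_def by blast
  ultimately show ?thesis by blast
qed

lemma bdry_on_circle: "set (bdry G) \<subseteq> sphere 0 1"
  using bdry_clockwise unfolding clockwise_on_circle_def by (auto simp: in_set_conv_nth)

lemma drawing_closed: "compact (\<Union> (edges G))" "interior (\<Union> (edges G)) = {}"
  using interior_Union_arcs_empty[OF finite_edges] edge_arc_ends by metis+

lemma drawing_compact: "compact (drawing G)" and interior_drawing: "interior (drawing G) = {}"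
proof -
  show "compact (drawing G)"
    unfolding drawing_def using drawing_closed(1) finite_verts by (simp add: compact_Un finite_imp_compact)
  have "closed (verts G)" "interior (verts G) = {}"
    using finite_verts by (auto simp: finite_imp_closed empty_interior_finite)
  then show "interior (drawing G) = {}"
    unfolding drawing_def using drawing_closed(2) interior_closed_Un_empty_interior[of "verts G" "\<Union> (edges G)"]
    by (simp add: Un_commute)
qed

lemma drawing_circle: "drawing G \<inter> sphere 0 1 = set (bdry G)"
proof
  have "\<Union> (edges G) \<subseteq> set (bdry G) \<union> ball 0 1" using edge_in_cball by blast
  moreover have "verts G \<subseteq> set (bdry G) \<union> ball 0 1"
    using internal_in_ball unfolding internal_verts_def by blast
  ultimately show "drawing G \<inter> sphere 0 1 \<subseteq> set (bdry G)" unfolding drawing_def by auto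
  show "set (bdry G) \<subseteq> drawing G \<inter> sphere 0 1"
    using bdry_on_circle bdry_black unfolding drawing_def verts_def by blast
qed

text \<open>The edge at the boundary vertex \<open>b\<close>.\<close>

definition bedge :: "complex \<Rightarrow> complex set" where
  "bedge b = (THE e. e \<in> edges_at G b)"

lemma bedge:
  assumes "b \<in> set (bdry G)"
  shows "edges_at G b = {bedge b}" "bedge b \<in> edges G" "b \<in> bedge b" "bl (bedge b) = b"
proof -
  obtain e where e: "edges_at G b = {e}" using bdry_degree[OF assms] card_1_singletonE by metis
  then show 1: "edges_at G b = {bedge b}" unfolding bedge_def by simp
  show 2: "bedge b \<in> edges G" "b \<in> bedge b" using 1 unfolding edges_at_def by blast+
  show "bl (bedge b) = b" using black_in_edge[OF 2(1)] 2(2) assms bdry_black by auto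
qed

lemma edge_at_bdry: "e \<in> edges G \<Longrightarrow> b \<in> e \<Longrightarrow> b \<in> set (bdry G) \<Longrightarrow> e = bedge b"
  using bedge(1) unfolding edges_at_def by blast

subsection \<open>Orientations and matchings\<close>

text \<open>Perfect orientations are the same as almost perfect matchings: the matching consists of the edges that
  are directed from black to white.\<close>

lemma orientation_matching:
  assumes "perfect_orientation G tail"
  shows "almost_perfect_matching G {e \<in> edges G. tail e \<in> black G}"
    "matching_boundary G {e \<in> edges G. tail e \<in> black G} = source_set G tail"
proof -
  let ?M = "{e \<in> edges G. tail e \<in> black G}"
  have tl: "tail e \<in> {bl e, wh e}" if "e \<in> edges G" for e
    using assms that edge_ends(5)[OF that] unfolding perfect_orientation_def orientation_def by blast
  have wb: "wh e \<notin> black G" if "e \<in> edges G" for e using edge_ends(2)[OF that] bw_disjoint by blast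
  have tb: "tail e \<in> black G \<longleftrightarrow> tail e = bl e" if "e \<in> edges G" for e
    using tl[OF that] wb[OF that] edge_ends(1)[OF that] by auto
  have b: "{e \<in> ?M. x \<in> e} = {e \<in> edges_at G x. tail e = x}" if x: "x \<in> black G" for x
  proof -
    have "tail e \<in> black G \<and> x \<in> e \<longleftrightarrow> x \<in> e \<and> tail e = x" if "e \<in> edges G" for e
      using tb[OF that] black_in_edge[OF that x] x by auto
    then show ?thesis unfolding edges_at_def by auto
  qed
  have w: "{e \<in> ?M. x \<in> e} = {e \<in> edges_at G x. tail e \<noteq> x}" if x: "x \<in> white G" for x
  proof -
    have "tail e \<in> black G \<and> x \<in> e \<longleftrightarrow> x \<in> e \<and> tail e \<noteq> x" if "e \<in> edges G" for e
      using tb[OF that] tl[OF that] edge_ends(6)[OF that] white_in_edge[OF that x] by auto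
    then show ?thesis unfolding edges_at_def by auto
  qed
  have "card {e \<in> ?M. x \<in> e} = 1" if x: "x \<in> internal_verts G" for x
  proof (cases "x \<in> black G")
    case True then show ?thesis using b assms x unfolding perfect_orientation_def by simp
  next
    case False
    then have "x \<in> white G" using x unfolding internal_verts_def verts_def by blast
    then show ?thesis using w assms x unfolding perfect_orientation_def by simp
  qed
  moreover have "card {e \<in> ?M. x \<in> e} \<le> 1" if x: "x \<in> set (bdry G)" for x
  proof -
    have "{e \<in> ?M. x \<in> e} \<subseteq> {bedge x}" using edge_at_bdry x by blast
    then show ?thesis using card_mono[of "{bedge x}" "{e \<in> ?M. x \<in> e}"] by simp
  qed
  ultimately show "almost_perfect_matching G ?M" unfolding almost_perfect_matching_def by blast
  have j: "bdry G ! j \<in> black G" "bdry G ! j \<notin> white G" if "j < length (bdry G)" for j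
    using bdry_black bw_disjoint that nth_mem by blast+
  have "(\<exists>e \<in> ?M. bdry G ! j \<in> e) \<longleftrightarrow> (\<exists>e \<in> edges_at G (bdry G ! j). tail e = bdry G ! j)"
    if "j < length (bdry G)" for j using b[OF j(1)[OF that]] by blast
  then show "matching_boundary G ?M = source_set G tail"
    unfolding matching_boundary_def source_set_def using j by blast
qed

lemma matching_orientation:
  assumes M: "almost_perfect_matching G M"
  obtains tail where "perfect_orientation G tail" "source_set G tail = matching_boundary G M"
proof -
  define tail where "tail e = (if e \<in> M then bl e else wh e)" for e
  have ME: "M \<subseteq> edges G" using M unfolding almost_perfect_matching_def by blast
  have b: "{e \<in> M. x \<in> e} = {e \<in> edges_at G x. tail e = x}" if x: "x \<in> black G" for x
  proof -
    have "e \<in> M \<and> x \<in> e \<longleftrightarrow> x \<in> e \<and> tail e = x" if "e \<in> edges G" for e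
      using black_in_edge[OF that x] edge_ends(2)[OF that] bw_disjoint x unfolding tail_def by auto
    then show ?thesis using ME unfolding edges_at_def by blast
  qed
  have w: "{e \<in> M. x \<in> e} = {e \<in> edges_at G x. tail e \<noteq> x}" if x: "x \<in> white G" for x
  proof -
    have "e \<in> M \<and> x \<in> e \<longleftrightarrow> x \<in> e \<and> tail e \<noteq> x" if "e \<in> edges G" for e
      using white_in_edge[OF that x] edge_ends(1)[OF that] bw_disjoint x unfolding tail_def by auto
    then show ?thesis using ME unfolding edges_at_def by blast
  qed
  have "tail e \<in> e \<inter> verts G" if "e \<in> edges G" for e
    using edge_ends(5)[OF that] unfolding tail_def by auto
  then have "perfect_orientation G tail"
    using M b w unfolding perfect_orientation_def orientation_def almost_perfect_matching_def by auto
  moreover have j: "bdry G ! j \<in> black G" "bdry G ! j \<notin> white G" if "j < length (bdry G)" for j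
    using bdry_black bw_disjoint that nth_mem by blast+
  have "(\<exists>e \<in> M. bdry G ! j \<in> e) \<longleftrightarrow> (\<exists>e \<in> edges_at G (bdry G ! j). tail e = bdry G ! j)"
    if "j < length (bdry G)" for j using b[OF j(1)[OF that]] by blast
  then have "source_set G tail = matching_boundary G M"
    unfolding matching_boundary_def source_set_def using j by blast
  ultimately show ?thesis using that by blast
qed

lemma positroid_matchings: "positroid G = matching_boundary G ` {M. almost_perfect_matching G M}"
proof
  show "positroid G \<subseteq> matching_boundary G ` {M. almost_perfect_matching G M}"
    unfolding positroid_def using orientation_matching by blast
  show "matching_boundary G ` {M. almost_perfect_matching G M} \<subseteq> positroid G"
    unfolding positroid_def using matching_orientation by (clarsimp; metis)
qed

lemma exists_matching: "\<exists>M. almost_perfect_matching G M"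
  using has_orientation orientation_matching by blast

lemma matching_boundary_iff:
  assumes "almost_perfect_matching G M" "j < length (bdry G)"
  shows "j \<in> matching_boundary G M \<longleftrightarrow> bedge (bdry G ! j) \<in> M"
proof -
  have b: "bdry G ! j \<in> set (bdry G)" "bdry G ! j \<notin> white G" "bdry G ! j \<in> black G"
    using assms(2) bdry_black bw_disjoint nth_mem by blast+
  have "M \<subseteq> edges G" using assms(1) unfolding almost_perfect_matching_def by blast
  then have "(\<exists>e \<in> M. bdry G ! j \<in> e) \<longleftrightarrow> bedge (bdry G ! j) \<in> M"
    using edge_at_bdry[OF _ _ b(1)] bedge(3)[OF b(1)] by blast
  then show ?thesis using assms(2) b unfolding matching_boundary_def by auto
qed

subsection \<open>Faces\<close>

text \<open>The complement of the circle has two components, and each arc that is added splits a component into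
  finitely many, so there are only finitely many faces.\<close>

lemma finite_components_complement_circle: "finite (components (- sphere (0::complex) 1))"
proof -
  have "- sphere (0::complex) 1 = ball 0 1 \<union> - cball 0 1" by auto
  moreover have "connected (- cball (0::complex) 1)"
    by (rule connected_complement_bounded_convex) auto
  moreover have "components (A \<union> B) \<subseteq> {connected_component_set (A \<union> B) a, connected_component_set (A \<union> B) b}"
    if "connected A" "connected B" "a \<in> A" "b \<in> B" for A B :: "complex set" and a b
  proof
    fix C assume "C \<in> components (A \<union> B)"
    then obtain x where x: "x \<in> A \<union> B" "C = connected_component_set (A \<union> B) x"
      unfolding components_def by blast
    have "connected_component (A \<union> B) a x \<or> connected_component (A \<union> B) b x"
      using x(1) that unfolding connected_component_def by blast
    then show "C \<in> {connected_component_set (A \<union> B) a, connected_component_set (A \<union> B) b}"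
      using x(2) connected_component_eq by (metis insertCI mem_Collect_eq)
  qed
  moreover have "(0::complex) \<in> ball 0 1" "(2::complex) \<in> - cball 0 1" by auto
  ultimately show ?thesis by (metis (no_types, lifting) connected_ball finite.emptyI finite.insertI finite_subset)
qed

lemma finite_components_complement_edges:
  assumes "F \<subseteq> edges G"
  shows "finite (components (- (sphere 0 1 \<union> \<Union>F)))"
proof -
  have "finite F" using assms finite_edges finite_subset by blast
  then show ?thesis using assms
  proof (induction F rule: finite_induct)
    case empty
    then show ?case using finite_components_complement_circle by simp
  next
    case (insert e F)
    then have e: "e \<in> edges G" and F: "F \<subseteq> edges G" by auto
    obtain g where g: "arc g" "path_image g = e" "e \<inter> verts G = {pathstart g, pathfinish g}"
      "e - {pathstart g, pathfinish g} \<subseteq> ball 0 1"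
      using edge_arc_ends[OF e] by metis
    have "closed (\<Union>F)"
      using F insert.hyps(1) edge_arc_ends compact_arc_image by (metis closed_Union compact_imp_closed subsetD)
    then have cl: "closed (sphere 0 1 \<union> \<Union>F)" by (simp add: closed_Un)
    have "e \<inter> f \<subseteq> {pathstart g, pathfinish g}" if "f \<in> F" for f
      using edges_meet[OF e, of f] that F insert.hyps(2) g(3) by blast
    moreover have "e \<inter> sphere 0 1 \<subseteq> {pathstart g, pathfinish g}" using g(4) by auto
    ultimately have "path_image g \<inter> (sphere 0 1 \<union> \<Union>F) \<subseteq> {pathstart g, pathfinish g}"
      unfolding g(2) by blast
    then have "finite (components (- ((sphere 0 1 \<union> \<Union>F) \<union> path_image g)))"
      using finite_components_add_arc[OF cl g(1)] insert.IH[OF F] by blast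
    moreover have "(sphere 0 1 \<union> \<Union>F) \<union> path_image g = sphere 0 1 \<union> \<Union>(insert e F)" using g(2) by blast
    ultimately show ?case by simp
  qed
qed

text \<open>An isolated inner vertex would violate the condition on orientations.\<close>

lemma vertex_has_edge:
  assumes "x \<in> verts G"
  shows "edges_at G x \<noteq> {}"
proof (cases "x \<in> set (bdry G)")
  case True then show ?thesis using bedge(1) by simp
next
  case False
  obtain M where M: "almost_perfect_matching G M" using exists_matching by blast
  have "x \<in> internal_verts G" using assms False unfolding internal_verts_def by blast
  then have "card {e \<in> M. x \<in> e} = 1" "M \<subseteq> edges G" using M unfolding almost_perfect_matching_def by blast+
  then have "{e \<in> M. x \<in> e} \<noteq> {}" by (metis card.empty zero_neq_one)
  then show ?thesis using \<open>M \<subseteq> edges G\<close> unfolding edges_at_def by blast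
qed

lemma drawing_edges: "drawing G = \<Union> (edges G)"
  using vertex_has_edge unfolding drawing_def edges_at_def by blast

end

text \<open>A set with empty interior does not contain a relatively open part of the disk.\<close>

lemma disk_open_not_subset:
  fixes D :: "complex set"
  assumes "interior D = {}" "z \<in> cball 0 1" "r > 0"
  obtains y where "y \<in> ball z r" "y \<in> ball 0 1" "y \<notin> D"
proof -
  have "z \<in> closure (ball 0 1)" using assms(2) by simp
  then have "ball z r \<inter> ball 0 1 \<noteq> {}"
    using assms(3) open_Int_closure_eq_empty[of "ball z r" "ball 0 1"] centre_in_ball[of z r] by blast
  moreover have "open (ball z r \<inter> ball 0 1)" by auto
  ultimately have "\<not> ball z r \<inter> ball 0 1 \<subseteq> D"
    using assms(1) interior_maximal by blast
  then show ?thesis using that by blast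
qed

lemma component_of_disk_contains_ball:
  fixes D :: "complex set"
  assumes "closed D" "K \<in> components (cball 0 1 - D)" "z \<in> K"
  obtains r where "r > 0" "ball z r \<inter> cball 0 1 \<subseteq> K" "z \<in> cball 0 1"
proof -
  have z: "z \<in> cball 0 1" "z \<notin> D" using in_components_subset[OF assms(2)] assms(3) by auto
  obtain r where r: "r > 0" "ball z r \<subseteq> - D"
    using assms(1) z(2) by (metis ComplI open_Compl open_contains_ball)
  have "connected (ball z r \<inter> cball 0 1)" by (simp add: convex_Int convex_connected)
  moreover have "ball z r \<inter> cball 0 1 \<subseteq> cball 0 1 - D" using r by blast
  moreover have "z \<in> K \<inter> (ball z r \<inter> cball 0 1)" using r z assms(3) by simp
  ultimately have "ball z r \<inter> cball 0 1 \<subseteq> K"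
    using components_maximal[OF assms(2), of "ball z r \<inter> cball 0 1"] by blast
  then show ?thesis using that[of r] r z by simp
qed

text \<open>Erasing a part of a closed curve in the drawing merges the two faces on its sides, so the
  number of faces goes down.\<close>

lemma fewer_components:
  fixes D D' C :: "complex set"
  assumes D: "closed D" "interior D = {}" "closed D'" "D' \<subseteq> D"
    and C: "C \<subseteq> D" "open (inside C)" "open (outside C)" "inside C \<inter> outside C = {}"
      "inside C \<union> outside C = - C" "z \<in> closure (inside C)" "z \<in> closure (outside C)"
    and z: "z \<in> ball 0 1" "z \<notin> D'"
    and fin: "finite (components (cball 0 1 - D))"
  shows "card (components (cball 0 1 - D')) < card (components (cball 0 1 - D))"
proof -
  let ?A = "components (cball 0 1 - D)" and ?B = "components (cball 0 1 - D')"
  have "\<exists>K' \<in> ?B. K \<subseteq> K'" if "K \<in> ?A" for K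
    using exists_component_superset[of K "cball 0 1 - D'"] in_components_subset[OF that]
      in_components_connected[OF that] in_components_nonempty[OF that] D(4) by blast
  then obtain f where f: "\<And>K. K \<in> ?A \<Longrightarrow> f K \<in> ?B \<and> K \<subseteq> f K" by metis
  \<comment> \<open>Every component of the smaller set's complement contains one of the larger set's complement.\<close>
  have surj: "f ` ?A = ?B"
  proof
    show "f ` ?A \<subseteq> ?B" using f by blast
    show "?B \<subseteq> f ` ?A"
    proof
      fix K' assume K': "K' \<in> ?B"
      obtain x where x: "x \<in> K'" using in_components_nonempty[OF K'] by blast
      obtain r where r: "r > 0" "ball x r \<inter> cball 0 1 \<subseteq> K'" "x \<in> cball 0 1"
        using component_of_disk_contains_ball[OF D(3) K' x] by blast
      obtain y where y: "y \<in> ball x r" "y \<in> ball 0 1" "y \<notin> D"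
        using disk_open_not_subset[OF D(2) r(3,1)] by blast
      define K where "K = connected_component_set (cball 0 1 - D) y"
      have "y \<in> cball 0 1 - D" using y by auto
      then have K: "K \<in> ?A" "y \<in> K" unfolding K_def components_def by auto
      have "y \<in> f K" "y \<in> K'" using K f r y by auto
      then have "f K = K'" using f[OF K(1)] K' components_nonoverlap by (metis disjoint_iff)
      then show "K' \<in> f ` ?A" using K by blast
    qed
  qed
  have "\<not> inj_on f ?A"
  proof
    assume inj: "inj_on f ?A"
    have "open (ball 0 1 - D')" using D(3) by (simp add: open_Diff)
    then obtain r where r: "r > 0" "ball z r \<subseteq> ball 0 1 - D'"
      using z by (metis DiffI open_contains_ball)
    have pt: "\<exists>y. y \<in> ball z r \<and> y \<in> S \<and> y \<notin> D" if "open S" "z \<in> closure S" for S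
    proof -
      have "ball z r \<inter> S \<noteq> {}"
        using that(2) r(1) open_Int_closure_eq_empty[of "ball z r" S] centre_in_ball[of z r] by blast
      moreover have "open (ball z r \<inter> S)" using that by auto
      ultimately have "\<not> ball z r \<inter> S \<subseteq> D" using D(2) interior_maximal by blast
      then show ?thesis by blast
    qed
    obtain a where a: "a \<in> ball z r" "a \<in> inside C" "a \<notin> D" using pt[OF C(2,6)] by blast
    obtain b where b: "b \<in> ball z r" "b \<in> outside C" "b \<notin> D" using pt[OF C(3,7)] by blast
    define K where "K x = connected_component_set (cball 0 1 - D) x" for x
    have ab: "a \<in> cball 0 1 - D" "b \<in> cball 0 1 - D" using a b r by auto
    then have K: "K a \<in> ?A" "a \<in> K a" "K b \<in> ?A" "b \<in> K b" unfolding K_def components_def by auto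
    have fK: "f (K a) \<in> ?B" "f (K b) \<in> ?B" "a \<in> f (K a)" "b \<in> f (K b)"
      using f[OF K(1)] f[OF K(3)] K(2,4) by blast+
    have "ball z r \<subseteq> cball 0 1 - D'" using r by auto
    moreover have "f (K a) \<inter> ball z r \<noteq> {}" using a fK by blast
    ultimately have "ball z r \<subseteq> f (K a)"
      using components_maximal[OF fK(1) connected_ball[of z r]] by simp
    then have "b \<in> f (K a) \<inter> f (K b)" using b fK by blast
    then have "f (K a) = f (K b)" using fK(1,2) components_nonoverlap by blast
    then have "K a = K b" using inj K by (meson inj_onD)
    then have "b \<in> K a" using K by simp
    moreover have "connected (K a)" "K a \<subseteq> - C"
      using K in_components_connected in_components_subset C(1) by blast+
    ultimately show False
      using K(2) a b C(2-5) unfolding connected_def by blast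
  qed
  then have "card (f ` ?A) < card ?A"
    using fin by (meson card_image_le eq_card_imp_inj_on le_neq_implies_less)
  then show ?thesis using surj by simp
qed

context disk_bip
begin

lemma finite_faces_all: "finite (faces G)"
proof -
  let ?T = "sphere 0 1 \<union> \<Union> (edges G)"
  have fin: "finite (components (- ?T))" using finite_components_complement_edges by blast
  have cl: "closed (drawing G)" using drawing_compact compact_imp_closed by blast
  have "\<exists>K \<in> components (- ?T). K \<inter> F \<noteq> {}" if F: "F \<in> faces G" for F
  proof -
    have F': "F \<in> components (cball 0 1 - drawing G)" using F unfolding faces_def .
    obtain x where x: "x \<in> F" using in_components_nonempty[OF F'] by blast
    obtain r where r: "r > 0" "ball x r \<inter> cball 0 1 \<subseteq> F" "x \<in> cball 0 1"
      using component_of_disk_contains_ball[OF cl F' x] by blast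
    obtain y where y: "y \<in> ball x r" "y \<in> ball 0 1" "y \<notin> drawing G"
      using disk_open_not_subset[OF interior_drawing r(3,1)] by blast
    then have yF: "y \<in> F" and yT: "y \<in> - ?T" using r drawing_edges by auto
    define K where "K = connected_component_set (- ?T) y"
    have "y \<in> K" unfolding K_def using yT by (simp only: mem_Collect_eq connected_component_refl_eq)
    moreover have "K \<in> components (- ?T)" unfolding K_def using yT by (rule componentsI)
    ultimately show ?thesis using yF by blast
  qed
  then obtain f where f: "\<And>F. F \<in> faces G \<Longrightarrow> f F \<in> components (- ?T) \<and> f F \<inter> F \<noteq> {}" by metis
  have "inj_on f (faces G)"
  proof (rule inj_onI)
    fix F F' assume F: "F \<in> faces G" "F' \<in> faces G" "f F = f F'"
    obtain a where a: "a \<in> f F" "a \<in> F" using f[OF F(1)] by blast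
    obtain b where b: "b \<in> f F" "b \<in> F'" using f[OF F(2)] F(3) by auto
    have K: "connected (f F)" "f F \<subseteq> - ?T" using f[OF F(1)] in_components_connected in_components_subset by blast+
    have "f F \<inter> sphere 0 1 = {}" using K(2) by blast
    moreover have "a \<in> cball 0 1" using a F in_components_subset unfolding faces_def by blast
    ultimately have "f F \<subseteq> cball 0 1"
      using connected_Int_frontier[OF K(1), of "cball 0 1"] a unfolding frontier_cball by blast
    then have "f F \<subseteq> cball 0 1 - drawing G" using K(2) drawing_edges by blast
    then have "f F \<subseteq> F"
      using components_maximal[of F "cball 0 1 - drawing G" "f F"] F(1) K(1) a unfolding faces_def by blast
    then have "b \<in> F \<inter> F'" using b by blast
    then show "F = F'" using F components_nonoverlap unfolding faces_def by blast
  qed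
  then show ?thesis using fin f by (meson finite_imageD finite_subset image_subsetI)
qed

end

section \<open>Reduced graphs have no parts attached at a single vertex\<close>

context plane_graph
begin

text \<open>If all vertices of \<open>S\<close>, except possibly \<open>x\<close>, have two neighbours in \<open>S\<close>, there is a cycle in \<open>S\<close>:
  one end of a longest path in \<open>S\<close> differs from \<open>x\<close>, and all its neighbours in \<open>S\<close> are on the path.\<close>

lemma exists_cycle:
  assumes S: "finite S" "h0 \<in> S" "h0 \<noteq> x"
    and nbrs: "\<And>h. h \<in> S \<Longrightarrow> h \<noteq> x \<Longrightarrow> \<exists>y z. y \<noteq> z \<and> adj h y \<and> adj h z \<and> y \<in> S \<and> z \<in> S"
  shows "\<exists>xs. cyc xs \<and> set xs \<subseteq> S"
proof -
  define P where "P xs \<longleftrightarrow> distinct xs \<and> walk xs \<and> set xs \<subseteq> S" for xs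
  have bound: "length xs \<le> card S" if "P xs" for xs
    using that card_mono[OF S(1)] distinct_card[of xs] unfolding P_def by metis
  obtain y0 where y0: "adj h0 y0" "y0 \<in> S" using nbrs[OF S(2,3)] by blast
  have P0: "P [h0, y0]" using y0 S adj_neq[OF y0(1)] unfolding P_def by simp
  obtain xs where xs: "P xs" "\<And>ys. P ys \<Longrightarrow> length ys \<le> length xs"
    using ex_has_greatest_nat[of P "[h0, y0]" length "card S + 1"] P0 bound by (metis less_Suc_eq_le Suc_eq_plus1)
  have len: "length xs \<ge> 2" using xs(2)[OF P0] by simp
  have rev: "P (rev xs)" using xs(1) walk_rev[of xs] unfolding P_def by simp
  have "hd xs \<noteq> last xs"
    using len xs(1) unfolding P_def
    by (cases xs) (auto simp: last_in_set)
  moreover have "hd (rev xs) = last xs" using len by (cases xs) (auto simp: hd_rev)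
  ultimately have "\<exists>ys. P ys \<and> length ys = length xs \<and> hd ys \<noteq> x"
    using xs(1) rev by (metis length_rev)
  then obtain ys where ys: "P ys" "length ys = length xs" "hd ys \<noteq> x" by blast
  obtain a zs where "ys = a # zs" using ys(2) len by (cases ys) auto
  moreover from this have "zs \<noteq> []" using ys(2) len by auto
  ultimately have a: "ys = a # zs" "zs \<noteq> []" by auto
  have "a \<in> S" "a \<noteq> x" using a ys unfolding P_def by auto
  then obtain y z where yz: "y \<noteq> z" "adj a y" "adj a z" "y \<in> S" "z \<in> S" using nbrs by blast
  have onp: "w \<in> set zs" if w: "adj a w" "w \<in> S" for w
  proof (rule ccontr)
    assume "w \<notin> set zs"
    then have "w \<notin> set ys" using a adj_neq[OF w(1)] by auto
    then have "P (w # ys)" using ys(1) w a adj_sym[of a w] unfolding P_def by (auto simp: successively_Cons)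
    then show False using xs(2)[of "w # ys"] ys(2) by simp
  qed
  obtain w where w: "w \<in> set zs" "w \<noteq> hd zs" "adj a w"
    using onp[OF yz(2,4)] onp[OF yz(3,5)] yz by metis
  obtain us vs where uv: "zs = us @ w # vs" using split_list[OF w(1)] by blast
  have us: "us \<noteq> []" using w(2) uv by auto
  have d: "distinct (a # us @ [w])" "set (a # us @ [w]) \<subseteq> S"
    using ys(1) a uv unfolding P_def by auto
  have wk: "walk (a # us @ [w])"
    using ys(1) a uv walk_append[of "a # us" w vs] unfolding P_def by simp
  have "cyc (a # us @ w # [])"
    unfolding cyc_two_paths using d wk us w(3) by auto
  then show ?thesis using d by (intro exI[of _ "a # us @ [w]"]) auto
qed

end

text \<open>The graph without the vertices in \<open>X\<close> and the edges at them.\<close>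

definition delete_verts :: "disk_graph \<Rightarrow> complex set \<Rightarrow> disk_graph" where
  "delete_verts G X = G\<lparr>black := black G - X, white := white G - X, edges := {e \<in> edges G. e \<inter> X = {}}\<rparr>"

context disk_bip
begin

lemma delete_verts_simps:
  "black (delete_verts G X) = black G - X" "white (delete_verts G X) = white G - X"
  "edges (delete_verts G X) = {e \<in> edges G. e \<inter> X = {}}" "bdry (delete_verts G X) = bdry G"
  "verts (delete_verts G X) = verts G - X" "internal_verts (delete_verts G X) = internal_verts G - X"
  unfolding delete_verts_def verts_def internal_verts_def by auto

lemma matching_edges: "almost_perfect_matching G M \<Longrightarrow> M \<subseteq> edges G"
  unfolding almost_perfect_matching_def by blast

lemma matching_unique:
  assumes "almost_perfect_matching G M" "e \<in> M" "e' \<in> M" "x \<in> e" "x \<in> e'" "x \<in> verts G"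
  shows "e = e'"
proof -
  have fin: "finite {e \<in> M. x \<in> e}"
    using matching_edges[OF assms(1)] by (intro finite_subset[OF _ finite_edges]) auto
  have "card {e \<in> M. x \<in> e} \<le> 1"
    using assms(1,6) unfolding almost_perfect_matching_def internal_verts_def by (cases "x \<in> set (bdry G)") auto
  then show ?thesis using fin assms(2-5) card_le_Suc0_iff_eq[OF fin] by auto
qed

lemma matching_covers:
  assumes "almost_perfect_matching G M" "x \<in> internal_verts G"
  obtains e where "e \<in> M" "x \<in> e"
proof -
  have "card {e \<in> M. x \<in> e} = 1" using assms unfolding almost_perfect_matching_def by blast
  then have "{e \<in> M. x \<in> e} \<noteq> {}" by (metis card.empty zero_neq_one)
  then show ?thesis using that by blast
qed

lemma card_matched_white:
  assumes "almost_perfect_matching G M" "H \<subseteq> internal_verts G"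
  shows "card {e \<in> M. wh e \<in> H} = card (H \<inter> white G)"
proof (rule bij_betw_same_card[of wh], unfold bij_betw_def, intro conjI)
  have M: "M \<subseteq> edges G" by (rule matching_edges[OF assms(1)])
  show "inj_on wh {e \<in> M. wh e \<in> H}"
  proof (rule inj_onI)
    fix e e' assume e: "e \<in> {e \<in> M. wh e \<in> H}" "e' \<in> {e \<in> M. wh e \<in> H}" "wh e = wh e'"
    then have "e \<in> edges G" "e' \<in> edges G" using M by auto
    then have "wh e \<in> e" "wh e \<in> e'" "wh e \<in> verts G" using edge_ends(5)[of e] edge_ends(5)[of e'] e(3) by auto
    then show "e = e'" using matching_unique[OF assms(1)] e by blast
  qed
  show "wh ` {e \<in> M. wh e \<in> H} = H \<inter> white G"
  proof
    show "wh ` {e \<in> M. wh e \<in> H} \<subseteq> H \<inter> white G" using edge_ends(2) M by auto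
    show "H \<inter> white G \<subseteq> wh ` {e \<in> M. wh e \<in> H}"
    proof
      fix x assume x: "x \<in> H \<inter> white G"
      then obtain e where e: "e \<in> M" "x \<in> e" using matching_covers[OF assms(1), of x] assms(2) by blast
      then have "x = wh e" using white_in_edge[of e x] x M by auto
      then show "x \<in> wh ` {e \<in> M. wh e \<in> H}" using x e by auto
    qed
  qed
qed

lemma card_matched_black:
  assumes "almost_perfect_matching G M" "H \<subseteq> internal_verts G"
  shows "card {e \<in> M. bl e \<in> H} = card (H \<inter> black G)"
proof (rule bij_betw_same_card[of bl], unfold bij_betw_def, intro conjI)
  have M: "M \<subseteq> edges G" by (rule matching_edges[OF assms(1)])
  show "inj_on bl {e \<in> M. bl e \<in> H}"
  proof (rule inj_onI)
    fix e e' assume e: "e \<in> {e \<in> M. bl e \<in> H}" "e' \<in> {e \<in> M. bl e \<in> H}" "bl e = bl e'"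
    then have "e \<in> edges G" "e' \<in> edges G" using M by auto
    then have "bl e \<in> e" "bl e \<in> e'" "bl e \<in> verts G" using edge_ends(5)[of e] edge_ends(5)[of e'] e(3) by auto
    then show "e = e'" using matching_unique[OF assms(1)] e by blast
  qed
  show "bl ` {e \<in> M. bl e \<in> H} = H \<inter> black G"
  proof
    show "bl ` {e \<in> M. bl e \<in> H} \<subseteq> H \<inter> black G" using edge_ends(1) M by auto
    show "H \<inter> black G \<subseteq> bl ` {e \<in> M. bl e \<in> H}"
    proof
      fix x assume x: "x \<in> H \<inter> black G"
      then obtain e where e: "e \<in> M" "x \<in> e" using matching_covers[OF assms(1), of x] assms(2) by blast
      then have "x = bl e" using black_in_edge[of e x] x M by auto
      then show "x \<in> bl ` {e \<in> M. bl e \<in> H}" using x e by auto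
    qed
  qed
qed

text \<open>If a set of inner vertices is joined to the rest of the graph at the vertex \<open>x\<close> only, the
  number of matching edges that join it to \<open>x\<close> is the difference of its numbers of black and
  white vertices, so it is the same for all matchings.\<close>

lemma card_crossing:
  assumes M: "almost_perfect_matching G M" and H: "H \<subseteq> internal_verts G" "x \<notin> H" "x \<in> verts G"
    and closed: "\<And>e. e \<in> edges G \<Longrightarrow> e \<inter> H \<noteq> {} \<Longrightarrow> e \<inter> verts G \<subseteq> insert x H"
  shows "card {e \<in> M. e \<inter> H \<noteq> {} \<and> x \<in> e} =
    (if x \<in> black G then card (H \<inter> white G) - card (H \<inter> black G) else card (H \<inter> black G) - card (H \<inter> white G))"
proof -
  have ME: "M \<subseteq> edges G" by (rule matching_edges[OF M])
  have fin: "finite M" using ME finite_edges finite_subset by blast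
  have HV: "H \<subseteq> verts G" using H(1) unfolding internal_verts_def by blast
  have touch: "e \<inter> H \<noteq> {} \<longleftrightarrow> bl e \<in> H \<or> wh e \<in> H" if "e \<in> M" for e
  proof -
    have "e \<in> edges G" using that ME by blast
    then have "e \<inter> H = {bl e, wh e} \<inter> H" using edge_ends(5)[of e] HV by blast
    then show ?thesis by auto
  qed
  have xin: "x \<in> e \<longleftrightarrow> x = bl e \<or> x = wh e" if "e \<in> M" for e
  proof -
    have "e \<in> edges G" using that ME by blast
    then show ?thesis using edge_ends(5)[of e] H(3) by blast
  qed
  have cl: "bl e \<in> insert x H \<and> wh e \<in> insert x H" if "e \<in> M" "bl e \<in> H \<or> wh e \<in> H" for e
    using closed[of e] touch[OF that(1)] that ME edge_ends(5)[of e] by auto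
  have col: "bl e \<in> black G" "wh e \<notin> black G" if "e \<in> M" for e
    using that ME edge_ends(1,2)[of e] bw_disjoint by auto
  let ?A = "{e \<in> M. wh e \<in> H}" and ?B = "{e \<in> M. bl e \<in> H}" and ?X = "{e \<in> M. e \<inter> H \<noteq> {} \<and> x \<in> e}"
  show ?thesis
  proof (cases "x \<in> black G")
    case True
    have "e \<in> ?X \<longleftrightarrow> e \<in> ?A - ?B" "e \<in> ?B \<Longrightarrow> e \<in> ?A" if e: "e \<in> M" for e
      using touch[OF e] xin[OF e] cl[OF e] col[OF e] True H(2) e by auto
    then have "?X = ?A - ?B" "?B \<subseteq> ?A" by blast+
    then have "card ?X = card ?A - card ?B" using fin by (simp add: card_Diff_subset)
    then show ?thesis using card_matched_white[OF M H(1)] card_matched_black[OF M H(1)] True by simp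
  next
    case False
    have "e \<in> ?X \<longleftrightarrow> e \<in> ?B - ?A" "e \<in> ?A \<Longrightarrow> e \<in> ?B" if e: "e \<in> M" for e
      using touch[OF e] xin[OF e] cl[OF e] col[OF e] False H(2) e by auto
    then have "?X = ?B - ?A" "?A \<subseteq> ?B" by blast+
    then have "card ?X = card ?B - card ?A" using fin by (simp add: card_Diff_subset)
    then show ?thesis using card_matched_white[OF M H(1)] card_matched_black[OF M H(1)] False by simp
  qed
qed

text \<open>A set \<open>X\<close> of inner vertices that every matching matches in itself can be deleted without
  changing the positroid.\<close>

lemma delete_verts_positroid:
  assumes X: "X \<subseteq> internal_verts G"
    and self: "\<And>M e. almost_perfect_matching G M \<Longrightarrow> e \<in> M \<Longrightarrow> e \<inter> X \<noteq> {} \<Longrightarrow> e \<inter> verts G \<subseteq> X"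
    and bX: "\<And>b. b \<in> set (bdry G) \<Longrightarrow> bedge b \<inter> X = {}"
  shows "planar_bipartite_disk_graph (delete_verts G X)" "positroid (delete_verts G X) = positroid G"
proof -
  let ?G = "delete_verts G X"
  note s = delete_verts_simps
  have bdryX: "set (bdry G) \<inter> X = {}" using X unfolding internal_verts_def by blast
  have at: "edges_at ?G x = edges_at G x" if "x \<in> set (bdry G)" for x
  proof -
    have "edges_at G x = {bedge x}" "bedge x \<inter> X = {}" using bedge(1)[OF that] bX[OF that] by auto
    then show ?thesis unfolding edges_at_def s by blast
  qed
  have XV: "X \<subseteq> verts G" using X unfolding internal_verts_def by blast
  have restr: "almost_perfect_matching ?G (M \<inter> edges ?G) \<and> matching_boundary ?G (M \<inter> edges ?G) = matching_boundary G M"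
    if M: "almost_perfect_matching G M" for M
  proof
    have ME: "M \<subseteq> edges G" by (rule matching_edges[OF M])
    have eq: "{e \<in> M \<inter> edges ?G. x \<in> e} = {e \<in> M. x \<in> e}" if "x \<in> verts G" "x \<notin> X" for x
    proof -
      have "e \<inter> X = {}" if "e \<in> M" "x \<in> e" for e
        using self[OF M that(1)] \<open>x \<in> verts G\<close> \<open>x \<notin> X\<close> that(2) by blast
      then show ?thesis using ME unfolding s by blast
    qed
    have iv: "x \<in> verts G" if "x \<in> internal_verts G \<or> x \<in> set (bdry G)" for x
      using that bdry_black unfolding internal_verts_def verts_def by blast
    show "almost_perfect_matching ?G (M \<inter> edges ?G)"
      unfolding almost_perfect_matching_def
    proof (intro conjI ballI)
      fix x assume "x \<in> internal_verts ?G"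
      then have "x \<in> internal_verts G" "x \<notin> X" unfolding s by auto
      then show "card {e \<in> M \<inter> edges ?G. x \<in> e} = 1"
        using eq[OF iv] M unfolding almost_perfect_matching_def by simp
    next
      fix x assume "x \<in> set (bdry ?G)"
      then have "x \<in> set (bdry G)" "x \<notin> X" unfolding s using bdryX by auto
      then show "card {e \<in> M \<inter> edges ?G. x \<in> e} \<le> 1"
        using eq[OF iv] M unfolding almost_perfect_matching_def by simp
    qed simp
    have "(\<exists>e \<in> M \<inter> edges ?G. bdry G ! j \<in> e) \<longleftrightarrow> (\<exists>e \<in> M. bdry G ! j \<in> e)" if "j < length (bdry G)" for j
    proof -
      have "bdry G ! j \<in> set (bdry G)" using that by simp
      then have "bdry G ! j \<in> verts G" "bdry G ! j \<notin> X" using iv bdryX by blast+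
      then show ?thesis using eq[of "bdry G ! j"] by blast
    qed
    moreover have "bdry G ! j \<in> black G - X \<and> bdry G ! j \<in> black G \<and> bdry G ! j \<notin> white G" if "j < length (bdry G)" for j
      using nth_mem[OF that] bdry_black bdryX bw_disjoint by blast
    ultimately show "matching_boundary ?G (M \<inter> edges ?G) = matching_boundary G M"
      unfolding matching_boundary_def s(1,2,4) by auto
  qed
  have extend: "\<exists>M. almost_perfect_matching G M \<and> M' = M \<inter> edges ?G" if M': "almost_perfect_matching ?G M'" for M'
  proof -
    obtain M0 where M0: "almost_perfect_matching G M0" using exists_matching by blast
    \<comment> \<open>Complete the matching by the part of a fixed matching in \<open>X\<close>.\<close>
    define M where "M = M' \<union> {e \<in> M0. e \<inter> X \<noteq> {}}"
    have M'E: "M' \<subseteq> edges ?G" using M' unfolding almost_perfect_matching_def by blast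
    have in1: "{e \<in> M. x \<in> e} = {e \<in> M0. x \<in> e}" if "x \<in> X" for x
      using that M'E unfolding M_def s by blast
    have in2: "{e \<in> M. x \<in> e} = {e \<in> M'. x \<in> e}" if "x \<notin> X" "x \<in> verts G" for x
      using that self[OF M0] unfolding M_def by blast
    have "almost_perfect_matching G M"
      unfolding almost_perfect_matching_def
    proof (intro conjI ballI)
      show "M \<subseteq> edges G" using M'E matching_edges[OF M0] unfolding M_def s by blast
      fix x assume x: "x \<in> internal_verts G"
      show "card {e \<in> M. x \<in> e} = 1"
      proof (cases "x \<in> X")
        case True
        then show ?thesis using in1 M0 x unfolding almost_perfect_matching_def by simp
      next
        case False
        moreover have "x \<in> verts G" using x unfolding internal_verts_def by blast
        ultimately show ?thesis using in2[OF False] M' x unfolding almost_perfect_matching_def s by simp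
      qed
    next
      fix b assume b: "b \<in> set (bdry G)"
      then have "b \<notin> X" "b \<in> verts G" using bdryX bdry_black unfolding verts_def by blast+
      then show "card {e \<in> M. b \<in> e} \<le> 1" using in2[of b] M' b unfolding almost_perfect_matching_def s by simp
    qed
    moreover have "M' = M \<inter> edges ?G" using M'E unfolding M_def s by blast
    ultimately show ?thesis by blast
  qed
  have edge_restr: "e \<inter> verts ?G = e \<inter> verts G" if "e \<in> edges ?G" for e
    using that unfolding s by blast
  have pre: "finite (verts ?G)" "finite (edges ?G)" "black ?G \<inter> white ?G = {}" "bdry ?G \<noteq> []"
    "clockwise_on_circle (bdry ?G)" "set (bdry ?G) \<subseteq> black ?G" "internal_verts ?G \<subseteq> ball 0 1"
    "\<forall>e \<in> edges ?G. \<forall>e' \<in> edges ?G. e \<noteq> e' \<longrightarrow> e \<inter> e' \<subseteq> verts ?G"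
    "\<forall>b \<in> set (bdry ?G). card (edges_at ?G b) = 1"
    unfolding s
    subgoal using finite_verts by simp
    subgoal using finite_edges by simp
    subgoal using bw_disjoint by blast
    subgoal using bdry_nonempty by simp
    subgoal using bdry_clockwise by simp
    subgoal using bdry_black bdryX by blast
    subgoal using internal_in_ball by blast
    subgoal
    proof (intro ballI impI)
      fix e e' assume "e \<in> {e \<in> edges G. e \<inter> X = {}}" "e' \<in> {e \<in> edges G. e \<inter> X = {}}" "e \<noteq> e'"
      then have "e \<inter> e' \<subseteq> verts G" "e \<inter> X = {}" using edges_meet[of e e'] by auto
      then show "e \<inter> e' \<subseteq> verts G - X" by blast
    qed
    subgoal using at bdry_degree by simp
    done
  have arcs: "\<forall>e \<in> edges ?G. \<exists>\<gamma>. arc \<gamma> \<and> path_image \<gamma> = e \<and>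
        pathstart \<gamma> \<in> black ?G \<and> pathfinish \<gamma> \<in> white ?G \<and>
        e \<inter> verts ?G = {pathstart \<gamma>, pathfinish \<gamma>} \<and>
        e - {pathstart \<gamma>, pathfinish \<gamma>} \<subseteq> ball 0 1"
  proof
    fix e assume e: "e \<in> edges ?G"
    then have eG: "e \<in> edges G" "e \<inter> X = {}" unfolding s by auto
    obtain g where g: "arc g" "path_image g = e" "pathstart g \<in> black G" "pathfinish g \<in> white G"
      "e \<inter> verts G = {pathstart g, pathfinish g}" "e - {pathstart g, pathfinish g} \<subseteq> ball 0 1"
      using edge_arc_ends[OF eG(1)] by metis
    have "pathstart g \<in> e" "pathfinish g \<in> e" using g(5) by blast+
    then have "pathstart g \<in> black ?G" "pathfinish g \<in> white ?G" using g(3,4) eG(2) unfolding s by blast+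
    then show "\<exists>\<gamma>. arc \<gamma> \<and> path_image \<gamma> = e \<and>
        pathstart \<gamma> \<in> black ?G \<and> pathfinish \<gamma> \<in> white ?G \<and>
        e \<inter> verts ?G = {pathstart \<gamma>, pathfinish \<gamma>} \<and>
        e - {pathstart \<gamma>, pathfinish \<gamma>} \<subseteq> ball 0 1"
      using g edge_restr[OF e] by (intro exI[of _ g]) simp
  qed
  obtain tail where tail: "perfect_orientation G tail" using has_orientation by blast
  have "perfect_orientation ?G tail"
  proof -
    have M: "almost_perfect_matching G {e \<in> edges G. tail e \<in> black G}" by (rule orientation_matching(1)[OF tail])
    have o: "tail e \<in> e \<inter> verts G" if "e \<in> edges G" for e
      using tail that unfolding perfect_orientation_def orientation_def by blast
    have o': "orientation ?G tail"
      unfolding orientation_def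
    proof
      fix e assume e: "e \<in> edges ?G"
      then show "tail e \<in> e \<inter> verts ?G" using o[of e] edge_restr[OF e] unfolding s by auto
    qed
    have noX: "e \<inter> X = {}" if "e \<in> edges G" "tail e \<in> black G" "x \<in> e" "x \<in> verts G" "x \<notin> X" for e x
      using self[OF M, of e] that by blast
    have "{e \<in> edges_at ?G x. tail e = x} = {e \<in> edges_at G x. tail e = x}" if "x \<in> internal_verts ?G \<inter> black ?G" for x
    proof -
      have x: "x \<in> black G" "x \<notin> X" "x \<in> verts G" using that unfolding s verts_def by auto
      have "e \<inter> X = {}" if "e \<in> edges G" "x \<in> e" "tail e = x" for e using noX[OF that(1) _ that(2)] that x by blast
      then show ?thesis unfolding edges_at_def s by blast
    qed
    moreover have "{e \<in> edges_at ?G x. tail e \<noteq> x} = {e \<in> edges_at G x. tail e \<noteq> x}" if "x \<in> internal_verts ?G \<inter> white ?G" for x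
    proof -
      have x: "x \<in> white G" "x \<notin> X" "x \<in> verts G" using that unfolding s verts_def by auto
      have "e \<inter> X = {}" if "e \<in> edges G" "x \<in> e" "tail e \<noteq> x" for e
      proof -
        have "tail e \<in> {bl e, wh e}" using o[OF that(1)] edge_ends(5)[OF that(1)] by blast
        moreover have "x = wh e" using white_in_edge[OF that(1) x(1)] that(2) by simp
        ultimately have "tail e \<in> black G" using that(3) edge_ends(1)[OF that(1)] by auto
        then show ?thesis using noX[OF that(1) _ that(2)] x by blast
      qed
      then show ?thesis unfolding edges_at_def s by blast
    qed
    moreover have "internal_verts ?G \<inter> black ?G \<subseteq> internal_verts G \<inter> black G"
      "internal_verts ?G \<inter> white ?G \<subseteq> internal_verts G \<inter> white G" unfolding s by auto
    ultimately show ?thesis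
      using o' tail unfolding perfect_orientation_def by (metis (no_types, lifting) subsetD)
  qed
  then show planar': "planar_bipartite_disk_graph ?G"
    using pre arcs unfolding planar_bipartite_disk_graph_def by - (intro conjI disjI1 exI, assumption+)
  interpret G': disk_bip ?G using planar' pre(6) by unfold_locales
  show "positroid ?G = positroid G"
  proof (intro equalityI subsetI)
    fix I assume "I \<in> positroid ?G"
    then obtain M' where M': "almost_perfect_matching ?G M'" "I = matching_boundary ?G M'"
      unfolding G'.positroid_matchings by blast
    then obtain M where "almost_perfect_matching G M" "M' = M \<inter> edges ?G" using extend by blast
    then show "I \<in> positroid G" unfolding positroid_matchings using restr[of M] M' by blast
  next
    fix I assume "I \<in> positroid G"
    then obtain M where M: "almost_perfect_matching G M" "I = matching_boundary G M"
      unfolding positroid_matchings by blast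
    then have "almost_perfect_matching ?G (M \<inter> edges ?G)" "I = matching_boundary ?G (M \<inter> edges ?G)"
      using restr[OF M(1)] by simp_all
    then show "I \<in> positroid ?G" unfolding G'.positroid_matchings by blast
  qed
qed

end

text \<open>The graphs of the theorem. The type \<open>(k, n)\<close> is a parameter.\<close>

locale reduced_disk_graph = disk_bip G for G +
  fixes k n :: nat
  assumes red: "reduced G" and type: "has_type G k n" and irr: "irreducible_positroid n (positroid G)"
begin

lemma len_bdry: "length (bdry G) = n"
  using type unfolding has_type_def by blast

sublocale pg: plane_graph "verts G" "edges G"
proof
  show "finite (verts G)" "finite (edges G)" by (rule finite_verts finite_edges)+
  show "\<exists>g. arc g \<and> path_image g = e \<and> e \<inter> verts G = {pathstart g, pathfinish g}" if "e \<in> edges G" for e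
    using edge_arc_ends[OF that] by metis
  show "e \<inter> e' \<subseteq> verts G" if "e \<in> edges G" "e' \<in> edges G" "e \<noteq> e'" for e e'
    using edges_meet[OF that] .
  show "e = e'" if "e \<in> edges G" "e' \<in> edges G" "e \<inter> verts G = e' \<inter> verts G" for e e'
    using red that unfolding reduced_def by metis
qed

text \<open>Irreducibility: every boundary vertex is used by some matching and missed by some other.\<close>

lemma boundary_used:
  assumes "i < n"
  shows "\<exists>M. almost_perfect_matching G M \<and> i \<in> matching_boundary G M"
    "\<exists>M. almost_perfect_matching G M \<and> i \<notin> matching_boundary G M"
  using irr assms unfolding irreducible_positroid_def positroid_matchings by auto

lemma boundary_edge_used:
  assumes "b \<in> set (bdry G)"
  obtains M M' where "almost_perfect_matching G M" "bedge b \<in> M" "almost_perfect_matching G M'" "bedge b \<notin> M'"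
proof -
  obtain i where i: "i < n" "b = bdry G ! i" using assms len_bdry by (metis in_set_conv_nth)
  then show ?thesis
    using boundary_used[OF i(1)] matching_boundary_iff that len_bdry by metis
qed

lemma leaf_at_bdry:
  assumes "h \<in> internal_verts G" "card (edges_at G h) = 1"
  obtains b where "b \<in> set (bdry G)" "h \<in> bedge b"
proof -
  have "\<exists>e \<in> edges_at G h. \<exists>b \<in> set (bdry G). b \<in> e"
    using red assms unfolding reduced_def by blast
  then obtain e b where eb: "e \<in> edges G" "h \<in> e" "b \<in> set (bdry G)" "b \<in> e"
    unfolding edges_at_def by blast
  then have "e = bedge b" using edge_at_bdry by blast
  then show ?thesis using that eb by blast
qed

text \<open>Every set of inner vertices is joined to at least two other vertices.
  Otherwise a part of the graph is attached to the rest at one vertex only. By \<open>card_crossing\<close>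
  every matching uses the same number of edges joining it to this vertex, so
  the part can be deleted, possibly together with that vertex. The part contains
  a cycle, so this would reduce the number of faces.\<close>

theorem inner_verts_two_nbrs:
  assumes H: "H \<subseteq> internal_verts G" "H \<noteq> {}"
  shows "pg.two_nbrs H"
proof (rule ccontr)
  assume nt: "\<not> pg.two_nbrs H"
  have HV: "H \<subseteq> verts G" using H unfolding internal_verts_def by blast
  have nbr_unique: "p = q" if "p \<notin> H" "q \<notin> H" "h \<in> H" "pg.adj p h" "h' \<in> H" "pg.adj q h'" for p q h h'
    using nt that unfolding pg.two_nbrs_def by blast
  obtain b0 where b0: "b0 \<in> set (bdry G)" using bdry_nonempty by (cases "bdry G") auto
  then have b0V: "b0 \<in> verts G" "b0 \<notin> H" using bdry_black H unfolding verts_def internal_verts_def by blast+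
  obtain x where x: "x \<in> verts G" "x \<notin> H" "\<And>p h. p \<notin> H \<Longrightarrow> h \<in> H \<Longrightarrow> pg.adj p h \<Longrightarrow> p = x"
  proof (cases "\<exists>p h. p \<notin> H \<and> h \<in> H \<and> pg.adj p h")
    case True
    then obtain p h where ph: "p \<notin> H" "h \<in> H" "pg.adj p h" by blast
    have "p \<in> verts G" using pg.adj_in_V[OF ph(3)] by blast
    then show ?thesis using that[of p] ph nbr_unique by blast
  next
    case False
    then show ?thesis using that[of b0] b0V by blast
  qed
  have adjI: "pg.adj (bl e) (wh e)" if "e \<in> edges G" for e
    unfolding pg.adj_def using edge_ends(5,6)[OF that] that by blast
  have closed: "e \<inter> verts G \<subseteq> insert x H" if e: "e \<in> edges G" "e \<inter> H \<noteq> {}" for e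
  proof -
    have "e \<inter> verts G = {bl e, wh e}" by (rule edge_ends(5)[OF e(1)])
    moreover have "bl e \<in> H \<or> wh e \<in> H"
    proof -
      obtain y where "y \<in> e" "y \<in> H" using e(2) by blast
      then have "y \<in> e \<inter> verts G" using HV by blast
      then show ?thesis using \<open>e \<inter> verts G = {bl e, wh e}\<close> \<open>y \<in> H\<close> by auto
    qed
    moreover have a: "pg.adj (bl e) (wh e)" "pg.adj (wh e) (bl e)"
      using adjI[OF e(1)] pg.adj_sym[of "bl e" "wh e"] by simp_all
    have "wh e \<in> insert x H" if "bl e \<in> H" using x(3)[OF _ that a(2)] by blast
    moreover have "bl e \<in> insert x H" if "wh e \<in> H" using x(3)[OF _ that a(1)] by blast
    ultimately show ?thesis by auto
  qed
  define cr where "cr M = card {e \<in> M. e \<inter> H \<noteq> {} \<and> x \<in> e}" for M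
  have cr_const: "cr M = cr M'" if "almost_perfect_matching G M" "almost_perfect_matching G M'" for M M'
  proof -
    have "cr N = (if x \<in> black G then card (H \<inter> white G) - card (H \<inter> black G) else card (H \<inter> black G) - card (H \<inter> white G))"
      if N: "almost_perfect_matching G N" for N
    proof -
      have c: "\<And>e. e \<in> edges G \<Longrightarrow> e \<inter> H \<noteq> {} \<Longrightarrow> e \<inter> verts G \<subseteq> insert x H"
        by (rule closed)
      show ?thesis
        unfolding cr_def
        using card_crossing[of N H x, OF N H(1) x(2) x(1)] c by blast
    qed
    from this[OF that(1)] this[OF that(2)] show ?thesis by (rule trans[OF _ sym])
  qed
  have finM: "finite M" if "almost_perfect_matching G M" for M
    using matching_edges[OF that] finite_edges by (rule finite_subset)
  have cr_pos: "cr M \<noteq> 0 \<longleftrightarrow> (\<exists>e \<in> M. e \<inter> H \<noteq> {} \<and> x \<in> e)" if "almost_perfect_matching G M" for M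
    unfolding cr_def using finM[OF that] by auto
  \<comment> \<open>The vertex \<open>x\<close> is not a boundary vertex, whose edge would be used by all matchings or by none.\<close>
  have x_bdry: False if xb: "x \<in> set (bdry G)" and e: "e \<in> edges G" "e \<inter> H \<noteq> {}" "x \<in> e" for e
  proof -
    have eb: "e = bedge x" using edge_at_bdry[OF e(1,3) xb] .
    obtain M M' where M: "almost_perfect_matching G M" "bedge x \<in> M" "almost_perfect_matching G M'" "bedge x \<notin> M'"
      using boundary_edge_used[OF xb] by blast
    have "cr M \<noteq> 0" using cr_pos[OF M(1)] M(2) e eb by blast
    then have "cr M' \<noteq> 0" using cr_const[OF M(1,3)] by simp
    then obtain e' where "e' \<in> M'" "x \<in> e'" using cr_pos[OF M(3)] by blast
    then have "e' = bedge x" using edge_at_bdry[OF _ _ xb] matching_edges[OF M(3)] by blast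
    then show False using M(4) \<open>e' \<in> M'\<close> by simp
  qed
  obtain M0 where M0: "almost_perfect_matching G M0" using exists_matching by blast
  \<comment> \<open>The vertex \<open>x\<close> is deleted as well if the matchings match it into \<open>H\<close>.\<close>
  define X where "X = (if cr M0 = 0 then H else insert x H)"
  have HX: "H \<subseteq> X" unfolding X_def by auto
  have X_int: "X \<subseteq> internal_verts G"
  proof (cases "cr M0 = 0")
    case False
    then obtain e where e: "e \<in> M0" "e \<inter> H \<noteq> {}" "x \<in> e" using cr_pos[OF M0] by blast
    then have "x \<notin> set (bdry G)" using x_bdry matching_edges[OF M0] by blast
    then show ?thesis using H x(1) unfolding X_def internal_verts_def by auto
  qed (simp add: X_def H)
  have self: "e \<inter> verts G \<subseteq> X" if M: "almost_perfect_matching G M" and e: "e \<in> M" "e \<inter> X \<noteq> {}" for M e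
  proof -
    have eG: "e \<in> edges G" using matching_edges[OF M] e by blast
    show ?thesis
    proof (cases "cr M = 0")
      case True
      then have "X = H" using cr_const[OF M M0] unfolding X_def by simp
      then have "x \<notin> e" using True cr_pos[OF M] e by blast
      then show ?thesis using closed[OF eG] e \<open>X = H\<close> by blast
    next
      case False
      then have XH: "X = insert x H" using cr_const[OF M M0] unfolding X_def by simp
      obtain f where f: "f \<in> M" "f \<inter> H \<noteq> {}" "x \<in> f" using False cr_pos[OF M] by blast
      have "e \<inter> H \<noteq> {}"
      proof (cases "x \<in> e")
        case True
        then have "e = f" using matching_unique[OF M e(1) f(1) True f(3) x(1)] by simp
        then show ?thesis using f by simp
      next
        case False then show ?thesis using e(2) XH by blast
      qed
      then show ?thesis using closed[OF eG] XH by simp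
    qed
  qed
  have bX: "bedge b \<inter> X = {}" if b: "b \<in> set (bdry G)" for b
  proof (rule ccontr)
    assume ne: "bedge b \<inter> X \<noteq> {}"
    obtain M where M: "almost_perfect_matching G M" "bedge b \<in> M" using boundary_edge_used[OF b] by blast
    have "b \<in> bedge b \<inter> verts G" using bedge(3)[OF b] b bdry_black unfolding verts_def by blast
    then have "b \<in> X" using self[OF M ne] by blast
    then show False using X_int b unfolding internal_verts_def by blast
  qed
  let ?G = "delete_verts G X"
  have planar': "planar_bipartite_disk_graph ?G" and pos': "positroid ?G = positroid G"
    by (rule delete_verts_positroid[OF X_int], erule (2) self, erule bX)+
  have "\<exists>y z. y \<noteq> z \<and> pg.adj h y \<and> pg.adj h z \<and> y \<in> insert x H \<and> z \<in> insert x H" if h: "h \<in> insert x H" "h \<noteq> x" for h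
  proof -
    have hH: "h \<in> H" using h by blast
    have hi: "h \<in> internal_verts G" using hH H by blast
    have fin: "finite (edges_at G h)" using finite_edges unfolding edges_at_def by simp
    have "card (edges_at G h) \<noteq> 1"
    proof
      assume "card (edges_at G h) = 1"
      then obtain b where "b \<in> set (bdry G)" "h \<in> bedge b" using leaf_at_bdry[OF hi] by blast
      then show False using bX hH HX by blast
    qed
    moreover have "card (edges_at G h) \<noteq> 0"
      using vertex_has_edge[of h] hH HV fin by auto
    ultimately have "\<not> card (edges_at G h) \<le> Suc 0" by simp
    then obtain e f where ef: "e \<in> edges_at G h" "f \<in> edges_at G h" "e \<noteq> f"
      using card_le_Suc0_iff_eq[OF fin] by blast
    have nb: "\<exists>y. g \<inter> verts G = {h, y} \<and> pg.adj h y \<and> y \<in> insert x H" if "g \<in> edges_at G h" for g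
    proof -
      have g: "g \<in> edges G" "h \<in> g" using that unfolding edges_at_def by auto
      obtain y where y: "g \<inter> verts G = {h, y}" "h \<noteq> y"
      proof -
        have "h \<in> {bl g, wh g}" using edge_ends(5)[OF g(1)] g(2) hH HV by blast
        then show ?thesis using that edge_ends(5,6)[OF g(1)] by (metis doubleton_eq_iff insertE singletonD)
      qed
      then have "pg.adj h y" using g unfolding pg.adj_def by blast
      moreover have "y \<in> insert x H" using closed[OF g(1)] g(2) hH y(1) by blast
      ultimately show ?thesis using y by blast
    qed
    obtain y where y: "e \<inter> verts G = {h, y}" "pg.adj h y" "y \<in> insert x H" using nb[OF ef(1)] by blast
    obtain z where z: "f \<inter> verts G = {h, z}" "pg.adj h z" "z \<in> insert x H" using nb[OF ef(2)] by blast
    have "y \<noteq> z" using pg.simple[of e f] ef y(1) z(1) unfolding edges_at_def by auto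
    then show ?thesis using y z by blast
  qed
  moreover obtain h0 where "h0 \<in> H" using H by blast
  moreover have "finite (insert x H)" using finite_subset[OF HV finite_verts] by simp
  ultimately obtain xs where xs: "pg.cyc xs" "set xs \<subseteq> insert x H"
    using pg.exists_cycle[of "insert x H" h0 x] x(2) by blast
  have "\<not> set xs \<subseteq> {x}"
  proof
    assume "set xs \<subseteq> {x}"
    then have "card (set xs) \<le> card {x}" by (intro card_mono) auto
    moreover have "card (set xs) \<ge> 3" using xs(1) distinct_card unfolding pg.cyc_def by metis
    ultimately show False by simp
  qed
  then obtain h where h: "h \<in> set xs" "h \<in> H" using xs(2) by blast
  obtain y z where yz: "pg.adj h y" "{e \<in> pg.ceds xs. h \<in> e} = {pg.ed h y, pg.ed h z}"
    using pg.cyc_two_edges[OF xs(1) h(1)] by metis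
  then have y: "pg.adj h y" "pg.ed h y \<in> pg.ceds xs" by auto
  define e where "e = pg.ed h y"
  have e: "e \<in> edges G" "e \<inter> verts G = {h, y}" using pg.ed_props[OF y(1)] unfolding e_def by auto
  obtain g where g: "arc g" "path_image g = e" "e \<inter> verts G = {pathstart g, pathfinish g}" "e - {pathstart g, pathfinish g} \<subseteq> ball 0 1"
    using edge_arc_ends[OF e(1)] by metis
  \<comment> \<open>Erasing the edge \<open>e\<close> merges the faces on its two sides.\<close>
  obtain z where z: "z \<in> e" "z \<notin> verts G"
    using nonempty_simple_path_endless[OF arc_imp_simple_path[OF g(1)]] g(2,3) by blast
  have zball: "z \<in> ball 0 1" using g z by blast
  interpret G': disk_bip ?G
  proof
    show "planar_bipartite_disk_graph ?G" by (rule planar')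
    show "set (bdry ?G) \<subseteq> black ?G"
      unfolding delete_verts_simps using bdry_black X_int unfolding internal_verts_def by blast
  qed
  have zD: "z \<notin> drawing ?G"
  proof
    assume "z \<in> drawing ?G"
    then obtain f where f: "f \<in> edges G" "f \<inter> X = {}" "z \<in> f"
      unfolding G'.drawing_edges delete_verts_simps by blast
    have "f \<noteq> e" using f(2) e(2) h(2) HX by blast
    then show False using edges_meet[OF f(1) e(1)] z f(3) by blast
  qed
  have "card (faces ?G) < card (faces G)"
    unfolding faces_def
  proof (rule fewer_components)
    show "closed (drawing G)" using drawing_compact compact_imp_closed by blast
    show "interior (drawing G) = {}" by (rule interior_drawing)
    show "closed (drawing ?G)" using G'.drawing_compact compact_imp_closed by blast
    show "drawing ?G \<subseteq> drawing G" unfolding drawing_def delete_verts_simps by blast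
    note J = pg.cyc_jordan[OF xs(1)]
    show "pg.crv xs \<subseteq> drawing G"
      unfolding drawing_edges pg.crv_def using pg.ceds_in_E[OF xs(1)] by blast
    show "open (inside (pg.crv xs))" "open (outside (pg.crv xs))" "inside (pg.crv xs) \<inter> outside (pg.crv xs) = {}"
      "inside (pg.crv xs) \<union> outside (pg.crv xs) = - pg.crv xs" by (rule J)+
    have zc: "z \<in> pg.crv xs" using z y(2) unfolding pg.crv_def e_def by blast
    show "z \<in> closure (inside (pg.crv xs))" using zc J(10) unfolding frontier_def by blast
    show "z \<in> closure (outside (pg.crv xs))" using zc J(11) unfolding frontier_def by blast
    show "z \<in> ball 0 1" "z \<notin> drawing ?G" by (rule zball zD)+
    show "finite (components (cball 0 1 - drawing G))" using finite_faces_all unfolding faces_def .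
  qed
  moreover have "card (faces G) \<le> card (faces ?G)"
    using red planar' pos' delete_verts_simps(4) unfolding reduced_def by metis
  ultimately show False by simp
qed

end

section \<open>The graph together with the boundary circle\<close>

lemma cis_eq_close:
  assumes "cis a = cis b" "\<bar>a - b\<bar> < 2 * pi"
  shows "a = b"
proof -
  have "sin a = sin b \<and> cos a = cos b" using assms(1) by (simp add: complex_eq_iff)
  then obtain m :: int where m: "a = b + 2 * pi * m" unfolding sin_cos_eq_iff by blast
  then have "\<bar>2 * pi * m\<bar> < 2 * pi" using assms(2) by simp
  then have "2 * pi * \<bar>real_of_int m\<bar> < 2 * pi * 1" by (simp add: abs_mult)
  then have "\<bar>real_of_int m\<bar> < 1" using pi_gt_zero by (simp only: mult_less_cancel_left_pos)
  then show ?thesis using m by simp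
qed

lemma cis_eq_within:
  assumes "cis a = cis b" "b \<le> a" "a - b \<le> 2 * pi"
  shows "a = b \<or> a = b + 2 * pi"
  using cis_eq_close[OF assms(1)] assms(2,3) by (cases "a - b < 2 * pi") auto

lemma ball_avoiding_closed:
  fixes z :: complex
  assumes "closed S" "z \<notin> S"
  obtains r where "r > 0" "ball z r \<subseteq> - S"
  using assms by (metis ComplI open_Compl open_contains_ball)

lemma arc_cis:
  assumes "s < t" "t - s < 2 * pi"
  obtains g where "arc g" "path_image g = cis ` {s..t}" "pathstart g = cis s" "pathfinish g = cis t"
proof -
  let ?g = "part_circlepath 0 1 s t"
  have "arc ?g" using assms by (intro arc_part_circlepath) auto
  moreover have "path_image ?g = cis ` {s..t}"
    using assms by (auto simp: path_image_part_circlepath cis_conv_exp mult.commute)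
  ultimately show ?thesis using that[of ?g] by (simp add: cis_conv_exp)
qed

context reduced_disk_graph
begin

text \<open>There is no irreducible positroid on one element, all sets having the same cardinality.\<close>

lemma n_ge_2: "n \<ge> 2"
proof -
  have n: "n > 0" using bdry_nonempty len_bdry by auto
  obtain I J where IJ: "I \<in> positroid G" "0 \<in> I" "J \<in> positroid G" "0 \<notin> J"
    using irr n unfolding irreducible_positroid_def by blast
  have sub: "K \<subseteq> {..<n} \<and> card K = k" if "K \<in> positroid G" for K
    using that type unfolding has_type_def positroid_def source_set_def by auto
  have "finite I" using sub[OF IJ(1)] finite_subset by blast
  then have "k \<noteq> 0" using sub[OF IJ(1)] IJ(2) card_0_eq[of I] by blast
  then have "J \<noteq> {}" using sub[OF IJ(3)] by auto
  then obtain j where "j \<in> J" "j < n" "j \<noteq> 0" using sub[OF IJ(3)] IJ(4) by fastforce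
  then show ?thesis by simp
qed

text \<open>The angles of the boundary vertices, which decrease.\<close>

definition ang :: "nat \<Rightarrow> real" where
  "ang = (SOME \<theta>. (\<forall>j < length (bdry G). bdry G ! j = cis (\<theta> j)) \<and>
        (\<forall>i j. i < j \<and> j < length (bdry G) \<longrightarrow> \<theta> j < \<theta> i) \<and>
        (\<forall>j < length (bdry G). \<theta> 0 - 2 * pi < \<theta> j))"

lemma ang:
  "j < n \<Longrightarrow> bdry G ! j = cis (ang j)" "i < j \<Longrightarrow> j < n \<Longrightarrow> ang j < ang i" "j < n \<Longrightarrow> ang 0 - 2 * pi < ang j"
proof -
  have "(\<forall>j < length (bdry G). bdry G ! j = cis (ang j)) \<and>
        (\<forall>i j. i < j \<and> j < length (bdry G) \<longrightarrow> ang j < ang i) \<and>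
        (\<forall>j < length (bdry G). ang 0 - 2 * pi < ang j)"
    using someI_ex[OF bdry_clockwise[unfolded clockwise_on_circle_def]] unfolding ang_def .
  then show "j < n \<Longrightarrow> bdry G ! j = cis (ang j)" "i < j \<Longrightarrow> j < n \<Longrightarrow> ang j < ang i" "j < n \<Longrightarrow> ang 0 - 2 * pi < ang j"
    using len_bdry by auto
qed

text \<open>The angles of the boundary vertices, of one more point \<open>pt n\<close> on the arc from the last boundary
  vertex to the first one, and of the first boundary vertex after a full turn. The additional
  point avoids double edges, and it marks the infinite face.\<close>

definition tht :: "nat \<Rightarrow> real" where
  "tht j = (if j < n then ang j else if j = n then (ang (n - 1) + (ang 0 - 2 * pi)) / 2 else ang 0 - 2 * pi)"

text \<open>The points with these angles, and the arcs of the circle from each of them to the next one. So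
  \<open>pt (Suc n) = pt 0\<close>.\<close>

definition pt :: "nat \<Rightarrow> complex" where "pt j = cis (tht j)"

definition carc :: "nat \<Rightarrow> complex set" where "carc j = cis ` {tht (Suc j)..tht j}"

text \<open>The augmented graph: the points \<open>pt j\<close> are joined by the arcs of the circle.\<close>

abbreviation Vt where "Vt \<equiv> insert (pt n) (verts G)"
abbreviation Et where "Et \<equiv> edges G \<union> carc ` {..n}"

lemma tht_Suc:
  assumes "j \<le> n"
  shows "tht (Suc j) < tht j"
proof -
  consider "Suc j < n" | "Suc j = n" | "j = n" using assms by linarith
  then show ?thesis
  proof cases
    case 1 then show ?thesis using ang(2)[of j "Suc j"] by (simp add: tht_def)
  next
    case 2
    then have "j = n - 1" "j < n" by auto
    then show ?thesis using ang(3)[of j] 2 by (simp add: tht_def)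
  next
    case 3
    have "n - 1 < n" using n_ge_2 by simp
    then show ?thesis using ang(3)[of "n - 1"] 3 by (simp add: tht_def)
  qed
qed

lemma tht_less: "i < j \<Longrightarrow> j \<le> Suc n \<Longrightarrow> tht j < tht i"
proof (induction j)
  case (Suc j)
  then show ?case using tht_Suc[of j] by (cases "i = j") auto
qed simp

lemma tht_le: "i \<le> j \<Longrightarrow> j \<le> Suc n \<Longrightarrow> tht j \<le> tht i"
  using tht_less[of i j] by (cases "i = j") auto

lemma tht_turn: "tht (Suc n) = tht 0 - 2 * pi"
  using n_ge_2 by (simp add: tht_def)

lemma pt_turn: "pt (Suc n) = pt 0"
  unfolding pt_def tht_turn by (simp add: cis_divide[symmetric])

lemma pt_bdry: "j < n \<Longrightarrow> pt j = bdry G ! j"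
  unfolding pt_def using ang(1) by (simp add: tht_def)

lemma pt_inj: "i \<le> n \<Longrightarrow> j \<le> n \<Longrightarrow> pt i = pt j \<longleftrightarrow> i = j"
proof -
  have "pt i \<noteq> pt j" if "i < j" "j \<le> n" for i j
  proof
    assume "pt i = pt j"
    have "tht j < tht i" "tht (Suc n) < tht j" "tht i \<le> tht 0" using that by (auto intro: tht_less tht_le)
    then show False using cis_eq_close[of "tht i" "tht j"] \<open>pt i = pt j\<close> tht_turn unfolding pt_def by auto
  qed
  then show "i \<le> n \<Longrightarrow> j \<le> n \<Longrightarrow> pt i = pt j \<longleftrightarrow> i = j" by (metis nat_neq_iff)
qed

lemma set_bdry: "set (bdry G) = pt ` {..<n}"
  using pt_bdry len_bdry by (auto simp: in_set_conv_nth)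

lemma pt_circle: "pt j \<in> sphere 0 1"
  by (simp add: pt_def)

lemma carc_circle: "carc j \<subseteq> sphere 0 1"
  by (auto simp: carc_def)

lemma pt_n_notin: "pt n \<notin> drawing G" "pt n \<notin> set (bdry G)" "pt n \<notin> verts G"
proof -
  show 1: "pt n \<notin> set (bdry G)" unfolding set_bdry using pt_inj by force
  then show 2: "pt n \<notin> drawing G" using drawing_circle pt_circle by blast
  then show "pt n \<notin> verts G" unfolding drawing_def by blast
qed

lemma verts_circle: "Vt \<inter> sphere 0 1 = pt ` {..n}"
proof -
  have "verts G \<inter> sphere 0 1 \<subseteq> set (bdry G)" using drawing_circle unfolding drawing_def by blast
  moreover have "set (bdry G) \<subseteq> verts G" using bdry_black unfolding verts_def by blast
  moreover have "{..n} = insert n {..<n}" by auto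
  ultimately show ?thesis using pt_circle set_bdry by auto
qed

lemma pt_arc_angle:
  assumes "j \<le> n" "i \<le> n" "tht (Suc j) \<le> \<phi>" "\<phi> \<le> tht j" "cis \<phi> = pt i"
  shows "(\<phi> = tht i \<and> (i = j \<or> i = Suc j)) \<or> (\<phi> = tht (Suc n) \<and> i = 0 \<and> j = n)"
proof -
  have r: "tht (Suc n) \<le> \<phi>" "\<phi> \<le> tht 0" "tht (Suc n) < tht i" "tht i \<le> tht 0"
    using assms tht_le[of "Suc j" "Suc n"] tht_le[of 0 j] tht_less[of i "Suc n"] tht_le[of 0 i] by auto
  have c: "cis \<phi> = cis (tht i)" using assms unfolding pt_def by simp
  show ?thesis
  proof (cases "\<phi> = tht i")
    case True
    have "\<not> i < j" using tht_less[of i j] True assms by force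
    moreover have "\<not> Suc j < i" using tht_less[of "Suc j" i] True assms by force
    ultimately show ?thesis using True by auto
  next
    case False
    then have "\<not> \<bar>\<phi> - tht i\<bar> < 2 * pi" using cis_eq_close[OF c] by blast
    then have "\<phi> = tht (Suc n)" "tht i = tht 0" using r tht_turn by auto
    moreover have "i = 0" using tht_less[of 0 i] \<open>tht i = tht 0\<close> assms by (cases i) auto
    moreover have "j = n" using tht_less[of "Suc j" "Suc n"] \<open>\<phi> = tht (Suc n)\<close> assms by (cases "j = n") auto
    ultimately show ?thesis by blast
  qed
qed

lemma carc_V:
  assumes "j \<le> n"
  shows "carc j \<inter> Vt = {pt j, pt (Suc j)}"
proof
  show "carc j \<inter> Vt \<subseteq> {pt j, pt (Suc j)}"
  proof
    fix z assume z: "z \<in> carc j \<inter> Vt"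
    then have "z \<in> cis ` {tht (Suc j)..tht j}" by (simp add: carc_def)
    then obtain \<phi> where "z = cis \<phi>" "\<phi> \<in> {tht (Suc j)..tht j}" by blast
    then have p: "z = cis \<phi>" "tht (Suc j) \<le> \<phi>" "\<phi> \<le> tht j" by auto
    have "z \<in> pt ` {..n}" using z carc_circle verts_circle by blast
    then obtain i where i: "i \<le> n" "z = pt i" by auto
    then show "z \<in> {pt j, pt (Suc j)}"
      using pt_arc_angle[OF assms i(1) p(2,3)] p(1) pt_turn by auto
  qed
  have "tht (Suc j) \<le> tht j" using tht_Suc[OF assms] by simp
  then have "pt j \<in> carc j" "pt (Suc j) \<in> carc j" unfolding carc_def pt_def by auto
  moreover have "pt j \<in> pt ` {..n}" "pt (Suc j) \<in> pt ` {..n}"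
    using assms pt_turn by (auto simp: le_Suc_eq) (metis atMost_iff image_eqI le0 le_antisym not_less_eq_eq)
  ultimately show "{pt j, pt (Suc j)} \<subseteq> carc j \<inter> Vt" using verts_circle by blast
qed

lemma carc_arc:
  assumes "j \<le> n"
  obtains g where "arc g" "path_image g = carc j" "pathstart g = pt (Suc j)" "pathfinish g = pt j"
proof -
  have "tht j \<le> tht 0" "tht (Suc n) \<le> tht (Suc j)" using assms by (auto intro: tht_le)
  moreover have "tht j < tht 0 \<or> tht (Suc n) < tht (Suc j)"
  proof (cases "j = 0")
    case True
    then show ?thesis using tht_less[of "Suc 0" "Suc n"] n_ge_2 by simp
  next
    case False
    then show ?thesis using tht_less[of 0 j] assms by simp
  qed
  ultimately have "tht j - tht (Suc j) < 2 * pi" using tht_turn by linarith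
  then show ?thesis using arc_cis[OF tht_Suc[OF assms]] that unfolding carc_def pt_def by metis
qed

lemma carc_Int:
  assumes "i < j" "j \<le> n"
  shows "carc i \<inter> carc j \<subseteq> Vt"
proof
  fix z assume "z \<in> carc i \<inter> carc j"
  then have "z \<in> cis ` {tht (Suc i)..tht i}" "z \<in> cis ` {tht (Suc j)..tht j}" by (simp_all add: carc_def)
  then obtain \<phi> \<psi> where "z = cis \<phi>" "\<phi> \<in> {tht (Suc i)..tht i}" "z = cis \<psi>" "\<psi> \<in> {tht (Suc j)..tht j}"
    by (elim imageE)
  then have p: "z = cis \<phi>" "tht (Suc i) \<le> \<phi>" "\<phi> \<le> tht i" "z = cis \<psi>" "tht (Suc j) \<le> \<psi>" "\<psi> \<le> tht j"
    by simp_all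
  have r: "tht j \<le> tht (Suc i)" "tht i \<le> tht 0" "tht (Suc n) \<le> tht (Suc j)"
    using assms by (auto intro: tht_le)
  then have "\<psi> \<le> \<phi>" "\<phi> - \<psi> \<le> 2 * pi" using p tht_turn by linarith+
  moreover have "cis \<phi> = cis \<psi>" using p by simp
  ultimately have "\<phi> = \<psi> \<or> \<phi> = \<psi> + 2 * pi" using cis_eq_within by blast
  then have "\<phi> = tht (Suc i) \<or> \<phi> = tht 0" using p r tht_turn by auto
  then have "z = pt (Suc i) \<or> z = pt 0" using p(1) by (auto simp: pt_def)
  then have "z \<in> pt ` {..n}" using assms by (auto intro: image_eqI[of _ _ "Suc i"] image_eqI[of _ _ 0])
  then show "z \<in> Vt" using verts_circle by blast
qed

lemma edge_Vt: "e \<in> edges G \<Longrightarrow> e \<inter> Vt = e \<inter> verts G"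
  using pt_n_notin(1) unfolding drawing_def by blast

lemma edge_carc_Int: "e \<in> edges G \<Longrightarrow> e \<inter> carc j \<subseteq> set (bdry G)"
  using drawing_circle carc_circle unfolding drawing_def by blast

lemma carc_ends_no_white: "j \<le> n \<Longrightarrow> w \<in> white G \<Longrightarrow> w \<notin> carc j"
  using carc_circle white_internal internal_in_ball by force

lemma carc_inj:
  assumes "i \<le> n" "j \<le> n" "{pt i, pt (Suc i)} = {pt j, pt (Suc j)}"
  shows "i = j"
proof -
  have "False" if ij: "i < j" "j \<le> n" "{pt i, pt (Suc i)} = {pt j, pt (Suc j)}" for i j
  proof -
    have "pt i \<noteq> pt j" using ij pt_inj by auto
    then have eq: "pt i = pt (Suc j)" "pt (Suc i) = pt j" using ij(3) by (auto simp: doubleton_eq_iff)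
    have "Suc i = j" using eq(2) ij pt_inj[of "Suc i" j] by simp
    have "j = n"
      using eq(1) ij pt_inj[of i "Suc j"] by (cases "j = n") auto
    then have "i = 0" using eq(1) ij pt_turn pt_inj[of i 0] by simp
    then show False using \<open>Suc i = j\<close> \<open>j = n\<close> n_ge_2 by simp
  qed
  from this[of i j] this[of j i] show ?thesis using assms by (metis nat_neq_iff)
qed

sublocale ag: plane_graph Vt Et
proof
  show "finite Vt" "finite Et" using finite_verts finite_edges by auto
  show "\<exists>g. arc g \<and> path_image g = e \<and> e \<inter> Vt = {pathstart g, pathfinish g}" if e: "e \<in> Et" for e
  proof (cases "e \<in> edges G")
    case True
    then show ?thesis using edge_arc_ends[OF True] edge_Vt[OF True] by metis
  next
    case False
    then obtain j where j: "j \<le> n" "e = carc j" using e by auto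
    obtain g where "arc g" "path_image g = carc j" "pathstart g = pt (Suc j)" "pathfinish g = pt j"
      using carc_arc[OF j(1)] by blast
    then show ?thesis using carc_V[OF j(1)] j by (intro exI[of _ g]) (auto simp: insert_commute)
  qed
  have bV: "set (bdry G) \<subseteq> Vt" using bdry_black unfolding verts_def by blast
  show "e \<inter> e' \<subseteq> Vt" if e: "e \<in> Et" "e' \<in> Et" "e \<noteq> e'" for e e'
  proof -
    consider "e \<in> edges G" "e' \<in> edges G" | j where "e \<in> edges G" "e' = carc j" | j where "e' \<in> edges G" "e = carc j"
      | i j where "i \<le> n" "e = carc i" "j \<le> n" "e' = carc j" using e by blast
    then show ?thesis
    proof cases
      case 1 then show ?thesis using edges_meet[of e e'] e by blast
    next
      case 2 then show ?thesis using edge_carc_Int[of e] bV by blast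
    next
      case 3 then show ?thesis using edge_carc_Int[of e'] bV by blast
    next
      case 4
      then have "i < j \<or> j < i" using e(3) by (metis nat_neq_iff)
      then show ?thesis using carc_Int[of i j] carc_Int[of j i] 4 by blast
    qed
  qed
  show "e = e'" if e: "e \<in> Et" "e' \<in> Et" "e \<inter> Vt = e' \<inter> Vt" for e e'
  proof -
    have mixed: False if "e \<in> edges G" "j \<le> n" "e \<inter> Vt = carc j \<inter> Vt" for e j
    proof -
      have "wh e \<in> e \<inter> Vt" using edge_ends[OF that(1)] edge_Vt[OF that(1)] by auto
      then show False using that carc_ends_no_white[OF that(2)] edge_ends(2)[OF that(1)] by blast
    qed
    consider "e \<in> edges G" "e' \<in> edges G" | j where "j \<le> n" "e \<in> edges G" "e' = carc j" | j where "j \<le> n" "e' \<in> edges G" "e = carc j"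
      | i j where "i \<le> n" "e = carc i" "j \<le> n" "e' = carc j" using e by blast
    then show ?thesis
    proof cases
      case 1 then show ?thesis using pg.simple[OF 1] e(3) edge_Vt by simp
    next
      case 2 then show ?thesis using mixed[of e j] e(3) by blast
    next
      case 3 then show ?thesis using mixed[of e' j] e(3) by metis
    next
      case 4
      then have "{pt i, pt (Suc i)} = {pt j, pt (Suc j)}" using e(3) carc_V[of i] carc_V[of j] by simp
      then show ?thesis using carc_inj 4 by blast
    qed
  qed
qed

lemma pg_adj_ag:
  assumes "pg.adj x y"
  shows "ag.adj x y"
proof -
  obtain e where "x \<noteq> y" "e \<in> edges G" "e \<inter> verts G = {x, y}" using assms unfolding pg.adj_def by blast
  then show ?thesis unfolding ag.adj_def using edge_Vt[of e] by auto
qed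

lemma edges_in_cball:
  assumes "e \<in> Et"
  shows "e \<subseteq> cball 0 1"
proof (cases "e \<in> edges G")
  case True
  then have "e \<subseteq> set (bdry G) \<union> ball 0 1" using edge_in_cball by blast
  then show ?thesis using bdry_on_circle by fastforce
next
  case False
  then obtain j where "e = carc j" using assms by blast
  then show ?thesis using carc_circle[of j] by fastforce
qed

lemma inside_in_ball:
  assumes "ag.cyc xs"
  shows "inside (ag.crv xs) \<subseteq> ball 0 1"
proof -
  have "ag.crv xs \<subseteq> cball 0 1"
    using ag.ceds_in_E[OF assms] edges_in_cball unfolding ag.crv_def by blast
  then have "- cball 0 1 \<subseteq> outside (ag.crv xs)"
    using convex_in_outside[of "cball 0 1"] outside_mono by blast
  then have "inside (ag.crv xs) \<subseteq> cball 0 1" using ag.cyc_jordan(8)[OF assms] by blast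
  then show ?thesis
    using ag.cyc_jordan(2)[OF assms] interior_maximal interior_cball by metis
qed

lemma two_nbrs_inside:
  assumes "ag.cyc xs" "H \<subseteq> Vt \<inter> inside (ag.crv xs)" "H \<noteq> {}"
  shows "ag.two_nbrs H"
proof -
  have "H \<subseteq> ball 0 1" using inside_in_ball[OF assms(1)] assms(2) by blast
  moreover have "pt n \<notin> ball 0 1" "set (bdry G) \<inter> ball 0 1 = {}"
    using pt_circle[of n] bdry_on_circle by auto
  ultimately have "H \<subseteq> internal_verts G"
    using assms(2) unfolding internal_verts_def by blast
  then have "pg.two_nbrs H" using inner_verts_two_nbrs assms(3) by blast
  then obtain p q h h' where "p \<noteq> q" "p \<notin> H" "q \<notin> H" "h \<in> H" "pg.adj p h" "h' \<in> H" "pg.adj q h'"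
    unfolding pg.two_nbrs_def by blast
  moreover from this have "ag.adj p h" "ag.adj q h'" using pg_adj_ag by simp_all
  ultimately show ?thesis unfolding ag.two_nbrs_def by blast
qed

text \<open>Next to a point of the circle at which a cycle follows the circle, the disk is inside the cycle.\<close>

lemma cycle_on_circle_local:
  assumes c: "ag.cyc xs" and z: "z \<in> ag.crv xs" and circ: "\<forall>e \<in> ag.ceds xs. z \<in> e \<longrightarrow> e \<subseteq> sphere 0 1"
  shows "\<exists>r>0. ball z r \<inter> ball 0 1 \<subseteq> inside (ag.crv xs) \<and>
    ball z r \<inter> cball 0 1 \<subseteq> inside (ag.crv xs) \<union> ag.crv xs"
proof -
  let ?F = "{e \<in> ag.ceds xs. z \<notin> e}"
  note J = ag.cyc_jordan[OF c]
  have "closed e" if "e \<in> ag.ceds xs" for e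
  proof -
    have "e \<in> Et" using that ag.ceds_in_E[OF c] by blast
    then obtain g where "arc g" "path_image g = e" using ag.edge by blast
    then show ?thesis using compact_arc_image compact_imp_closed by blast
  qed
  then have "closed (\<Union>?F)" by (intro closed_Union) auto
  moreover have "z \<notin> \<Union>?F" by blast
  ultimately obtain r where r: "r > 0" "ball z r \<subseteq> - \<Union>?F"
    by (rule ball_avoiding_closed)
  have miss: "(ball z r \<inter> ball 0 1) \<inter> ag.crv xs = {}"
  proof -
    have "y \<in> sphere 0 1" if y: "y \<in> ball z r" "y \<in> ag.crv xs" for y
    proof -
      obtain e where e: "e \<in> ag.ceds xs" "y \<in> e" using y(2) unfolding ag.crv_def by blast
      then have "z \<in> e" using r y by blast
      then show ?thesis using circ e by blast
    qed
    then show ?thesis by auto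
  qed
  have "z \<in> closure (inside (ag.crv xs))" using z J(10) unfolding frontier_def by blast
  then have "ball z r \<inter> inside (ag.crv xs) \<noteq> {}"
    using r(1) open_Int_closure_eq_empty[of "ball z r" "inside (ag.crv xs)"] centre_in_ball[of z r] by blast
  then have ne: "(ball z r \<inter> ball 0 1) \<inter> inside (ag.crv xs) \<noteq> {}" using inside_in_ball[OF c] by blast
  have "connected (ball z r \<inter> ball 0 1)" by (simp add: convex_Int convex_connected)
  then have 1: "ball z r \<inter> ball 0 1 \<subseteq> inside (ag.crv xs)"
    using connected_Int_frontier[of "ball z r \<inter> ball 0 1" "inside (ag.crv xs)"] ne miss J(10) by blast
  have "ball z r \<inter> cball 0 1 \<subseteq> closure (ball z r \<inter> ball 0 1)"
    using open_Int_closure_subset[of "ball z r" "ball 0 1"] by simp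
  then have 2: "ball z r \<inter> cball 0 1 \<subseteq> inside (ag.crv xs) \<union> ag.crv xs"
    using closure_mono[OF 1] J(13) by blast
  show ?thesis using r(1) 1 2 by (intro exI[of _ r]) simp
qed

text \<open>A cycle that passes a boundary vertex along the circle has the edge at this vertex in its inside.\<close>

lemma bedge_inside:
  assumes c: "ag.cyc xs" and b: "b \<in> set (bdry G)" "b \<in> set xs" "bedge b \<notin> ag.ceds xs"
  shows "bedge b - Vt \<subseteq> inside (ag.crv xs)" "bedge b \<inter> inside (ag.crv xs) \<noteq> {}"
proof -
  have bV: "b \<in> Vt" using b(1) bdry_black unfolding verts_def by blast
  have bc: "b \<in> ag.crv xs" using ag.crv_V[OF c] b(2) by blast
  have "e \<subseteq> sphere 0 1" if e: "e \<in> ag.ceds xs" "b \<in> e" for e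
  proof -
    have "e \<notin> edges G" using edge_at_bdry[OF _ e(2) b(1)] e(1) b(3) by blast
    moreover have "e \<in> Et" using ag.ceds_in_E[OF c] e(1) by blast
    ultimately show ?thesis using carc_circle by blast
  qed
  then have "\<forall>e \<in> ag.ceds xs. b \<in> e \<longrightarrow> e \<subseteq> sphere 0 1" by simp
  from cycle_on_circle_local[OF c bc this]
  obtain r where r: "r > 0" "ball b r \<inter> ball 0 1 \<subseteq> inside (ag.crv xs)" by (elim exE conjE)
  have be: "bedge b \<in> edges G" "b \<in> bedge b" by (rule bedge[OF b(1)])+
  obtain g where g: "arc g" "path_image g = bedge b" using edge_arc_ends[OF be(1)] by metis
  have "uncountable (bedge b)" using arc_image_uncountable[OF g(1)] unfolding g(2) .
  then have inf: "infinite (bedge b)" using countable_finite[of "bedge b"] by auto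
  have "\<exists>y. y \<in> bedge b \<and> y \<in> ball b r \<and> y \<notin> set (bdry G)"
  proof (rule ccontr)
    assume "\<not> ?thesis"
    then have "bedge b \<inter> ball b r \<subseteq> set (bdry G)" by blast
    then have fin: "finite (bedge b \<inter> ball b r)" by (rule finite_subset) simp
    have "connected (bedge b)" using connected_arc_image[OF g(1)] g(2) by simp
    moreover have "openin (top_of_set (bedge b)) (bedge b \<inter> ball b r)" by (rule openin_open_Int) simp
    moreover have "closedin (top_of_set (bedge b)) (bedge b \<inter> ball b r)"
      using fin by (simp add: closed_subset finite_imp_closed)
    moreover have "bedge b \<inter> ball b r \<noteq> {}" using be(2) r(1) by auto
    ultimately have "bedge b \<inter> ball b r = bedge b" unfolding connected_clopen by blast
    then show False using fin inf by simp
  qed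
  then obtain y where y: "y \<in> bedge b" "y \<in> ball b r" "y \<notin> set (bdry G)" by blast
  then have "y \<in> ball 0 1" using edge_in_cball[OF be(1)] by blast
  then show ne: "bedge b \<inter> inside (ag.crv xs) \<noteq> {}" using y r by blast
  show "bedge b - Vt \<subseteq> inside (ag.crv xs)"
    using ag.edge_inside(1)[OF c _ ne] be(1) by blast
qed

subsection \<open>Faces bounded by cycles\<close>

lemma closed_drawing: "closed (drawing G)"
  using drawing_compact compact_imp_closed by blast

lemma on_crv_not_drawing:
  assumes c: "ag.cyc xs" and z: "z \<notin> drawing G" and e: "e \<in> ag.ceds xs" "z \<in> e"
  shows "e \<subseteq> sphere 0 1"
proof -
  have "e \<notin> edges G" using z e(2) unfolding drawing_def by blast
  moreover have "e \<in> Et" using ag.ceds_in_E[OF c] e(1) by blast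
  ultimately show ?thesis using carc_circle by blast
qed

text \<open>If a cycle of the augmented graph encloses no part of the graph, its inside belongs to one face, which
  has no other points, except on the circle. The face is the infinite one if and only if
  the cycle runs through \<open>pt n\<close>.\<close>

lemma face_of_cycle:
  assumes c: "ag.cyc xs" and empty: "inside (ag.crv xs) \<inter> drawing G = {}"
    and F: "\<Omega> \<in> faces G" "\<Omega> \<inter> inside (ag.crv xs) \<noteq> {}"
  shows "inside (ag.crv xs) \<subseteq> \<Omega>" "\<Omega> \<subseteq> inside (ag.crv xs) \<union> ag.crv xs" "frontier \<Omega> = ag.crv xs"
    "pt n \<in> \<Omega> \<longleftrightarrow> pt n \<in> set xs"
proof -
  let ?I = "inside (ag.crv xs)" let ?C = "ag.crv xs"
  note J = ag.cyc_jordan[OF c]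
  have F': "\<Omega> \<in> components (cball 0 1 - drawing G)" using F(1) unfolding faces_def .
  have "?I \<subseteq> cball 0 1 - drawing G" using inside_in_ball[OF c] empty by auto
  then show 1: "?I \<subseteq> \<Omega>" using components_maximal[OF F' J(3)] F(2) by blast
  have clopen: "openin (top_of_set \<Omega>) (\<Omega> \<inter> (?I \<union> ?C))"
  proof (subst openin_contains_ball, intro conjI ballI)
    fix z assume z: "z \<in> \<Omega> \<inter> (?I \<union> ?C)"
    have zF: "z \<notin> drawing G" "\<Omega> \<subseteq> cball 0 1" using z in_components_subset[OF F'] by auto
    show "\<exists>e>0. ball z e \<inter> \<Omega> \<subseteq> \<Omega> \<inter> (?I \<union> ?C)"
    proof (cases "z \<in> ?I")
      case True
      then obtain r where "r > 0" "ball z r \<subseteq> ?I" using J(2) open_contains_ball by blast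
      then show ?thesis by (intro exI[of _ r]) blast
    next
      case False
      then have zC: "z \<in> ?C" using z by blast
      have "\<forall>e \<in> ag.ceds xs. z \<in> e \<longrightarrow> e \<subseteq> sphere 0 1"
        using on_crv_not_drawing[OF c zF(1)] by simp
      from cycle_on_circle_local[OF c zC this]
      obtain r where "r > 0" "ball z r \<inter> cball 0 1 \<subseteq> ?I \<union> ?C" by (elim exE conjE)
      then show ?thesis using zF(2) by (intro exI[of _ r]) blast
    qed
  qed blast
  have "closed (?I \<union> ?C)" using J(13) by (metis closed_closure)
  then have "closedin (top_of_set \<Omega>) (\<Omega> \<inter> (?I \<union> ?C))" by (rule closedin_closed_Int)
  then have "\<Omega> \<inter> (?I \<union> ?C) = \<Omega>"
    using clopen in_components_connected[OF F'] F(2) unfolding connected_clopen by blast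
  then show 2: "\<Omega> \<subseteq> ?I \<union> ?C" by blast
  have clo: "closure \<Omega> = ?I \<union> ?C"
    using closure_mono[OF 1] closure_mono[OF 2] J(13) by (metis closed_closure closure_closed subset_antisym)
  have "interior \<Omega> \<inter> ?C = {}"
  proof (rule ccontr)
    assume "interior \<Omega> \<inter> ?C \<noteq> {}"
    then obtain z where z: "z \<in> interior \<Omega>" "z \<in> closure (outside ?C)" using J(11) unfolding frontier_def by blast
    then have "interior \<Omega> \<inter> outside ?C \<noteq> {}"
      using open_Int_closure_eq_empty[of "interior \<Omega>" "outside ?C"] open_interior by blast
    then show False using 2 interior_subset[of \<Omega>] J(8) J(9) by blast
  qed
  moreover have "?I \<subseteq> interior \<Omega>" using 1 J(2) by (rule interior_maximal)
  moreover have "interior \<Omega> \<subseteq> ?I \<union> ?C" using 2 interior_subset by blast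
  ultimately have "interior \<Omega> = ?I" by blast
  then show 3: "frontier \<Omega> = ?C" unfolding frontier_def clo using J(9) by blast
  show "pt n \<in> \<Omega> \<longleftrightarrow> pt n \<in> set xs"
  proof
    assume "pt n \<in> \<Omega>"
    moreover have "pt n \<notin> ?I" using inside_in_ball[OF c] pt_circle[of n] by auto
    ultimately have "pt n \<in> ?C" using 2 by blast
    then show "pt n \<in> set xs" using ag.crv_V[OF c] by blast
  next
    assume "pt n \<in> set xs"
    then have "pt n \<in> ?C" using ag.crv_V[OF c] by blast
    then have pcl: "pt n \<in> closure \<Omega>" using clo by blast
    have pin: "pt n \<in> cball 0 1 - drawing G" using pt_n_notin(1) pt_circle[of n] by auto
    define K where "K = connected_component_set (cball 0 1 - drawing G) (pt n)"
    have K: "K \<in> components (cball 0 1 - drawing G)" "pt n \<in> K"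
      using pin unfolding K_def components_def by auto
    obtain r where r: "r > 0" "ball (pt n) r \<inter> cball 0 1 \<subseteq> K"
      using component_of_disk_contains_ball[OF closed_drawing K] by blast
    have "ball (pt n) r \<inter> \<Omega> \<noteq> {}"
      using pcl r(1) open_Int_closure_eq_empty[of "ball (pt n) r" \<Omega>] centre_in_ball[of "pt n" r] by blast
    then have "K \<inter> \<Omega> \<noteq> {}" using r(2) in_components_subset[OF F'] by blast
    then have "K = \<Omega>" using components_nonoverlap[OF K(1) F'] by blast
    then show "pt n \<in> \<Omega>" using K by simp
  qed
qed

end

context reduced_disk_graph
begin

lemma infinite_face_iff: "infinite_face G \<Omega> \<longleftrightarrow> \<Omega> \<in> faces G \<and> pt n \<in> \<Omega>"
proof -
  let ?A = "cis ` {tht (Suc n)<..<tht (n - 1)}"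
  have n: "n - 1 < n" "0 < n" using n_ge_2 by auto
  have ends: "last (bdry G) = cis (tht (n - 1))" "hd (bdry G) = cis (tht (Suc n))"
  proof -
    show "last (bdry G) = cis (tht (n - 1))"
      using pt_bdry[OF n(1)] bdry_nonempty len_bdry by (simp add: last_conv_nth pt_def)
    have "hd (bdry G) = pt 0" using pt_bdry[OF n(2)] bdry_nonempty by (simp add: hd_conv_nth)
    then show "hd (bdry G) = cis (tht (Suc n))" using pt_turn by (simp add: pt_def)
  qed
  have D: "tht (Suc n) < tht n" "tht n < tht (n - 1)" "tht (n - 1) < tht 0"
    using tht_less[of n "Suc n"] tht_less[of "n - 1" n] tht_less[of 0 "n - 1"] n_ge_2 by auto
  have ptA: "pt n \<in> clockwise_arc (last (bdry G)) (hd (bdry G))"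
    unfolding clockwise_arc_def ends pt_def using D tht_turn
    by (intro CollectI exI[of _ "tht n"] exI[of _ "tht (n - 1)"] exI[of _ "tht (Suc n)"]) auto
  have sub: "clockwise_arc (last (bdry G)) (hd (bdry G)) \<subseteq> ?A"
  proof
    fix z assume "z \<in> clockwise_arc (last (bdry G)) (hd (bdry G))"
    then obtain \<phi> \<alpha> \<beta> where z: "z = cis \<phi>" "cis \<alpha> = cis (tht (n - 1))" "cis \<beta> = cis (tht (Suc n))"
      "\<beta> < \<phi>" "\<phi> < \<alpha>" "\<alpha> - \<beta> \<le> 2 * pi"
      unfolding clockwise_arc_def ends by (auto simp: eq_commute)
    have "\<exists>m::int. x = y + 2 * pi * m" if "cis x = cis y" for x y
      using that sin_cos_eq_iff[of x y] by (simp add: complex_eq_iff)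
    then obtain a b :: int where ab: "\<alpha> = tht (n - 1) + 2 * pi * a" "\<beta> = tht (Suc n) + 2 * pi * b"
      using z(2,3) by metis
    have d: "\<alpha> - \<beta> = (tht (n - 1) - tht (Suc n)) + 2 * pi * (a - b)"
      using ab by (simp add: algebra_simps)
    have "2 * pi * (a - b) < 2 * pi * 1" "2 * pi * (- 1) < 2 * pi * (a - b)"
      using d D z(4-6) tht_turn by linarith+
    then have "real_of_int (a - b) < 1" "- 1 < real_of_int (a - b)"
      using mult_less_cancel_left_pos[of "2 * pi" "real_of_int (a - b)" 1]
        mult_less_cancel_left_pos[of "2 * pi" "- 1" "real_of_int (a - b)"] by simp_all
    then have "a = b" by linarith
    then have "cis (\<phi> - 2 * pi * a) = z" "\<phi> - 2 * pi * a \<in> {tht (Suc n)<..<tht (n - 1)}"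
      using z ab by (auto simp: cis_divide[symmetric] cis_multiple_2pi)
    then show "z \<in> ?A" by blast
  qed
  have Adraw: "?A \<inter> drawing G = {}"
  proof (rule ccontr)
    assume "?A \<inter> drawing G \<noteq> {}"
    then obtain \<phi> where p: "tht (Suc n) < \<phi>" "\<phi> < tht (n - 1)" "cis \<phi> \<in> drawing G" by auto
    then have "cis \<phi> \<in> drawing G \<inter> sphere 0 1" by simp
    then have "cis \<phi> \<in> set (bdry G)" unfolding drawing_circle .
    then obtain i where i: "i < n" "cis \<phi> = pt i" unfolding set_bdry by blast
    have "tht (n - 1) \<le> tht i" "tht i \<le> tht 0" using i n_ge_2 by (auto intro: tht_le)
    then have "\<phi> = tht i" using cis_eq_close[of \<phi> "tht i"] i(2) p tht_turn unfolding pt_def by auto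
    then show False using p \<open>tht (n - 1) \<le> tht i\<close> by simp
  qed
  have conn: "connected ?A" by (intro connected_continuous_image continuous_intros) auto
  show ?thesis
  proof
    assume "infinite_face G \<Omega>"
    then show "\<Omega> \<in> faces G \<and> pt n \<in> \<Omega>" using ptA unfolding infinite_face_def by blast
  next
    assume F: "\<Omega> \<in> faces G \<and> pt n \<in> \<Omega>"
    have "?A \<subseteq> cball 0 1 - drawing G" using Adraw by auto
    moreover have "pt n \<in> ?A" using sub ptA by blast
    ultimately have "?A \<subseteq> \<Omega>" using components_maximal[OF _ conn] F unfolding faces_def by blast
    then show "infinite_face G \<Omega>" using F sub unfolding infinite_face_def by blast
  qed
qed

subsection \<open>The signs of cycles\<close>

lemma ceds_at_white:
  assumes "ag.cyc xs" "w \<in> white G" "e \<in> ag.ceds xs" "w \<in> e"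
  shows "e \<in> edges G"
  using assms carc_ends_no_white ag.ceds_in_E by blast

text \<open>A cycle has two edges at each of its white vertices, and these are all its edges off the circle.\<close>

lemma card_cycle_edges:
  assumes c: "ag.cyc xs"
  shows "card (ag.ceds xs \<inter> edges G) = 2 * card (white G \<inter> set xs)"
proof -
  have eq: "ag.ceds xs \<inter> edges G = (\<Union>w \<in> white G \<inter> set xs. {e \<in> ag.ceds xs. w \<in> e})"
  proof
    show "ag.ceds xs \<inter> edges G \<subseteq> (\<Union>w \<in> white G \<inter> set xs. {e \<in> ag.ceds xs. w \<in> e})"
    proof
      fix e assume e: "e \<in> ag.ceds xs \<inter> edges G"
      then have w: "wh e \<in> white G" "wh e \<in> e" "wh e \<in> Vt" using edge_ends[of e] by auto
      then have "wh e \<in> set xs" using ag.crv_V[OF c] e unfolding ag.crv_def by blast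
      then show "e \<in> (\<Union>w \<in> white G \<inter> set xs. {e \<in> ag.ceds xs. w \<in> e})" using w e by blast
    qed
    show "(\<Union>w \<in> white G \<inter> set xs. {e \<in> ag.ceds xs. w \<in> e}) \<subseteq> ag.ceds xs \<inter> edges G"
      using ceds_at_white[OF c] by blast
  qed
  have "card (\<Union>w \<in> white G \<inter> set xs. {e \<in> ag.ceds xs. w \<in> e}) = (\<Sum>w \<in> white G \<inter> set xs. card {e \<in> ag.ceds xs. w \<in> e})"
  proof (rule card_UN_disjoint)
    show "\<forall>i \<in> white G \<inter> set xs. \<forall>j \<in> white G \<inter> set xs. i \<noteq> j \<longrightarrow> {e \<in> ag.ceds xs. i \<in> e} \<inter> {e \<in> ag.ceds xs. j \<in> e} = {}"
    proof (intro ballI impI)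
      fix i j assume ij: "i \<in> white G \<inter> set xs" "j \<in> white G \<inter> set xs" "i \<noteq> j"
      have False if "e \<in> ag.ceds xs" "i \<in> e" "j \<in> e" for e
        using ceds_at_white[OF c _ that(1,2)] white_in_edge[of e i] white_in_edge[of e j] that ij by auto
      then show "{e \<in> ag.ceds xs. i \<in> e} \<inter> {e \<in> ag.ceds xs. j \<in> e} = {}" by blast
    qed
  qed auto
  also have "\<dots> = (\<Sum>w \<in> white G \<inter> set xs. 2)"
    using ag.cyc_degree[OF c] by (intro sum.cong) auto
  finally show ?thesis unfolding eq by simp
qed

lemma face_edges_of_cycle:
  assumes c: "ag.cyc xs" and F: "frontier \<Omega> = ag.crv xs"
  shows "face_edges G \<Omega> = ag.ceds xs \<inter> edges G"
proof
  show "ag.ceds xs \<inter> edges G \<subseteq> face_edges G \<Omega>"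
    unfolding face_edges_def F ag.crv_def by blast
  show "face_edges G \<Omega> \<subseteq> ag.ceds xs \<inter> edges G"
  proof
    fix e assume "e \<in> face_edges G \<Omega>"
    then have e: "e \<in> edges G" "e \<subseteq> ag.crv xs" unfolding face_edges_def F by auto
    obtain g where g: "arc g" "path_image g = e" "e \<inter> verts G = {pathstart g, pathfinish g}"
      using edge_arc_ends[OF e(1)] by metis
    obtain z where z: "z \<in> e" "z \<notin> verts G"
      using nonempty_simple_path_endless[OF arc_imp_simple_path[OF g(1)]] g(2,3) by blast
    then have "z \<notin> Vt" using pt_n_notin(1) e(1) unfolding drawing_def by blast
    obtain f where f: "f \<in> ag.ceds xs" "z \<in> f" using z e(2) unfolding ag.crv_def by blast
    then have "f \<in> Et" using ag.ceds_in_E[OF c] by blast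
    then have "f = e" using ag.meet[of e f] e(1) z f \<open>z \<notin> Vt\<close> by blast
    then show "e \<in> ag.ceds xs \<inter> edges G" using f e by blast
  qed
qed

text \<open>The colors alternate along a walk off the circle.\<close>

lemma alternating_walk_parity:
  assumes "ag.walk ws" "ag.eds ws \<subseteq> edges G" "ws \<noteq> []"
  shows "even (of_bool (hd ws \<in> white G) + of_bool (last ws \<in> white G) + length ws + (1::nat))"
  using assms
proof (induction ws rule: ag.eds.induct)
  case (1 x y zs)
  have a: "ag.adj x y" "ag.ed x y \<in> edges G" using 1 by auto
  have "ag.ed x y \<inter> verts G = {x, y}" using ag.ed_props(2)[OF a(1)] edge_Vt[OF a(2)] by simp
  then have "{x, y} = {bl (ag.ed x y), wh (ag.ed x y)}" using edge_ends(5)[OF a(2)] by simp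
  then have "(x \<in> white G) \<noteq> (y \<in> white G)"
    using edge_ends(1,2)[OF a(2)] bw_disjoint by (auto simp: doubleton_eq_iff)
  moreover have "even (of_bool (y \<in> white G) + of_bool (last (y # zs) \<in> white G) + length (y # zs) + (1::nat))"
    using 1 by simp
  ultimately show ?case by (auto split: if_splits)
qed auto

text \<open>Kasteleyn's condition passes from the finite faces to all cycles that do not run through \<open>pt n\<close>. If a
  cycle is cut by a path through its inside, the product of its signs is the product for the two
  parts, because the signs on the path cancel; the exponents on the right-hand side add up likewise,
  up to an even number.\<close>

theorem kasteleyn_cycle:
  assumes \<sigma>: "kasteleyn_signature G \<sigma>" and c: "ag.cyc xs" and u: "pt n \<notin> set xs"
  shows "(\<Prod>e \<in> ag.ceds xs \<inter> edges G. \<sigma> e) = (-1) ^ (card (white G \<inter> set xs) + 1 + card (Vt \<inter> inside (ag.crv xs)))"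
proof -
  have sq: "\<sigma> e * \<sigma> e = 1" if "e \<in> edges G" for e
    using \<sigma> that unfolding kasteleyn_signature_def by fastforce
  have "pt n \<notin> set xs \<longrightarrow> (\<Prod>e \<in> ag.ceds xs \<inter> edges G. \<sigma> e) = (-1) ^ (card (white G \<inter> set xs) + 1 + card (Vt \<inter> inside (ag.crv xs)))"
  proof (rule ag.cycle_split_induct[OF c two_nbrs_inside[OF c]])
    fix ys assume y: "ag.cyc ys" "inside (ag.crv ys) \<inter> \<Union> Et = {}"
    show "pt n \<notin> set ys \<longrightarrow> (\<Prod>e \<in> ag.ceds ys \<inter> edges G. \<sigma> e) = (-1) ^ (card (white G \<inter> set ys) + 1 + card (Vt \<inter> inside (ag.crv ys)))"
    proof
      assume u: "pt n \<notin> set ys"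
      have empty: "inside (ag.crv ys) \<inter> drawing G = {}" using y(2) unfolding drawing_edges by blast
      obtain z where z: "z \<in> inside (ag.crv ys)" using ag.cyc_jordan(1)[OF y(1)] by blast
      define \<Omega> where "\<Omega> = connected_component_set (cball 0 1 - drawing G) z"
      have "z \<in> cball 0 1 - drawing G" using z empty inside_in_ball[OF y(1)] by auto
      then have F: "\<Omega> \<in> faces G" "z \<in> \<Omega>" unfolding \<Omega>_def faces_def components_def by auto
      have "\<Omega> \<inter> inside (ag.crv ys) \<noteq> {}" using F z by blast
      note fc = face_of_cycle[OF y(1) empty F(1) this]
      have "\<Omega> \<in> finite_faces G" using F fc(4) u infinite_face_iff unfolding finite_faces_def by blast
      then have k: "(\<Prod>e \<in> face_edges G \<Omega>. \<sigma> e) = (-1) ^ (card (face_edges G \<Omega>) div 2 + 1)"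
        using \<sigma> unfolding kasteleyn_signature_def by blast
      have "verts G \<subseteq> drawing G" unfolding drawing_def by blast
      moreover have "pt n \<notin> inside (ag.crv ys)" using inside_in_ball[OF y(1)] pt_circle[of n] by auto
      ultimately have "Vt \<inter> inside (ag.crv ys) = {}" using empty by blast
      then show "(\<Prod>e \<in> ag.ceds ys \<inter> edges G. \<sigma> e) = (-1) ^ (card (white G \<inter> set ys) + 1 + card (Vt \<inter> inside (ag.crv ys)))"
        using k unfolding face_edges_of_cycle[OF y(1) fc(3)] card_cycle_edges[OF y(1)] by simp
    qed
  next
    fix ys as bs cs :: "complex list" and p q :: complex
    let ?C1 = "p # as @ q # rev cs" and ?C2 = "p # cs @ q # bs"
    let ?w = "\<lambda>zs. card (white G \<inter> set zs)" and ?v = "\<lambda>zs. card (Vt \<inter> inside (ag.crv zs))"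
    let ?s = "\<lambda>F. \<Prod>e \<in> F \<inter> edges G. \<sigma> e"
    assume y: "ag.cyc ys" "set ys = set (p # as @ q # bs)" "ag.ceds ys = ag.ceds (p # as @ q # bs)"
      and th: "ag.theta p as q bs cs" and csV: "set cs \<subseteq> Vt \<inter> inside (ag.crv ys)"
      and IH: "pt n \<notin> set ?C1 \<longrightarrow> ?s (ag.ceds ?C1) = (-1) ^ (?w ?C1 + 1 + ?v ?C1)"
        "pt n \<notin> set ?C2 \<longrightarrow> ?s (ag.ceds ?C2) = (-1) ^ (?w ?C2 + 1 + ?v ?C2)"
    show "pt n \<notin> set ys \<longrightarrow> ?s (ag.ceds ys) = (-1) ^ (?w ys + 1 + ?v ys)"
    proof
      assume u: "pt n \<notin> set ys"
      define A where "A = ag.eds (p # as @ [q])"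
      define B where "B = ag.eds (p # rev bs @ [q])"
      define C where "C = ag.eds (p # cs @ [q])"
      define I1 where "I1 = inside (ag.crv ?C1)"
      define I2 where "I2 = inside (ag.crv ?C2)"
      define I where "I = inside (ag.crv ys)"
      have crv: "ag.crv ys = ag.crv (p # as @ q # bs)" unfolding ag.crv_def y(3) ..
      have th': "ag.cyc ?C1" "ag.cyc ?C2" "distinct (p # q # as @ bs @ cs)" "ag.walk (p # cs @ [q])"
        "A \<inter> B = {}" "A \<inter> C = {}" "B \<inter> C = {}" "\<Union>C - {p, q} \<subseteq> I" "I1 \<inter> I2 = {}"
        "I1 \<union> I2 \<union> (\<Union>C - {p, q}) = I"
        using th unfolding ag.theta_def A_def B_def C_def I1_def I2_def I_def crv by - (elim conjE, assumption)+
      have Iball: "I \<subseteq> ball 0 1" using inside_in_ball[OF y(1)] unfolding I_def .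
      have un: "pt n \<notin> set cs" using csV Iball pt_circle[of n] unfolding I_def by auto
      then have u12: "pt n \<notin> set ?C1" "pt n \<notin> set ?C2" using u y(2) by auto
      have ceds: "ag.ceds ys = A \<union> B" "ag.ceds ?C1 = A \<union> C" "ag.ceds ?C2 = C \<union> B"
        using ag.ceds_two_paths[of p as q bs] ag.ceds_two_paths[of p as q "rev cs"] ag.ceds_two_paths[of p cs q bs]
        unfolding y(3) A_def B_def C_def rev_rev_ident .
      have fin: "finite A" "finite B" "finite C" unfolding A_def B_def C_def by simp_all
      \<comment> \<open>The path runs in the open disk, so it has no edges on the circle.\<close>
      have CE: "C \<subseteq> edges G"
      proof
        fix e assume e: "e \<in> C"
        then have eE: "e \<in> Et" using ag.eds_in_E[OF th'(4)] unfolding C_def by blast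
        obtain g where g: "arc g" "path_image g = e" using ag.edge[OF eE] by blast
        have "uncountable e" using arc_image_uncountable[OF g(1)] unfolding g(2) .
        then have "\<not> e \<subseteq> {p, q}" using countable_finite finite_subset by blast
        then obtain z where "z \<in> e" "z \<in> I" using th'(8) e by blast
        then have "z \<in> ball 0 1" using Iball by blast
        then have "e \<noteq> carc j" for j using carc_circle[of j] \<open>z \<in> e\<close> by auto
        then show "e \<in> edges G" using eE by blast
      qed
      have s1: "?s (A \<union> C) = ?s A * ?s C" "?s (C \<union> B) = ?s C * ?s B" "?s (A \<union> B) = ?s A * ?s B"
        using fin th'(5-7) by (auto simp: Int_Un_distrib2 intro!: prod.union_disjoint)
      have "?s C * ?s C = (\<Prod>e \<in> C \<inter> edges G. \<sigma> e * \<sigma> e)" by (rule prod.distrib[symmetric])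
      also have "\<dots> = 1" by (rule prod.neutral) (use sq in blast)
      finally have cc: "?s C * ?s C = 1" .
      have "?s (ag.ceds ?C1) * ?s (ag.ceds ?C2) = ?s A * ?s B * (?s C * ?s C)"
        unfolding ceds s1 by (simp only: ac_simps)
      then have prods: "?s (ag.ceds ys) = ?s (ag.ceds ?C1) * ?s (ag.ceds ?C2)"
        unfolding cc ceds(1) s1(3) by simp
      have VC: "Vt \<inter> (\<Union>C - {p, q}) = set cs"
        using ag.Union_eds_V[OF th'(4)] th'(3) unfolding C_def by auto
      have vsum: "?v ys = ?v ?C1 + ?v ?C2 + length cs"
      proof -
        have I: "Vt \<inter> I = (Vt \<inter> I1) \<union> ((Vt \<inter> I2) \<union> set cs)" using th'(10) VC by blast
        have out: "set cs \<inter> I1 = {}" "set cs \<inter> I2 = {}"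
        proof -
          have "set cs \<subseteq> ag.crv ?C1" "set cs \<subseteq> ag.crv ?C2"
            using ag.crv_V[OF th'(1)] ag.crv_V[OF th'(2)] by auto
          then show "set cs \<inter> I1 = {}" "set cs \<inter> I2 = {}"
            unfolding I1_def I2_def using ag.cyc_jordan(9)[OF th'(1)] ag.cyc_jordan(9)[OF th'(2)] by blast+
        qed
        have "card (Vt \<inter> I) = card (Vt \<inter> I1) + card ((Vt \<inter> I2) \<union> set cs)"
          unfolding I using out th'(9) finite_verts by (intro card_Un_disjoint) auto
        also have "card ((Vt \<inter> I2) \<union> set cs) = card (Vt \<inter> I2) + card (set cs)"
          using out finite_verts by (intro card_Un_disjoint) auto
        also have "card (set cs) = length cs" using th'(3) by (simp add: distinct_card)
        finally show ?thesis unfolding I_def I1_def I2_def by simp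
      qed
      have wsum: "?w ?C1 + ?w ?C2 = ?w ys + of_bool (p \<in> white G) + of_bool (q \<in> white G) + 2 * ?w cs"
      proof -
        have cnt: "card (white G \<inter> set zs) = length (filter (\<lambda>x. x \<in> white G) zs)" if "distinct zs" for zs
        proof -
          have "white G \<inter> set zs = set (filter (\<lambda>x. x \<in> white G) zs)" by auto
          then show ?thesis using distinct_card[of "filter (\<lambda>x. x \<in> white G) zs"] that by simp
        qed
        have d: "distinct ?C1" "distinct ?C2" "distinct (p # as @ q # bs)" "distinct cs" using th'(3) by auto
        have "?w ys = card (white G \<inter> set (p # as @ q # bs))" using y(2) by simp
        then show ?thesis unfolding cnt[OF d(1)] cnt[OF d(2)] cnt[OF d(3)] cnt[OF d(4)] by (simp add: rev_filter[symmetric])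
      qed
      have "even (of_bool (p \<in> white G) + of_bool (q \<in> white G) + length (p # cs @ [q]) + (1::nat))"
        using alternating_walk_parity[OF th'(4)] CE unfolding C_def by simp
      then have par: "even (of_bool (p \<in> white G) + of_bool (q \<in> white G) + length cs + (1::nat))" by simp
      have "?s (ag.ceds ys) = (-1) ^ ((?w ?C1 + 1 + ?v ?C1) + (?w ?C2 + 1 + ?v ?C2))"
        unfolding prods mp[OF IH(1) u12(1)] mp[OF IH(2) u12(2)] by (rule power_add[symmetric])
      also have "\<dots> = (-1) ^ (?w ys + 1 + ?v ys)"
      proof -
        have "even ((?w ?C1 + 1 + ?v ?C1) + (?w ?C2 + 1 + ?v ?C2)) = even (?w ys + 1 + ?v ys)"
          using wsum vsum par by presburger
        then show ?thesis by (simp only: minus_one_power_iff)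
      qed
      finally show "?s (ag.ceds ys) = (-1) ^ (?w ys + 1 + ?v ys)" .
    qed
  qed
  then show ?thesis using u by blast
qed

subsection \<open>The boundary of a face\<close>

text \<open>The boundary circle as a cycle of the augmented graph.\<close>

definition circle_list :: "complex list" where
  "circle_list = map pt [0..<Suc n]"

lemma circle_adj: "j \<le> n \<Longrightarrow> ag.adj (pt j) (pt (Suc j))" and circle_ed: "j \<le> n \<Longrightarrow> ag.ed (pt j) (pt (Suc j)) = carc j"
proof -
  assume j: "j \<le> n"
  have "pt j \<noteq> pt (Suc j)"
  proof (cases "j = n")
    case True then show ?thesis using pt_turn pt_inj[of n 0] n_ge_2 by simp
  next
    case False then show ?thesis using pt_inj[of j "Suc j"] j by simp
  qed
  then show "ag.adj (pt j) (pt (Suc j))" unfolding ag.adj_def using carc_V[OF j] j by blast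
  show "ag.ed (pt j) (pt (Suc j)) = carc j" using ag.ed_eqI[OF _ carc_V[OF j]] j by blast
qed

lemma circle_walk: "i \<le> j \<Longrightarrow> j \<le> Suc n \<Longrightarrow> ag.walk (map pt [i..<Suc j]) \<and> ag.eds (map pt [i..<Suc j]) = carc ` {i..<j}"
proof (induction j)
  case 0 then show ?case by simp
next
  case (Suc j)
  show ?case
  proof (cases "i = Suc j")
    case True then show ?thesis by simp
  next
    case False
    then have ij: "i \<le> j" using Suc by simp
    then have IH: "ag.walk (map pt [i..<Suc j])" "ag.eds (map pt [i..<Suc j]) = carc ` {i..<j}" using Suc by auto
    have l: "map pt [i..<Suc (Suc j)] = map pt [i..<j] @ pt j # [pt (Suc j)]" "map pt [i..<Suc j] = map pt [i..<j] @ [pt j]"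
      using ij by simp_all
    have a: "ag.adj (pt j) (pt (Suc j))" "ag.ed (pt j) (pt (Suc j)) = carc j" using Suc circle_adj circle_ed by auto
    have "{i..<Suc j} = insert j {i..<j}" using ij by auto
    then show ?thesis
      unfolding l(1) using IH a ag.walk_append[of "map pt [i..<j]" "pt j" "[pt (Suc j)]"]
        ag.eds_append[of "map pt [i..<j]" "pt j" "[pt (Suc j)]"] unfolding l(2) by simp
  qed
qed

lemma circle_cyc: "ag.cyc circle_list" "ag.ceds circle_list = carc ` {..n}" "ag.crv circle_list = sphere 0 1"
proof -
  have l: "circle_list @ [hd circle_list] = map pt [0..<Suc (Suc n)]"
  proof -
    have "hd [0..<Suc n] = 0" by (simp del: upt_Suc)
    then have "hd (map pt [0..<Suc n]) = pt (Suc n)" using pt_turn by (simp add: hd_map del: upt_Suc)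
    then show ?thesis unfolding circle_list_def by simp
  qed
  have w: "ag.walk (map pt [0..<Suc (Suc n)])" "ag.eds (map pt [0..<Suc (Suc n)]) = carc ` {0..<Suc n}"
    using circle_walk[of 0 "Suc n"] by simp_all
  have "distinct circle_list"
    unfolding circle_list_def using pt_inj by (auto simp: distinct_map inj_on_def)
  then show c: "ag.cyc circle_list"
    unfolding ag.cyc_def l using w n_ge_2 by (simp add: circle_list_def)
  have "{0..<Suc n} = {..n}" by auto
  then show e: "ag.ceds circle_list = carc ` {..n}" unfolding ag.ceds_def l w(2) by simp
  show "ag.crv circle_list = sphere 0 1"
  proof
    show "ag.crv circle_list \<subseteq> sphere 0 1" unfolding ag.crv_def e using carc_circle by blast
    show "sphere 0 1 \<subseteq> ag.crv circle_list"
    proof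
      fix z :: complex assume z: "z \<in> sphere 0 1"
      have arcs: "\<phi> \<in> {tht (Suc j)..tht 0} \<Longrightarrow> j \<le> n \<Longrightarrow> \<exists>i \<le> n. \<phi> \<in> {tht (Suc i)..tht i}" for \<phi> j
      proof (induction j)
        case 0 then show ?case by auto
      next
        case (Suc j)
        then show ?case by (cases "\<phi> \<le> tht (Suc j)") force+
      qed
      define m where "m = \<lfloor>(tht 0 - Arg z) / (2 * pi)\<rfloor>"
      define \<phi> where "\<phi> = Arg z + 2 * pi * m"
      have "m \<le> (tht 0 - Arg z) / (2 * pi)" "(tht 0 - Arg z) / (2 * pi) < m + 1" unfolding m_def by linarith+
      then have "m * (2 * pi) \<le> tht 0 - Arg z" "tht 0 - Arg z < (m + 1) * (2 * pi)"
        by (simp_all only: pos_le_divide_eq pos_divide_less_eq pi_gt_zero mult_pos_pos zero_less_numeral)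
      then have "\<phi> \<in> {tht (Suc n)..tht 0}" unfolding \<phi>_def tht_turn by (auto simp: algebra_simps)
      then obtain i where i: "i \<le> n" "\<phi> \<in> {tht (Suc i)..tht i}" using arcs[of \<phi> n] by blast
      have "z \<noteq> 0" using z by auto
      then have "z = cis (Arg z)" using z cis_Arg[of z] by (simp add: sgn_eq)
      also have "\<dots> = cis \<phi>" unfolding \<phi>_def by (simp add: cis_mult[symmetric] cis_multiple_2pi)
      finally have "z \<in> carc i" using i unfolding carc_def by blast
      then show "z \<in> ag.crv circle_list" unfolding ag.crv_def e using i by blast
    qed
  qed
qed

text \<open>Every face is enclosed by a cycle of the augmented graph. Start with the circle and cut it by paths,
  keeping the part that contains a chosen point of the face.\<close>

theorem face_boundary_cycle:
  assumes F: "\<Omega> \<in> faces G"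
  obtains xs where "ag.cyc xs" "inside (ag.crv xs) \<inter> drawing G = {}" "\<Omega> \<inter> inside (ag.crv xs) \<noteq> {}"
proof -
  have F': "\<Omega> \<in> components (cball 0 1 - drawing G)" using F unfolding faces_def .
  obtain x where x: "x \<in> \<Omega>" using in_components_nonempty[OF F'] by blast
  obtain r where r: "r > 0" "ball x r \<inter> cball 0 1 \<subseteq> \<Omega>" "x \<in> cball 0 1"
    using component_of_disk_contains_ball[OF closed_drawing F' x] by blast
  obtain z where z: "z \<in> ball x r" "z \<in> ball 0 1" "z \<notin> drawing G"
    using disk_open_not_subset[OF interior_drawing r(3,1)] by blast
  have zF: "z \<in> \<Omega>" using z r by auto
  have "z \<in> inside (ag.crv xs) \<longrightarrow> (\<exists>ys. ag.cyc ys \<and> inside (ag.crv ys) \<inter> drawing G = {} \<and> z \<in> inside (ag.crv ys))"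
    if c: "ag.cyc xs" for xs
  proof (rule ag.cycle_split_induct[OF c two_nbrs_inside[OF c]])
    fix ys assume y: "ag.cyc ys" "inside (ag.crv ys) \<inter> \<Union> Et = {}"
    show "z \<in> inside (ag.crv ys) \<longrightarrow> (\<exists>ys. ag.cyc ys \<and> inside (ag.crv ys) \<inter> drawing G = {} \<and> z \<in> inside (ag.crv ys))"
    proof
      assume "z \<in> inside (ag.crv ys)"
      moreover have "inside (ag.crv ys) \<inter> drawing G = {}" using y(2) unfolding drawing_edges by blast
      ultimately show "\<exists>ys. ag.cyc ys \<and> inside (ag.crv ys) \<inter> drawing G = {} \<and> z \<in> inside (ag.crv ys)"
        using y(1) by (intro exI[of _ ys]) simp
    qed
  next
    fix ys as bs cs :: "complex list" and p q :: complex
    let ?P = "\<exists>ys. ag.cyc ys \<and> inside (ag.crv ys) \<inter> drawing G = {} \<and> z \<in> inside (ag.crv ys)"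
    define C where "C = \<Union> (ag.eds (p # cs @ [q]))"
    assume y: "ag.cyc ys" "ag.ceds ys = ag.ceds (p # as @ q # bs)" and th: "ag.theta p as q bs cs"
      and IH: "z \<in> inside (ag.crv (p # as @ q # rev cs)) \<longrightarrow> ?P" "z \<in> inside (ag.crv (p # cs @ q # bs)) \<longrightarrow> ?P"
    show "z \<in> inside (ag.crv ys) \<longrightarrow> ?P"
    proof
      assume zy: "z \<in> inside (ag.crv ys)"
      have crv: "ag.crv ys = ag.crv (p # as @ q # bs)" unfolding ag.crv_def y(2) ..
      have th': "ag.walk (p # cs @ [q])" "C - {p, q} \<subseteq> inside (ag.crv ys)"
        "inside (ag.crv (p # as @ q # rev cs)) \<union> inside (ag.crv (p # cs @ q # bs)) \<union> (C - {p, q}) = inside (ag.crv ys)"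
        using th unfolding ag.theta_def crv C_def by - (elim conjE, assumption)+
      have "C \<subseteq> \<Union> (edges G) \<union> sphere 0 1"
      proof -
        have "ag.eds (p # cs @ [q]) \<subseteq> Et" by (rule ag.eds_in_E[OF th'(1)])
        then show ?thesis unfolding C_def using carc_circle by blast
      qed
      then have "z \<notin> C" using z(2,3) unfolding drawing_edges by auto
      then have "z \<in> inside (ag.crv (p # as @ q # rev cs)) \<union> inside (ag.crv (p # cs @ q # bs))"
        using th'(3) zy by blast
      then show ?P using IH by (elim UnE) simp_all
    qed
  qed
  note step = this[OF circle_cyc(1)]
  have "z \<in> inside (ag.crv circle_list)"
    unfolding circle_cyc(3) using z(2) by (simp add: inside_frontier_eq_interior[of "cball 0 1", simplified])
  with step obtain ys where "ag.cyc ys" "inside (ag.crv ys) \<inter> drawing G = {}" "z \<in> inside (ag.crv ys)" by blast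
  then show ?thesis using that zF by blast
qed

end

section \<open>Face weights of the dual network\<close>

context plane_graph
begin

lemma cyc_closing_edge:
  assumes "cyc xs" "e \<in> ceds xs"
  obtains x ys y where "cyc (x # ys @ [y])" "ceds (x # ys @ [y]) = ceds xs" "adj y x" "e = ed y x" "ys \<noteq> []"
proof -
  obtain a where a: "a \<in> set xs" "a \<in> e"
  proof -
    obtain a b where ab: "adj a b" "e = ed a b" using edge_adj ceds_in_E[OF assms(1)] assms(2) by blast
    then have "a \<in> crv xs \<inter> V" using ed_props(2)[OF ab(1)] assms(2) unfolding crv_def by blast
    then show ?thesis using that crv_V[OF assms(1)] ed_props(2)[OF ab(1)] ab by blast
  qed
  obtain ws where ws: "cyc (a # ws)" "ceds (a # ws) = ceds xs"
    using cyc_start_at[OF assms(1) a(1)] by metis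
  obtain y us z where yz: "a # ws = a # y # us @ [z]"
    using cyc_hd_last[OF ws(1)] by (metis list.exhaust append_Cons list.inject)
  have c: "distinct (a # y # us @ [z])" "walk (a # y # us @ [z, a])" using ws(1) yz unfolding cyc_def by auto
  have adjs: "adj a y" "adj z a" "walk (y # us @ [z])"
    using c walk_append[of "a # y # us" z "[a]"] by auto
  have "ceds xs = {ed a y, ed z a} \<union> eds (y # us @ [z])"
    using ws(2) yz eds_append[of "a # y # us" z "[a]"] unfolding ceds_def by auto
  moreover have "a \<notin> f" if "f \<in> eds (y # us @ [z])" for f
    using eds_V_subset[OF adjs(3) that] adj_in_V[OF adjs(1)] c by auto
  ultimately have "e = ed a y \<or> e = ed z a" using assms(2) a(2) by blast
  then show ?thesis
  proof
    assume e: "e = ed z a"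
    show ?thesis using that[of a "y # us" z] ws yz adjs e by simp
  next
    assume e: "e = ed a y"
    have r: "rotate1 (a # y # us @ [z]) = y # (us @ [z]) @ [a]" by simp
    have "cyc (y # (us @ [z]) @ [a])" "ceds (y # (us @ [z]) @ [a]) = ceds xs"
      using cyc_rotate1(1,2)[OF ws(1)] ws(2) unfolding yz r by simp_all
    then show ?thesis using that[of y "us @ [z]" a] adjs e by simp
  qed
qed

end

text \<open>An edge is traversed in only one direction if one of its inner points is a limit of points off the
  closure of the face. Indeed, near such a point the winding numbers of two closed curves that run
  through the edge in opposite directions add up to a constant. This constant is 0 because of the
  points off the face, but it is \<open>-1\<close> or \<open>-2\<close> at the points inside the first curve.\<close>

lemma opposite_traversals_disagree:
  assumes t1: "traversed_clockwise \<Omega> e p q" and t2: "traversed_clockwise \<Omega> e q p"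
    and out: "open U" "U \<inter> closure \<Omega> = {}" "x \<in> closure U" "x \<in> e" "x \<noteq> p" "x \<noteq> q"
  shows False
proof -
  obtain g1 d1 where g1: "arc g1" "path_image g1 = e" "pathstart g1 = p" "pathfinish g1 = q"
    "arc d1" "pathstart d1 = q" "pathfinish d1 = p" "simple_path (g1 +++ d1)"
    "\<forall>z \<in> inside (path_image (g1 +++ d1)). z \<in> \<Omega> \<and> winding_number (g1 +++ d1) z = -1"
    using t1 unfolding traversed_clockwise_def by metis
  obtain g2 d2 where g2: "arc g2" "path_image g2 = e" "pathstart g2 = q" "pathfinish g2 = p"
    "arc d2" "pathstart d2 = p" "pathfinish d2 = q" "simple_path (g2 +++ d2)"
    "\<forall>z \<in> inside (path_image (g2 +++ d2)). z \<in> \<Omega> \<and> winding_number (g2 +++ d2) z = -1"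
    using t2 unfolding traversed_clockwise_def by metis
  let ?J1 = "path_image (g1 +++ d1)" and ?J2 = "path_image (g2 +++ d2)"
  have im: "?J1 = e \<union> path_image d1" "?J2 = e \<union> path_image d2"
    using g1 g2 by (simp_all add: path_image_join)
  have loops: "pathfinish (g1 +++ d1) = pathstart (g1 +++ d1)" "pathfinish (g2 +++ d2) = pathstart (g2 +++ d2)"
    using g1 g2 by simp_all
  note J1 = Jordan_inside_outside[OF g1(8) loops(1)] and J2 = Jordan_inside_outside[OF g2(8) loops(2)]
  have closedJ: "closed ?J1" "closed ?J2"
    using g1(8) g2(8) by (auto intro!: compact_imp_closed compact_path_image simple_path_imp_path)
  have int: "e \<inter> path_image d1 \<subseteq> {p, q}" "e \<inter> path_image d2 \<subseteq> {p, q}"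
    using g1 g2 simple_path_join_loop_eq[of d1 g1] simple_path_join_loop_eq[of d2 g2] by auto
  have "closed (path_image d1 \<union> path_image d2)"
    using g1(5) g2(5) by (simp add: closed_Un compact_arc_image compact_imp_closed)
  moreover have "x \<notin> path_image d1 \<union> path_image d2" using int out(4-6) by blast
  ultimately obtain r where r: "r > 0" "ball x r \<subseteq> - (path_image d1 \<union> path_image d2)"
    by (rule ball_avoiding_closed)
  let ?D = "d1 +++ d2"
  have pathD: "path ?D" "pathfinish ?D = pathstart ?D" "path_image ?D = path_image d1 \<union> path_image d2"
    using g1 g2 by (auto simp: arc_imp_path path_image_join)
  have "winding_number ?D constant_on ball x r"
    using winding_number_constant[OF pathD(1,2) connected_ball[of x r]] r(2) pathD(3) by blast
  then obtain c where c: "\<And>z. z \<in> ball x r \<Longrightarrow> winding_number ?D z = c"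
    unfolding constant_on_def by blast
  have sum: "winding_number (g1 +++ d1) z + winding_number (g2 +++ d2) z = c"
    if z: "z \<in> ball x r" "z \<notin> e" for z
  proof -
    have zd: "z \<notin> path_image d1" "z \<notin> path_image d2" using r z by blast+
    have "winding_number (g1 +++ g2) z = 0"
    proof (rule winding_number_zero_in_outside)
      show "path (g1 +++ g2)" "pathfinish (g1 +++ g2) = pathstart (g1 +++ g2)"
        using g1 g2 by (auto simp: arc_imp_path)
      have "path_image (g1 +++ g2) = path_image g1" using g1 g2 by (simp add: path_image_join)
      then show "z \<in> outside (path_image (g1 +++ g2))"
        using inside_arc_empty[OF g1(1)] z g1(2) by (metis ComplI Un_iff empty_iff inside_Un_outside)
    qed
    moreover have "winding_number (g1 +++ g2) z = winding_number g1 z + winding_number g2 z"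
      using g1 g2 z by (intro winding_number_join) (auto simp: arc_imp_path)
    moreover have "winding_number (g1 +++ d1) z = winding_number g1 z + winding_number d1 z"
      using g1 z zd by (intro winding_number_join) (auto simp: arc_imp_path)
    moreover have "winding_number (g2 +++ d2) z = winding_number g2 z + winding_number d2 z"
      using g2 z zd by (intro winding_number_join) (auto simp: arc_imp_path)
    moreover have "winding_number ?D z = winding_number d1 z + winding_number d2 z"
      using g1 g2 zd by (intro winding_number_join) (auto simp: arc_imp_path)
    ultimately show ?thesis using c[OF z(1)] by (simp add: algebra_simps add_eq_0_iff)
  qed
  have fr: "frontier (inside ?J1) = ?J1" "frontier (inside ?J2) = ?J2"
    and split: "inside ?J1 \<union> outside ?J1 = - ?J1" "inside ?J2 \<union> outside ?J2 = - ?J2" and op1: "open (inside ?J1)"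
    using J1 J2 by - (elim conjE, assumption)+
  have sub: "inside ?J1 \<subseteq> \<Omega>" "inside ?J2 \<subseteq> \<Omega>" using g1(9) g2(9) by blast+
  have Jcl: "?J1 \<subseteq> closure \<Omega>" "?J2 \<subseteq> closure \<Omega>"
    using fr closure_mono[OF sub(1)] closure_mono[OF sub(2)] unfolding frontier_def by blast+
  have "ball x r \<inter> U \<noteq> {}"
    using out(1,3) r(1) open_Int_closure_eq_empty[of "ball x r" U] centre_in_ball[of x r] by blast
  then obtain z' where z': "z' \<in> ball x r" "z' \<notin> closure \<Omega>" using out(2) by blast
  have "z' \<notin> \<Omega>" using z'(2) closure_subset[of \<Omega>] by blast
  then have notin: "z' \<notin> inside ?J1" "z' \<notin> inside ?J2" using sub by blast+
  have notJ: "z' \<notin> ?J1" "z' \<notin> ?J2" using z'(2) Jcl by blast+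
  have out': "z' \<in> outside ?J1" "z' \<in> outside ?J2"
    using notin notJ split by (metis ComplI Un_iff)+
  have "z' \<notin> e" using notJ(1) unfolding im by blast
  have paths: "path (g1 +++ d1)" "path (g2 +++ d2)" using g1(8) g2(8) by (auto intro: simple_path_imp_path)
  have "winding_number (g1 +++ d1) z' = 0" "winding_number (g2 +++ d2) z' = 0"
    using winding_number_zero_in_outside[OF paths(1) loops(1) out'(1)]
      winding_number_zero_in_outside[OF paths(2) loops(2) out'(2)] by simp_all
  then have c0: "c = 0" using sum[OF z'(1) \<open>z' \<notin> e\<close>] by simp
  have "x \<in> ?J1" using out(4) im by blast
  then have "x \<in> closure (inside ?J1)" using fr(1) unfolding frontier_def by blast
  then have "ball x r \<inter> inside ?J1 \<noteq> {}"
    using r(1) open_Int_closure_eq_empty[of "ball x r" "inside ?J1"] centre_in_ball[of x r] by blast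
  then obtain z where z: "z \<in> ball x r" "z \<in> inside ?J1" by blast
  have "z \<notin> ?J1" using z(2) split(1) by blast
  then have ze1: "z \<notin> e" unfolding im by blast
  have "z \<notin> path_image d2" using r(2) z(1) by blast
  then have ze: "z \<notin> e" "z \<notin> ?J2" using ze1 unfolding im by blast+
  have "winding_number (g1 +++ d1) z = -1" using g1(9) z(2) by blast
  moreover have "winding_number (g2 +++ d2) z = -1 \<or> winding_number (g2 +++ d2) z = 0"
  proof (cases "z \<in> inside ?J2")
    case True then show ?thesis using g2(9) by blast
  next
    case False
    then have "z \<in> outside ?J2" using ze(2) split(2) by (metis ComplI Un_iff)
    then show ?thesis using winding_number_zero_in_outside[OF paths(2) loops(2)] by simp
  qed
  ultimately show False using sum[OF z(1) ze(1)] c0 by auto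
qed

context reduced_disk_graph
begin

text \<open>Every edge of a cycle whose inside is in the face is traversed in one of the two directions.\<close>

lemma traversed_exists:
  assumes c: "ag.cyc xs" and e: "e \<in> ag.ceds xs" and sub: "inside (ag.crv xs) \<subseteq> \<Omega>"
  obtains p q where "e \<inter> Vt = {p, q}" "traversed_clockwise \<Omega> e p q"
proof -
  obtain x ys y where xy: "ag.cyc (x # ys @ [y])" "ag.ceds (x # ys @ [y]) = ag.ceds xs" "ag.adj y x" "e = ag.ed y x" "ys \<noteq> []"
    using ag.cyc_closing_edge[OF c e] by metis
  have crv: "ag.crv (x # ys @ [y]) = ag.crv xs" unfolding ag.crv_def xy(2) ..
  have eV: "e \<inter> Vt = {y, x}" using ag.ed_props(2)[OF xy(3)] xy(4) by simp
  have cd: "distinct (x # ys @ y # [])" "ag.walk (x # ys @ [y])" "ag.walk (x # [] @ [y])"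
    using xy(1) ag.cyc_two_paths[of x ys y "[]"] by auto
  obtain d where d: "arc d" "path_image d = \<Union> (ag.eds (x # ys @ [y]))" "pathstart d = x" "pathfinish d = y"
    using ag.arc_of_walk[OF cd(2)] cd(1) by auto
  obtain g where g: "arc g" "path_image g = e" "pathstart g = y" "pathfinish g = x"
    using ag.ed_arc[OF xy(3)] xy(4) by metis
  have "path_image g \<inter> path_image d = {x, y}"
    using ag.theta_arcs_Int[OF cd(2,3)] cd(1) xy g d by (auto simp: ag.ed_sym)
  then have sp: "simple_path (g +++ d)" "simple_path (reversepath g +++ reversepath d)"
    using g d by (auto intro!: simple_path_join_loop simp: arc_reversepath)
  have im: "path_image (g +++ d) = ag.crv xs"
  proof -
    have "ag.ceds (x # ys @ [y]) = insert e (ag.eds (x # ys @ [y]))"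
      using ag.ceds_two_paths[of x ys y "[]"] xy(4) ag.ed_sym[of x y] by simp
    then have "ag.crv (x # ys @ [y]) = e \<union> \<Union> (ag.eds (x # ys @ [y]))"
      unfolding ag.crv_def by simp
    then have "ag.crv xs = e \<union> \<Union> (ag.eds (x # ys @ [y]))" unfolding crv .
    then show ?thesis using g d by (simp add: path_image_join)
  qed
  have im': "path_image (reversepath g +++ reversepath d) = ag.crv xs"
    using im g d by (simp add: path_image_join)
  have loop: "pathfinish (g +++ d) = pathstart (g +++ d)" using g d by simp
  have wn: "winding_number (reversepath g +++ reversepath d) z = - winding_number (g +++ d) z"
    if "z \<in> inside (ag.crv xs)" for z
  proof -
    have "z \<notin> ag.crv xs" using that inside_no_overlap[of "ag.crv xs"] by blast
    then have z: "z \<notin> path_image g" "z \<notin> path_image d" using im g d by (auto simp: path_image_join)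
    have "winding_number (reversepath g +++ reversepath d) z = winding_number (reversepath g) z + winding_number (reversepath d) z"
      using z g d by (intro winding_number_join) (auto simp: arc_imp_path)
    also have "\<dots> = - winding_number g z - winding_number d z"
      using z g d by (simp add: winding_number_reversepath arc_imp_path)
    also have "\<dots> = - winding_number (g +++ d) z"
      using z g d by (simp add: winding_number_join arc_imp_path)
    finally show ?thesis .
  qed
  from simple_closed_path_winding_number_inside[OF sp(1)]
  consider "\<And>z. z \<in> inside (ag.crv xs) \<Longrightarrow> winding_number (g +++ d) z = 1"
    | "\<And>z. z \<in> inside (ag.crv xs) \<Longrightarrow> winding_number (g +++ d) z = - 1"
    unfolding im by metis
  then show ?thesis
  proof cases
    case 1
    have "traversed_clockwise \<Omega> e x y"
      unfolding traversed_clockwise_def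
      using g d sp(2) wn 1 sub
      by (intro exI[of _ "reversepath g"] exI[of _ "reversepath d"]) (auto simp: arc_reversepath im')
    then show ?thesis using that eV by (metis insert_commute)
  next
    case 2
    have "traversed_clockwise \<Omega> e y x"
      unfolding traversed_clockwise_def
      using g d sp(1) 2 sub by (intro exI[of _ g] exI[of _ d]) (auto simp: im)
    then show ?thesis using that eV by blast
  qed
qed

lemma traversed_in_closure:
  assumes "traversed_clockwise \<Omega> e p q"
  shows "e \<subseteq> closure \<Omega>"
proof -
  obtain g d where g: "path_image g = e" "pathfinish g = q" "pathstart d = q" "pathfinish d = p" "pathstart g = p"
    "simple_path (g +++ d)" "\<forall>z \<in> inside (path_image (g +++ d)). z \<in> \<Omega> \<and> winding_number (g +++ d) z = -1"
    using assms unfolding traversed_clockwise_def by metis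
  have loop: "pathfinish (g +++ d) = pathstart (g +++ d)" using g by simp
  have "frontier (inside (path_image (g +++ d))) = path_image (g +++ d)"
    using Jordan_inside_outside[OF g(6) loop] by - (elim conjE, assumption)
  moreover have "e \<subseteq> path_image (g +++ d)" using g by (auto simp: path_image_join)
  moreover have "inside (path_image (g +++ d)) \<subseteq> \<Omega>" using g(7) by blast
  ultimately show ?thesis using closure_mono unfolding frontier_def by blast
qed

text \<open>The signs that turn the boundary measurements of the dual graph into the complementary minors: an edge at
  the boundary vertex \<open>pt j\<close> has the sign \<open>(-1)^j\<close>.\<close>

definition bsign :: "complex set \<Rightarrow> complex" where
  "bsign e = (if \<exists>j<n. e = bedge (pt j) then (-1) ^ (THE j. j < n \<and> e = bedge (pt j)) else 1)"

lemma pt_in_bdry: "j < n \<Longrightarrow> pt j \<in> set (bdry G)"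
  unfolding set_bdry by blast

lemma bedge_inj: "i < n \<Longrightarrow> j < n \<Longrightarrow> bedge (pt i) = bedge (pt j) \<longleftrightarrow> i = j"
  using bedge(4)[OF pt_in_bdry] pt_inj by (metis less_imp_le)

lemma bsign_bedge: "j < n \<Longrightarrow> bsign (bedge (pt j)) = (-1) ^ j"
proof -
  assume j: "j < n"
  then have "(THE i. i < n \<and> bedge (pt j) = bedge (pt i)) = j" using bedge_inj by (intro the_equality) auto
  then show ?thesis unfolding bsign_def using j by auto
qed

lemma bsign_sq: "bsign e * bsign e = 1"
  unfolding bsign_def by (auto simp: power_add[symmetric] mult_2[symmetric])

lemma bsign_other: "(\<And>j. j < n \<Longrightarrow> e \<noteq> bedge (pt j)) \<Longrightarrow> bsign e = 1"
  unfolding bsign_def by auto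

text \<open>The boundary vertices of a finite face are the end points of its arcs on the circle, and these arcs
  are disjoint. So the boundary vertices come in pairs with consecutive numbers, and each pair contributes
  the sign \<open>-1\<close>.\<close>

lemma boundary_vertices_of_cycle:
  assumes c: "ag.cyc xs" and empty: "inside (ag.crv xs) \<inter> drawing G = {}" and u: "pt n \<notin> set xs"
  defines "\<Phi> \<equiv> {j. j < n \<and> pt j \<in> set xs}"
  shows "j \<in> \<Phi> \<Longrightarrow> bedge (pt j) \<in> ag.ceds xs" "(\<Prod>j \<in> \<Phi>. (-1) ^ j) = ((-1) ^ (card \<Phi> div 2) :: complex)"
proof -
  have be: "bedge (pt j) \<in> ag.ceds xs" if "j \<in> \<Phi>" for j
  proof (rule ccontr)
    assume "bedge (pt j) \<notin> ag.ceds xs"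
    then have "bedge (pt j) \<inter> inside (ag.crv xs) \<noteq> {}"
      using bedge_inside(2)[OF c pt_in_bdry] that unfolding \<Phi>_def by blast
    moreover have "bedge (pt j) \<subseteq> drawing G"
      using bedge(2)[OF pt_in_bdry] that unfolding \<Phi>_def drawing_def by blast
    ultimately show False using empty by blast
  qed
  then show "j \<in> \<Phi> \<Longrightarrow> bedge (pt j) \<in> ag.ceds xs" .
  \<comment> \<open>The arcs of the face on the circle.\<close>
  define K where "K = {i. i \<le> n \<and> carc i \<in> ag.ceds xs}"
  have inxs: "pt j \<in> set xs" if "carc i \<in> ag.ceds xs" "pt j \<in> carc i" "j \<le> n" for i j
  proof -
    have "pt j \<in> Vt" using verts_circle that(3) by blast
    then have "pt j \<in> ag.crv xs \<inter> Vt" using that unfolding ag.crv_def by blast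
    then show ?thesis using ag.crv_V[OF c] by simp
  qed
  have K: "Suc i < n \<and> i \<in> \<Phi> \<and> Suc i \<in> \<Phi>" if "i \<in> K" for i
  proof -
    have i: "i \<le> n" "carc i \<in> ag.ceds xs" using that unfolding K_def by auto
    have e: "pt i \<in> carc i" "pt (Suc i) \<in> carc i" using carc_V[OF i(1)] by auto
    have "i \<noteq> n" using inxs[OF i(2) e(1)] u by auto
    moreover have "Suc i \<noteq> n" using inxs[OF i(2) e(2)] u by auto
    ultimately have "Suc i < n" using i by simp
    then show ?thesis using inxs[OF i(2) e(1)] inxs[OF i(2) e(2)] unfolding \<Phi>_def by simp
  qed
  have carc_bedge: "carc i \<noteq> bedge (pt j)" if "j < n" for i j
  proof -
    have "wh (bedge (pt j)) \<in> bedge (pt j)" "wh (bedge (pt j)) \<in> white G"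
      using edge_ends[OF bedge(2)[OF pt_in_bdry[OF that]]] by auto
    then have "wh (bedge (pt j)) \<in> ball 0 1" using white_internal internal_in_ball by blast
    then have "wh (bedge (pt j)) \<notin> carc i" using carc_circle[of i] by auto
    then show ?thesis using \<open>wh (bedge (pt j)) \<in> bedge (pt j)\<close> by blast
  qed
  have at: "{e \<in> ag.ceds xs. pt j \<in> e} \<subseteq> insert (bedge (pt j)) (carc ` {i. i \<in> K \<and> (i = j \<or> Suc i = j)})" if j: "j \<in> \<Phi>" for j
  proof
    fix e assume e: "e \<in> {e \<in> ag.ceds xs. pt j \<in> e}"
    have jn: "j < n" using j unfolding \<Phi>_def by simp
    show "e \<in> insert (bedge (pt j)) (carc ` {i. i \<in> K \<and> (i = j \<or> Suc i = j)})"
    proof (cases "e \<in> edges G")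
      case True
      then show ?thesis using edge_at_bdry[OF True _ pt_in_bdry[OF jn]] e by blast
    next
      case False
      then obtain i where i: "i \<le> n" "e = carc i" using ag.ceds_in_E[OF c] e by blast
      then have iK: "i \<in> K" using e unfolding K_def by blast
      have "pt j \<in> carc i \<inter> Vt" using e i verts_circle jn by auto
      then have "pt j = pt i \<or> pt j = pt (Suc i)" using carc_V[OF i(1)] by blast
      then have "i = j \<or> Suc i = j" using pt_inj[of j i] pt_inj[of j "Suc i"] K[OF iK] jn by auto
      then show ?thesis using iK i(2) by blast
    qed
  qed
  have two: "card {e \<in> ag.ceds xs. pt j \<in> e} = 2" if "j \<in> \<Phi>" for j
    using ag.cyc_degree[OF c] that unfolding \<Phi>_def by blast
  have ex: "\<exists>i \<in> K. i = j \<or> Suc i = j" if j: "j \<in> \<Phi>" for j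
  proof (rule ccontr)
    assume "\<not> ?thesis"
    then have "{e \<in> ag.ceds xs. pt j \<in> e} \<subseteq> {bedge (pt j)}" using at[OF j] by blast
    then have "card {e \<in> ag.ceds xs. pt j \<in> e} \<le> card {bedge (pt j)}" by (intro card_mono) auto
    then show False using two[OF j] by simp
  qed
  have unique: "\<not> (Suc i \<in> K \<and> i \<in> K)" for i
  proof
    assume i: "Suc i \<in> K \<and> i \<in> K"
    have jn: "Suc i < n" "Suc i \<in> \<Phi>" using K[of i] i by auto
    have "{carc i, carc (Suc i), bedge (pt (Suc i))} \<subseteq> {e \<in> ag.ceds xs. pt (Suc i) \<in> e}"
      using i jn be[OF jn(2)] bedge(3)[OF pt_in_bdry[OF jn(1)]] carc_V[of i] carc_V[of "Suc i"] unfolding K_def by auto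
    then have "card {carc i, carc (Suc i), bedge (pt (Suc i))} \<le> card {e \<in> ag.ceds xs. pt (Suc i) \<in> e}"
      by (intro card_mono) auto
    moreover have "carc i \<noteq> carc (Suc i)"
    proof
      assume "carc i = carc (Suc i)"
      then have "{pt i, pt (Suc i)} = {pt (Suc i), pt (Suc (Suc i))}" using carc_V[of i] carc_V[of "Suc i"] jn by simp
      then show False using carc_inj[of i "Suc i"] jn by simp
    qed
    then have "card {carc i, carc (Suc i), bedge (pt (Suc i))} = 3"
      using carc_bedge[OF jn(1)] by simp
    ultimately show False using two[OF jn(2)] by simp
  qed
  have \<Phi>: "\<Phi> = (\<Union>i \<in> K. {i, Suc i})" using ex K by blast
  have fin: "finite K" unfolding K_def by simp
  have dis: "\<forall>i \<in> K. \<forall>j \<in> K. i \<noteq> j \<longrightarrow> {i, Suc i} \<inter> {j, Suc j} = {}" using unique by auto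
  have "(\<Prod>j \<in> \<Phi>. (-1) ^ j) = (\<Prod>i \<in> K. \<Prod>j \<in> {i, Suc i}. (-1 :: complex) ^ j)"
    unfolding \<Phi> using fin dis by (intro prod.UNION_disjoint) auto
  also have "\<dots> = (\<Prod>i \<in> K. -1)"
    by (intro prod.cong refl) (auto simp: power_add[symmetric] mult_2[symmetric])
  also have "\<dots> = (-1) ^ card K" by simp
  finally have p: "(\<Prod>j \<in> \<Phi>. (-1) ^ j) = (-1 :: complex) ^ card K" .
  have "card \<Phi> = (\<Sum>i \<in> K. card {i, Suc i})"
    unfolding \<Phi> using fin dis by (intro card_UN_disjoint) auto
  then have "card \<Phi> = 2 * card K" by simp
  then show "(\<Prod>j \<in> \<Phi>. (-1) ^ j) = ((-1) ^ (card \<Phi> div 2) :: complex)" using p by simp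
qed

text \<open>Exchanging the colors inverts the face weights. The signs on the edges at the boundary vertices of a
  face give the factor \<open>(-1)^b\<close>: each of these edges is traversed in exactly one direction.\<close>

theorem dual_face_weight_signed:
  assumes F: "\<Omega> \<in> finite_faces G" and t: "\<forall>e \<in> edges G. t e \<noteq> 0"
  shows "face_weight (dual_graph G) (\<lambda>e. t e * bsign e) \<Omega> = dual_face_weight G (face_weight G t) \<Omega>"
    "dual_face_weight G (face_weight G t) \<Omega> \<noteq> 0"
proof -
  have F1: "\<Omega> \<in> faces G" "pt n \<notin> \<Omega>" using F infinite_face_iff unfolding finite_faces_def by auto
  obtain xs where xs: "ag.cyc xs" "inside (ag.crv xs) \<inter> drawing G = {}" "\<Omega> \<inter> inside (ag.crv xs) \<noteq> {}"
    using face_boundary_cycle[OF F1(1)] by blast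
  note fc = face_of_cycle[OF xs(1,2) F1(1) xs(3)]
  note J = ag.cyc_jordan[OF xs(1)]
  have u: "pt n \<notin> set xs" using fc(4) F1(2) by simp
  define \<Phi> where "\<Phi> = {j. j < n \<and> pt j \<in> set xs}"
  note bv = boundary_vertices_of_cycle[OF xs(1,2) u, folded \<Phi>_def]
  \<comment> \<open>The edges that are traversed from black to white, and from white to black.\<close>
  define T1 where "T1 = {e. e \<in> edges G \<and> (\<exists>b \<in> black G. \<exists>w \<in> white G. traversed_clockwise \<Omega> e b w)}"
  define T2 where "T2 = {e. e \<in> edges G \<and> (\<exists>b \<in> black G. \<exists>w \<in> white G. traversed_clockwise \<Omega> e w b)}"
  have fin: "finite T1" "finite T2" using finite_edges unfolding T1_def T2_def by auto
  have frontier_iff: "pt j \<in> frontier \<Omega> \<longleftrightarrow> j \<in> \<Phi>" if "j < n" for j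
  proof -
    have "pt j \<in> Vt" using verts_circle that by auto
    then show ?thesis unfolding fc(3) \<Phi>_def using ag.crv_V[OF xs(1)] that by blast
  qed
  have clo: "closure \<Omega> \<subseteq> inside (ag.crv xs) \<union> ag.crv xs"
    using closure_mono[OF fc(2)] J(13) by (metis closed_closure closure_closed)
  have bd: "bedge (pt j) \<in> T1 \<union> T2 \<longleftrightarrow> j \<in> \<Phi>" if j: "j < n" for j
  proof
    assume "bedge (pt j) \<in> T1 \<union> T2"
    then have "bedge (pt j) \<subseteq> closure \<Omega>" unfolding T1_def T2_def using traversed_in_closure by blast
    then have "pt j \<in> closure \<Omega>" using bedge(3)[OF pt_in_bdry[OF j]] by blast
    moreover have "pt j \<notin> inside (ag.crv xs)" using inside_in_ball[OF xs(1)] pt_circle[of j] by auto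
    ultimately have "pt j \<in> ag.crv xs" using clo by blast
    then show "j \<in> \<Phi>" using frontier_iff[OF j] fc(3) by simp
  next
    assume j\<Phi>: "j \<in> \<Phi>"
    have e: "bedge (pt j) \<in> edges G" by (rule bedge(2)[OF pt_in_bdry[OF j]])
    obtain p q where pq: "bedge (pt j) \<inter> Vt = {p, q}" "traversed_clockwise \<Omega> (bedge (pt j)) p q"
      using traversed_exists[OF xs(1) bv(1)[OF j\<Phi>] fc(1)] by blast
    then have "{p, q} = {bl (bedge (pt j)), wh (bedge (pt j))}"
      using edge_ends(5)[OF e] edge_Vt[OF e] by simp
    then have "(p \<in> black G \<and> q \<in> white G) \<or> (p \<in> white G \<and> q \<in> black G)"
      using edge_ends(1,2)[OF e] by (auto simp: doubleton_eq_iff)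
    then show "bedge (pt j) \<in> T1 \<union> T2" unfolding T1_def T2_def using pq(2) e by blast
  qed
  have excl: "bedge (pt j) \<notin> T1 \<inter> T2" if j: "j < n" for j
  proof
    let ?e = "bedge (pt j)"
    assume a: "?e \<in> T1 \<inter> T2"
    then have j\<Phi>: "j \<in> \<Phi>" using bd[OF j] by blast
    have e: "?e \<in> edges G" by (rule bedge(2)[OF pt_in_bdry[OF j]])
    obtain b w b' w' where t: "b \<in> black G" "w \<in> white G" "traversed_clockwise \<Omega> ?e b w"
      "b' \<in> black G" "w' \<in> white G" "traversed_clockwise \<Omega> ?e w' b'"
      using a unfolding T1_def T2_def by blast
    have ends: "p \<in> ?e \<and> q \<in> ?e" if "traversed_clockwise \<Omega> ?e p q" for p q
      using that unfolding traversed_clockwise_def by (metis pathstart_in_path_image pathfinish_in_path_image)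
    have "b = bl ?e" "w = wh ?e" "b' = bl ?e" "w' = wh ?e"
      using ends[OF t(3)] ends[OF t(6)] t black_in_edge[OF e] white_in_edge[OF e] by blast+
    then have t': "traversed_clockwise \<Omega> ?e (bl ?e) (wh ?e)" "traversed_clockwise \<Omega> ?e (wh ?e) (bl ?e)" using t by auto
    obtain g where g: "arc g" "path_image g = ?e" "?e \<inter> verts G = {pathstart g, pathfinish g}"
      using edge_arc_ends[OF e] by metis
    obtain x where x: "x \<in> ?e" "x \<notin> verts G"
      using nonempty_simple_path_endless[OF arc_imp_simple_path[OF g(1)]] g(2,3) by blast
    have xne: "x \<noteq> bl ?e" "x \<noteq> wh ?e" using x edge_ends(1,2)[OF e] unfolding verts_def by auto
    have "x \<in> ag.crv xs" using x(1) bv(1)[OF j\<Phi>] unfolding ag.crv_def by blast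
    then have xo: "x \<in> closure (outside (ag.crv xs))" using J(11) unfolding frontier_def by blast
    have "outside (ag.crv xs) \<inter> closure \<Omega> = {}" using clo J(8,9) by blast
    then show False using opposite_traversals_disagree[OF t' J(4) _ xo x(1) xne] by simp
  qed
  have signs: "(\<Prod>e \<in> T. bsign e) = (\<Prod>j \<in> {j. j < n \<and> bedge (pt j) \<in> T}. (-1) ^ j)" if "finite T" for T
  proof -
    let ?J = "{j. j < n \<and> bedge (pt j) \<in> T}"
    have "(\<Prod>e \<in> T. bsign e) = (\<Prod>e \<in> (\<lambda>j. bedge (pt j)) ` ?J. bsign e)"
    proof (rule prod.mono_neutral_right[OF that])
      show "(\<lambda>j. bedge (pt j)) ` ?J \<subseteq> T" by blast
      show "\<forall>e \<in> T - (\<lambda>j. bedge (pt j)) ` ?J. bsign e = 1" by (intro ballI bsign_other) blast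
    qed
    also have "\<dots> = (\<Prod>j \<in> ?J. bsign (bedge (pt j)))"
      by (rule prod.reindex_cong[of "\<lambda>j. bedge (pt j)"]) (auto simp: inj_on_def bedge_inj)
    also have "\<dots> = (\<Prod>j \<in> ?J. (-1) ^ j)" by (intro prod.cong refl bsign_bedge) simp
    finally show ?thesis .
  qed
  have s12: "(\<Prod>e \<in> T1. bsign e) * (\<Prod>e \<in> T2. bsign e) = (-1) ^ (card \<Phi> div 2)"
  proof -
    have un: "{j. j < n \<and> bedge (pt j) \<in> T1} \<union> {j. j < n \<and> bedge (pt j) \<in> T2} = \<Phi>"
    proof -
      have "j < n \<and> bedge (pt j) \<in> T1 \<or> j < n \<and> bedge (pt j) \<in> T2 \<longleftrightarrow> j \<in> \<Phi>" for j
        using bd[of j] unfolding \<Phi>_def by auto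
      then show ?thesis by blast
    qed
    have "(\<Prod>e \<in> T1. bsign e) * (\<Prod>e \<in> T2. bsign e) = (\<Prod>j \<in> \<Phi>. (-1) ^ j)"
      unfolding signs[OF fin(1)] signs[OF fin(2)] un[symmetric]
      using excl by (subst prod.union_disjoint) auto
    then show ?thesis using bv(2) by simp
  qed
  have fb: "face_b G \<Omega> = card \<Phi> div 2"
  proof -
    have "{j. j < length (bdry G) \<and> bdry G ! j \<in> frontier \<Omega>} = \<Phi>"
    proof -
      have "j < length (bdry G) \<and> bdry G ! j \<in> frontier \<Omega> \<longleftrightarrow> j \<in> \<Phi>" for j
        using frontier_iff[of j] pt_bdry[of j] len_bdry unfolding \<Phi>_def by auto
      then show ?thesis by blast
    qed
    then show ?thesis unfolding face_b_def by simp
  qed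
  have internal: "card \<Phi> = 0" if "internal_face \<Omega>"
  proof -
    have "\<Phi> = {}" using that frontier_iff pt_circle unfolding internal_face_def \<Phi>_def by blast
    then show ?thesis by simp
  qed
  have fw: "face_weight G t \<Omega> = (\<Prod>e \<in> T1. t e) / (\<Prod>e \<in> T2. t e)"
    unfolding face_weight_def T1_def T2_def ..
  have T': "{e \<in> edges (dual_graph G). \<exists>b \<in> black (dual_graph G). \<exists>w \<in> white (dual_graph G). traversed_clockwise \<Omega> e b w} = T2"
    "{e \<in> edges (dual_graph G). \<exists>b \<in> black (dual_graph G). \<exists>w \<in> white (dual_graph G). traversed_clockwise \<Omega> e w b} = T1"
    unfolding T1_def T2_def dual_graph_def by auto
  have nz: "(\<Prod>e \<in> T1. t e) \<noteq> 0" "(\<Prod>e \<in> T2. t e) \<noteq> 0"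
    using t unfolding T1_def T2_def by (auto simp: finite_edges)
  define s1 s2 where "s1 = (\<Prod>e \<in> T1. bsign e)" and "s2 = (\<Prod>e \<in> T2. bsign e)"
  have sq: "s1 * s1 = 1" "s2 * s2 = 1"
    unfolding s1_def s2_def by (simp_all add: prod.distrib[symmetric] bsign_sq)
  then have "s1 \<noteq> 0" by auto
  have "face_weight (dual_graph G) (\<lambda>e. t e * bsign e) \<Omega> = ((\<Prod>e \<in> T2. t e) * s2) / ((\<Prod>e \<in> T1. t e) * s1)"
    unfolding face_weight_def T' s1_def s2_def by (simp add: prod.distrib)
  also have "\<dots> = (s1 * s2) * inverse (face_weight G t \<Omega>)"
  proof -
    have "s2 / s1 = s1 * s2" using sq \<open>s1 \<noteq> 0\<close> by (metis (no_types, lifting) mult.commute nonzero_mult_div_cancel_left mult.assoc mult_1)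
    moreover have "((\<Prod>e \<in> T2. t e) * s2) / ((\<Prod>e \<in> T1. t e) * s1) = (s2 / s1) * ((\<Prod>e \<in> T2. t e) / (\<Prod>e \<in> T1. t e))"
      by (simp only: times_divide_times_eq mult.commute)
    ultimately show ?thesis unfolding fw inverse_divide by simp
  qed
  also have "s1 * s2 = (-1) ^ face_b G \<Omega>" using s12 unfolding s1_def s2_def fb .
  finally have w: "face_weight (dual_graph G) (\<lambda>e. t e * bsign e) \<Omega> = (-1) ^ face_b G \<Omega> * inverse (face_weight G t \<Omega>)" .
  then show "face_weight (dual_graph G) (\<lambda>e. t e * bsign e) \<Omega> = dual_face_weight G (face_weight G t) \<Omega>"
    unfolding dual_face_weight_def using internal fb by auto
  show "dual_face_weight G (face_weight G t) \<Omega> \<noteq> 0"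
    unfolding dual_face_weight_def fw using nz by auto
qed

end

section \<open>Determinants with prescribed columns\<close>

text \<open>The matrix with the columns \<open>f _ x\<close>, where \<open>x\<close> runs through the list \<open>xs\<close>.\<close>

definition colmat :: "nat \<Rightarrow> (nat \<Rightarrow> 'b \<Rightarrow> complex) \<Rightarrow> 'b list \<Rightarrow> complex mat" where
  "colmat m f xs = Matrix.mat m (length xs) (\<lambda>(i, c). f i (xs ! c))"

abbreviation dt :: "complex mat \<Rightarrow> complex" where "dt \<equiv> Determinant.det"

lemma colmat_carrier [simp]: "length xs = m \<Longrightarrow> colmat m f xs \<in> carrier_mat m m"
  by (simp add: colmat_def)

lemma colmat_index [simp]: "i < m \<Longrightarrow> c < length xs \<Longrightarrow> colmat m f xs $$ (i, c) = f i (xs ! c)"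
  "dim_row (colmat m f xs) = m" "dim_col (colmat m f xs) = length xs"
  by (simp_all add: colmat_def)

text \<open>The sign of the permutation that sorts a list of distinct numbers.\<close>

fun lsign :: "nat list \<Rightarrow> complex" where
  "lsign [] = 1"
| "lsign (x # xs) = (-1) ^ length (filter (\<lambda>y. y < x) xs) * lsign xs"

lemma lsign_sq: "lsign xs * lsign xs = 1"
proof (induction xs)
  case (Cons x xs)
  have "lsign (x # xs) * lsign (x # xs)
      = ((-1) ^ length (filter (\<lambda>y. y < x) xs) * (-1) ^ length (filter (\<lambda>y. y < x) xs)) * (lsign xs * lsign xs)"
    by simp
  also have "\<dots> = 1" unfolding Cons power_add[symmetric] mult_2[symmetric] by simp
  finally show ?case .
qed simp

lemma det_swap_adjacent:
  assumes "length (as @ x # y # bs) = m"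
  shows "dt (colmat m f (as @ y # x # bs)) = - dt (colmat m f (as @ x # y # bs))"
proof -
  let ?k = "length as"
  have "colmat m f (as @ y # x # bs) = swapcols ?k (Suc ?k) (colmat m f (as @ x # y # bs))"
    using assms by (intro eq_matI) (auto simp: nth_append nth_Cons' mat_swapcols_def)
  then show ?thesis using assms by (simp add: det_swapcols[of _ m])
qed

lemma det_insort:
  assumes "sorted zs" "length ys + Suc (length zs) = m"
  shows "dt (colmat m f (ys @ map g (x # zs))) =
    (-1) ^ length (filter (\<lambda>y. y < x) zs) * dt (colmat m f (ys @ map g (insort x zs)))"
  using assms
proof (induction zs arbitrary: ys)
  case (Cons z zs)
  show ?case
  proof (cases "x \<le> z")
    case True
    then have "filter (\<lambda>y. y < x) (z # zs) = []" using Cons.prems(1) by (auto simp: filter_empty_conv)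
    then show ?thesis using True by simp
  next
    case False
    have "dt (colmat m f (ys @ map g (x # z # zs))) = - dt (colmat m f ((ys @ [g z]) @ map g (x # zs)))"
      using det_swap_adjacent[of ys "g z" "g x" "map g zs" m f] Cons.prems by simp
    also have "dt (colmat m f ((ys @ [g z]) @ map g (x # zs))) =
        (-1) ^ length (filter (\<lambda>y. y < x) zs) * dt (colmat m f ((ys @ [g z]) @ map g (insort x zs)))"
      using Cons.prems by (intro Cons.IH) auto
    finally show ?thesis using False by simp
  qed
qed simp

lemma det_sort:
  assumes "length ys + length xs = m"
  shows "dt (colmat m f (ys @ map g xs)) = lsign xs * dt (colmat m f (ys @ map g (sort xs)))"
  using assms
proof (induction xs arbitrary: ys)
  case (Cons x xs)
  have "dt (colmat m f (ys @ map g (x # xs))) = lsign xs * dt (colmat m f (ys @ map g (x # sort xs)))"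
    using Cons.IH[of "ys @ [g x]"] Cons.prems by simp
  also have "dt (colmat m f (ys @ map g (x # sort xs))) =
      (-1) ^ length (filter (\<lambda>y. y < x) (sort xs)) * dt (colmat m f (ys @ map g (insort x (sort xs))))"
    using Cons.prems by (intro det_insort) auto
  also have "length (filter (\<lambda>y. y < x) (sort xs)) = length (filter (\<lambda>y. y < x) xs)"
    by (metis filter_sort length_sort)
  finally show ?case by simp
qed simp

lemma lsign_middle:
  "lsign (as @ x # bs) = (-1) ^ (length (filter (\<lambda>y. y < x) bs) + length (filter (\<lambda>y. x < y) as)) * lsign (as @ bs)"
  by (induction as) (auto simp: power_add)

text \<open>Replacing an entry by another number \<open>j\<close> changes the sign by the number of entries between the
  two.\<close>

lemma lsign_replace:
  assumes "i \<notin> set (as @ bs)" "j \<notin> set (as @ bs)"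
  shows "lsign (as @ j # bs) = (-1) ^ length (filter (\<lambda>y. min i j < y \<and> y < max i j) (as @ bs)) * lsign (as @ i # bs)"
proof -
  let ?b = "\<lambda>y. min i j < y \<and> y < max i j"
  have 1: "even (length (filter (\<lambda>y. y < i) xs) + length (filter (\<lambda>y. y < j) xs) + length (filter ?b xs))"
    if "i \<notin> set xs" "j \<notin> set xs" for xs
    using that by (induction xs) (auto simp: min_def max_def)
  have 2: "even (length (filter (\<lambda>y. i < y) xs) + length (filter (\<lambda>y. j < y) xs) + length (filter ?b xs))"
    if "i \<notin> set xs" "j \<notin> set xs" for xs
    using that by (induction xs) (auto simp: min_def max_def)
  define e where "e x = length (filter (\<lambda>y. y < x) bs) + length (filter (\<lambda>y. x < y) as)" for x
  have "even (e i + e j + length (filter ?b (as @ bs)))"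
    using 1[of bs] 2[of as] assms unfolding e_def by auto
  then have "(-1 :: complex) ^ e j = (-1) ^ length (filter ?b (as @ bs)) * (-1) ^ e i"
    unfolding power_add[symmetric] by (simp add: minus_one_power_iff) presburger
  then show ?thesis unfolding lsign_middle e_def[symmetric] by simp
qed

lemma sort_complement_lsign:
  assumes "sorted is" "distinct is" "sorted js" "distinct js" "set is \<inter> set js = {}" "set is \<union> set js = {..<n}"
  shows "lsign (is @ js) = (-1) ^ (sum_list is + sum_list [0..<length is])"
proof -
  have js: "lsign js = 1" using assms(3)
  proof (induction js)
    case (Cons a js)
    then have "filter (\<lambda>y. y < a) js = []" by (auto simp: filter_empty_conv)
    then show ?case using Cons by simp
  qed simp
  have cnt: "length (filter (\<lambda>y. y < x) js) + length (filter (\<lambda>y. y < x) is) = x" if "x < n" for x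
  proof -
    have "y \<in> set is \<union> set js" if "y < x" for y unfolding assms(6) using that \<open>x < n\<close> by simp
    then have "set (filter (\<lambda>y. y < x) js) \<union> set (filter (\<lambda>y. y < x) is) = {..<x}" by auto
    moreover have "card (set (filter (\<lambda>y. y < x) js) \<union> set (filter (\<lambda>y. y < x) is))
        = card (set (filter (\<lambda>y. y < x) js)) + card (set (filter (\<lambda>y. y < x) is))"
      using assms(5) by (intro card_Un_disjoint) auto
    moreover have "card (set (filter (\<lambda>y. y < x) zs)) = length (filter (\<lambda>y. y < x) zs)" if "distinct zs" for zs
      using that by (intro distinct_card) simp
    ultimately show ?thesis using assms(2,4) by (metis card_lessThan)
  qed
  have "lsign (as @ js) = (-1) ^ (sum_list as + sum_list [length us..<length us + length as])"
    if "is = us @ as" for us as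
    using that
  proof (induction as arbitrary: us)
    case Nil then show ?case using js by simp
  next
    case (Cons a as)
    have IH: "lsign (as @ js) = (-1) ^ (sum_list as + sum_list [Suc (length us)..<Suc (length us) + length as])"
      using Cons.IH[of "us @ [a]"] Cons.prems by simp
    have "filter (\<lambda>y. y < a) as = []" using assms(1) Cons.prems by (auto simp: filter_empty_conv sorted_append)
    moreover have "filter (\<lambda>y. y < a) is = us"
    proof -
      have "y < a" if "y \<in> set us" for y
        using assms(1,2) Cons.prems that by (auto simp: sorted_append order_less_le)
      then have "filter (\<lambda>y. y < a) us = us" by simp
      then show ?thesis using Cons.prems \<open>filter (\<lambda>y. y < a) as = []\<close> by simp
    qed
    moreover have "a < n" using assms(6) Cons.prems by auto
    ultimately have c: "length (filter (\<lambda>y. y < a) (as @ js)) + length us = a" using cnt[of a] by simp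
    have "[length us..<length us + length (a # as)] = length us # [Suc (length us)..<Suc (length us) + length as]"
      by (simp add: upt_rec)
    then have "(-1 :: complex) ^ (sum_list (a # as) + sum_list [length us..<length us + length (a # as)])
        = (-1) ^ (a + length us) * (-1) ^ (sum_list as + sum_list [Suc (length us)..<Suc (length us) + length as])"
      by (simp add: power_add[symmetric] ac_simps)
    also have "(-1 :: complex) ^ (a + length us) = (-1) ^ length (filter (\<lambda>y. y < a) (as @ js))"
    proof -
      have "even (a + length us) = even (length (filter (\<lambda>y. y < a) (as @ js)))" using c by presburger
      then show ?thesis by (simp only: minus_one_power_iff)
    qed
    finally show ?case using IH by simp
  qed
  from this[of "[]" "is"] show ?thesis by simp
qed

lemma det_replace_col:
  assumes "M \<in> carrier_mat m m" "s < m"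
  shows "dt (replace_col M (vec m v) s) = (\<Sum>i<m. v i * cofactor M i s)"
proof -
  have R: "replace_col M (vec m v) s \<in> carrier_mat m m" using assms by (simp add: replace_col_def)
  have "cofactor (replace_col M (vec m v) s) i s = cofactor M i s" if "i < m" for i
  proof -
    have "mat_delete (replace_col M (vec m v) s) i s = mat_delete M i s"
      using assms that by (intro eq_matI) (auto simp: mat_delete_def replace_col_def)
    then show ?thesis by (simp add: cofactor_def)
  qed
  moreover have "replace_col M (vec m v) s $$ (i, s) = v i" if "i < m" for i
    using assms that by (simp add: replace_col_def)
  ultimately show ?thesis
    unfolding laplace_expansion_column[OF R assms(2)] by (intro sum.cong) auto
qed

lemma colmat_update:
  assumes "length xs = m" "s < m"
  shows "colmat m f (xs[s := x]) = replace_col (colmat m f xs) (vec m (\<lambda>i. f i x)) s"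
  using assms by (intro eq_matI) (auto simp: replace_col_def nth_list_update)

lemma det_repeated:
  assumes "length xs = m" "\<not> distinct xs"
  shows "dt (colmat m f xs) = 0"
proof -
  obtain i j where ij: "i < m" "j < m" "i \<noteq> j" "xs ! i = xs ! j"
    using assms unfolding distinct_conv_nth by blast
  have "col (colmat m f xs) i = col (colmat m f xs) j"
    using ij assms(1) by (intro eq_vecI) auto
  then show ?thesis using det_identical_cols[of _ m i j] ij assms(1) colmat_carrier by blast
qed

lemma det_kernel:
  assumes "M \<in> carrier_mat m m" "dt M \<noteq> 0" "\<And>r. r < m \<Longrightarrow> (\<Sum>c<m. M $$ (r, c) * z c) = 0" "c < m"
  shows "z c = 0"
proof -
  have "M *\<^sub>v vec m z = 0\<^sub>v m"
    using assms(1,3) by (intro eq_vecI) (auto simp: scalar_prod_def lessThan_atLeast0)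
  then have "vec m z = 0\<^sub>v m"
    using assms(1,2) det_0_iff_vec_prod_zero[OF assms(1)] by (metis vec_carrier)
  then show ?thesis using assms(4) by (metis index_vec index_zero_vec(1))
qed

lemma det_cokernel:
  assumes "M \<in> carrier_mat m m" "dt M \<noteq> 0" "\<And>c. c < m \<Longrightarrow> (\<Sum>r<m. M $$ (r, c) * z r) = 0" "r < m"
  shows "z r = 0"
  using assms det_transpose[OF assms(1)]
  by (intro det_kernel[of "transpose_mat M" m z r]) auto

section \<open>Orthogonality and complementary minors\<close>

text \<open>If the maximal minors of \<open>A\<close> are proportional to the minors of \<open>K\<close> that contain the columns \<open>\<beta>\<close>,
  every vector in the kernel of \<open>K\<close> restricts to a vector in the kernel of \<open>A\<close>. By
  Cramer's rule it suffices that replacing a column of a nonsingular block of \<open>A\<close> by the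
  image of the vector gives determinant 0, and this determinant is the one that is
  obtained from \<open>K\<close> in this way, up to the columns \<open>\<beta>\<close>, which do not contribute.\<close>

lemma kernel_orthogonal:
  fixes K :: "nat \<Rightarrow> 'b \<Rightarrow> complex" and A :: "complex mat" and x :: "'b \<Rightarrow> complex"
  assumes len: "length \<beta> + k = m" and dist: "distinct \<beta>"
    and minors: "\<And>is. length is = k \<Longrightarrow> set is \<subseteq> {..<n} \<Longrightarrow>
      dt (colmat k (\<lambda>r j. A $$ (r, j)) is) = \<kappa> * dt (colmat m K (\<beta> @ map g is))"
    and is0: "length is0 = k" "set is0 \<subseteq> {..<n}" "dt (colmat k (\<lambda>r j. A $$ (r, j)) is0) \<noteq> 0"
    and ker: "\<And>i. i < m \<Longrightarrow> (\<Sum>b \<in> set \<beta>. K i b * x b) + (\<Sum>j<n. K i (g j) * x (g j)) = 0"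
    and r: "r < k"
  shows "(\<Sum>j<n. A $$ (r, j) * x (g j)) = 0"
proof -
  let ?A = "\<lambda>r j. A $$ (r, j)"
  let ?M = "colmat k ?A is0"
  define y where "y r = (\<Sum>j<n. A $$ (r, j) * x (g j))" for r
  have M: "?M \<in> carrier_mat k k" using is0 by simp
  have cof0: "(\<Sum>r<k. y r * cofactor ?M r s) = 0" if s: "s < k" for s
  proof -
    let ?N = "colmat m K (\<beta> @ map g is0)" and ?s = "length \<beta> + s"
    have N: "?N \<in> carrier_mat m m" "?s < m" using len is0(1) s by auto
    have upd: "dt (colmat k ?A (is0[s := j])) = \<kappa> * (\<Sum>i<m. K i (g j) * cofactor ?N i ?s)" if "j < n" for j
    proof -
      have "set (is0[s := j]) \<subseteq> {..<n}" using is0(2) that set_update_subset_insert[of is0 s j] by blast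
      then have "dt (colmat k ?A (is0[s := j])) = \<kappa> * dt (colmat m K (\<beta> @ map g (is0[s := j])))"
        using is0(1) by (intro minors) auto
      also have "\<beta> @ map g (is0[s := j]) = (\<beta> @ map g is0)[?s := g j]"
        by (simp add: list_update_append map_update)
      also have "dt (colmat m K \<dots>) = (\<Sum>i<m. K i (g j) * cofactor ?N i ?s)"
        using colmat_update[of "\<beta> @ map g is0" m ?s K "g j"] det_replace_col[OF N] len is0(1) N by simp
      finally show ?thesis .
    qed
    have beta: "(\<Sum>i<m. K i b * cofactor ?N i ?s) = 0" if b: "b \<in> set \<beta>" for b
    proof -
      obtain c where c: "c < length \<beta>" "\<beta> ! c = b" using b by (metis in_set_conv_nth)
      let ?l = "(\<beta> @ map g is0)[?s := b]"
      have l: "length ?l = m" using len is0(1) by simp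
      have "?l ! c = ?l ! ?s" "c \<noteq> ?s" using c N(2) l by (auto simp: nth_append)
      then have "\<not> distinct ?l" unfolding distinct_conv_nth using c N(2) l len by (metis trans_less_add1)
      then have "dt (colmat m K ?l) = 0" using det_repeated[OF l] by blast
      then show ?thesis
        using colmat_update[of "\<beta> @ map g is0" m ?s K b] det_replace_col[OF N] len is0(1) N by simp
    qed
    have "(\<Sum>r<k. y r * cofactor ?M r s) = (\<Sum>j<n. x (g j) * (\<Sum>r<k. A $$ (r, j) * cofactor ?M r s))"
      unfolding y_def sum_distrib_left sum_distrib_right
      by (subst sum.swap) (intro sum.cong refl, simp)
    also have "\<dots> = (\<Sum>j<n. x (g j) * dt (colmat k ?A (is0[s := j])))"
      using colmat_update[of is0 k s ?A] det_replace_col[OF M s] is0(1) s by simp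
    also have "\<dots> = (\<Sum>j<n. x (g j) * (\<kappa> * (\<Sum>i<m. K i (g j) * cofactor ?N i ?s)))"
      using upd by (intro sum.cong) auto
    also have "\<dots> = \<kappa> * (\<Sum>i<m. (\<Sum>j<n. K i (g j) * x (g j)) * cofactor ?N i ?s)"
      unfolding sum_distrib_left sum_distrib_right
      by (subst sum.swap) (intro sum.cong refl, simp)
    also have "(\<Sum>i<m. (\<Sum>j<n. K i (g j) * x (g j)) * cofactor ?N i ?s)
        = (\<Sum>i<m. - (\<Sum>b \<in> set \<beta>. K i b * x b) * cofactor ?N i ?s)"
      using ker by (intro sum.cong refl arg_cong2[of _ _ _ _ "(*)"]) (auto simp: add_eq_0_iff)
    also have "\<dots> = - (\<Sum>b \<in> set \<beta>. x b * (\<Sum>i<m. K i b * cofactor ?N i ?s))"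
      unfolding sum_distrib_left sum_distrib_right sum_negf minus_mult_left[symmetric]
      by (subst sum.swap) (simp add: ac_simps)
    also have "\<dots> = 0" using beta by simp
    finally show ?thesis by simp
  qed
  have adj: "adj_mat ?M \<in> carrier_mat k k" "?M * adj_mat ?M = dt ?M \<cdot>\<^sub>m 1\<^sub>m k" using adj_mat[OF M] by auto
  have ortho: "(\<Sum>s<k. ?M $$ (r, s) * cofactor ?M r' s) = dt ?M * of_bool (r = r')" if "r' < k" for r'
  proof -
    have "(\<Sum>s<k. ?M $$ (r, s) * cofactor ?M r' s) = (?M * adj_mat ?M) $$ (r, r')"
      using r that M adj(1) is0(1)
      by (auto simp: scalar_prod_def adj_mat_def lessThan_atLeast0 intro!: sum.cong)
    then show ?thesis unfolding adj(2) using r that by simp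
  qed
  have "0 = (\<Sum>s<k. ?M $$ (r, s) * (\<Sum>r'<k. y r' * cofactor ?M r' s))" using cof0 by simp
  also have "\<dots> = (\<Sum>r'<k. y r' * (\<Sum>s<k. ?M $$ (r, s) * cofactor ?M r' s))"
    unfolding sum_distrib_left by (subst sum.swap) (simp add: ac_simps)
  also have "\<dots> = (\<Sum>r'<k. y r' * (dt ?M * of_bool (r = r')))" using ortho by simp
  also have "\<dots> = y r * dt ?M" using r by (simp add: sum.remove[of "{..<k}" r] of_bool_def)
  finally show ?thesis using is0(3) unfolding y_def by simp
qed

lemma set_sorted_sum_list: "finite I \<Longrightarrow> sum_list (sorted_list_of_set I) = \<Sum>I"
  by (metis distinct_sorted_list_of_set set_sorted_list_of_set sum_list_distinct_conv_sum_set sum.cong list.map_ident)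

lemma pluecker_colmat:
  assumes "A \<in> carrier_mat k n" "I \<subseteq> {..<n}" "card I = k"
  shows "pluecker A I = dt (colmat k (\<lambda>r j. A $$ (r, j)) (sorted_list_of_set I))"
proof -
  have fin: "finite I" using assms(2) finite_subset by blast
  have J: "{j. j < n \<and> j \<in> I} = I" using assms(2) by auto
  have "sorted_list_of_set I = map (pick I) [0..<card I]"
  proof (rule sorted_distinct_set_unique)
    have mono: "pick I a < pick I b" if "a < b" "b < card I" for a b
      using pick_mono_inf pick_mono[of b I a] that fin by auto
    then show "sorted (map (pick I) [0..<card I])"
      by (auto simp: sorted_iff_nth_mono_less intro: less_imp_le)
    show "distinct (map (pick I) [0..<card I])"
      unfolding distinct_map inj_on_def using mono by (auto, metis nat_neq_iff)
    have "pick I ` {..<card I} = I"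
    proof (rule card_subset_eq[OF fin])
      show "pick I ` {..<card I} \<subseteq> I" using pick_in_set_le by auto
      show "card (pick I ` {..<card I}) = card I"
        using mono by (subst card_image) (auto simp: inj_on_def, metis nat_neq_iff)
    qed
    then show "set (sorted_list_of_set I) = set (map (pick I) [0..<card I])"
      using fin by (auto simp: lessThan_atLeast0)
  qed (use fin in auto)
  then have nth: "sorted_list_of_set I ! c = pick I c" if "c < k" for c
    using that assms(3) by simp
  have "submatrix A UNIV I = colmat k (\<lambda>r j. A $$ (r, j)) (sorted_list_of_set I)"
    using assms fin J by (intro eq_matI) (auto simp: dim_submatrix submatrix_index pick_UNIV nth)
  then show ?thesis by (simp add: pluecker_def)
qed

text \<open>A matrix of full rank has a nonzero maximal minor.\<close>

lemma full_rank_minor: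
  assumes A: "gr_rep k n A"
  obtains "is" where "length is = k" "set is \<subseteq> {..<n}" "distinct is" "dt (colmat k (\<lambda>r j. A $$ (r, j)) is) \<noteq> 0"
proof -
  interpret vec_space "TYPE(complex)" k .
  have Ac: "A \<in> carrier_mat k n" "rank A = k" using A unfolding gr_rep_def by auto
  let ?P = "\<lambda>T. T \<subseteq> set (cols A) \<and> \<not> lin_dep T"
  have "\<exists>S. finite S \<and> maximal S ?P"
    by (rule maximal_exists[of _ "card (set (cols A))" "{}"])
      (auto intro: finite_subset card_mono simp: lin_dep_def)
  then obtain S where S: "finite S" "maximal S ?P" by blast
  have cS: "card S = k" using rank_card_indpt[OF Ac(1) S(2)] Ac(2) by simp
  have SP: "S \<subseteq> set (cols A)" "\<not> lin_dep S" using S(2) unfolding maximal_def by auto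
  obtain vs where vs: "set vs = S" "distinct vs" using finite_distinct_list[OF S(1)] by blast
  have len: "length vs = k" using vs cS distinct_card by metis
  have "\<exists>j<n. v = col A j" if "v \<in> S" for v
  proof -
    have "v \<in> col A ` {0..<n}" using SP(1) Ac(1) that unfolding cols_def by auto
    then show ?thesis by auto
  qed
  then obtain h where h: "\<And>v. v \<in> S \<Longrightarrow> h v < n \<and> v = col A (h v)" by metis
  let ?is = "map h vs"
  have "colmat k (\<lambda>r j. A $$ (r, j)) ?is = mat_of_cols k vs"
  proof (intro eq_matI)
    fix i j assume ij: "i < dim_row (mat_of_cols k vs)" "j < dim_col (mat_of_cols k vs)"
    then have "vs ! j \<in> S" using vs len by auto
    then have "vs ! j = col A (h (vs ! j))" "h (vs ! j) < n" using h by auto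
    then show "colmat k (\<lambda>r j. A $$ (r, j)) ?is $$ (i, j) = mat_of_cols k vs $$ (i, j)"
      using ij Ac(1) len by (auto simp: mat_of_cols_def) (metis carrier_matD index_col)
  qed (use len in auto)
  moreover have "dt (mat_of_cols k vs) \<noteq> 0"
  proof -
    have c: "mat_of_cols k vs \<in> carrier_mat k k" using len mat_of_cols_carrier(1)[of k vs] by simp
    have "set vs \<subseteq> carrier_vec k" using SP(1) vs Ac(1) cols_dim[of A] by auto
    then have "cols (mat_of_cols k vs) = vs" by (rule cols_mat_of_cols)
    then have "rank (mat_of_cols k vs) = k"
      using lin_indpt_full_rank[OF c] vs SP(2) by simp
    then show ?thesis using det_rank_iff[OF c] by simp
  qed
  moreover have "distinct ?is"
    using vs h by (simp add: distinct_map inj_on_def) metis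
  moreover have "set ?is \<subseteq> {..<n}" using h vs by auto
  ultimately show ?thesis using that[of ?is] len by simp
qed

text \<open>Complementary minors: if the rows of \<open>X\<close> span the kernel of \<open>A\<close>, then the maximal minors of \<open>X\<close> are,
  up to a common factor and up to sign, the complementary minors of \<open>A\<close>. For a right inverse
  \<open>R\<close> of \<open>A\<close> and the rows \<open>E\<close> of the unit matrix that are selected by the
  complement, compare the determinants in \<open>[A; E] [R, X\<^sup>T] = [1, 0; E R, E X\<^sup>T]\<close>.\<close>

lemma complementary_minors:
  assumes A: "gr_rep k n A" and X: "gr_rep d n X" and kd: "k + d = n"
    and orth: "\<And>r l. r < k \<Longrightarrow> l < d \<Longrightarrow> (\<Sum>j<n. A $$ (r, j) * X $$ (l, j)) = 0"
  obtains c where "c \<noteq> 0" "\<And>I. I \<subseteq> {..<n} \<Longrightarrow> card I = k \<Longrightarrow>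
    pluecker X ({..<n} - I) = c * (-1) ^ (\<Sum>I) * pluecker A I"
proof -
  have Ac: "A \<in> carrier_mat k n" and Xc: "X \<in> carrier_mat d n" using A X unfolding gr_rep_def by auto
  obtain "is0" where is0: "length is0 = k" "set is0 \<subseteq> {..<n}" "distinct is0" "dt (colmat k (\<lambda>r j. A $$ (r, j)) is0) \<noteq> 0"
    using full_rank_minor[OF A] by metis
  obtain js0 where js0: "length js0 = d" "set js0 \<subseteq> {..<n}" "dt (colmat d (\<lambda>r j. X $$ (r, j)) js0) \<noteq> 0"
    using full_rank_minor[OF X] by metis
  let ?M = "colmat k (\<lambda>r j. A $$ (r, j)) is0"
  have M: "?M \<in> carrier_mat k k" using is0 by simp
  define N where "N c s = adj_mat ?M $$ (c, s) / dt ?M" for c s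
  have MN: "(\<Sum>c<k. A $$ (r, is0 ! c) * N c s) = of_bool (r = s)" if "r < k" "s < k" for r s
  proof -
    have "(?M * adj_mat ?M) $$ (r, s) = (dt ?M \<cdot>\<^sub>m 1\<^sub>m k) $$ (r, s)" using adj_mat(2)[OF M] by simp
    moreover have "(?M * adj_mat ?M) $$ (r, s) = (\<Sum>c<k. A $$ (r, is0 ! c) * adj_mat ?M $$ (c, s))"
      using that adj_mat(1)[OF M] is0(1) by (auto simp: scalar_prod_def lessThan_atLeast0 intro!: sum.cong)
    ultimately have "(\<Sum>c<k. A $$ (r, is0 ! c) * adj_mat ?M $$ (c, s)) = dt ?M * of_bool (r = s)"
      using that by simp
    then show ?thesis unfolding N_def using is0(4) by (simp add: sum_divide_distrib[symmetric])
  qed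
  define R where "R j s = (\<Sum>c<k. of_bool (j = is0 ! c) * N c s)" for j s
  have AR: "(\<Sum>j<n. A $$ (r, j) * R j s) = of_bool (r = s)" if rs: "r < k" "s < k" for r s
  proof -
    have "(\<Sum>j<n. A $$ (r, j) * R j s) = (\<Sum>c<k. \<Sum>j<n. A $$ (r, j) * (of_bool (j = is0 ! c) * N c s))"
      unfolding R_def sum_distrib_left by (rule sum.swap)
    also have "\<dots> = (\<Sum>c<k. A $$ (r, is0 ! c) * N c s)"
    proof (rule sum.cong[OF refl])
      fix c assume "c \<in> {..<k}"
      then have "is0 ! c \<in> {..<n}" using is0(1,2) nth_mem by blast
      then show "(\<Sum>j<n. A $$ (r, j) * (of_bool (j = is0 ! c) * N c s)) = A $$ (r, is0 ! c) * N c s"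
        by (simp add: sum.remove[of "{..<n}" "is0 ! c"] of_bool_def)
    qed
    finally show ?thesis using MN[OF rs] by simp
  qed
  define W where "W = Matrix.mat n n (\<lambda>(j, c). if c < k then R j c else X $$ (c - k, j))"
  have W: "W \<in> carrier_mat n n" unfolding W_def by simp
  have detW: "dt W \<noteq> 0"
  proof
    assume "dt W = 0"
    then obtain v where v: "v \<in> carrier_vec n" "v \<noteq> 0\<^sub>v n" "W *\<^sub>v v = 0\<^sub>v n"
      using det_0_iff_vec_prod_zero[OF W] by blast
    have Wv: "(\<Sum>c<k. R j c * v $ c) + (\<Sum>l<d. X $$ (l, j) * v $ (k + l)) = 0" if "j < n" for j
    proof -
      have "(W *\<^sub>v v) $ j = (\<Sum>c<n. (if c < k then R j c else X $$ (c - k, j)) * v $ c)"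
        using v(1) that unfolding W_def by (simp add: scalar_prod_def lessThan_atLeast0)
      also have "{..<n} = {..<k} \<union> {k..<k + d}" using kd by auto
      also have "(\<Sum>c \<in> {..<k} \<union> {k..<k + d}. (if c < k then R j c else X $$ (c - k, j)) * v $ c)
          = (\<Sum>c<k. R j c * v $ c) + (\<Sum>c \<in> {k..<k + d}. X $$ (c - k, j) * v $ c)"
        by (subst sum.union_disjoint) (auto intro!: sum.cong arg_cong2[of _ _ _ _ "(+)"])
      also have "(\<Sum>c \<in> {k..<k + d}. X $$ (c - k, j) * v $ c) = (\<Sum>l<d. X $$ (l, j) * v $ (k + l))"
        by (rule sum.reindex_bij_witness[of _ "\<lambda>l. k + l" "\<lambda>c. c - k"]) auto
      finally show ?thesis using v(3) that by simp
    qed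
    have v0: "v $ r = 0" if r: "r < k" for r
    proof -
      have "0 = (\<Sum>j<n. A $$ (r, j) * ((\<Sum>c<k. R j c * v $ c) + (\<Sum>l<d. X $$ (l, j) * v $ (k + l))))"
        using Wv by simp
      also have "\<dots> = (\<Sum>j<n. \<Sum>c<k. A $$ (r, j) * R j c * v $ c) + (\<Sum>j<n. \<Sum>l<d. A $$ (r, j) * X $$ (l, j) * v $ (k + l))"
        by (simp add: distrib_left sum.distrib sum_distrib_left mult.assoc)
      also have "(\<Sum>j<n. \<Sum>l<d. A $$ (r, j) * X $$ (l, j) * v $ (k + l)) = 0"
        using orth[OF r] by (subst sum.swap) (simp add: sum_distrib_right[symmetric])
      also have "(\<Sum>j<n. \<Sum>c<k. A $$ (r, j) * R j c * v $ c) = (\<Sum>c<k. of_bool (r = c) * v $ c)"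
        using AR[OF r] by (subst sum.swap) (simp add: sum_distrib_right[symmetric])
      also have "\<dots> = v $ r" using r by (simp add: sum.remove[of "{..<k}" r] of_bool_def)
      finally show ?thesis by simp
    qed
    have "v $ (k + l) = 0" if "l < d" for l
    proof (rule det_cokernel[OF _ js0(3), where z = "\<lambda>l. v $ (k + l)"])
      show "colmat d (\<lambda>r j. X $$ (r, j)) js0 \<in> carrier_mat d d" using js0 by simp
      fix c assume c: "c < d"
      then have "js0 ! c < n" using js0 nth_mem by blast
      then have "(\<Sum>l<d. X $$ (l, js0 ! c) * v $ (k + l)) = 0" using Wv[of "js0 ! c"] v0 by simp
      then show "(\<Sum>r<d. colmat d (\<lambda>r j. X $$ (r, j)) js0 $$ (r, c) * v $ (k + r)) = 0"
        using c js0(1) by simp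
    qed (rule that)
    then have "v $ i = 0" if "i < n" for i
      using v0[of i] \<open>\<And>l. l < d \<Longrightarrow> v $ (k + l) = 0\<close>[of "i - k"] that kd by (cases "i < k") auto
    then have "v = 0\<^sub>v n" using v(1) by (intro eq_vecI) auto
    then show False using v(2) by simp
  qed
  have main: "dt (colmat d (\<lambda>r j. X $$ (r, j)) js) = lsign (is @ js) * dt W * dt (colmat k (\<lambda>r j. A $$ (r, j)) is)"
    if ij: "length is = k" "length js = d" "distinct (is @ js)" "set (is @ js) = {..<n}" for "is" js
  proof -
    define q where "q r j = (if r < k then A $$ (r, j) else of_bool (j = js ! (r - k)) :: complex)" for r j
    let ?Q = "colmat n q [0..<n]"
    have Q: "?Q \<in> carrier_mat n n" by simp
    have "sort (is @ js) = [0..<n]"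
      using ij by (intro sorted_distinct_set_unique) auto
    then have "dt (colmat n q ([] @ map id (is @ js))) = lsign (is @ js) * dt ?Q"
      using det_sort[of "[]" "is @ js" n q id] ij kd by simp
    moreover have "colmat n q ([] @ map id (is @ js)) =
        four_block_mat (colmat k (\<lambda>r j. A $$ (r, j)) is) (colmat k (\<lambda>r j. A $$ (r, j)) js) (0\<^sub>m d k) (1\<^sub>m d)"
    proof (intro eq_matI)
      fix r c assume rc: "r < dim_row (four_block_mat (colmat k (\<lambda>r j. A $$ (r, j)) is) (colmat k (\<lambda>r j. A $$ (r, j)) js) (0\<^sub>m d k) (1\<^sub>m d))"
        "c < dim_col (four_block_mat (colmat k (\<lambda>r j. A $$ (r, j)) is) (colmat k (\<lambda>r j. A $$ (r, j)) js) (0\<^sub>m d k) (1\<^sub>m d))"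
      then have rc': "r < n" "c < n" using ij kd by auto
      have disj: "is ! c \<noteq> js ! (r - k)" if "c < k" "\<not> r < k"
      proof -
        have "is ! c \<in> set is" "js ! (r - k) \<in> set js" using ij rc' that kd by auto
        then show ?thesis using ij(3) by auto
      qed
      have eqj: "js ! (c - k) = js ! (r - k) \<longleftrightarrow> r = c" if "\<not> c < k" "\<not> r < k"
        using ij rc' that kd nth_eq_iff_index_eq[of js "c - k" "r - k"] by auto
      show "colmat n q ([] @ map id (is @ js)) $$ (r, c) =
        four_block_mat (colmat k (\<lambda>r j. A $$ (r, j)) is) (colmat k (\<lambda>r j. A $$ (r, j)) js) (0\<^sub>m d k) (1\<^sub>m d) $$ (r, c)"
        using rc' ij kd disj eqj by (auto simp: q_def nth_append)
    qed (use ij kd in auto)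
    ultimately have "lsign (is @ js) * dt ?Q = dt (colmat k (\<lambda>r j. A $$ (r, j)) is)"
      using ij det_four_block_mat_lower_left_zero[of "colmat k (\<lambda>r j. A $$ (r, j)) is" k "colmat k (\<lambda>r j. A $$ (r, j)) js" d "0\<^sub>m d k" "1\<^sub>m d"]
      by (simp add: colmat_def)
    then have dQ: "dt ?Q = lsign (is @ js) * dt (colmat k (\<lambda>r j. A $$ (r, j)) is)"
      using lsign_sq[of "is @ js"] by (metis mult.assoc mult_1)
    let ?ER = "Matrix.mat d k (\<lambda>(r, s). R (js ! r) s)" and ?EX = "transpose_mat (colmat d (\<lambda>r j. X $$ (r, j)) js)"
    have "?Q * W = four_block_mat (1\<^sub>m k) (0\<^sub>m k d) ?ER ?EX"
    proof (intro eq_matI)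
      fix r c assume "r < dim_row (four_block_mat (1\<^sub>m k) (0\<^sub>m k d) ?ER ?EX)" "c < dim_col (four_block_mat (1\<^sub>m k) (0\<^sub>m k d) ?ER ?EX)"
      then have rc: "r < n" "c < n" using ij kd by auto
      have e: "(?Q * W) $$ (r, c) = (\<Sum>j<n. q r j * (if c < k then R j c else X $$ (c - k, j)))"
        using rc W unfolding W_def by (auto simp: scalar_prod_def lessThan_atLeast0 intro!: sum.cong)
      show "(?Q * W) $$ (r, c) = four_block_mat (1\<^sub>m k) (0\<^sub>m k d) ?ER ?EX $$ (r, c)"
      proof (cases "r < k")
        case True
        then show ?thesis using e rc AR[of r c] orth[of r "c - k"] kd ij by (auto simp: q_def)
      next
        case False
        then have jr: "js ! (r - k) < n" using ij rc kd nth_mem[of "r - k" js] by auto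
        have "(\<Sum>j<n. q r j * h j) = h (js ! (r - k))" for h :: "nat \<Rightarrow> complex"
          using False jr by (simp add: q_def sum.remove[of "{..<n}" "js ! (r - k)"] of_bool_def)
        then show ?thesis using e rc False kd ij by auto
      qed
    qed (use ij kd W in auto)
    then have "dt ?Q * dt W = dt ?EX"
      using det_mult[OF Q W] det_four_block_mat_upper_right_zero[of "1\<^sub>m k" k "0\<^sub>m k d" d ?ER ?EX] ij by simp
    also have "\<dots> = dt (colmat d (\<lambda>r j. X $$ (r, j)) js)"
      using det_transpose[of "colmat d (\<lambda>r j. X $$ (r, j)) js" d] ij by simp
    finally show ?thesis using dQ by (simp add: ac_simps)
  qed
  have "pluecker X ({..<n} - I) = (dt W * (-1) ^ sum_list [0..<k]) * (-1) ^ (\<Sum>I) * pluecker A I"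
    if I: "I \<subseteq> {..<n}" "card I = k" for I
  proof -
    let ?is = "sorted_list_of_set I" and ?js = "sorted_list_of_set ({..<n} - I)"
    have fin: "finite I" using I(1) finite_subset by blast
    have cJ: "card ({..<n} - I) = d" using I fin kd by (simp add: card_Diff_subset)
    have l: "length ?is = k" "length ?js = d" using I cJ by auto
    have sets: "set ?is = I" "set ?js = {..<n} - I" using fin by auto
    have "lsign (?is @ ?js) = (-1) ^ (\<Sum>I + sum_list [0..<k])"
      using sort_complement_lsign[of ?is ?js n] sets I(1) l(1) set_sorted_sum_list[OF fin] by auto
    moreover have "dt (colmat d (\<lambda>r j. X $$ (r, j)) ?js) = lsign (?is @ ?js) * dt W * dt (colmat k (\<lambda>r j. A $$ (r, j)) ?is)"
      using l sets I(1) by (intro main) auto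
    ultimately show ?thesis
      using pluecker_colmat[OF Ac I] pluecker_colmat[OF Xc _ cJ] by (simp add: power_add ac_simps)
  qed
  moreover have "dt W * (-1) ^ sum_list [0..<k] \<noteq> 0" using detW by simp
  ultimately show ?thesis using that by blast
qed

text \<open>Two matrices of full rank whose rows span the kernel of \<open>A\<close> represent the same point. They have
  nonzero maximal minors at the same columns; adjust them to agree there, and note that a vector in the
  kernel of \<open>A\<close> that vanishes on these columns is 0.\<close>

lemma same_kernel_same_point:
  assumes A: "gr_rep k n A" and X: "gr_rep d n X" and Y: "gr_rep d n Y" and kd: "k + d = n"
    and orthX: "\<And>r l. r < k \<Longrightarrow> l < d \<Longrightarrow> (\<Sum>j<n. A $$ (r, j) * X $$ (l, j)) = 0"
    and orthY: "\<And>r l. r < k \<Longrightarrow> l < d \<Longrightarrow> (\<Sum>j<n. A $$ (r, j) * Y $$ (l, j)) = 0"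
  shows "same_gr_point d X Y"
proof -
  have Ac: "A \<in> carrier_mat k n" and Xc: "X \<in> carrier_mat d n" and Yc: "Y \<in> carrier_mat d n"
    using A X Y unfolding gr_rep_def by auto
  obtain is0 where is0: "length is0 = k" "set is0 \<subseteq> {..<n}" "distinct is0" "dt (colmat k (\<lambda>r j. A $$ (r, j)) is0) \<noteq> 0"
    using full_rank_minor[OF A] by metis
  define I where "I = set is0"
  have I: "I \<subseteq> {..<n}" "card I = k" "finite I" using is0 distinct_card unfolding I_def by auto
  have pA: "pluecker A I \<noteq> 0"
  proof -
    have "sort is0 = sorted_list_of_set I"
      unfolding I_def using is0(3) by (simp add: sorted_list_of_set_sort_remdups distinct_remdups_id)
    then have "dt (colmat k (\<lambda>r j. A $$ (r, j)) is0) = lsign is0 * pluecker A I"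
      using det_sort[of "[]" is0 k "\<lambda>r j. A $$ (r, j)" id] is0(1) pluecker_colmat[OF Ac I(1,2)] by simp
    then show ?thesis using is0(4) by auto
  qed
  let ?js = "sorted_list_of_set ({..<n} - I)"
  have cJ: "card ({..<n} - I) = d" using I kd by (simp add: card_Diff_subset)
  have js: "length ?js = d" "set ?js = {..<n} - I" using cJ by auto
  obtain c c' where "pluecker X ({..<n} - I) = c * (-1) ^ (\<Sum>I) * pluecker A I" "c \<noteq> 0"
    "pluecker Y ({..<n} - I) = c' * (-1) ^ (\<Sum>I) * pluecker A I" "c' \<noteq> 0"
    using complementary_minors[OF A X kd orthX] complementary_minors[OF A Y kd orthY] I(1,2) by metis
  then have "pluecker X ({..<n} - I) \<noteq> 0" "pluecker Y ({..<n} - I) \<noteq> 0" using pA by auto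
  then have XJ: "dt (colmat d (\<lambda>r j. X $$ (r, j)) ?js) \<noteq> 0" and YJ: "dt (colmat d (\<lambda>r j. Y $$ (r, j)) ?js) \<noteq> 0"
    using pluecker_colmat[OF Xc _ cJ] pluecker_colmat[OF Yc _ cJ] by auto
  let ?XJ = "colmat d (\<lambda>r j. X $$ (r, j)) ?js" and ?YJ = "colmat d (\<lambda>r j. Y $$ (r, j)) ?js"
  have carr: "?XJ \<in> carrier_mat d d" "?YJ \<in> carrier_mat d d" using js by auto
  define N where "N = (1 / dt ?XJ) \<cdot>\<^sub>m adj_mat ?XJ"
  have N: "N \<in> carrier_mat d d" unfolding N_def using adj_mat(1)[OF carr(1)] by simp
  have NX: "N * ?XJ = 1\<^sub>m d" "?XJ * N = 1\<^sub>m d"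
    unfolding N_def using adj_mat[OF carr(1)] carr(1) XJ
    by (auto simp: mult_smult_assoc_mat[of _ d d] mult_smult_distrib[of _ d d] intro!: eq_matI)
  define C where "C = ?YJ * N"
  have C: "C \<in> carrier_mat d d" unfolding C_def using carr N by simp
  have CX: "C * ?XJ = ?YJ"
    unfolding C_def using assoc_mult_mat[OF carr(2) N carr(1)] NX(1) right_mult_one_mat[OF carr(2)] by simp
  have "dt C \<noteq> 0"
  proof
    assume "dt C = 0"
    then have "dt ?YJ = 0" using det_mult[OF C carr(1)] CX by simp
    then show False using YJ by simp
  qed
  then have inv: "invertible_mat C"
  proof -
    let ?D = "(1 / dt C) \<cdot>\<^sub>m adj_mat C"
    have "C * ?D = 1\<^sub>m d" "?D * C = 1\<^sub>m d"
      using adj_mat[OF C] C \<open>dt C \<noteq> 0\<close>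
      by (auto simp: mult_smult_assoc_mat[of _ d d] mult_smult_distrib[of _ d d] intro!: eq_matI)
    moreover have "dim_row ?D = d" using adj_mat(1)[OF C] by simp
    ultimately show ?thesis
      unfolding invertible_mat_def inverts_mat_def using C by (auto simp: square_mat.simps)
  qed
  have "Y = C * X"
  proof (intro eq_matI)
    show "dim_row Y = dim_row (C * X)" "dim_col Y = dim_col (C * X)" using C Xc Yc by auto
    fix l j assume "l < dim_row (C * X)" "j < dim_col (C * X)"
    then have lj: "l < d" "j < n" using C Xc by auto
    define z where "z j = Y $$ (l, j) - (C * X) $$ (l, j)" for j
    have CXe: "(C * X) $$ (l, j) = (\<Sum>i<d. C $$ (l, i) * X $$ (i, j))" if "j < n" for j
      using lj that C Xc by (auto simp: scalar_prod_def lessThan_atLeast0 intro!: sum.cong)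
    have zJ: "z j = 0" if j: "j \<in> {..<n} - I" for j
    proof -
      have "j \<in> set ?js" using j js(2) by simp
      then obtain c where c: "c < d" "?js ! c = j" using js(1) by (metis in_set_conv_nth)
      have "(C * ?XJ) $$ (l, c) = (\<Sum>i<d. C $$ (l, i) * X $$ (i, j))"
        using lj c C carr js by (auto simp: scalar_prod_def lessThan_atLeast0 intro!: sum.cong)
      then have "Y $$ (l, j) = (C * X) $$ (l, j)"
        using CX CXe[of j] j c js lj by simp
      then show ?thesis unfolding z_def by simp
    qed
    have zA: "(\<Sum>j<n. A $$ (r, j) * z j) = 0" if r: "r < k" for r
    proof -
      have "(\<Sum>j<n. A $$ (r, j) * z j) = (\<Sum>j<n. A $$ (r, j) * Y $$ (l, j)) - (\<Sum>j<n. \<Sum>i<d. A $$ (r, j) * (C $$ (l, i) * X $$ (i, j)))"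
        unfolding z_def by (simp add: right_diff_distrib sum_subtractf CXe sum_distrib_left)
      also have "(\<Sum>j<n. \<Sum>i<d. A $$ (r, j) * (C $$ (l, i) * X $$ (i, j))) = (\<Sum>i<d. C $$ (l, i) * (\<Sum>j<n. A $$ (r, j) * X $$ (i, j)))"
        unfolding sum_distrib_left by (subst sum.swap) (simp add: ac_simps)
      finally show ?thesis using orthX[OF r] orthY[OF r lj(1)] by simp
    qed
    have "z (is0 ! c) = 0" if "c < k" for c
    proof (rule det_kernel[OF _ is0(4), where z = "\<lambda>c. z (is0 ! c)"])
      show "colmat k (\<lambda>r j. A $$ (r, j)) is0 \<in> carrier_mat k k" using is0 by simp
      fix r assume r: "r < k"
      have "(\<Sum>c<k. A $$ (r, is0 ! c) * z (is0 ! c)) = (\<Sum>j \<in> I. A $$ (r, j) * z j)"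
        by (rule sum.reindex_bij_betw[of "\<lambda>c. is0 ! c"])
          (use is0 in \<open>auto simp: I_def bij_betw_def inj_on_def nth_eq_iff_index_eq set_conv_nth\<close>)
      also have "\<dots> = (\<Sum>j<n. A $$ (r, j) * z j)"
        using I zJ by (intro sum.mono_neutral_left) auto
      finally show "(\<Sum>c<k. colmat k (\<lambda>r j. A $$ (r, j)) is0 $$ (r, c) * z (is0 ! c)) = 0"
        using zA[OF r] r is0(1) by simp
    qed (rule that)
    then have "z j = 0"
      using zJ[of j] lj(2) is0(1) unfolding I_def by (cases "j \<in> set is0") (auto simp: in_set_conv_nth)
    then show "Y $$ (l, j) = (C * X) $$ (l, j)" unfolding z_def by simp
  qed
  then show ?thesis unfolding same_gr_point_def using C inv by blast
qed

lemma spanning_cols_gr_rep: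
  assumes "set vs \<subseteq> carrier_vec d" "length vs = n"
    and "LinearCombinations.module.span class_ring (module_vec TYPE(complex) d) (set vs) = carrier_vec d"
  shows "gr_rep d n (mat_of_cols d vs)"
proof -
  interpret vec_space "TYPE(complex)" d .
  have "cols (mat_of_cols d vs) = vs" by (rule cols_mat_of_cols[OF assms(1)])
  then have "rank (mat_of_cols d vs) = vectorspace.dim class_ring (module_vec TYPE(complex) d\<lparr>carrier := carrier_vec d\<rparr>)"
    unfolding rank_def using assms(3) by simp
  also have "module_vec TYPE(complex) d\<lparr>carrier := carrier_vec d\<rparr> = module_vec TYPE(complex) d"
    by (simp add: module_vec_def)
  finally have "rank (mat_of_cols d vs) = d" using dim_is_n by simp
  then show ?thesis unfolding gr_rep_def using assms(2) mat_of_cols_carrier(1)[of d vs] by simp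
qed

section \<open>Matchings and the Kasteleyn matrix\<close>

context reduced_disk_graph
begin

text \<open>The black inner vertices.\<close>

abbreviation Bint where "Bint \<equiv> internal_verts G \<inter> black G"

text \<open>An almost perfect matching, given by the partners of the white vertices (with the default value
  elsewhere); the set of indices of the boundary vertices that it uses; and its set of edges.\<close>

definition matchfun :: "(complex \<Rightarrow> complex) \<Rightarrow> bool" where
  "matchfun \<mu> \<longleftrightarrow> \<mu> \<in> extensional (white G) \<and> (\<forall>w \<in> white G. pg.adj w (\<mu> w)) \<and>
     inj_on \<mu> (white G) \<and> Bint \<subseteq> \<mu> ` white G"

definition bd :: "(complex \<Rightarrow> complex) \<Rightarrow> nat set" where
  "bd \<mu> = {j. j < n \<and> pt j \<in> \<mu> ` white G}"

definition medges :: "(complex \<Rightarrow> complex) \<Rightarrow> complex set set" where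
  "medges \<mu> = (\<lambda>w. pg.ed w (\<mu> w)) ` white G"

lemma finite_white: "finite (white G)" and finite_black: "finite (black G)"
  using finite_verts unfolding verts_def by auto

lemma adj_ends:
  assumes "pg.adj w b" "w \<in> white G"
  shows "b \<in> black G" "pg.ed w b \<in> edges G" "wh (pg.ed w b) = w" "bl (pg.ed w b) = b"
proof -
  have e: "pg.ed w b \<in> edges G" "pg.ed w b \<inter> verts G = {w, b}" using pg.ed_props[OF assms(1)] by auto
  then have "{w, b} = {bl (pg.ed w b), wh (pg.ed w b)}" using edge_ends(5)[OF e(1)] by simp
  moreover have "w \<noteq> bl (pg.ed w b)" using edge_ends(1)[OF e(1)] assms(2) bw_disjoint by auto
  ultimately have "wh (pg.ed w b) = w" "bl (pg.ed w b) = b" by (auto simp: doubleton_eq_iff)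
  then show "b \<in> black G" "pg.ed w b \<in> edges G" "wh (pg.ed w b) = w" "bl (pg.ed w b) = b"
    using e edge_ends(1)[OF e(1)] by auto
qed

lemma edge_is_ed:
  assumes "e \<in> edges G"
  shows "pg.adj (wh e) (bl e)" "e = pg.ed (wh e) (bl e)"
proof -
  have e: "e \<inter> verts G = {wh e, bl e}" "wh e \<noteq> bl e" using edge_ends(5,6)[OF assms] by auto
  then show "pg.adj (wh e) (bl e)" unfolding pg.adj_def using assms by blast
  show "e = pg.ed (wh e) (bl e)" using pg.ed_eqI[OF assms e(1)] by simp
qed

lemma black_split: "black G = Bint \<union> set (bdry G)" "Bint \<inter> set (bdry G) = {}"
  using bdry_black unfolding internal_verts_def verts_def by auto

lemma matchfun_black: "matchfun \<mu> \<Longrightarrow> w \<in> white G \<Longrightarrow> \<mu> w \<in> black G"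
  using adj_ends(1) unfolding matchfun_def by blast

lemma matchfun_image:
  assumes "matchfun \<mu>"
  shows "\<mu> ` white G = Bint \<union> pt ` bd \<mu>"
proof
  show "Bint \<union> pt ` bd \<mu> \<subseteq> \<mu> ` white G" using assms unfolding matchfun_def bd_def by blast
  have "\<mu> ` white G \<subseteq> Bint \<union> set (bdry G)" using matchfun_black[OF assms] black_split(1) by blast
  then have sub: "\<mu> ` white G \<subseteq> Bint \<union> pt ` {..<n}" unfolding set_bdry .
  show "\<mu> ` white G \<subseteq> Bint \<union> pt ` bd \<mu>"
  proof
    fix x assume x: "x \<in> \<mu> ` white G"
    then consider "x \<in> Bint" | j where "j < n" "x = pt j" using sub by blast
    then show "x \<in> Bint \<union> pt ` bd \<mu>"
    proof cases
      case 2
      then have "j \<in> bd \<mu>" using x unfolding bd_def by simp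
      then show ?thesis using 2(2) by blast
    qed simp
  qed
qed

lemma medges_matching:
  assumes \<mu>: "matchfun \<mu>"
  shows "almost_perfect_matching G (medges \<mu>)" "matching_boundary G (medges \<mu>) = bd \<mu>"
    "(\<Prod>e \<in> medges \<mu>. t e) = (\<Prod>w \<in> white G. t (pg.ed w (\<mu> w)) :: complex)"
proof -
  have adj: "pg.adj w (\<mu> w)" if "w \<in> white G" for w using \<mu> that unfolding matchfun_def by blast
  have ME: "medges \<mu> \<subseteq> edges G" unfolding medges_def using adj_ends(2)[OF adj] by blast
  have inj: "inj_on (\<lambda>w. pg.ed w (\<mu> w)) (white G)"
  proof (rule inj_onI)
    fix w w' assume w: "w \<in> white G" "w' \<in> white G" "pg.ed w (\<mu> w) = pg.ed w' (\<mu> w')"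
    then show "w = w'" using adj_ends(3)[OF adj[OF w(1)] w(1)] adj_ends(3)[OF adj[OF w(2)] w(2)] by metis
  qed
  have at_black: "x \<in> pg.ed w (\<mu> w) \<longleftrightarrow> x = \<mu> w" if "w \<in> white G" "x \<in> black G" for w x
    unfolding black_in_edge[OF adj_ends(2)[OF adj[OF that(1)] that(1)] that(2)]
      adj_ends(4)[OF adj[OF that(1)] that(1)] by (rule refl)
  have at_white: "x \<in> pg.ed w (\<mu> w) \<longleftrightarrow> x = w" if "w \<in> white G" "x \<in> white G" for w x
    unfolding white_in_edge[OF adj_ends(2)[OF adj[OF that(1)] that(1)] that(2)]
      adj_ends(3)[OF adj[OF that(1)] that(1)] by (rule refl)
  have "card {e \<in> medges \<mu>. x \<in> e} = 1" if x: "x \<in> internal_verts G" for x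
  proof (cases "x \<in> white G")
    case True
    have "{e \<in> medges \<mu>. x \<in> e} = {pg.ed x (\<mu> x)}"
      unfolding medges_def using at_white[OF _ True] True by auto
    then show ?thesis by simp
  next
    case False
    then have xb: "x \<in> black G" using x unfolding internal_verts_def verts_def by blast
    then obtain w where w: "w \<in> white G" "x = \<mu> w" using \<mu> x unfolding matchfun_def by blast
    have "inj_on \<mu> (white G)" using \<mu> unfolding matchfun_def by blast
    then have "{e \<in> medges \<mu>. x \<in> e} = {pg.ed w (\<mu> w)}"
      unfolding medges_def using at_black[OF _ xb] w by (auto dest: inj_onD)
    then show ?thesis by simp
  qed
  moreover have "card {e \<in> medges \<mu>. b \<in> e} \<le> 1" if b: "b \<in> set (bdry G)" for b
  proof -
    have "{e \<in> medges \<mu>. b \<in> e} \<subseteq> {bedge b}" using edge_at_bdry[OF _ _ b] ME by blast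
    then show ?thesis using card_mono[of "{bedge b}" "{e \<in> medges \<mu>. b \<in> e}"] by simp
  qed
  ultimately show M: "almost_perfect_matching G (medges \<mu>)"
    unfolding almost_perfect_matching_def using ME by blast
  have "j \<in> matching_boundary G (medges \<mu>) \<longleftrightarrow> j \<in> bd \<mu>" for j
  proof (cases "j < n")
    case True
    have b: "pt j \<in> set (bdry G)" "pt j \<in> black G" using pt_in_bdry[OF True] bdry_black by auto
    have "j \<in> matching_boundary G (medges \<mu>) \<longleftrightarrow> bedge (pt j) \<in> medges \<mu>"
      using matching_boundary_iff[OF M] True len_bdry pt_bdry by simp
    also have "\<dots> \<longleftrightarrow> (\<exists>e \<in> medges \<mu>. pt j \<in> e)"
      using edge_at_bdry[OF _ _ b(1)] bedge(3)[OF b(1)] ME by blast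
    also have "\<dots> \<longleftrightarrow> pt j \<in> \<mu> ` white G" unfolding medges_def using at_black[OF _ b(2)] by auto
    finally show ?thesis unfolding bd_def using True by simp
  next
    case False
    then show ?thesis unfolding matching_boundary_def bd_def using len_bdry by simp
  qed
  then show "matching_boundary G (medges \<mu>) = bd \<mu>" by blast
  show "(\<Prod>e \<in> medges \<mu>. t e) = (\<Prod>w \<in> white G. t (pg.ed w (\<mu> w)))"
    unfolding medges_def using inj by (simp add: prod.reindex)
qed

lemma medges_bij: "bij_betw medges {\<mu>. matchfun \<mu>} {M. almost_perfect_matching G M}"
  unfolding bij_betw_def
proof
  show "inj_on medges {\<mu>. matchfun \<mu>}"
  proof (rule inj_onI)
    fix \<mu> \<mu>' assume a: "\<mu> \<in> {\<mu>. matchfun \<mu>}" "\<mu>' \<in> {\<mu>. matchfun \<mu>}" "medges \<mu> = medges \<mu>'"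
    have adj: "pg.adj w (\<mu> w)" "pg.adj w (\<mu>' w)" if "w \<in> white G" for w
      using a that unfolding matchfun_def by auto
    have "\<mu> w = \<mu>' w" if w: "w \<in> white G" for w
    proof -
      have "pg.ed w (\<mu> w) \<in> medges \<mu>'" using w a(3) unfolding medges_def by blast
      then obtain w' where w': "w' \<in> white G" "pg.ed w (\<mu> w) = pg.ed w' (\<mu>' w')" unfolding medges_def by blast
      then show ?thesis using adj_ends(3,4)[OF adj(1)[OF w] w] adj_ends(3,4)[OF adj(2)[OF w'(1)] w'(1)] by auto
    qed
    then show "\<mu> = \<mu>'" using a unfolding matchfun_def by (auto intro: extensionalityI)
  qed
  show "medges ` {\<mu>. matchfun \<mu>} = {M. almost_perfect_matching G M}"
  proof
    show "medges ` {\<mu>. matchfun \<mu>} \<subseteq> {M. almost_perfect_matching G M}" using medges_matching(1) by blast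
    show "{M. almost_perfect_matching G M} \<subseteq> medges ` {\<mu>. matchfun \<mu>}"
    proof
      fix M assume "M \<in> {M. almost_perfect_matching G M}"
      then have M: "almost_perfect_matching G M" by simp
      have ME: "M \<subseteq> edges G" by (rule matching_edges[OF M])
      have "\<exists>e. e \<in> M \<and> w \<in> e" if "w \<in> white G" for w
        using matching_covers[OF M] white_internal that by blast
      then obtain f where f: "\<And>w. w \<in> white G \<Longrightarrow> f w \<in> M \<and> w \<in> f w" by metis
      have fE: "f w \<in> edges G" "wh (f w) = w" "f w = pg.ed w (bl (f w))" "pg.adj w (bl (f w))" if "w \<in> white G" for w
      proof -
        show 1: "f w \<in> edges G" using f[OF that] ME by blast
        show 2: "wh (f w) = w" using white_in_edge[OF 1 that] f[OF that] by simp
        show "f w = pg.ed w (bl (f w))" "pg.adj w (bl (f w))" using edge_is_ed[OF 1] 2 by auto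
      qed
      define \<mu> where "\<mu> = restrict (\<lambda>w. bl (f w)) (white G)"
      have \<mu>w: "\<mu> w = bl (f w)" if "w \<in> white G" for w using that unfolding \<mu>_def by simp
      have inj: "inj_on \<mu> (white G)"
      proof (rule inj_onI)
        fix w w' assume w: "w \<in> white G" "w' \<in> white G" "\<mu> w = \<mu> w'"
        have "bl (f w) \<in> f w" "bl (f w) \<in> f w'" "bl (f w) \<in> verts G"
          using edge_ends(5)[OF fE(1)[OF w(1)]] edge_ends(5)[OF fE(1)[OF w(2)]] w(3) \<mu>w[OF w(1)] \<mu>w[OF w(2)] by auto
        then have "f w = f w'" using matching_unique[OF M] f[OF w(1)] f[OF w(2)] by blast
        then show "w = w'" using fE(2)[OF w(1)] fE(2)[OF w(2)] by metis
      qed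
      have "b \<in> \<mu> ` white G" if b: "b \<in> Bint" for b
      proof -
        obtain e where e: "e \<in> M" "b \<in> e" using matching_covers[OF M, of b] b by blast
        have eE: "e \<in> edges G" using e ME by blast
        have w: "wh e \<in> white G" "wh e \<in> e" using edge_ends[OF eE] by auto
        then have "f (wh e) = e"
          using matching_unique[OF M _ e(1), of "f (wh e)" "wh e"] f[OF w(1)] unfolding verts_def by blast
        moreover have "b = bl e" using black_in_edge[OF eE] b e(2) by blast
        ultimately show ?thesis using \<mu>w[OF w(1)] w(1) by force
      qed
      then have mf: "matchfun \<mu>" unfolding matchfun_def using inj fE(4) \<mu>w by (auto simp: \<mu>_def)
      have "medges \<mu> = M"
      proof
        show "medges \<mu> \<subseteq> M"
        proof
          fix e assume "e \<in> medges \<mu>"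
          then obtain w where w: "w \<in> white G" "e = pg.ed w (\<mu> w)" unfolding medges_def by blast
          then have "e = f w" using fE(3)[OF w(1)] \<mu>w[OF w(1)] by simp
          then show "e \<in> M" using f[OF w(1)] by simp
        qed
        show "M \<subseteq> medges \<mu>"
        proof
          fix e assume e: "e \<in> M"
          have w: "wh e \<in> white G" "wh e \<in> e" using edge_ends[of e] e ME by auto
          have "e = f (wh e)"
            using matching_unique[OF M e, of "f (wh e)" "wh e"] f[OF w(1)] w unfolding verts_def by blast
          then have "e = pg.ed (wh e) (\<mu> (wh e))" using fE(3)[OF w(1)] \<mu>w[OF w(1)] by simp
          then show "e \<in> medges \<mu>" unfolding medges_def using w(1) by blast
        qed
      qed
      then show "M \<in> medges ` {\<mu>. matchfun \<mu>}" using mf by blast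
    qed
  qed
qed

lemma finite_matchfun: "finite {\<mu>. matchfun \<mu>}"
proof -
  have "{M. almost_perfect_matching G M} \<subseteq> Pow (edges G)" using matching_edges by blast
  then have "finite {M. almost_perfect_matching G M}" using finite_edges by (meson finite_Pow_iff finite_subset)
  then show ?thesis using medges_bij bij_betw_finite by blast
qed

lemma bd_positroid: "positroid G = bd ` {\<mu>. matchfun \<mu>}"
proof -
  have "positroid G = matching_boundary G ` (medges ` {\<mu>. matchfun \<mu>})"
    unfolding positroid_matchings using medges_bij unfolding bij_betw_def by simp
  also have "\<dots> = bd ` {\<mu>. matchfun \<mu>}" unfolding image_image by (intro image_cong) (simp_all add: medges_matching(2))
  finally show ?thesis .
qed

lemma boundary_measurement_sum:
  "boundary_measurement G t I = (\<Sum>\<mu> | matchfun \<mu> \<and> bd \<mu> = I. \<Prod>w \<in> white G. t (pg.ed w (\<mu> w)))"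
proof -
  have "bij_betw medges {\<mu>. matchfun \<mu> \<and> bd \<mu> = I} {M. almost_perfect_matching G M \<and> matching_boundary G M = I}"
  proof (rule bij_betw_subset[OF medges_bij])
    show "{\<mu>. matchfun \<mu> \<and> bd \<mu> = I} \<subseteq> {\<mu>. matchfun \<mu>}" by blast
    have im: "medges ` {\<mu>. matchfun \<mu>} = {M. almost_perfect_matching G M}"
      using medges_bij unfolding bij_betw_def by blast
    show "medges ` {\<mu>. matchfun \<mu> \<and> bd \<mu> = I} = {M. almost_perfect_matching G M \<and> matching_boundary G M = I}"
    proof
      show "medges ` {\<mu>. matchfun \<mu> \<and> bd \<mu> = I} \<subseteq> {M. almost_perfect_matching G M \<and> matching_boundary G M = I}"
        using medges_matching(1,2) by blast
      show "{M. almost_perfect_matching G M \<and> matching_boundary G M = I} \<subseteq> medges ` {\<mu>. matchfun \<mu> \<and> bd \<mu> = I}"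
      proof
        fix M assume M: "M \<in> {M. almost_perfect_matching G M \<and> matching_boundary G M = I}"
        then have "M \<in> medges ` {\<mu>. matchfun \<mu>}" unfolding im by blast
        then obtain \<mu> where \<mu>: "matchfun \<mu>" "M = medges \<mu>" by blast
        then have "bd \<mu> = I" using M medges_matching(2)[OF \<mu>(1)] by simp
        then show "M \<in> medges ` {\<mu>. matchfun \<mu> \<and> bd \<mu> = I}" using \<mu> by blast
      qed
    qed
  qed
  note bij = this
  show ?thesis
    unfolding boundary_measurement_def sum.reindex_bij_betw[OF bij, of "\<lambda>M. prod t M", symmetric]
    by (intro sum.cong refl) (simp add: medges_matching(3))
qed

lemma card_bd: "matchfun \<mu> \<Longrightarrow> card (bd \<mu>) = k"
  using bd_positroid type unfolding has_type_def by blast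

text \<open>Enumerations of the white vertices, which number the rows of the Kasteleyn matrix, and of the black inner
  vertices; the number of rows.\<close>

definition WL :: "complex list" where "WL = (SOME l. set l = white G \<and> distinct l)"
definition BL :: "complex list" where "BL = (SOME l. set l = Bint \<and> distinct l)"
definition mm :: nat where "mm = card (white G)"

lemma WL: "set WL = white G" "distinct WL" "length WL = mm"
proof -
  have "\<exists>l. set l = white G \<and> distinct l" using finite_distinct_list[OF finite_white] .
  then have "set WL = white G \<and> distinct WL" unfolding WL_def by (rule someI_ex)
  then show "set WL = white G" "distinct WL" "length WL = mm" unfolding mm_def using distinct_card by metis+
qed

lemma BL: "set BL = Bint" "distinct BL"
proof -
  have "finite Bint" using finite_black by simp
  then have "\<exists>l. set l = Bint \<and> distinct l" by (rule finite_distinct_list)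
  then have "set BL = Bint \<and> distinct BL" unfolding BL_def by (rule someI_ex)
  then show "set BL = Bint" "distinct BL" by auto
qed

lemma exists_matchfun: "\<exists>\<mu>. matchfun \<mu>"
proof -
  have "positroid G \<noteq> {}" using irr n_ge_2 unfolding irreducible_positroid_def by fastforce
  then show ?thesis unfolding bd_positroid by blast
qed

lemma len_BL: "length BL + k = mm"
proof -
  obtain \<mu> where \<mu>: "matchfun \<mu>" using exists_matchfun by blast
  have "card (\<mu> ` white G) = mm" using \<mu> unfolding matchfun_def mm_def by (simp add: card_image)
  moreover have "card (\<mu> ` white G) = card Bint + card (pt ` bd \<mu>)"
    unfolding matchfun_image[OF \<mu>] using finite_black black_split(2) set_bdry
    by (intro card_Un_disjoint) (auto simp: bd_def)
  moreover have "card (pt ` bd \<mu>) = k"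
    using card_bd[OF \<mu>] pt_inj by (subst card_image) (auto simp: inj_on_def bd_def)
  ultimately show ?thesis using BL distinct_card by metis
qed

text \<open>The sign with which a matching enters the expansion of the minor of the Kasteleyn matrix with
  the inner columns and the boundary columns in the list \<open>is\<close>.\<close>

definition msign :: "(complex set \<Rightarrow> int) \<Rightarrow> (complex \<Rightarrow> complex) \<Rightarrow> nat list \<Rightarrow> complex" where
  "msign \<sigma> \<mu> is = of_int (\<Prod>w \<in> white G. \<sigma> (pg.ed w (\<mu> w))) *
     dt (colmat mm (\<lambda>i b. of_bool (b = \<mu> (WL ! i))) (BL @ map pt is))"

text \<open>The Kasteleyn matrix. Its rows are numbered, its columns are the black vertices.\<close>

definition kast :: "(complex set \<Rightarrow> int) \<Rightarrow> (complex set \<Rightarrow> complex) \<Rightarrow> nat \<Rightarrow> complex \<Rightarrow> complex" where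
  "kast \<sigma> t i b = (if pg.adj (WL ! i) b then of_int (\<sigma> (pg.ed (WL ! i) b)) * t (pg.ed (WL ! i) b) else 0)"

lemma prod_WL: "(\<Prod>i<mm. f (WL ! i)) = (\<Prod>w \<in> white G. f w)"
proof (rule prod.reindex_bij_betw)
  show "bij_betw (\<lambda>i. WL ! i) {..<mm} (white G)"
    using bij_betw_nth[OF WL(2)] WL by auto
qed

text \<open>The terms of the Leibniz formula that do not vanish correspond to the matchings with the given boundary.\<close>

lemma kast_minor:
  assumes "is": "length is = k" "distinct is" "set is \<subseteq> {..<n}"
  shows "dt (colmat mm (kast \<sigma> t) (BL @ map pt is)) =
    (\<Sum>\<mu> | matchfun \<mu> \<and> bd \<mu> = set is. (\<Prod>w \<in> white G. t (pg.ed w (\<mu> w))) * msign \<sigma> \<mu> is)"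
proof -
  let ?L = "BL @ map pt is"
  let ?S = "{\<mu>. matchfun \<mu> \<and> bd \<mu> = set is}"
  let ?P = "{p. p permutes {0..<mm}}"
  have len: "length ?L = mm" using "is"(1) len_BL by simp
  have ptinj: "inj_on pt (set is)"
  proof (rule inj_onI)
    fix x y assume a: "x \<in> set is" "y \<in> set is" "pt x = pt y"
    then have "x \<le> n" "y \<le> n" using "is"(3) by auto
    then show "x = y" using pt_inj[of x y] a(3) by simp
  qed
  have disj: "Bint \<inter> pt ` set is = {}" using black_split(2) "is"(3) unfolding set_bdry by blast
  have distL: "distinct ?L"
    unfolding distinct_append distinct_map set_map BL(1) using BL(2) "is"(2) ptinj disj by (intro conjI)
  have setL: "set ?L = Bint \<union> pt ` set is" unfolding set_append set_map BL(1) ..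
  have leib: "dt (colmat mm f ?L) = (\<Sum>p \<in> ?P. of_int (sign p) * (\<Prod>i<mm. f i (?L ! p i)))" for f
  proof -
    have "p i < mm" if "p permutes {0..<mm}" "i < mm" for p i
      using that permutes_in_image[of p "{0..<mm}" i] by simp
    then show ?thesis
      using det_def'[of "colmat mm f ?L" mm] len by (auto simp: lessThan_atLeast0 intro!: sum.cong prod.cong)
  qed
  have key: "(\<Sum>\<mu> \<in> ?S. (\<Prod>w \<in> white G. t (pg.ed w (\<mu> w)) * of_int (\<sigma> (pg.ed w (\<mu> w)))) * (\<Prod>i<mm. of_bool (?L ! p i = \<mu> (WL ! i))))
      = (\<Prod>i<mm. kast \<sigma> t i (?L ! p i))" if p: "p permutes {0..<mm}" for p
  proof -
    define idx where "idx w = (THE i. i < mm \<and> WL ! i = w)" for w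
    have idx: "idx (WL ! i) = i" if "i < mm" for i
      unfolding idx_def using that WL by (intro the_equality) (auto simp: nth_eq_iff_index_eq)
    define \<nu> where "\<nu> = restrict (\<lambda>w. ?L ! p (idx w)) (white G)"
    have WLw: "WL ! i \<in> white G" if "i < mm" for i using that WL nth_mem by metis
    have \<nu>: "\<nu> (WL ! i) = ?L ! p i" if "i < mm" for i unfolding \<nu>_def using idx[OF that] WLw[OF that] by simp
    have pim: "p ` {..<mm} = {..<mm}" using permutes_image[OF p] by (simp add: lessThan_atLeast0)
    have whites: "white G = (\<lambda>i. WL ! i) ` {..<mm}" using WL by (auto simp: set_conv_nth)
    have "\<nu> ` white G = (\<lambda>i. ?L ! p i) ` {..<mm}" unfolding whites image_image using \<nu> by (intro image_cong) auto
    also have "\<dots> = (\<lambda>c. ?L ! c) ` (p ` {..<mm})" by (simp add: image_image)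
    also have "\<dots> = set ?L" unfolding pim set_conv_nth using len by auto
    finally have im: "\<nu> ` white G = set ?L" .
    have uniq: "\<mu> = \<nu>" if "\<mu> \<in> ?S" "\<forall>i<mm. ?L ! p i = \<mu> (WL ! i)" for \<mu>
    proof (rule extensionalityI[of _ "white G"])
      show "\<mu> \<in> extensional (white G)" using that unfolding matchfun_def by blast
      show "\<nu> \<in> extensional (white G)" unfolding \<nu>_def by simp
      fix w assume "w \<in> white G"
      then obtain i where "i < mm" "w = WL ! i" unfolding whites by blast
      then show "\<mu> w = \<nu> w" using that(2) \<nu> by simp
    qed
    show ?thesis
    proof (cases "\<forall>i<mm. pg.adj (WL ! i) (?L ! p i)")
      case True
      have "inj_on \<nu> (white G)"
      proof (rule eq_card_imp_inj_on[OF finite_white])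
        show "card (\<nu> ` white G) = card (white G)" unfolding im using distinct_card[OF distL] len mm_def by simp
      qed
      moreover have "pg.adj w (\<nu> w)" if "w \<in> white G" for w
        using that True \<nu> unfolding whites by auto
      ultimately have mf: "matchfun \<nu>" unfolding matchfun_def using im setL by (auto simp: \<nu>_def)
      have "bd \<nu> = set is"
      proof -
        have "j \<in> bd \<nu> \<longleftrightarrow> j \<in> set is" for j
        proof -
          have "pt j \<notin> Bint" if "j < n" using black_split(2) pt_in_bdry[OF that] by blast
          moreover have "pt j \<in> pt ` set is \<longleftrightarrow> j \<in> set is" if "j < n"
          proof
            assume "pt j \<in> pt ` set is"
            then obtain i where "i \<in> set is" "pt j = pt i" by blast
            then show "j \<in> set is" using pt_inj[of j i] "is"(3) that by auto
          qed simp
          ultimately show ?thesis unfolding bd_def im setL using "is"(3) by auto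
        qed
        then show ?thesis by blast
      qed
      then have \<nu>S: "\<nu> \<in> ?S" using mf by simp
      have "(\<Sum>\<mu> \<in> ?S. (\<Prod>w \<in> white G. t (pg.ed w (\<mu> w)) * of_int (\<sigma> (pg.ed w (\<mu> w)))) * (\<Prod>i<mm. of_bool (?L ! p i = \<mu> (WL ! i))))
          = (\<Sum>\<mu> \<in> {\<nu>}. (\<Prod>w \<in> white G. t (pg.ed w (\<mu> w)) * of_int (\<sigma> (pg.ed w (\<mu> w)))) * (\<Prod>i<mm. of_bool (?L ! p i = \<mu> (WL ! i))))"
      proof (rule sum.mono_neutral_right)
        show "finite ?S" using finite_matchfun by simp
        show "{\<nu>} \<subseteq> ?S" using \<nu>S by simp
        show "\<forall>\<mu> \<in> ?S - {\<nu>}. (\<Prod>w \<in> white G. t (pg.ed w (\<mu> w)) * of_int (\<sigma> (pg.ed w (\<mu> w)))) * (\<Prod>i<mm. of_bool (?L ! p i = \<mu> (WL ! i))) = 0"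
        proof
          fix \<mu> assume "\<mu> \<in> ?S - {\<nu>}"
          then obtain i where "i < mm" "?L ! p i \<noteq> \<mu> (WL ! i)" using uniq by blast
          then have "(\<Prod>i<mm. of_bool (?L ! p i = \<mu> (WL ! i)) :: complex) = 0" by (intro prod_zero) auto
          then show "(\<Prod>w \<in> white G. t (pg.ed w (\<mu> w)) * of_int (\<sigma> (pg.ed w (\<mu> w)))) * (\<Prod>i<mm. of_bool (?L ! p i = \<mu> (WL ! i))) = 0" by simp
        qed
      qed
      also have "\<dots> = (\<Prod>i<mm. t (pg.ed (WL ! i) (\<nu> (WL ! i))) * of_int (\<sigma> (pg.ed (WL ! i) (\<nu> (WL ! i)))))"
        using \<nu> prod_WL[of "\<lambda>w. t (pg.ed w (\<nu> w)) * of_int (\<sigma> (pg.ed w (\<nu> w)))"] by simp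
      also have "\<dots> = (\<Prod>i<mm. kast \<sigma> t i (?L ! p i))"
        using True \<nu> by (intro prod.cong) (auto simp: kast_def)
      finally show ?thesis .
    next
      case False
      then obtain i where i: "i < mm" "\<not> pg.adj (WL ! i) (?L ! p i)" by blast
      then have r: "(\<Prod>i<mm. kast \<sigma> t i (?L ! p i)) = 0" by (intro prod_zero) (auto simp: kast_def)
      have "(\<Prod>i<mm. of_bool (?L ! p i = \<mu> (WL ! i)) :: complex) = 0" if "\<mu> \<in> ?S" for \<mu>
      proof -
        have "pg.adj (WL ! i) (\<mu> (WL ! i))" using that WLw[OF i(1)] unfolding matchfun_def by blast
        then have "?L ! p i \<noteq> \<mu> (WL ! i)" using i(2) by metis
        then show ?thesis using i(1) by (intro prod_zero) auto
      qed
      then show ?thesis unfolding r by (intro sum.neutral) auto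
    qed
  qed
  have "(\<Sum>\<mu> \<in> ?S. (\<Prod>w \<in> white G. t (pg.ed w (\<mu> w))) * msign \<sigma> \<mu> is)
      = (\<Sum>\<mu> \<in> ?S. \<Sum>p \<in> ?P. of_int (sign p) * ((\<Prod>w \<in> white G. t (pg.ed w (\<mu> w)) * of_int (\<sigma> (pg.ed w (\<mu> w)))) * (\<Prod>i<mm. of_bool (?L ! p i = \<mu> (WL ! i)))))"
    unfolding msign_def leib sum_distrib_left by (intro sum.cong refl) (simp add: prod.distrib ac_simps)
  also have "\<dots> = (\<Sum>p \<in> ?P. of_int (sign p) * (\<Sum>\<mu> \<in> ?S. (\<Prod>w \<in> white G. t (pg.ed w (\<mu> w)) * of_int (\<sigma> (pg.ed w (\<mu> w)))) * (\<Prod>i<mm. of_bool (?L ! p i = \<mu> (WL ! i)))))"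
    unfolding sum_distrib_left by (rule sum.swap)
  also have "\<dots> = (\<Sum>p \<in> ?P. of_int (sign p) * (\<Prod>i<mm. kast \<sigma> t i (?L ! p i)))"
    using key by (intro sum.cong) auto
  also have "\<dots> = dt (colmat mm (kast \<sigma> t) ?L)" by (rule leib[symmetric])
  finally show ?thesis by simp
qed

lemma msign_sort:
  assumes "length is = k" "distinct is"
  shows "lsign is * msign \<sigma> \<mu> is = msign \<sigma> \<mu> (sorted_list_of_set (set is))"
proof -
  have "sort is = sorted_list_of_set (set is)"
    using assms(2) by (simp add: sorted_list_of_set_sort_remdups distinct_remdups_id)
  then have "dt (colmat mm (\<lambda>i b. of_bool (b = \<mu> (WL ! i))) (BL @ map pt is)) =
      lsign is * dt (colmat mm (\<lambda>i b. of_bool (b = \<mu> (WL ! i))) (BL @ map pt (sorted_list_of_set (set is))))"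
    using det_sort[of BL "is" mm "\<lambda>i b. of_bool (b = \<mu> (WL ! i))" pt] assms(1) len_BL by simp
  then show ?thesis unfolding msign_def using lsign_sq[of "is"] by (simp add: ac_simps)
qed

end

section \<open>Exchanging matchings along cycles and paths\<close>

context reduced_disk_graph
begin

text \<open>The minor of the incidence matrix of a partner function (not necessarily a matching).\<close>

abbreviation mdet :: "(complex \<Rightarrow> complex) \<Rightarrow> complex list \<Rightarrow> complex" where
  "mdet f L \<equiv> dt (colmat mm (\<lambda>i b. of_bool (b = f (WL ! i))) L)"

lemma WL_white: "i < mm \<Longrightarrow> WL ! i \<in> white G"
  using WL nth_mem by metis

lemma mdet_cong:
  assumes "\<And>w. w \<in> white G \<Longrightarrow> f w = g w"
  shows "mdet f L = mdet g L"
proof -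
  have "colmat mm (\<lambda>i b. of_bool (b = f (WL ! i))) L = colmat mm (\<lambda>i b. of_bool (b = g (WL ! i))) L"
    by (rule eq_matI) (use assms[OF WL_white] in simp_all)
  then show ?thesis by simp
qed

lemma mdet_swap:
  assumes L: "length L = mm" and w: "w \<in> white G" "w' \<in> white G" "w \<noteq> w'"
  shows "mdet (f(w := f w', w' := f w)) L = - mdet f L"
proof -
  obtain i j where ij: "i < mm" "j < mm" "w = WL ! i" "w' = WL ! j"
    using w(1,2) WL in_set_conv_nth by metis
  have ne: "i \<noteq> j" using ij w(3) by blast
  have at: "WL ! c = WL ! i \<longleftrightarrow> c = i" "WL ! c = WL ! j \<longleftrightarrow> c = j" if "c < mm" for c
    using nth_eq_iff_index_eq[OF WL(2)] WL(3) ij that by auto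
  have "colmat mm (\<lambda>i b. of_bool (b = (f(w := f w', w' := f w)) (WL ! i))) L
      = swaprows i j (colmat mm (\<lambda>i b. of_bool (b = f (WL ! i))) L)"
    by (rule eq_matI) (use ij ne at L in \<open>auto simp: mat_swaprows_def\<close>)
  then show ?thesis using det_swaprows[OF ij(1,2) ne colmat_carrier[OF L]] by simp
qed

text \<open>A cyclic shift of the partners along a list of \<open>\<ell>\<close> white vertices is a product of \<open>\<ell> - 1\<close>
  transpositions.\<close>

lemma mdet_rotate:
  assumes "length L = mm" "distinct ws" "ws \<noteq> []" "set ws \<subseteq> white G"
    "successively (\<lambda>w w'. g w = f w') ws" "g (last ws) = f (hd ws)" "\<And>w. w \<in> white G - set ws \<Longrightarrow> g w = f w"
  shows "mdet g L = (-1) ^ (length ws - 1) * mdet f L"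
  using assms(2-)
proof (induction ws arbitrary: f rule: induct_list012)
  case (2 w)
  then have "mdet g L = mdet f L" by (intro mdet_cong) auto
  then show ?case by simp
next
  case (3 w w' r)
  let ?f = "f(w := f w', w' := f w)"
  have "mdet g L = (-1) ^ (length (w' # r) - 1) * mdet ?f L"
  proof (rule "3.IH"(2))
    show "distinct (w' # r)" "w' # r \<noteq> []" "set (w' # r) \<subseteq> white G" using "3.prems" by auto
    show "successively (\<lambda>w w'. g w = ?f w') (w' # r)"
    proof -
      have "successively (\<lambda>w w'. g w = f w') (w' # r)" using "3.prems"(4) by simp
      moreover have "w \<notin> set (w' # r)" "w' \<notin> set r" using "3.prems"(1) by auto
      ultimately show ?thesis
        by (cases r) (auto intro: successively_mono)
    qed
    show "g (last (w' # r)) = ?f (hd (w' # r))" using "3.prems" by simp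
    show "g u = ?f u" if "u \<in> white G - set (w' # r)" for u
      using "3.prems"(1,4,6) that by auto
  qed
  also have "mdet ?f L = - mdet f L" using "3.prems" by (intro mdet_swap assms(1)) auto
  finally show ?case by simp
qed simp

text \<open>Two matchings that differ exactly along an alternating path or cycle with the white vertices \<open>ws\<close>,
  in this order.\<close>

definition exch :: "(complex \<Rightarrow> complex) \<Rightarrow> (complex \<Rightarrow> complex) \<Rightarrow> complex list \<Rightarrow> bool" where
  "exch \<mu> \<nu> ws \<longleftrightarrow> matchfun \<mu> \<and> matchfun \<nu> \<and> ws \<noteq> [] \<and> distinct ws \<and> set ws \<subseteq> white G \<and>
     (\<forall>w \<in> white G - set ws. \<nu> w = \<mu> w) \<and> (\<forall>w \<in> set ws. \<nu> w \<noteq> \<mu> w) \<and>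
     successively (\<lambda>w w'. \<nu> w = \<mu> w') ws"

lemma exch_rev: "exch \<mu> \<nu> ws \<Longrightarrow> exch \<nu> \<mu> (rev ws)"
  unfolding exch_def by (auto simp: eq_commute)

text \<open>The vertices of an alternating path or cycle, without the first black one.\<close>

definition zig :: "(complex \<Rightarrow> complex) \<Rightarrow> complex list \<Rightarrow> complex list" where
  "zig \<nu> ws = concat (map (\<lambda>w. [w, \<nu> w]) ws)"

lemma zig_simps [simp]: "zig \<nu> [] = []" "zig \<nu> (w # ws) = w # \<nu> w # zig \<nu> ws"
  by (simp_all add: zig_def)

lemma zig_append [simp]: "zig \<nu> (us @ ws) = zig \<nu> us @ zig \<nu> ws"
  by (simp add: zig_def)

lemma length_zig [simp]: "length (zig \<nu> ws) = 2 * length ws"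
  by (induction ws) auto

lemma set_zig: "set (zig \<nu> ws) = set ws \<union> \<nu> ` set ws"
  by (induction ws) auto

lemma last_zig: "ws \<noteq> [] \<Longrightarrow> last (zig \<nu> ws) = \<nu> (last ws)"
  by (induction ws rule: rev_induct) auto

lemma rotate_image_path:
  assumes "ws \<noteq> []" "successively (\<lambda>w w'. g w = f w') ws"
  shows "insert (f (hd ws)) (g ` set ws) = insert (g (last ws)) (f ` set ws)"
  using assms by (induction ws rule: induct_list012) auto

lemma rotate_image:
  assumes "ws \<noteq> []" "successively (\<lambda>w w'. g w = f w') ws" "g (last ws) = f (hd ws)"
  shows "g ` set ws = f ` set ws"
proof -
  have "f (hd ws) \<in> f ` set ws" "g (last ws) \<in> g ` set ws" using assms(1) by auto
  then show ?thesis using rotate_image_path[OF assms(1,2)] assms(3) by (metis insert_absorb)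
qed

lemma distinct_zig:
  assumes "distinct ws" "inj_on \<nu> (set ws)" "set ws \<inter> \<nu> ` set ws = {}"
  shows "distinct (zig \<nu> ws)"
  using assms by (induction ws) (auto simp: set_zig)

lemma pg_ed_ag:
  assumes "pg.adj x y"
  shows "ag.ed x y = pg.ed x y"
proof (rule ag.ed_eqI)
  show "pg.ed x y \<in> Et" using pg.ed_props(1)[OF assms] by blast
  show "pg.ed x y \<inter> Vt = {x, y}" using pg.ed_props[OF assms] edge_Vt by simp
qed

lemma zig_walk:
  assumes "ws \<noteq> []" "successively (\<lambda>w w'. \<nu> w = \<mu> w') ws"
    "\<And>w. w \<in> set ws \<Longrightarrow> pg.adj w (\<mu> w)" "\<And>w. w \<in> set ws \<Longrightarrow> pg.adj w (\<nu> w)"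
  shows "ag.walk (\<mu> (hd ws) # zig \<nu> ws) \<and>
    ag.eds (\<mu> (hd ws) # zig \<nu> ws) = (\<lambda>w. pg.ed w (\<mu> w)) ` set ws \<union> (\<lambda>w. pg.ed w (\<nu> w)) ` set ws"
  using assms
proof (induction ws rule: induct_list012)
  case (2 w)
  have "ag.adj (\<mu> w) w" "ag.adj w (\<nu> w)" using "2.prems"(3,4)[of w] pg_adj_ag ag.adj_sym by auto
  moreover have "ag.ed (\<mu> w) w = pg.ed w (\<mu> w)" "ag.ed w (\<nu> w) = pg.ed w (\<nu> w)"
    using "2.prems"(3,4)[of w] pg_ed_ag ag.ed_sym by auto
  ultimately show ?case by (simp add: insert_commute)
next
  case (3 w w' r)
  have eq: "\<nu> w = \<mu> w'" using "3.prems"(2) by simp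
  have a: "ag.adj (\<mu> w) w" "ag.adj w (\<nu> w)" using "3.prems"(3,4)[of w] pg_adj_ag ag.adj_sym by auto
  have e: "ag.ed (\<mu> w) w = pg.ed w (\<mu> w)" "ag.ed w (\<nu> w) = pg.ed w (\<nu> w)"
    using "3.prems"(3,4)[of w] pg_ed_ag ag.ed_sym by auto
  have IH: "ag.walk (\<mu> w' # zig \<nu> (w' # r))"
    "ag.eds (\<mu> w' # zig \<nu> (w' # r)) = (\<lambda>w. pg.ed w (\<mu> w)) ` set (w' # r) \<union> (\<lambda>w. pg.ed w (\<nu> w)) ` set (w' # r)"
    using "3.IH"(2) "3.prems"(2-4) by simp_all
  have "ag.walk (\<mu> w # w # \<mu> w' # zig \<nu> (w' # r))" using a IH(1) eq by simp
  moreover have "ag.eds (\<mu> w # w # \<mu> w' # zig \<nu> (w' # r)) =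
      {pg.ed w (\<mu> w), pg.ed w (\<nu> w)} \<union> ag.eds (\<mu> w' # zig \<nu> (w' # r))"
  proof -
    have "ag.eds (\<mu> w # w # \<mu> w' # Z) = {ag.ed (\<mu> w) w, ag.ed w (\<mu> w')} \<union> ag.eds (\<mu> w' # Z)" for Z
      unfolding ag.eds.simps(1)[of "\<mu> w" w] ag.eds.simps(1)[of w "\<mu> w'"] by blast
    then show ?thesis using e eq by metis
  qed
  ultimately show ?case unfolding IH(2) using eq by auto
qed simp

lemma distinct_zig_matchfun:
  assumes "matchfun \<nu>" "distinct ws" "set ws \<subseteq> white G"
  shows "distinct (zig \<nu> ws)"
proof (rule distinct_zig[OF assms(2)])
  show "inj_on \<nu> (set ws)" using assms(1,3) inj_on_subset unfolding matchfun_def by blast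
  show "set ws \<inter> \<nu> ` set ws = {}" using matchfun_black[OF assms(1)] assms(3) bw_disjoint by blast
qed

text \<open>Exchange along a cycle, or along a path that is closed by the circle. By \<open>kasteleyn_cycle\<close> the signs of
  the two matchings differ by the length and the number of vertices inside. The
  matching pairs the white vertices inside with the black ones, except that some have partners on
  the circle: these are the used boundary vertices that the closing arc passes, with the indices in
  \<open>S\<close>.\<close>

lemma exch_parity:
  assumes \<sigma>: "kasteleyn_signature G \<sigma>" and ex: "exch \<mu> \<nu> ws" and c: "ag.cyc zs" and u: "pt n \<notin> set zs"
    and E: "ag.ceds zs \<inter> edges G = (\<lambda>w. pg.ed w (\<mu> w)) ` set ws \<union> (\<lambda>w. pg.ed w (\<nu> w)) ` set ws"
    and W: "white G \<inter> set zs = set ws" and B: "\<mu> ` set ws \<subseteq> set zs"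
    and S: "S \<subseteq> {..<n}" "pt ` S \<subseteq> set zs" "pt ` S \<inter> \<mu> ` set ws = {}"
    and BS: "set zs \<inter> \<mu> ` white G \<subseteq> \<mu> ` set ws \<union> pt ` S"
  shows "(\<Prod>w \<in> white G. \<sigma> (pg.ed w (\<mu> w))) * (\<Prod>w \<in> white G. \<sigma> (pg.ed w (\<nu> w))) = (-1) ^ (length ws + 1 + card (S \<inter> bd \<mu>))"
proof -
  let ?I = "inside (ag.crv zs)"
  have mf: "matchfun \<mu>" "matchfun \<nu>" and ws: "distinct ws" "set ws \<subseteq> white G"
    and out: "\<And>w. w \<in> white G \<Longrightarrow> w \<notin> set ws \<Longrightarrow> \<nu> w = \<mu> w" and neq: "\<And>w. w \<in> set ws \<Longrightarrow> \<nu> w \<noteq> \<mu> w"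
    using ex unfolding exch_def by auto
  have adj: "pg.adj w (\<mu> w)" "pg.adj w (\<nu> w)" if "w \<in> white G" for w
    using mf that unfolding matchfun_def by auto
  have inj: "inj_on \<mu> (white G)" using mf(1) unfolding matchfun_def by blast
  have sq: "\<sigma> e * \<sigma> e = 1" if "e \<in> edges G" for e
    using \<sigma> that unfolding kasteleyn_signature_def by fastforce
  \<comment> \<open>The signs outside \<open>ws\<close> cancel.\<close>
  have "(\<Prod>w \<in> white G. \<sigma> (pg.ed w (\<mu> w))) * (\<Prod>w \<in> white G. \<sigma> (pg.ed w (\<nu> w)))
      = (\<Prod>w \<in> white G. \<sigma> (pg.ed w (\<mu> w)) * \<sigma> (pg.ed w (\<nu> w)))" by (simp add: prod.distrib)
  also have "\<dots> = (\<Prod>w \<in> set ws. \<sigma> (pg.ed w (\<mu> w)) * \<sigma> (pg.ed w (\<nu> w)))"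
  proof (rule prod.mono_neutral_right[OF finite_white ws(2)], rule ballI)
    fix w assume "w \<in> white G - set ws"
    then show "\<sigma> (pg.ed w (\<mu> w)) * \<sigma> (pg.ed w (\<nu> w)) = 1" using out[of w] sq[OF pg.ed_props(1)[OF adj(1)]] by simp
  qed
  also have "\<dots> = (\<Prod>e \<in> ag.ceds zs \<inter> edges G. \<sigma> e)"
  proof -
    have inj1: "inj_on (\<lambda>w. pg.ed w (f w)) (set ws)" if "\<And>w. w \<in> set ws \<Longrightarrow> pg.adj w (f w)" for f
    proof (rule inj_onI)
      fix w w' assume a: "w \<in> set ws" "w' \<in> set ws" "pg.ed w (f w) = pg.ed w' (f w')"
      then have "w \<in> white G" "w' \<in> white G" using ws(2) by auto
      then show "w = w'" using adj_ends(3)[OF that[OF a(1)]] adj_ends(3)[OF that[OF a(2)]] a(3) by metis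
    qed
    have dis: "(\<lambda>w. pg.ed w (\<mu> w)) ` set ws \<inter> (\<lambda>w. pg.ed w (\<nu> w)) ` set ws = {}"
    proof (rule ccontr)
      assume "\<not> ?thesis"
      then obtain w w' where a: "w \<in> set ws" "w' \<in> set ws" "pg.ed w (\<mu> w) = pg.ed w' (\<nu> w')" by blast
      then have w: "w \<in> white G" "w' \<in> white G" using ws(2) by auto
      have "w = w'" using adj_ends(3)[OF adj(1)[OF w(1)] w(1)] adj_ends(3)[OF adj(2)[OF w(2)] w(2)] a(3) by metis
      moreover have "\<mu> w = \<nu> w'" using adj_ends(4)[OF adj(1)[OF w(1)] w(1)] adj_ends(4)[OF adj(2)[OF w(2)] w(2)] a(3) by metis
      ultimately show False using neq a(1) by metis
    qed
    have "(\<Prod>e \<in> ag.ceds zs \<inter> edges G. \<sigma> e) = (\<Prod>e \<in> (\<lambda>w. pg.ed w (\<mu> w)) ` set ws. \<sigma> e) * (\<Prod>e \<in> (\<lambda>w. pg.ed w (\<nu> w)) ` set ws. \<sigma> e)"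
      unfolding E by (rule prod.union_disjoint[OF _ _ dis]) auto
    also have "\<dots> = (\<Prod>w \<in> set ws. \<sigma> (pg.ed w (\<mu> w))) * (\<Prod>w \<in> set ws. \<sigma> (pg.ed w (\<nu> w)))"
    proof -
      have "pg.adj w (\<mu> w)" "pg.adj w (\<nu> w)" if "w \<in> set ws" for w using adj[of w] ws(2) that by blast+
      then have "inj_on (\<lambda>w. pg.ed w (\<mu> w)) (set ws)" "inj_on (\<lambda>w. pg.ed w (\<nu> w)) (set ws)"
        using inj1[of \<mu>] inj1[of \<nu>] by blast+
      then show ?thesis by (simp add: prod.reindex)
    qed
    finally show ?thesis by (simp add: prod.distrib)
  qed
  also have "\<dots> = (-1) ^ (card (set ws) + 1 + card (Vt \<inter> ?I))"
    using kasteleyn_cycle[OF \<sigma> c u] W by simp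
  also have "card (Vt \<inter> ?I) = 2 * card (Bint \<inter> ?I) + card (S \<inter> bd \<mu>)"
  proof -
    \<comment> \<open>The partners of the white vertices inside the cycle are the black vertices inside it and the
      matched boundary vertices on it that do not belong to the exchange.\<close>
    have notcrv: "z \<notin> ag.crv zs" if "z \<in> ?I" for z
    proof
      assume "z \<in> ag.crv zs"
      then show False using ag.cyc_jordan(9)[OF c] that by blast
    qed
    have crvV: "z \<in> set zs" if "z \<in> ag.crv zs" "z \<in> Vt" for z using ag.crv_V[OF c] that by blast
    have zsV: "set zs \<subseteq> ag.crv zs" using ag.crv_V[OF c] by blast
    have white_partner: "\<mu> w \<in> ?I \<union> set zs" if w: "w \<in> white G" "w \<in> ?I" for w
    proof -
      have e: "pg.ed w (\<mu> w) \<in> Et" "w \<in> pg.ed w (\<mu> w)" "\<mu> w \<in> pg.ed w (\<mu> w)" "\<mu> w \<in> Vt"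
        using pg.ed_props[OF adj(1)[OF w(1)]] by auto
      have "pg.ed w (\<mu> w) \<subseteq> ?I \<union> ag.crv zs" by (rule ag.edge_inside(2)[OF c e(1)]) (use e(2) w(2) in blast)
      then show ?thesis using e(3,4) crvV by blast
    qed
    have black_partner: "w \<in> ?I" if w: "w \<in> white G" "w \<notin> set ws" "pg.ed w (\<mu> w) \<inter> ?I \<noteq> {}" for w
    proof -
      have e: "pg.ed w (\<mu> w) \<in> Et" "w \<in> pg.ed w (\<mu> w)" "w \<in> Vt"
        using pg.ed_props[OF adj(1)[OF w(1)]] by auto
      have "pg.ed w (\<mu> w) \<subseteq> ?I \<union> ag.crv zs" by (rule ag.edge_inside(2)[OF c e(1) w(3)])
      moreover have "w \<notin> set zs" using W w(1,2) by blast
      ultimately show ?thesis using e(2,3) crvV by blast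
    qed
    have im: "\<mu> ` (white G \<inter> ?I) = (Bint \<inter> ?I) \<union> pt ` (S \<inter> bd \<mu>)"
    proof
      show "\<mu> ` (white G \<inter> ?I) \<subseteq> (Bint \<inter> ?I) \<union> pt ` (S \<inter> bd \<mu>)"
      proof
        fix b assume "b \<in> \<mu> ` (white G \<inter> ?I)"
        then obtain w where w: "w \<in> white G" "w \<in> ?I" "b = \<mu> w" by blast
        have wz: "w \<notin> set ws" using W notcrv[OF w(2)] zsV by blast
        show "b \<in> (Bint \<inter> ?I) \<union> pt ` (S \<inter> bd \<mu>)"
        proof (cases "b \<in> ?I")
          case True
          have "norm b < 1" using inside_in_ball[OF c] True by auto
          then have "b \<notin> set (bdry G)" using bdry_on_circle by fastforce
          then have "b \<in> Bint" using matchfun_black[OF mf(1) w(1)] w(3) black_split(1) by blast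
          then show ?thesis using True by blast
        next
          case False
          then have "b \<in> set zs" using white_partner[OF w(1,2)] w(3) by blast
          moreover have "b \<notin> \<mu> ` set ws"
          proof
            assume "b \<in> \<mu> ` set ws"
            then obtain w' where "w' \<in> set ws" "\<mu> w' = \<mu> w" using w(3) by auto
            then show False using inj_onD[OF inj] w(1) ws(2) wz by blast
          qed
          ultimately have "b \<in> pt ` S" using BS w by blast
          then obtain s where s: "s \<in> S" "b = pt s" by blast
          have "s \<in> bd \<mu>" unfolding bd_def using s S(1) w by force
          then show ?thesis using s by blast
        qed
      qed
      show "(Bint \<inter> ?I) \<union> pt ` (S \<inter> bd \<mu>) \<subseteq> \<mu> ` (white G \<inter> ?I)"
      proof
        fix b assume b: "b \<in> (Bint \<inter> ?I) \<union> pt ` (S \<inter> bd \<mu>)"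
        show "b \<in> \<mu> ` (white G \<inter> ?I)"
        proof (cases "b \<in> Bint \<and> b \<in> ?I")
          case True
          then have "b \<in> \<mu> ` white G" using mf(1) unfolding matchfun_def by blast
          then obtain w where w: "w \<in> white G" "b = \<mu> w" by blast
          have "b \<notin> set zs" using notcrv True zsV by blast
          then have wz: "w \<notin> set ws" using B w(2) by blast
          have "b \<in> pg.ed w (\<mu> w)" using pg.ed_props(2)[OF adj(1)[OF w(1)]] w(2) by blast
          then have "w \<in> ?I" using black_partner[OF w(1) wz] True by blast
          then show ?thesis using w by blast
        next
          case False
          then obtain s where s: "s \<in> S" "s \<in> bd \<mu>" "b = pt s" using b by blast
          have sn: "s < n" using S(1) s(1) by blast
          have "b \<in> \<mu> ` white G" using s(2,3) unfolding bd_def by blast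
          then obtain w where w: "w \<in> white G" "b = \<mu> w" by blast
          have wz: "w \<notin> set ws" using S(3) s w(2) by blast
          have "w \<in> pg.ed w (\<mu> w)" "b \<in> pg.ed w (\<mu> w)" using pg.ed_props(2)[OF adj(1)[OF w(1)]] w(2) by auto
          then have be: "bedge b = pg.ed w (\<mu> w)" "w \<in> bedge b"
            using edge_at_bdry[OF pg.ed_props(1)[OF adj(1)[OF w(1)]], of b] pt_in_bdry[OF sn] s(3) by auto
          have "bedge b \<notin> ag.ceds zs"
          proof
            assume "bedge b \<in> ag.ceds zs"
            then have "w \<in> ag.crv zs" unfolding ag.crv_def using be(2) by blast
            then have "w \<in> set zs" using crvV w(1) unfolding verts_def by blast
            then show False using W w(1) wz by blast
          qed
          moreover have "b \<in> set zs" using S(2) s by blast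
          ultimately have "bedge b \<inter> ?I \<noteq> {}" using bedge_inside(2)[OF c] pt_in_bdry[OF sn] s(3) by blast
          then have "w \<in> ?I" using black_partner[OF w(1) wz] be(1) by metis
          then show ?thesis using w by blast
        qed
      qed
    qed
    have "card (white G \<inter> ?I) = card (\<mu> ` (white G \<inter> ?I))"
      by (rule card_image[symmetric]) (rule inj_on_subset[OF inj Int_lower1])
    also have "\<dots> = card (Bint \<inter> ?I) + card (pt ` (S \<inter> bd \<mu>))"
      unfolding im
    proof (rule card_Un_disjoint)
      show "finite (Bint \<inter> ?I)" using finite_black by simp
      show "finite (pt ` (S \<inter> bd \<mu>))" using finite_subset[OF S(1)] by simp
      have "pt ` S \<subseteq> set zs" by (rule S(2))
      then show "(Bint \<inter> ?I) \<inter> pt ` (S \<inter> bd \<mu>) = {}" using notcrv zsV by blast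
    qed
    also have "card (pt ` (S \<inter> bd \<mu>)) = card (S \<inter> bd \<mu>)"
    proof (rule card_image, rule inj_onI)
      fix x y assume a: "x \<in> S \<inter> bd \<mu>" "y \<in> S \<inter> bd \<mu>" "pt x = pt y"
      then have "x \<le> n" "y \<le> n" using S(1) by auto
      then show "x = y" using pt_inj[of x y] a(3) by simp
    qed
    finally have cw: "card (white G \<inter> ?I) = card (Bint \<inter> ?I) + card (S \<inter> bd \<mu>)" .
    have "z \<in> ?I \<Longrightarrow> z \<notin> set (bdry G)" "z \<in> ?I \<Longrightarrow> z \<noteq> pt n" for z
      using inside_in_ball[OF c] bdry_on_circle pt_circle[of n] by fastforce+
    then have "Vt \<inter> ?I = (white G \<inter> ?I) \<union> (Bint \<inter> ?I)"
      using black_split(1) unfolding verts_def by blast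
    then have "card (Vt \<inter> ?I) = card (white G \<inter> ?I) + card (Bint \<inter> ?I)"
    proof (simp only:, intro card_Un_disjoint)
      show "(white G \<inter> ?I) \<inter> (Bint \<inter> ?I) = {}" using bw_disjoint by blast
    qed (use finite_white finite_black in simp_all)
    then show ?thesis using cw by simp
  qed
  finally show ?thesis using distinct_card[OF ws(1)] by (simp add: power_add power_mult)
qed

lemma exch_sign_product:
  assumes \<sigma>: "kasteleyn_signature G \<sigma>" and P: "(\<Prod>w \<in> white G. \<sigma> (pg.ed w (\<mu> w))) * (\<Prod>w \<in> white G. \<sigma> (pg.ed w (\<nu> w))) = (-1) ^ m"
    and \<mu>: "matchfun \<mu>"
  shows "(\<Prod>w \<in> white G. \<sigma> (pg.ed w (\<nu> w))) = (-1) ^ m * (\<Prod>w \<in> white G. \<sigma> (pg.ed w (\<mu> w)))"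
proof -
  let ?p = "\<Prod>w \<in> white G. \<sigma> (pg.ed w (\<mu> w))"
  have sq: "\<sigma> e * \<sigma> e = 1" if "e \<in> edges G" for e
    using \<sigma> that unfolding kasteleyn_signature_def by fastforce
  have "?p * ?p = 1"
    unfolding prod.distrib[symmetric]
  proof (rule prod.neutral, rule ballI)
    fix w assume w: "w \<in> white G"
    have "pg.adj w (\<mu> w)" using \<mu> w unfolding matchfun_def by blast
    then show "\<sigma> (pg.ed w (\<mu> w)) * \<sigma> (pg.ed w (\<mu> w)) = 1" using sq pg.ed_props(1) by blast
  qed
  then have "(\<Prod>w \<in> white G. \<sigma> (pg.ed w (\<nu> w))) = ?p * (?p * (\<Prod>w \<in> white G. \<sigma> (pg.ed w (\<nu> w))))"
    by (metis mult.assoc mult_1)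
  then show ?thesis unfolding P by (metis mult.commute)
qed

lemma cyc_of_closed_walk:
  assumes "ag.walk (x # as @ [x])" "distinct (x # as)" "length as \<ge> 2"
  shows "ag.cyc (x # as)" "ag.ceds (x # as) = ag.eds (x # as @ [x])"
  using assms unfolding ag.cyc_def ag.ceds_def by auto

text \<open>The sign of a matching in the minor with its own boundary vertices in increasing order.\<close>

abbreviation Msign :: "(complex set \<Rightarrow> int) \<Rightarrow> (complex \<Rightarrow> complex) \<Rightarrow> complex" where
  "Msign \<sigma> \<mu> \<equiv> msign \<sigma> \<mu> (sorted_list_of_set (bd \<mu>))"

lemma exch_cycle_sign:
  assumes \<sigma>: "kasteleyn_signature G \<sigma>" and ex: "exch \<mu> \<nu> ws" and closed: "\<nu> (last ws) = \<mu> (hd ws)"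
  shows "Msign \<sigma> \<nu> = Msign \<sigma> \<mu>"
proof -
  have mf: "matchfun \<mu>" "matchfun \<nu>" and ws: "ws \<noteq> []" "distinct ws" "set ws \<subseteq> white G"
    and out: "\<And>w. w \<in> white G \<Longrightarrow> w \<notin> set ws \<Longrightarrow> \<nu> w = \<mu> w" and neq: "\<And>w. w \<in> set ws \<Longrightarrow> \<nu> w \<noteq> \<mu> w"
    and suc: "successively (\<lambda>w w'. \<nu> w = \<mu> w') ws"
    using ex unfolding exch_def by auto
  have adj: "pg.adj w (\<mu> w)" "pg.adj w (\<nu> w)" if "w \<in> white G" for w
    using mf that unfolding matchfun_def by auto
  let ?x = "\<mu> (hd ws)"
  have im: "\<nu> ` set ws = \<mu> ` set ws"
    by (rule rotate_image[OF ws(1) suc closed])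
  have len: "length ws \<ge> 2"
  proof (rule ccontr)
    assume "\<not> ?thesis"
    then obtain w where "ws = [w]" using ws(1) by (cases ws rule: remdups_adj.cases) auto
    then show False using closed neq by simp
  qed
  have zw: "ag.walk (?x # zig \<nu> ws)"
    "ag.eds (?x # zig \<nu> ws) = (\<lambda>w. pg.ed w (\<mu> w)) ` set ws \<union> (\<lambda>w. pg.ed w (\<nu> w)) ` set ws"
    using zig_walk[of ws \<nu> \<mu>, OF ws(1) suc] adj ws(3) by auto
  obtain as where as: "zig \<nu> ws = as @ [?x]" 
    using last_zig[OF ws(1), of \<nu>] closed ws(1) append_butlast_last_id[of "zig \<nu> ws"]
    by (metis length_zig list.size(3) length_0_conv mult_eq_0_iff zero_neq_numeral)
  have las: "length as = 2 * length ws - 1" using arg_cong[OF as, of length] by simp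
  have dz: "distinct (zig \<nu> ws)" by (rule distinct_zig_matchfun[OF mf(2) ws(2,3)])
  have dist: "distinct (?x # as)" using dz unfolding as by auto
  have setz: "set (?x # as) = set ws \<union> \<mu> ` set ws"
    using set_zig[of \<nu> ws] unfolding as im by auto
  have cyc: "ag.cyc (?x # as)" "ag.ceds (?x # as) = ag.eds (?x # as @ [?x])"
    using cyc_of_closed_walk[of ?x as] zw(1) dist las len unfolding as by auto
  have blackz: "\<mu> ` set ws \<subseteq> black G" using matchfun_black[OF mf(1)] ws(3) by blast
  have "(\<Prod>w \<in> white G. \<sigma> (pg.ed w (\<mu> w))) * (\<Prod>w \<in> white G. \<sigma> (pg.ed w (\<nu> w))) = (-1) ^ (length ws + 1 + card ({} \<inter> bd \<mu>))"
  proof (rule exch_parity[OF \<sigma> ex cyc(1)])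
    show "pt n \<notin> set (?x # as)" unfolding setz using blackz ws(3) pt_n_notin(3) unfolding verts_def by blast
    show "ag.ceds (?x # as) \<inter> edges G = (\<lambda>w. pg.ed w (\<mu> w)) ` set ws \<union> (\<lambda>w. pg.ed w (\<nu> w)) ` set ws"
      unfolding cyc(2) as[symmetric] zw(2) using adj pg.ed_props(1) ws(3) by blast
    show "white G \<inter> set (?x # as) = set ws" unfolding setz using blackz bw_disjoint ws(3) by blast
    show "\<mu> ` set ws \<subseteq> set (?x # as)" unfolding setz by blast
    show "set (?x # as) \<inter> \<mu> ` white G \<subseteq> \<mu> ` set ws \<union> pt ` {}" 
      unfolding setz using ws(3) matchfun_black[OF mf(1)] bw_disjoint by blast
  qed auto
  then have P: "(\<Prod>w \<in> white G. \<sigma> (pg.ed w (\<nu> w))) = (-1) ^ (length ws + 1) * (\<Prod>w \<in> white G. \<sigma> (pg.ed w (\<mu> w)))"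
    using exch_sign_product[OF \<sigma> _ mf(1), of \<nu> "length ws + 1"] by simp
  have imw: "\<nu> ` white G = \<mu> ` white G"
  proof -
    have "white G = set ws \<union> (white G - set ws)" using ws(3) by blast
    moreover have "\<nu> ` (white G - set ws) = \<mu> ` (white G - set ws)" using out by (intro image_cong) auto
    ultimately show ?thesis using im by (metis image_Un)
  qed
  then have bd: "bd \<nu> = bd \<mu>" unfolding bd_def by simp
  let ?L = "BL @ map pt (sorted_list_of_set (bd \<mu>))"
  have "length ?L = mm" using card_bd[OF mf(1)] len_BL by simp
  then have "mdet \<nu> ?L = (-1) ^ (length ws - 1) * mdet \<mu> ?L"
    by (rule mdet_rotate[OF _ ws(2,1,3) suc closed]) (use out in auto)
  then have "Msign \<sigma> \<nu> = (-1) ^ (length ws + 1 + (length ws - 1)) * Msign \<sigma> \<mu>"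
    unfolding msign_def bd P by (simp add: power_add)
  also have "length ws + 1 + (length ws - 1) = 2 * length ws" using len by simp
  finally show ?thesis by (simp add: power_mult)
qed

text \<open>Exchange along a path from \<open>pt i\<close> to \<open>pt j\<close>. The used boundary vertices between \<open>pt j\<close> and \<open>pt i\<close>
  enter twice, once through the number of vertices inside the closed curve, and once when the
  column of \<open>pt j\<close> is moved to its place in the increasing order.\<close>

lemma exch_path_sign:
  assumes \<sigma>: "kasteleyn_signature G \<sigma>" and ex: "exch \<mu> \<nu> ws" and ij: "j < i" "i < n"
    and x: "\<mu> (hd ws) = pt i" "pt i \<notin> \<nu> ` white G" and y: "\<nu> (last ws) = pt j" "pt j \<notin> \<mu> ` white G"
  shows "Msign \<sigma> \<nu> = Msign \<sigma> \<mu>"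
proof -
  have mf: "matchfun \<mu>" "matchfun \<nu>" and ws: "ws \<noteq> []" "distinct ws" "set ws \<subseteq> white G"
    and out: "\<And>w. w \<in> white G \<Longrightarrow> w \<notin> set ws \<Longrightarrow> \<nu> w = \<mu> w" and neq: "\<And>w. w \<in> set ws \<Longrightarrow> \<nu> w \<noteq> \<mu> w"
    and suc: "successively (\<lambda>w w'. \<nu> w = \<mu> w') ws"
    using ex unfolding exch_def by auto
  have adj: "pg.adj w (\<mu> w)" "pg.adj w (\<nu> w)" if "w \<in> white G" for w
    using mf that unfolding matchfun_def by auto
  have inj: "inj_on \<mu> (white G)" "inj_on \<nu> (white G)" using mf unfolding matchfun_def by auto
  have hl: "hd ws \<in> set ws" "last ws \<in> set ws" using ws(1) by auto
  have im: "insert (pt i) (\<nu> ` set ws) = insert (pt j) (\<mu> ` set ws)"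
    using rotate_image_path[OF ws(1) suc] x(1) y(1) by simp
  have zw: "ag.walk (pt i # zig \<nu> ws)"
    "ag.eds (pt i # zig \<nu> ws) = (\<lambda>w. pg.ed w (\<mu> w)) ` set ws \<union> (\<lambda>w. pg.ed w (\<nu> w)) ` set ws"
    using zig_walk[of ws \<nu> \<mu>, OF ws(1) suc] adj ws(3) unfolding x(1) by auto
  obtain as where as: "zig \<nu> ws = as @ [pt j]"
    using last_zig[OF ws(1), of \<nu>] y(1) ws(1) append_butlast_last_id[of "zig \<nu> ws"]
    by (metis length_zig list.size(3) length_0_conv mult_eq_0_iff zero_neq_numeral)
  have las: "length as = 2 * length ws - 1" using arg_cong[OF as, of length] by simp
  \<comment> \<open>The path is closed along the circle, on the side that avoids the additional vertex.\<close>
  let ?cs = "map pt [Suc j..<i]"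
  let ?zs = "pt i # as @ pt j # ?cs"
  have circ: "ag.walk (map pt [j..<Suc i])" "ag.eds (map pt [j..<Suc i]) = carc ` {j..<i}"
    using circle_walk[of j i] ij by auto
  have cl: "map pt [j..<Suc i] = pt j # ?cs @ [pt i]" using ij(1) by (simp add: upt_conv_Cons)
  have walk: "ag.walk (pt i # (as @ pt j # ?cs) @ [pt i])"
    using ag.walk_append[of "pt i # as" "pt j" "?cs @ [pt i]"] zw(1) circ(1) unfolding as cl by simp
  have eds: "ag.eds (pt i # (as @ pt j # ?cs) @ [pt i]) = ag.eds (pt i # zig \<nu> ws) \<union> carc ` {j..<i}"
    using ag.eds_append[of "pt i # as" "pt j" "?cs @ [pt i]"] circ(2) unfolding as cl by simp
  have dz: "distinct (zig \<nu> ws)" by (rule distinct_zig_matchfun[OF mf(2) ws(2,3)])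
  have ptb: "pt s \<in> black G" "pt s \<notin> white G" if "s < n" for s
    using pt_in_bdry[OF that] bdry_black bw_disjoint by auto
  have unique_white: "w = w'" if "w \<in> white G" "w' \<in> white G" "pg.adj w (pt s)" "pg.adj w' (pt s)" "s < n" for w w' s
  proof -
    have "pg.ed w (pt s) = bedge (pt s)" "pg.ed w' (pt s) = bedge (pt s)"
      using edge_at_bdry[OF pg.ed_props(1)] pg.ed_props(2) pt_in_bdry[OF that(5)] that(3,4) by blast+
    then show ?thesis using adj_ends(3)[OF that(3,1)] adj_ends(3)[OF that(4,2)] by metis
  qed
  have \<nu>_on_circle: "s = j" if s: "s < n" "pt s \<in> \<nu> ` set ws" for s
  proof (rule ccontr)
    assume ne: "s \<noteq> j"
    obtain w where w: "w \<in> set ws" "pt s = \<nu> w" using s(2) by blast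
    have "pt s \<in> insert (pt j) (\<mu> ` set ws)" using im s(2) by blast
    moreover have "pt s \<noteq> pt j" using pt_inj[of s j] ne s(1) ij by simp
    ultimately obtain w' where w': "w' \<in> set ws" "pt s = \<mu> w'" by blast
    have "w = w'" using unique_white[of w w' s] adj w w' ws(3) s(1) by (metis subsetD)
    then show False using neq w w' by metis
  qed
  have \<mu>_on_circle: "s = i" if s: "s < n" "pt s \<in> \<mu> ` set ws" for s
  proof (rule ccontr)
    assume ne: "s \<noteq> i"
    then have "pt s \<noteq> pt i" using pt_inj[of s i] s(1) ij by simp
    then have "pt s \<in> \<nu> ` set ws" using im s(2) by blast
    then have "s = j" using \<nu>_on_circle s(1) by blast
    then show False using y(2) s(2) ws(3) by blast
  qed
  have setz: "set ?zs = insert (pt i) (set ws \<union> \<nu> ` set ws \<union> pt ` {j<..<i})"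
    using set_zig[of \<nu> ws] unfolding as by (auto simp: atLeastSucLessThan_greaterThanLessThan)
  have dist: "distinct ?zs"
  proof -
    have "distinct ?cs" unfolding distinct_map using pt_inj ij(2) by (auto intro!: inj_onI)
    moreover have "set (zig \<nu> ws) \<inter> set ?cs = {}"
    proof (rule ccontr)
      assume "\<not> ?thesis"
      then obtain s where "s \<in> set [Suc j..<i]" "pt s \<in> set (zig \<nu> ws)" unfolding set_map by blast
      then have "j < s" "s < i" "pt s \<in> set ws \<union> \<nu> ` set ws" unfolding set_zig by auto
      then show False using ptb[of s] ws(3) \<nu>_on_circle[of s] ij(2) by auto
    qed
    moreover have "pt i \<notin> set (zig \<nu> ws)" unfolding set_zig using x(2) ws(3) ptb(2)[OF ij(2)] by blast
    moreover have "pt i \<notin> set ?cs"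
    proof
      assume "pt i \<in> set ?cs"
      then obtain s where "s < i" "pt i = pt s" by auto
      then show False using pt_inj[of i s] ij by simp
    qed
    ultimately show ?thesis using dz unfolding as by auto
  qed
  have las1: "length as \<ge> 1" using las ws(1) by (cases ws) auto
  have cyc: "ag.cyc ?zs" "ag.ceds ?zs = ag.eds (pt i # (as @ pt j # ?cs) @ [pt i])"
    using cyc_of_closed_walk[OF walk dist] las1 by auto
  have bz: "\<nu> ` set ws \<subseteq> black G" "\<mu> ` set ws \<subseteq> black G" using matchfun_black[OF mf(1)] matchfun_black[OF mf(2)] ws(3) by auto
  let ?S = "{j<..<i}"
  have "(\<Prod>w \<in> white G. \<sigma> (pg.ed w (\<mu> w))) * (\<Prod>w \<in> white G. \<sigma> (pg.ed w (\<nu> w))) = (-1) ^ (length ws + 1 + card (?S \<inter> bd \<mu>))"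
  proof (rule exch_parity[OF \<sigma> ex cyc(1)])
    have pn: "pt n \<noteq> pt s" if "s \<le> i" for s using pt_inj[of n s] ij(2) that by simp
    then have "pt n \<noteq> pt i" by blast
    moreover have "pt n \<notin> pt ` {j<..<i}"
    proof
      assume "pt n \<in> pt ` {j<..<i}"
      then obtain s where "s < i" "pt n = pt s" by auto
      then show False using pn[of s] by simp
    qed
    moreover have "pt n \<notin> set ws" "pt n \<notin> \<nu> ` set ws" using bz ws(3) pt_n_notin(3) unfolding verts_def by auto
    ultimately show "pt n \<notin> set ?zs" unfolding setz by blast
    have "carc s \<notin> edges G" if "s < i" for s
      using edge_ends(2,4)[of "carc s"] carc_ends_no_white[of s] ij(2) that edge_ends(5)[of "carc s"] by (metis IntE insertI1 insertI2 less_imp_le less_trans)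
    then show "ag.ceds ?zs \<inter> edges G = (\<lambda>w. pg.ed w (\<mu> w)) ` set ws \<union> (\<lambda>w. pg.ed w (\<nu> w)) ` set ws"
      unfolding cyc(2) eds zw(2) using adj pg.ed_props(1) ws(3) by fastforce
    have "pt s \<notin> white G" if "s \<le> i" for s using ptb(2)[of s] ij(2) that by simp
    then show "white G \<inter> set ?zs = set ws" unfolding setz using bz bw_disjoint ws(3) by auto
    show "\<mu> ` set ws \<subseteq> set ?zs" unfolding setz using im by blast
    show "?S \<subseteq> {..<n}" using ij(2) by auto
    show "pt ` ?S \<subseteq> set ?zs" unfolding setz by blast
    show "pt ` ?S \<inter> \<mu> ` set ws = {}"
    proof (rule ccontr)
      assume "pt ` ?S \<inter> \<mu> ` set ws \<noteq> {}"
      then obtain s where "s \<in> ?S" "pt s \<in> \<mu> ` set ws" by blast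
      then show False using \<mu>_on_circle[of s] ij(2) by simp
    qed
    have "\<nu> ` set ws \<subseteq> insert (pt j) (\<mu> ` set ws)" using im by blast
    moreover have "pt i \<in> \<mu> ` set ws" using x(1) hl(1) by (metis imageI)
    moreover have "set ws \<inter> \<mu> ` white G = {}" using ws(3) matchfun_black[OF mf(1)] bw_disjoint by blast
    moreover note circ_facts = calculation
    have el: "z \<in> \<mu> ` set ws \<union> pt ` ?S" if zz: "z \<in> set ?zs" "z \<in> \<mu> ` white G" for z
    proof -
      consider "z = pt i" | "z \<in> set ws" | "z \<in> \<nu> ` set ws" | "z \<in> pt ` ?S" using zz(1) unfolding setz by blast
      then show ?thesis
      proof cases
        case 3
        then have "z \<in> insert (pt j) (\<mu> ` set ws)" using circ_facts(1) by (rule subsetD[rotated])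
        then show ?thesis using y(2) zz(2) by (metis UnI1 insertE)
      qed (use circ_facts(2,3) zz(2) in \<open>simp_all add: disjoint_iff\<close>)
    qed
    show "set ?zs \<inter> \<mu> ` white G \<subseteq> \<mu> ` set ws \<union> pt ` ?S" by (rule subsetI) (erule IntE, rule el)
  qed
  then have P: "(\<Prod>w \<in> white G. \<sigma> (pg.ed w (\<nu> w))) = (-1) ^ (length ws + 1 + card (?S \<inter> bd \<mu>)) * (\<Prod>w \<in> white G. \<sigma> (pg.ed w (\<mu> w)))"
    by (rule exch_sign_product[OF \<sigma> _ mf(1)])
  have imw: "insert (pt i) (\<nu> ` white G) = insert (pt j) (\<mu> ` white G)"
  proof -
    have W: "white G = set ws \<union> (white G - set ws)" using ws(3) by blast
    have eq: "\<nu> ` (white G - set ws) = \<mu> ` (white G - set ws)" using out by (intro image_cong) auto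
    have "insert (pt i) (\<nu> ` set ws) \<union> \<nu> ` (white G - set ws) = insert (pt j) (\<mu> ` set ws) \<union> \<mu> ` (white G - set ws)"
      unfolding im eq ..
    then show ?thesis using arg_cong[OF W, of "\<lambda>A. \<nu> ` A"] arg_cong[OF W, of "\<lambda>A. \<mu> ` A"] by (metis Un_insert_left image_Un)
  qed
  let ?R = "bd \<mu> - {i}"
  have bds: "bd \<mu> = insert i ?R" "bd \<nu> = insert j ?R" "i \<notin> ?R" "j \<notin> ?R"
  proof -
    have "pt i \<in> \<mu> ` white G" using x(1) hl(1) ws(3) by (metis imageI subsetD)
    then have "i \<in> bd \<mu>" unfolding bd_def using ij(2) by simp
    then show "bd \<mu> = insert i ?R" by blast
    have "j \<notin> bd \<mu>" unfolding bd_def using y(2) by simp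
    then show "i \<notin> ?R" "j \<notin> ?R" by auto
    show "bd \<nu> = insert j ?R"
    proof (rule Set.set_eqI)
      fix s
      show "s \<in> bd \<nu> \<longleftrightarrow> s \<in> insert j ?R"
      proof (cases "s < n")
        case True
        then have "pt s = pt i \<longleftrightarrow> s = i" "pt s = pt j \<longleftrightarrow> s = j" using pt_inj[of s] ij by auto
        moreover have "pt s \<in> insert (pt i) (\<nu> ` white G) \<longleftrightarrow> pt s \<in> insert (pt j) (\<mu> ` white G)" using imw by simp
        moreover have "s \<in> bd f \<longleftrightarrow> pt s \<in> f ` white G" for f unfolding bd_def using True by simp
        ultimately show ?thesis using True x(2) y(2) ij by (metis Diff_iff insert_iff nat_neq_iff singletonD)
      next
        case False
        then have "s \<notin> bd f" for f unfolding bd_def by simp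
        then show ?thesis using False ij by auto
      qed
    qed
  qed
  have fin: "finite ?R" unfolding bd_def by simp
  define r where "r = sorted_list_of_set ?R"
  have r: "set r = ?R" "distinct r" unfolding r_def using fin by auto
  have lr: "length (i # r) = k" using card_bd[OF mf(1)] distinct_card[of "i # r"] r bds(1,3) by simp
  have len: "length (BL @ map pt (i # r)) = mm" "length (BL @ map pt (j # r)) = mm" using lr len_BL by auto
  have M\<mu>: "Msign \<sigma> \<mu> = lsign (i # r) * msign \<sigma> \<mu> (i # r)"
    using msign_sort[of "i # r" \<sigma> \<mu>] lr r bds(1,3) by simp
  have M\<nu>: "Msign \<sigma> \<nu> = lsign (j # r) * msign \<sigma> \<nu> (j # r)"
    using msign_sort[of "j # r" \<sigma> \<nu>] lr r bds(2,4) by simp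
  have S: "length (filter (\<lambda>y. j < y \<and> y < i) r) = card (?S \<inter> bd \<mu>)"
  proof -
    have "set (filter (\<lambda>y. j < y \<and> y < i) r) = ?S \<inter> bd \<mu>" unfolding set_filter r(1) by auto
    moreover have "distinct (filter (\<lambda>y. j < y \<and> y < i) r)" by (rule distinct_filter[OF r(2)])
    ultimately show ?thesis by (metis distinct_card)
  qed
  have ls: "lsign (j # r) = (-1) ^ card (?S \<inter> bd \<mu>) * lsign (i # r)"
    using lsign_replace[of i "[]" r j] S ij(1) r(1) bds(3,4) by simp
  \<comment> \<open>Replace the column of \<open>pt i\<close> by that of \<open>pt j\<close>, then shift the partners.\<close>
  let ?f = "\<mu>(hd ws := pt j)"
  have "mdet \<nu> (BL @ map pt (j # r)) = (-1) ^ (length ws - 1) * mdet ?f (BL @ map pt (j # r))"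
  proof (rule mdet_rotate[OF len(2) ws(2,1,3)])
    obtain w us where wu: "ws = w # us" using ws(1) by (cases ws) auto
    have "successively (\<lambda>v v'. \<nu> v = ?f v') ws"
    proof (cases us)
      case Nil
      then show ?thesis using wu by simp
    next
      case (Cons u us')
      then have "successively (\<lambda>v v'. \<nu> v = \<mu> v') (u # us')" "\<nu> w = \<mu> u" using suc wu by auto
      moreover have "w \<notin> set (u # us')" using ws(2) wu Cons by simp
      moreover have "successively (\<lambda>v v'. \<nu> v = ?f v') (u # us')"
      proof (rule successively_mono[OF calculation(1)])
        fix v v' assume "v \<in> set (u # us')" "v' \<in> set (u # us')" "\<nu> v = \<mu> v'"
        then show "\<nu> v = ?f v'" using calculation(3) wu by auto
      qed
      ultimately show ?thesis using wu Cons by auto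
    qed
    then show "successively (\<lambda>v v'. \<nu> v = ?f v') ws" .
    show "\<nu> (last ws) = ?f (hd ws)" using y(1) by simp
    show "\<nu> w = ?f w" if "w \<in> white G - set ws" for w using that out hl(1) by auto
  qed
  also have "mdet ?f (BL @ map pt (j # r)) = mdet \<mu> (BL @ map pt (i # r))"
  proof -
    have "colmat mm (\<lambda>c b. of_bool (b = ?f (WL ! c))) (BL @ map pt (j # r))
        = colmat mm (\<lambda>c b. of_bool (b = \<mu> (WL ! c)) :: complex) (BL @ map pt (i # r))"
    proof (rule eq_matI)
      fix a c assume "a < dim_row (colmat mm (\<lambda>c b. of_bool (b = \<mu> (WL ! c)) :: complex) (BL @ map pt (i # r)))"
        "c < dim_col (colmat mm (\<lambda>c b. of_bool (b = \<mu> (WL ! c)) :: complex) (BL @ map pt (i # r)))"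
      then have ac: "a < mm" "c < mm" using len(1) by simp_all
      have aw: "WL ! a \<in> white G" by (rule WL_white[OF ac(1)])
      have hdw: "hd ws \<in> white G" using hl(1) ws(3) by blast
      have pi: "\<mu> w = pt i \<longleftrightarrow> w = hd ws" if "w \<in> white G" for w
        using inj_onD[OF inj(1), of w "hd ws"] x(1) that hdw by auto
      have "((BL @ map pt (j # r)) ! c = ?f (WL ! a)) \<longleftrightarrow> ((BL @ map pt (i # r)) ! c = \<mu> (WL ! a))"
      proof (cases "c = length BL")
        case True
        then show ?thesis using pi[OF aw] y(2) aw by (auto simp: nth_append)
      next
        case False
        then have eq: "(BL @ map pt (j # r)) ! c = (BL @ map pt (i # r)) ! c"
          by (auto simp: nth_append nth_Cons split: nat.split)
        let ?b = "(BL @ map pt (i # r)) ! c"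
        have "?b \<in> Bint \<union> pt ` ?R"
        proof (cases "c < length BL")
          case True
          then have "?b \<in> set BL" by (simp add: nth_append)
          then show ?thesis unfolding BL(1) by blast
        next
          case c: False
          then obtain c' where c': "c = length BL + Suc c'" using False by (metis add_Suc_right less_imp_Suc_add nat_neq_iff)
          then have "?b = map pt r ! c'" "c' < length r" using ac(2) len(1) by (auto simp: nth_append)
          then have "?b \<in> pt ` set r" by simp
          then show ?thesis using r(1) by blast
        qed
        moreover have "b \<noteq> pt i \<and> b \<noteq> pt j" if "b \<in> Bint" for b
          using that black_split(2) pt_in_bdry ij by (metis IntI disjoint_iff less_trans)
        moreover have "pt s \<noteq> pt i \<and> pt s \<noteq> pt j" if "s \<in> ?R" for s
          using that bds(3,4) pt_inj[of s] ij unfolding bd_def by auto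
        ultimately have "?b \<noteq> pt i \<and> ?b \<noteq> pt j" by (elim UnE imageE) (assumption | metis)+
        then show ?thesis unfolding eq using pi[OF aw] by auto
      qed
      then show "colmat mm (\<lambda>c b. of_bool (b = ?f (WL ! c))) (BL @ map pt (j # r)) $$ (a, c)
          = colmat mm (\<lambda>c b. of_bool (b = \<mu> (WL ! c)) :: complex) (BL @ map pt (i # r)) $$ (a, c)"
        using ac len by simp
    qed (use len in simp_all)
    then show ?thesis by simp
  qed
  finally have D: "mdet \<nu> (BL @ map pt (j # r)) = (-1) ^ (length ws - 1) * mdet \<mu> (BL @ map pt (i # r))" .
  have "Msign \<sigma> \<nu> = (-1) ^ (card (?S \<inter> bd \<mu>) + (length ws + 1 + card (?S \<inter> bd \<mu>)) + (length ws - 1)) * Msign \<sigma> \<mu>"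
    unfolding M\<mu> M\<nu> ls unfolding msign_def P D by (simp add: power_add)
  also have "card (?S \<inter> bd \<mu>) + (length ws + 1 + card (?S \<inter> bd \<mu>)) + (length ws - 1) = 2 * (card (?S \<inter> bd \<mu>) + length ws)"
    using ws(1) by (cases ws) auto
  finally show ?thesis by (simp add: power_mult)
qed

end

context reduced_disk_graph
begin

section \<open>All matchings enter with the same sign\<close>

text \<open>Two different matchings admit an exchange that brings the first one closer to the second. Follow the edges
  of the two matchings alternately, starting at a boundary vertex that only the
  first one uses, if there is one, and at any vertex where they differ otherwise.\<close>

lemma exists_exchange:
  assumes mf: "matchfun \<mu>" "matchfun \<mu>'" and ne: "\<mu> \<noteq> \<mu>'"
  obtains \<nu> ws where "exch \<mu> \<nu> ws" "\<And>w. w \<in> set ws \<Longrightarrow> \<nu> w = \<mu>' w"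
    "\<nu> (last ws) = \<mu> (hd ws) \<or> (\<exists>i<n. \<exists>j<n. \<mu> (hd ws) = pt i \<and> pt i \<notin> \<nu> ` white G \<and>
       \<nu> (last ws) = pt j \<and> pt j \<notin> \<mu> ` white G)"
proof -
  define D where "D = {w \<in> white G. \<mu> w \<noteq> \<mu>' w}"
  have inj: "inj_on \<mu> (white G)" "inj_on \<mu>' (white G)" using mf unfolding matchfun_def by auto
  have finD: "finite D" unfolding D_def using finite_white by simp
  obtain w1 where w1: "w1 \<in> D"
  proof -
    have "\<exists>w \<in> white G. \<mu> w \<noteq> \<mu>' w"
    proof (rule ccontr)
      assume "\<not> ?thesis"
      then have "\<mu> = \<mu>'" using mf unfolding matchfun_def by (intro extensionalityI[of \<mu> "white G"]) auto
      then show False using ne by simp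
    qed
    then show ?thesis using that unfolding D_def by blast
  qed
  \<comment> \<open>Start at a boundary vertex that only \<open>\<mu>\<close> uses, if there is one.\<close>
  obtain w0 where w0: "w0 \<in> D" and start: "bd \<mu> = bd \<mu>' \<or> (\<exists>i<n. \<mu> w0 = pt i \<and> pt i \<notin> \<mu>' ` white G)"
  proof (cases "bd \<mu> = bd \<mu>'")
    case True
    then show ?thesis using w1 that by blast
  next
    case False
    have fin: "finite (bd \<mu>')" unfolding bd_def by simp
    have "card (bd \<mu>) = card (bd \<mu>')" using card_bd mf by simp
    then have "\<not> bd \<mu> \<subseteq> bd \<mu>'" using card_subset_eq[OF fin] False by blast
    then obtain i where i: "i \<in> bd \<mu>" "i \<notin> bd \<mu>'" by blast
    then have i': "i < n" "pt i \<in> \<mu> ` white G" "pt i \<notin> \<mu>' ` white G" unfolding bd_def by auto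
    then obtain w where w: "w \<in> white G" "\<mu> w = pt i" by (metis imageE)
    have "\<mu> w \<noteq> \<mu>' w" using i'(3) w by (metis imageI)
    then have "w \<in> D" unfolding D_def using w(1) by simp
    then show ?thesis by (rule that) (use i' w in blast)
  qed
  let ?P = "\<lambda>ws. ws \<noteq> [] \<and> hd ws = w0 \<and> distinct ws \<and> set ws \<subseteq> D \<and> successively (\<lambda>w w'. \<mu>' w = \<mu> w') ws"
  have "\<exists>ws. ?P ws \<and> (\<forall>vs. ?P vs \<longrightarrow> length vs \<le> length ws)"
  proof (rule ex_has_greatest_nat)
    show "?P [w0]" using w0 by simp
    show "\<forall>vs. ?P vs \<longrightarrow> length vs < Suc (card D)"
    proof (intro allI impI)
      fix vs assume "?P vs"
      then have vs: "distinct vs" "set vs \<subseteq> D" by blast+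
      have "card (set vs) \<le> card D" by (rule card_mono[OF finD vs(2)])
      moreover have "card (set vs) = length vs" by (rule distinct_card[OF vs(1)])
      ultimately show "length vs < Suc (card D)" by linarith
    qed
  qed
  then obtain ws where Pm: "?P ws \<and> (\<forall>vs. ?P vs \<longrightarrow> length vs \<le> length ws)" ..
  have P: "?P ws" by (rule conjunct1[OF Pm])
  have maxi: "length vs \<le> length ws" if "?P vs" for vs by (rule conjunct2[OF Pm, THEN spec, THEN mp, OF that])
  have ws: "ws \<noteq> []" "hd ws = w0" "distinct ws" "set ws \<subseteq> D" "successively (\<lambda>w w'. \<mu>' w = \<mu> w') ws"
    using P by auto
  have DW: "D \<subseteq> white G" unfolding D_def by blast
  have wsW: "set ws \<subseteq> white G" using ws(4) DW by blast
  let ?l = "last ws"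
  have l: "?l \<in> set ws" "?l \<in> D" "?l \<in> white G" using ws(1,4) wsW by auto
  have w0s: "w0 \<in> set ws" using ws(1,2) by auto
  have rot: "insert (\<mu> w0) (\<mu>' ` set ws) = insert (\<mu>' ?l) (\<mu> ` set ws)"
    using rotate_image_path[OF ws(1,5)] ws(2) by simp
  \<comment> \<open>A maximal list cannot be continued.\<close>
  have ends: "\<mu>' ?l = \<mu> w0 \<or> \<mu>' ?l \<notin> \<mu> ` white G"
  proof (rule ccontr)
    assume "\<not> ?thesis"
    then obtain w where w: "w \<in> white G" "\<mu>' ?l = \<mu> w" "w \<noteq> w0" by auto
    have "w \<in> D"
    proof (rule ccontr)
      assume "w \<notin> D"
      then have "\<mu>' w = \<mu>' ?l" unfolding D_def using w by simp
      then have "w = ?l" using inj_onD[OF inj(2)] w(1) l(3) by blast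
      then show False using l(2) \<open>w \<notin> D\<close> by blast
    qed
    have "w \<in> set ws"
    proof (rule ccontr)
      assume nw: "w \<notin> set ws"
      have "?P (ws @ [w])" using ws w nw \<open>w \<in> D\<close> by (simp add: successively_append_iff)
      then show False using maxi[of "ws @ [w]"] by simp
    qed
    then obtain us vs where uv: "ws = us @ w # vs" by (meson split_list)
    have "us \<noteq> []" using uv ws(2) w(3) by auto
    then obtain us' u where u: "us = us' @ [u]" by (cases us rule: rev_cases) auto
    have "\<mu>' u = \<mu> w" using ws(5) unfolding uv u by (simp add: successively_append_iff)
    then have "\<mu>' u = \<mu>' ?l" using w(2) by simp
    moreover have "u \<in> white G" using wsW unfolding uv u by simp
    ultimately have "u = ?l" using inj_onD[OF inj(2)] l(3) by blast
    moreover have "?l \<in> set (w # vs)" unfolding uv by simp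
    moreover have "u \<notin> set (w # vs)" using ws(3) unfolding uv u by auto
    ultimately show False by simp
  qed
  have ends2: "\<mu>' ?l = \<mu> w0 \<or> (\<exists>i<n. \<exists>j<n. \<mu> w0 = pt i \<and> pt i \<notin> \<mu>' ` white G \<and> \<mu>' ?l = pt j \<and> pt j \<notin> \<mu> ` white G)"
  proof (cases "\<mu>' ?l = \<mu> w0")
    case False
    then have y: "\<mu>' ?l \<notin> \<mu> ` white G" using ends by blast
    have "\<mu>' ?l \<in> \<mu>' ` white G" using l(3) by blast
    then have mem: "\<mu>' ?l \<in> Bint \<union> pt ` bd \<mu>'" using matchfun_image[OF mf(2)] by simp
    have "bd \<mu> \<noteq> bd \<mu>'"
    proof
      assume "bd \<mu> = bd \<mu>'"
      then show False using mem y matchfun_image[OF mf(1)] by simp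
    qed
    then obtain i where i: "i < n" "\<mu> w0 = pt i" "pt i \<notin> \<mu>' ` white G" using start by blast
    have "\<mu>' ?l \<notin> Bint" using y matchfun_image[OF mf(1)] by auto
    then obtain j where "j \<in> bd \<mu>'" "\<mu>' ?l = pt j" using mem by auto
    then have "j < n" "\<mu>' ?l = pt j" "pt j \<notin> \<mu> ` white G" using y unfolding bd_def by auto
    then show ?thesis using i by blast
  qed simp
  define \<nu> where "\<nu> = (\<lambda>w. if w \<in> set ws then \<mu>' w else \<mu> w)"
  have \<nu>in: "\<nu> w = \<mu>' w" if "w \<in> set ws" for w using that unfolding \<nu>_def by simp
  have \<nu>out: "\<nu> w = \<mu> w" if "w \<notin> set ws" for w using that unfolding \<nu>_def by simp
  have sep: "\<mu>' w \<noteq> \<mu> w'" if w: "w \<in> set ws" "w' \<in> white G" "w' \<notin> set ws" for w w'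
  proof
    assume eq: "\<mu>' w = \<mu> w'"
    have "\<mu>' w \<in> insert (\<mu>' ?l) (\<mu> ` set ws)" using rot w(1) by blast
    moreover have "\<mu> w' \<notin> \<mu> ` set ws"
    proof
      assume "\<mu> w' \<in> \<mu> ` set ws"
      then obtain w'' where "w'' \<in> set ws" "\<mu> w' = \<mu> w''" by blast
      then show False using inj_onD[OF inj(1)] w(2,3) wsW by blast
    qed
    ultimately have "\<mu> w' = \<mu>' ?l" using eq by simp
    then have "\<mu> w' = \<mu> w0" using ends w(2) by (metis imageI)
    then have "w' = w0" using inj_onD[OF inj(1)] w(2) w0s wsW by blast
    then show False using w0s w(3) by blast
  qed
  have "matchfun \<nu>"
    unfolding matchfun_def
  proof (intro conjI ballI)
    have ext: "\<mu> \<in> extensional (white G)" using mf(1) unfolding matchfun_def by blast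
    show "\<nu> \<in> extensional (white G)"
      unfolding extensional_def
    proof (intro CollectI allI impI)
      fix x assume "x \<notin> white G"
      then show "\<nu> x = undefined" using extensional_arb[OF ext] \<nu>out wsW by (metis subsetD)
    qed
    show "pg.adj w (\<nu> w)" if "w \<in> white G" for w using mf that unfolding matchfun_def \<nu>_def by simp
    show "inj_on \<nu> (white G)"
    proof (rule inj_onI)
      fix w w' assume a: "w \<in> white G" "w' \<in> white G" "\<nu> w = \<nu> w'"
      show "w = w'"
      proof (cases "w \<in> set ws"; cases "w' \<in> set ws")
        assume "w \<in> set ws" "w' \<in> set ws"
        then show ?thesis using a \<nu>in inj_onD[OF inj(2)] by metis
      next
        assume "w \<in> set ws" "w' \<notin> set ws"
        then show ?thesis using a sep \<nu>in \<nu>out by metis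
      next
        assume "w \<notin> set ws" "w' \<in> set ws"
        then show ?thesis using a sep \<nu>in \<nu>out by metis
      next
        assume "w \<notin> set ws" "w' \<notin> set ws"
        then show ?thesis using a \<nu>out inj_onD[OF inj(1)] by metis
      qed
    qed
    show "Bint \<subseteq> \<nu> ` white G"
    proof
      fix b assume b: "b \<in> Bint"
      then have "b \<in> \<mu> ` white G" using matchfun_image[OF mf(1)] by auto
      then obtain w where w: "w \<in> white G" "b = \<mu> w" by blast
      show "b \<in> \<nu> ` white G"
      proof (cases "w \<in> set ws")
        case False
        then show ?thesis using w \<nu>out by (metis imageI)
      next
        case True
        then have "b \<in> insert (\<mu> w0) (\<mu>' ` set ws)" using rot w(2) by blast
        moreover have "b \<in> \<mu>' ` set ws" if "b = \<mu> w0"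
        proof -
          have "pt i \<notin> Bint" if "i < n" for i using black_split(2) pt_in_bdry[OF that] by blast
          then have "\<mu>' ?l = \<mu> w0" using ends2 b \<open>b = \<mu> w0\<close> by auto
          then show ?thesis using \<open>b = \<mu> w0\<close> l(1) by (metis imageI)
        qed
        ultimately have "b \<in> \<mu>' ` set ws" by blast
        then obtain w' where "w' \<in> set ws" "b = \<mu>' w'" by blast
        then show ?thesis using \<nu>in wsW by (metis imageI subsetD)
      qed
    qed
  qed
  moreover have "successively (\<lambda>w w'. \<nu> w = \<mu> w') ws"
    by (rule successively_mono[OF ws(5)]) (simp add: \<nu>in)
  moreover have "\<forall>w \<in> set ws. \<nu> w \<noteq> \<mu> w" using ws(4) \<nu>in unfolding D_def by fastforce
  ultimately have ex: "exch \<mu> \<nu> ws"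
    unfolding exch_def using mf(1) ws(1,3) wsW \<nu>out by simp
  have "\<nu> ?l = \<mu>' ?l" using \<nu>in l(1) by blast
  moreover have "pt i \<notin> \<nu> ` white G" if i: "\<mu> w0 = pt i" "pt i \<notin> \<mu>' ` white G" for i
  proof
    assume "pt i \<in> \<nu> ` white G"
    then obtain w where w: "w \<in> white G" "pt i = \<nu> w" by blast
    show False
    proof (cases "w \<in> set ws")
      case True
      then show False using \<nu>in w i(2) by (metis imageI)
    next
      case False
      then have "\<mu> w = \<mu> w0" using \<nu>out w(2) i(1) by simp
      then show False using inj_onD[OF inj(1)] w(1) w0s wsW False by blast
    qed
  qed
  ultimately have "\<nu> (last ws) = \<mu> (hd ws) \<or> (\<exists>i<n. \<exists>j<n. \<mu> (hd ws) = pt i \<and> pt i \<notin> \<nu> ` white G \<and>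
       \<nu> (last ws) = pt j \<and> pt j \<notin> \<mu> ` white G)"
    using ends2 unfolding ws(2) by metis
  then show ?thesis using that[OF ex] \<nu>in by blast
qed

lemma exch_sign:
  assumes \<sigma>: "kasteleyn_signature G \<sigma>" and ex: "exch \<mu> \<nu> ws"
    and ends: "\<nu> (last ws) = \<mu> (hd ws) \<or> (\<exists>i<n. \<exists>j<n. \<mu> (hd ws) = pt i \<and> pt i \<notin> \<nu> ` white G \<and>
       \<nu> (last ws) = pt j \<and> pt j \<notin> \<mu> ` white G)"
  shows "Msign \<sigma> \<nu> = Msign \<sigma> \<mu>"
proof (cases "\<nu> (last ws) = \<mu> (hd ws)")
  case True
  then show ?thesis by (rule exch_cycle_sign[OF \<sigma> ex])
next
  case False
  then obtain i j where ij: "i < n" "j < n" "\<mu> (hd ws) = pt i" "pt i \<notin> \<nu> ` white G"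
    "\<nu> (last ws) = pt j" "pt j \<notin> \<mu> ` white G" using ends by blast
  have "ws \<noteq> []" using ex unfolding exch_def by blast
  then have r: "hd (rev ws) = last ws" "last (rev ws) = hd ws" by (simp_all add: hd_rev last_rev)
  consider "j < i" | "i < j" using False ij by (metis nat_neq_iff)
  then show ?thesis
  proof cases
    case 1
    show ?thesis by (rule exch_path_sign[OF \<sigma> ex 1 ij(1,3,4,5,6)])
  next
    case 2
    have "Msign \<sigma> \<mu> = Msign \<sigma> \<nu>"
      by (rule exch_path_sign[OF \<sigma> exch_rev[OF ex] 2 ij(2)]) (use ij r in simp_all)
    then show ?thesis ..
  qed
qed

text \<open>Induction on the number of white vertices with different partners.\<close>

lemma Msign_constant:
  assumes \<sigma>: "kasteleyn_signature G \<sigma>" and mf: "matchfun \<mu>" "matchfun \<mu>'"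
  shows "Msign \<sigma> \<mu> = Msign \<sigma> \<mu>'"
  using mf(1)
proof (induction "card {w \<in> white G. \<mu> w \<noteq> \<mu>' w}" arbitrary: \<mu> rule: less_induct)
  case less
  show ?case
  proof (cases "\<mu> = \<mu>'")
    case False
    obtain \<nu> ws where \<nu>: "exch \<mu> \<nu> ws" "\<And>w. w \<in> set ws \<Longrightarrow> \<nu> w = \<mu>' w"
      "\<nu> (last ws) = \<mu> (hd ws) \<or> (\<exists>i<n. \<exists>j<n. \<mu> (hd ws) = pt i \<and> pt i \<notin> \<nu> ` white G \<and>
         \<nu> (last ws) = pt j \<and> pt j \<notin> \<mu> ` white G)"
      using exists_exchange[OF less.prems mf(2) False] by blast
    have e: "matchfun \<nu>" "ws \<noteq> []" "set ws \<subseteq> white G" "\<forall>w \<in> white G - set ws. \<nu> w = \<mu> w"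
      "\<forall>w \<in> set ws. \<nu> w \<noteq> \<mu> w" using \<nu>(1) unfolding exch_def by auto
    have "{w \<in> white G. \<nu> w \<noteq> \<mu>' w} \<subset> {w \<in> white G. \<mu> w \<noteq> \<mu>' w}"
    proof
      show "{w \<in> white G. \<nu> w \<noteq> \<mu>' w} \<subseteq> {w \<in> white G. \<mu> w \<noteq> \<mu>' w}"
      proof
        fix w assume w: "w \<in> {w \<in> white G. \<nu> w \<noteq> \<mu>' w}"
        then have "w \<notin> set ws" using \<nu>(2) by blast
        then show "w \<in> {w \<in> white G. \<mu> w \<noteq> \<mu>' w}" using w e(4) by auto
      qed
      have "hd ws \<in> set ws" using e(2) by simp
      then have "hd ws \<in> white G" "\<nu> (hd ws) = \<mu>' (hd ws)" "\<nu> (hd ws) \<noteq> \<mu> (hd ws)" using e(3,5) \<nu>(2) by auto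
      then have "hd ws \<in> {w \<in> white G. \<mu> w \<noteq> \<mu>' w}" "hd ws \<notin> {w \<in> white G. \<nu> w \<noteq> \<mu>' w}" by auto
      then show "{w \<in> white G. \<nu> w \<noteq> \<mu>' w} \<noteq> {w \<in> white G. \<mu> w \<noteq> \<mu>' w}" by blast
    qed
    then have "card {w \<in> white G. \<nu> w \<noteq> \<mu>' w} < card {w \<in> white G. \<mu> w \<noteq> \<mu>' w}"
      using finite_white by (intro psubset_card_mono) auto
    then have "Msign \<sigma> \<nu> = Msign \<sigma> \<mu>'" using less.hyps e(1) by blast
    then show ?thesis using exch_sign[OF \<sigma> \<nu>(1,3)] by simp
  qed simp
qed

lemma Msign_nonzero:
  assumes \<sigma>: "kasteleyn_signature G \<sigma>" and mf: "matchfun \<mu>"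
  shows "Msign \<sigma> \<mu> \<noteq> 0"
proof -
  let ?l = "sorted_list_of_set (bd \<mu>)"
  let ?L = "BL @ map pt ?l"
  let ?M = "colmat mm (\<lambda>i b. of_bool (b = \<mu> (WL ! i)) :: complex) ?L"
  have fin: "finite (bd \<mu>)" unfolding bd_def by simp
  have len: "length ?L = mm" using card_bd[OF mf] len_BL by simp
  have setL: "set ?L = \<mu> ` white G" using matchfun_image[OF mf] BL(1) fin by simp
  have inj: "inj_on \<mu> (white G)" using mf unfolding matchfun_def by blast
  have "card (set ?L) = length ?L" unfolding setL len using card_image[OF inj] by (simp add: mm_def)
  then have dist: "distinct ?L" by (rule card_distinct)
  \<comment> \<open>A permutation matrix is orthogonal.\<close>
  have "?M * transpose_mat ?M = 1\<^sub>m mm"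
  proof (rule eq_matI)
    fix a a' assume a: "a < dim_row (1\<^sub>m mm :: complex mat)" "a' < dim_col (1\<^sub>m mm :: complex mat)"
    then have am: "a < mm" "a' < mm" by auto
    have "(?M * transpose_mat ?M) $$ (a, a') = (\<Sum>c<mm. of_bool (?L ! c = \<mu> (WL ! a)) * of_bool (?L ! c = \<mu> (WL ! a')))"
      using am len by (simp add: scalar_prod_def lessThan_atLeast0)
    also have "\<dots> = (\<Sum>b \<in> set ?L. of_bool (b = \<mu> (WL ! a)) * of_bool (b = \<mu> (WL ! a')))"
    proof (rule sum.reindex_bij_betw)
      show "bij_betw ((!) ?L) {..<mm} (set ?L)" by (rule bij_betw_nth[OF dist _ refl]) (use len in simp)
    qed
    also have "\<dots> = (\<Sum>b \<in> {\<mu> (WL ! a)}. of_bool (b = \<mu> (WL ! a)) * of_bool (b = \<mu> (WL ! a')))"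
    proof (rule sum.mono_neutral_right)
      show "{\<mu> (WL ! a)} \<subseteq> set ?L" unfolding setL using WL_white[OF am(1)] by blast
    qed auto
    also have "\<dots> = of_bool (\<mu> (WL ! a) = \<mu> (WL ! a'))" by simp
    also have "\<mu> (WL ! a) = \<mu> (WL ! a') \<longleftrightarrow> a = a'"
    proof
      assume "\<mu> (WL ! a) = \<mu> (WL ! a')"
      then have "WL ! a = WL ! a'" by (rule inj_onD[OF inj _ WL_white[OF am(1)] WL_white[OF am(2)]])
      then show "a = a'" using nth_eq_iff_index_eq[OF WL(2), of a a'] WL(3) am by simp
    qed simp
    finally show "(?M * transpose_mat ?M) $$ (a, a') = 1\<^sub>m mm $$ (a, a')" using am by simp
  qed (use len in simp_all)
  then have "dt ?M * dt (transpose_mat ?M) = 1"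
    using det_mult[of ?M mm "transpose_mat ?M"] colmat_carrier[OF len] by simp
  then have "mdet \<mu> ?L \<noteq> 0" by auto
  moreover have "(\<Prod>w \<in> white G. \<sigma> (pg.ed w (\<mu> w))) \<noteq> 0"
  proof -
    have "\<sigma> (pg.ed w (\<mu> w)) \<noteq> 0" if "w \<in> white G" for w
    proof -
      have "pg.adj w (\<mu> w)" using mf that unfolding matchfun_def by blast
      then show ?thesis using \<sigma> pg.ed_props(1) unfolding kasteleyn_signature_def by fastforce
    qed
    then show ?thesis using finite_white by simp
  qed
  ultimately show ?thesis unfolding msign_def mult_eq_0_iff of_int_eq_0_iff by blast
qed

text \<open>Kasteleyn's theorem: up to one common factor, the minors of the Kasteleyn matrix that contain all
  inner columns are the boundary measurements.\<close>

theorem kasteleyn_minors: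
  assumes \<sigma>: "kasteleyn_signature G \<sigma>"
  obtains \<epsilon> where "\<epsilon> \<noteq> 0" "\<And>is t. length is = k \<Longrightarrow> distinct is \<Longrightarrow> set is \<subseteq> {..<n} \<Longrightarrow>
    dt (colmat mm (kast \<sigma> t) (BL @ map pt is)) = \<epsilon> * lsign is * boundary_measurement G t (set is)"
proof -
  obtain \<mu>0 where \<mu>0: "matchfun \<mu>0" using exists_matchfun by blast
  show ?thesis
  proof (rule that)
    show "Msign \<sigma> \<mu>0 \<noteq> 0" by (rule Msign_nonzero[OF \<sigma> \<mu>0])
    fix "is" t assume "is": "length is = k" "distinct is" "set is \<subseteq> {..<n}"
    have "msign \<sigma> \<mu> is = lsign is * Msign \<sigma> \<mu>0" if "matchfun \<mu>" "bd \<mu> = set is" for \<mu>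
    proof -
      have "lsign is * msign \<sigma> \<mu> is = Msign \<sigma> \<mu>0"
        using msign_sort[OF "is"(1,2)] that(2) Msign_constant[OF \<sigma> that(1) \<mu>0] by simp
      then have "lsign is * (lsign is * msign \<sigma> \<mu> is) = lsign is * Msign \<sigma> \<mu>0" by simp
      then show ?thesis using lsign_sq[of "is"] by (simp add: mult.assoc[symmetric])
    qed
    then show "dt (colmat mm (kast \<sigma> t) (BL @ map pt is)) = Msign \<sigma> \<mu>0 * lsign is * boundary_measurement G t (set is)"
      unfolding kast_minor[OF "is"] boundary_measurement_sum sum_distrib_left
      by (intro sum.cong refl) simp
  qed
qed

section \<open>Vector configurations\<close>

text \<open>A vector configuration is, in each coordinate, in the kernel of the Kasteleyn matrix.\<close>

lemma config_relation:
  assumes v: "vector_configuration G \<sigma> t d v" and i: "i < mm" and l: "l < d"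
  shows "(\<Sum>b \<in> set BL. kast \<sigma> t i b * vec_index (v b) l) + (\<Sum>j<n. kast \<sigma> t i (pt j) * vec_index (v (pt j)) l) = 0"
proof -
  let ?w = "WL ! i"
  have w: "?w \<in> white G" by (rule WL_white[OF i])
  let ?N = "{b \<in> black G. pg.adj ?w b}"
  have vc: "v b \<in> carrier_vec d" if "b \<in> black G" for b using v that unfolding vector_configuration_def by blast
  have bij: "bij_betw (pg.ed ?w) ?N (edges_at G ?w)"
    unfolding bij_betw_def
  proof
    show "inj_on (pg.ed ?w) ?N"
    proof (rule inj_onI)
      fix b b' assume a: "b \<in> ?N" "b' \<in> ?N" "pg.ed ?w b = pg.ed ?w b'"
      then have "pg.adj ?w b" "pg.adj ?w b'" by auto
      then show "b = b'" using adj_ends(4)[OF _ w] a(3) by metis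
    qed
    show "pg.ed ?w ` ?N = edges_at G ?w"
    proof
      have "pg.ed ?w b \<in> edges_at G ?w" if "pg.adj ?w b" for b
        using pg.ed_props[OF that] unfolding edges_at_def by blast
      then show "pg.ed ?w ` ?N \<subseteq> edges_at G ?w" by blast
      show "edges_at G ?w \<subseteq> pg.ed ?w ` ?N"
      proof
        fix e assume "e \<in> edges_at G ?w"
        then have e: "e \<in> edges G" "?w \<in> e" unfolding edges_at_def by auto
        have "wh e = ?w" using white_in_edge[OF e(1) w] e(2) by simp
        then have "pg.adj ?w (bl e)" "e = pg.ed ?w (bl e)" using edge_is_ed[OF e(1)] by auto
        moreover have "bl e \<in> black G" by (rule edge_ends(1)[OF e(1)])
        ultimately show "e \<in> pg.ed ?w ` ?N" by blast
      qed
    qed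
  qed
  have fin: "finite (edges_at G ?w)" unfolding edges_at_def using finite_edges by simp
  have "finsum_vec TYPE(complex) d (\<lambda>e. (of_int (\<sigma> e) * t e) \<cdot>\<^sub>v v (bl e)) (edges_at G ?w) = 0\<^sub>v d"
    using v w unfolding vector_configuration_def by blast
  then have "0 = vec_index (finsum_vec TYPE(complex) d (\<lambda>e. (of_int (\<sigma> e) * t e) \<cdot>\<^sub>v v (bl e)) (edges_at G ?w)) l"
    using l by simp
  also have "\<dots> = (\<Sum>e \<in> edges_at G ?w. vec_index ((of_int (\<sigma> e) * t e) \<cdot>\<^sub>v v (bl e)) l)"
  proof (rule index_finsum_vec[OF fin l])
    have "bl e \<in> black G" if "e \<in> edges_at G ?w" for e using that edge_ends(1) unfolding edges_at_def by blast
    then show "(\<lambda>e. (of_int (\<sigma> e) * t e) \<cdot>\<^sub>v v (bl e)) \<in> edges_at G ?w \<rightarrow> carrier_vec d"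
      using vc by (intro Pi_I smult_carrier_vec) auto
  qed
  also have "\<dots> = (\<Sum>b \<in> ?N. vec_index ((of_int (\<sigma> (pg.ed ?w b)) * t (pg.ed ?w b)) \<cdot>\<^sub>v v (bl (pg.ed ?w b))) l)"
    by (rule sum.reindex_bij_betw[OF bij, symmetric])
  also have "\<dots> = (\<Sum>b \<in> ?N. kast \<sigma> t i b * vec_index (v b) l)"
  proof (rule sum.cong[OF refl])
    fix b assume b: "b \<in> ?N"
    then have "bl (pg.ed ?w b) = b" using adj_ends(4)[OF _ w] by blast
    moreover have "dim_vec (v b) = d" using vc b by auto
    ultimately show "vec_index ((of_int (\<sigma> (pg.ed ?w b)) * t (pg.ed ?w b)) \<cdot>\<^sub>v v (bl (pg.ed ?w b))) l = kast \<sigma> t i b * vec_index (v b) l"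
      unfolding kast_def using b l by simp
  qed
  also have "\<dots> = (\<Sum>b \<in> black G. kast \<sigma> t i b * vec_index (v b) l)"
    by (rule sum.mono_neutral_left) (auto simp: finite_black kast_def)
  also have "\<dots> = (\<Sum>b \<in> set BL \<union> pt ` {..<n}. kast \<sigma> t i b * vec_index (v b) l)"
    unfolding BL(1) set_bdry[symmetric] black_split(1)[symmetric] ..
  also have "\<dots> = (\<Sum>b \<in> set BL. kast \<sigma> t i b * vec_index (v b) l) + (\<Sum>b \<in> pt ` {..<n}. kast \<sigma> t i b * vec_index (v b) l)"
  proof (rule sum.union_disjoint)
    show "set BL \<inter> pt ` {..<n} = {}" unfolding BL(1) set_bdry[symmetric] by (rule black_split(2))
  qed auto
  also have "(\<Sum>b \<in> pt ` {..<n}. kast \<sigma> t i b * vec_index (v b) l) = (\<Sum>j<n. kast \<sigma> t i (pt j) * vec_index (v (pt j)) l)"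
  proof (rule sum.reindex[unfolded comp_def], rule inj_onI)
    fix x y assume "x \<in> {..<n}" "y \<in> {..<n}" "pt x = pt y"
    then show "x = y" using pt_inj[of x y] by simp
  qed
  finally show ?thesis ..
qed

lemma k_le_n: "k \<le> n"
proof -
  obtain \<mu> where \<mu>: "matchfun \<mu>" using exists_matchfun by blast
  have "bd \<mu> \<subseteq> {..<n}" unfolding bd_def by auto
  then have "card (bd \<mu>) \<le> n" using card_mono[of "{..<n}" "bd \<mu>"] by simp
  then show ?thesis using card_bd[OF \<mu>] by simp
qed

lemma boundary_matrix_gr_rep:
  assumes "vector_configuration G \<sigma> t d v"
  shows "gr_rep d n (boundary_matrix G d v)"
  unfolding boundary_matrix_def
proof (rule spanning_cols_gr_rep)
  show "set (map v (bdry G)) \<subseteq> carrier_vec d"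
    using assms bdry_black unfolding vector_configuration_def by auto
  show "length (map v (bdry G)) = n" using len_bdry by simp
  show "LinearCombinations.module.span class_ring (module_vec TYPE(complex) d) (set (map v (bdry G))) = carrier_vec d"
    using assms unfolding vector_configuration_def by simp
qed

lemma boundary_matrix_index:
  "l < d \<Longrightarrow> j < n \<Longrightarrow> boundary_matrix G d v $$ (l, j) = vec_index (v (pt j)) l"
  unfolding boundary_matrix_def using len_bdry pt_bdry by (simp add: mat_of_cols_index)

lemma configuration_orthogonal:
  assumes \<sigma>: "kasteleyn_signature G \<sigma>" and A: "represents G t k A" and v: "vector_configuration G \<sigma> t d v"
    and rl: "r < k" "l < d"
  shows "(\<Sum>j<n. A $$ (r, j) * boundary_matrix G d v $$ (l, j)) = 0"
proof -
  have gr: "gr_rep k n A" and "\<exists>c. c \<noteq> 0 \<and> (\<forall>I. I \<subseteq> {..<n} \<and> card I = k \<longrightarrow> pluecker A I = c * boundary_measurement G t I)"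
    using A len_bdry unfolding represents_def by auto
  then obtain c where c: "\<And>I. I \<subseteq> {..<n} \<Longrightarrow> card I = k \<Longrightarrow> pluecker A I = c * boundary_measurement G t I" by blast
  have cA: "A \<in> carrier_mat k n" using gr unfolding gr_rep_def by blast
  obtain \<epsilon> where \<epsilon>: "\<epsilon> \<noteq> 0" "\<And>is t. length is = k \<Longrightarrow> distinct is \<Longrightarrow> set is \<subseteq> {..<n} \<Longrightarrow>
    dt (colmat mm (kast \<sigma> t) (BL @ map pt is)) = \<epsilon> * lsign is * boundary_measurement G t (set is)"
    using kasteleyn_minors[OF \<sigma>] by blast
  have minors: "dt (colmat k (\<lambda>r j. A $$ (r, j)) is) = c / \<epsilon> * dt (colmat mm (kast \<sigma> t) (BL @ map pt is))"
    if "is": "length is = k" "set is \<subseteq> {..<n}" for "is"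
  proof (cases "distinct is")
    case True
    have "sort is = sorted_list_of_set (set is)"
      using True by (simp add: sorted_list_of_set_sort_remdups distinct_remdups_id)
    then have "dt (colmat k (\<lambda>r j. A $$ (r, j)) is) = lsign is * pluecker A (set is)"
      using det_sort[of "[]" "is" k "\<lambda>r j. A $$ (r, j)" id] "is"(1) pluecker_colmat[OF cA "is"(2)] distinct_card[OF True] by simp
    also have "\<dots> = lsign is * (c * boundary_measurement G t (set is))"
      using c[OF "is"(2)] distinct_card[OF True] "is"(1) by simp
    finally show ?thesis using \<epsilon>(2)[OF "is"(1) True "is"(2), of t] \<epsilon>(1) by simp
  next
    case False
    then have "\<not> distinct (BL @ map pt is)" by (auto simp: distinct_map)
    moreover have "length (BL @ map pt is) = mm" using "is"(1) len_BL by simp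
    ultimately have "dt (colmat mm (kast \<sigma> t) (BL @ map pt is)) = 0" by (intro det_repeated)
    then show ?thesis using det_repeated[OF "is"(1) False] by simp
  qed
  obtain is0 where is0: "length is0 = k" "set is0 \<subseteq> {..<n}" "dt (colmat k (\<lambda>r j. A $$ (r, j)) is0) \<noteq> 0"
    using full_rank_minor[OF gr] by metis
  have "(\<Sum>j<n. A $$ (r, j) * vec_index (v (pt j)) l) = 0"
  proof (rule kernel_orthogonal[where \<beta> = BL and k = k and m = mm and n = n and K = "kast \<sigma> t" and g = pt and A = A
      and \<kappa> = "c / \<epsilon>" and x = "\<lambda>b. vec_index (v b) l"])
    show "dt (colmat k (\<lambda>r j. A $$ (r, j)) is) = c / \<epsilon> * dt (colmat mm (kast \<sigma> t) (BL @ map pt is))"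
      if "length is = k" "set is \<subseteq> {..<n}" for "is" by (rule minors[OF that])
    show "(\<Sum>b \<in> set BL. kast \<sigma> t i b * vec_index (v b) l) + (\<Sum>j<n. kast \<sigma> t i (pt j) * vec_index (v (pt j)) l) = 0"
      if "i < mm" for i by (rule config_relation[OF v that rl(2)])
  qed (rule len_BL BL(2) is0 rl(1))+
  then show ?thesis using boundary_matrix_index[OF rl(2)] by simp
qed

section \<open>The dual network\<close>

lemma dual_graph_simps:
  "almost_perfect_matching (dual_graph G) M = almost_perfect_matching G M"
  "finite_faces (dual_graph G) = finite_faces G" "bdry (dual_graph G) = bdry G" "edges (dual_graph G) = edges G"
proof -
  have v: "verts (dual_graph G) = verts G" unfolding verts_def dual_graph_def by auto
  have e: "bdry (dual_graph G) = bdry G" "edges (dual_graph G) = edges G" unfolding dual_graph_def by auto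
  show "almost_perfect_matching (dual_graph G) M = almost_perfect_matching G M"
    unfolding almost_perfect_matching_def internal_verts_def v e ..
  show "finite_faces (dual_graph G) = finite_faces G"
    unfolding finite_faces_def infinite_face_def faces_def drawing_def v e ..
qed (simp_all add: dual_graph_def)

lemma dual_matching_boundary: "matching_boundary (dual_graph G) M = {..<n} - matching_boundary G M"
proof -
  have "bdry G ! j \<in> black G" "bdry G ! j \<notin> white G" if "j < n" for j
    using pt_in_bdry[OF that] pt_bdry[OF that] bdry_black bw_disjoint by auto
  then show ?thesis
    unfolding matching_boundary_def dual_graph_def using len_bdry by auto
qed

lemma prod_bsign_matching:
  assumes M: "almost_perfect_matching G M"
  shows "(\<Prod>e \<in> M. bsign e) = (-1) ^ (\<Sum>(matching_boundary G M))"
proof -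
  let ?I = "matching_boundary G M"
  have I: "?I \<subseteq> {..<n}" unfolding matching_boundary_def using len_bdry by auto
  have iff: "j \<in> ?I \<longleftrightarrow> bedge (pt j) \<in> M" if "j < n" for j
    using matching_boundary_iff[OF M] pt_bdry[OF that] that len_bdry by simp
  have fin: "finite M" by (rule finite_subset[OF matching_edges[OF M] finite_edges])
  have "(\<Prod>e \<in> M. bsign e) = (\<Prod>e \<in> (\<lambda>j. bedge (pt j)) ` ?I. bsign e)"
  proof (rule prod.mono_neutral_right[OF fin])
    show "(\<lambda>j. bedge (pt j)) ` ?I \<subseteq> M" using iff I by blast
    show "\<forall>e \<in> M - (\<lambda>j. bedge (pt j)) ` ?I. bsign e = 1"
    proof
      fix e assume e: "e \<in> M - (\<lambda>j. bedge (pt j)) ` ?I"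
      show "bsign e = 1"
      proof (rule bsign_other)
        fix j assume "j < n"
        then show "e \<noteq> bedge (pt j)" using e iff by blast
      qed
    qed
  qed
  also have "\<dots> = (\<Prod>j \<in> ?I. bsign (bedge (pt j)))"
  proof (rule prod.reindex[unfolded comp_def], rule inj_onI)
    fix i j assume "i \<in> ?I" "j \<in> ?I" "bedge (pt i) = bedge (pt j)"
    then show "i = j" using bedge_inj[of i j] I by auto
  qed
  also have "\<dots> = (\<Prod>j \<in> ?I. (-1) ^ j)" using bsign_bedge I by (intro prod.cong) auto
  also have "\<dots> = (-1) ^ (\<Sum>j \<in> ?I. j)" by (rule power_sum[symmetric])
  finally show ?thesis .
qed

text \<open>The matchings of the dual graph are those of the graph, with the complementary boundary.\<close>

lemma dual_boundary_measurement:
  assumes J: "J \<subseteq> {..<n}"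
  shows "boundary_measurement (dual_graph G) (\<lambda>e. t e * bsign e) J =
    (-1) ^ (\<Sum>({..<n} - J)) * boundary_measurement G t ({..<n} - J)"
proof -
  have mb: "matching_boundary G M \<subseteq> {..<n}" for M unfolding matching_boundary_def using len_bdry by auto
  have "matching_boundary (dual_graph G) M = J \<longleftrightarrow> matching_boundary G M = {..<n} - J" for M
    unfolding dual_matching_boundary using mb[of M] J by blast
  then have "boundary_measurement (dual_graph G) (\<lambda>e. t e * bsign e) J =
      (\<Sum>M | almost_perfect_matching G M \<and> matching_boundary G M = {..<n} - J. (\<Prod>e \<in> M. t e * bsign e))"
    unfolding boundary_measurement_def dual_graph_simps by simp
  also have "\<dots> = (\<Sum>M | almost_perfect_matching G M \<and> matching_boundary G M = {..<n} - J. (-1) ^ (\<Sum>({..<n} - J)) * (\<Prod>e \<in> M. t e))"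
    using prod_bsign_matching by (intro sum.cong refl) (auto simp: prod.distrib)
  finally show ?thesis unfolding boundary_measurement_def sum_distrib_left .
qed

lemma configuration_represents_dual:
  assumes \<sigma>: "kasteleyn_signature G \<sigma>" and t: "\<forall>e \<in> edges G. t e \<noteq> 0"
    and A: "A \<in> positroid_variety k n (positroid G)" "represents G t k A"
    and v: "vector_configuration G \<sigma> t (n - k) v"
  shows "boundary_matrix G (n - k) v \<in> positroid_variety (n - k) n (dual_positroid n (positroid G))"
    "network_represents (dual_graph G) (dual_face_weight G (face_weight G t)) (n - k) (boundary_matrix G (n - k) v)"
proof -
  let ?X = "boundary_matrix G (n - k) v"
  have gr: "gr_rep k n A" and "\<exists>c. c \<noteq> 0 \<and> (\<forall>I. I \<subseteq> {..<n} \<and> card I = k \<longrightarrow> pluecker A I = c * boundary_measurement G t I)"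
    using A(2) len_bdry unfolding represents_def by auto
  then obtain c where c: "c \<noteq> 0" "\<And>I. I \<subseteq> {..<n} \<Longrightarrow> card I = k \<Longrightarrow> pluecker A I = c * boundary_measurement G t I" by blast
  have grX: "gr_rep (n - k) n ?X" by (rule boundary_matrix_gr_rep[OF v])
  have kd: "k + (n - k) = n" using k_le_n by simp
  obtain c' where c': "c' \<noteq> 0" "\<And>I. I \<subseteq> {..<n} \<Longrightarrow> card I = k \<Longrightarrow>
      pluecker ?X ({..<n} - I) = c' * (-1) ^ (\<Sum>I) * pluecker A I"
    using complementary_minors[OF gr grX kd configuration_orthogonal[OF \<sigma> A(2) v]] by blast
  have compl: "pluecker ?X J = c' * (-1) ^ (\<Sum>({..<n} - J)) * pluecker A ({..<n} - J)" "card ({..<n} - J) = k"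
    if J: "J \<subseteq> {..<n}" "card J = n - k" for J
  proof -
    have "card ({..<n} - J) = card {..<n} - card J"
      by (rule card_Diff_subset[OF finite_subset[OF J(1) finite_lessThan] J(1)])
    then show 1: "card ({..<n} - J) = k" using J(2) k_le_n by simp
    have "{..<n} - ({..<n} - J) = J" using J(1) by blast
    then show "pluecker ?X J = c' * (-1) ^ (\<Sum>({..<n} - J)) * pluecker A ({..<n} - J)"
      using c'(2)[OF Diff_subset 1] by simp
  qed
  show "?X \<in> positroid_variety (n - k) n (dual_positroid n (positroid G))"
    unfolding positroid_variety_def
  proof (intro CollectI conjI grX allI impI)
    fix J assume J: "J \<subseteq> {..<n} \<and> card J = n - k \<and> J \<notin> dual_positroid n (positroid G)"
    have "{..<n} - J \<notin> positroid G"
    proof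
      assume "{..<n} - J \<in> positroid G"
      then have "{..<n} - ({..<n} - J) \<in> dual_positroid n (positroid G)" unfolding dual_positroid_def by blast
      moreover have "{..<n} - ({..<n} - J) = J" using J by blast
      ultimately show False using J by simp
    qed
    then have "pluecker A ({..<n} - J) = 0" using A(1) compl(2) J unfolding positroid_variety_def by auto
    then show "pluecker ?X J = 0" using compl(1) J by simp
  qed
  show "network_represents (dual_graph G) (dual_face_weight G (face_weight G t)) (n - k) ?X"
    unfolding network_represents_def
  proof (intro conjI ballI exI)
    show "dual_face_weight G (face_weight G t) \<Omega> \<noteq> 0" if "\<Omega> \<in> finite_faces (dual_graph G)" for \<Omega>
      using dual_face_weight_signed(2) that t dual_graph_simps(2) by simp
    show "t e * bsign e \<noteq> 0" if "e \<in> edges (dual_graph G)" for e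
    proof -
      have "bsign e \<noteq> 0" using bsign_sq[of e] by auto
      then show ?thesis using that t unfolding dual_graph_simps by simp
    qed
    show "face_weight (dual_graph G) (\<lambda>e. t e * bsign e) \<Omega> = dual_face_weight G (face_weight G t) \<Omega>"
      if "\<Omega> \<in> finite_faces (dual_graph G)" for \<Omega>
      using dual_face_weight_signed(1) that t dual_graph_simps(2) by simp
    show "represents (dual_graph G) (\<lambda>e. t e * bsign e) (n - k) ?X"
      unfolding represents_def dual_graph_simps len_bdry
    proof (intro conjI exI allI impI)
      show "gr_rep (n - k) n ?X" by (rule grX)
      show "c' * c \<noteq> 0" using c c' by simp
      fix J assume J: "J \<subseteq> {..<n} \<and> card J = n - k"
      then show "pluecker ?X J = c' * c * boundary_measurement (dual_graph G) (\<lambda>e. t e * bsign e) J"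
        using compl(1)[of J] c(2)[OF Diff_subset compl(2), of J] dual_boundary_measurement[of J t] by simp
    qed
  qed
qed

end

theorem theorem4p4:
  fixes G :: disk_graph and k n :: nat
    and \<sigma> :: "complex set \<Rightarrow> int" and t :: "complex set \<Rightarrow> complex"
    and A :: "complex mat" and v :: "complex \<Rightarrow> complex vec"
  assumes "planar_bipartite_disk_graph G"
    and "set (bdry G) \<subseteq> black G"
    and "reduced G"
    and "has_type G k n"
    and "irreducible_positroid n (positroid G)"
    and "kasteleyn_signature G \<sigma>"
    and "\<forall>e \<in> edges G. t e \<noteq> 0"
    and "A \<in> positroid_variety k n (positroid G)"
    and "represents G t k A"
    and "vector_configuration G \<sigma> t (n - k) v"
  shows "A * transpose_mat (boundary_matrix G (n - k) v) = 0\<^sub>m k (n - k) \<and>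
    (\<forall>u. vector_configuration G \<sigma> t (n - k) u \<longrightarrow>
       same_gr_point (n - k) (boundary_matrix G (n - k) v) (boundary_matrix G (n - k) u)) \<and>
    boundary_matrix G (n - k) v \<in> positroid_variety (n - k) n (dual_positroid n (positroid G)) \<and>
    network_represents (dual_graph G) (dual_face_weight G (face_weight G t)) (n - k)
      (boundary_matrix G (n - k) v)"
proof -
  interpret reduced_disk_graph G k n
    using assms(1-5) by unfold_locales
  let ?X = "boundary_matrix G (n - k) v"
  have gr: "gr_rep k n A" using assms(9) len_bdry unfolding represents_def by simp
  have grX: "gr_rep (n - k) n (boundary_matrix G (n - k) u)" if "vector_configuration G \<sigma> t (n - k) u" for u
    by (rule boundary_matrix_gr_rep[OF that])
  have orth: "(\<Sum>j<n. A $$ (r, j) * boundary_matrix G (n - k) u $$ (l, j)) = 0"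
    if "vector_configuration G \<sigma> t (n - k) u" "r < k" "l < n - k" for u r l
    by (rule configuration_orthogonal[OF assms(6,9) that])
  have "A * transpose_mat ?X = 0\<^sub>m k (n - k)"
  proof (rule eq_matI)
    have dims: "dim_row A = k" "dim_col A = n" "dim_row ?X = n - k" "dim_col ?X = n"
      using gr grX[OF assms(10)] unfolding gr_rep_def by auto
    fix r l assume "r < dim_row (0\<^sub>m k (n - k) :: complex mat)" "l < dim_col (0\<^sub>m k (n - k) :: complex mat)"
    then have rl: "r < k" "l < n - k" by auto
    have "(A * transpose_mat ?X) $$ (r, l) = (\<Sum>j<n. A $$ (r, j) * ?X $$ (l, j))"
      using rl dims by (simp add: scalar_prod_def lessThan_atLeast0)
    then show "(A * transpose_mat ?X) $$ (r, l) = 0\<^sub>m k (n - k) $$ (r, l)" using orth[OF assms(10) rl] rl by simp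
  qed (use gr grX[OF assms(10)] in \<open>auto simp: gr_rep_def\<close>)
  moreover have "same_gr_point (n - k) ?X (boundary_matrix G (n - k) u)" if u: "vector_configuration G \<sigma> t (n - k) u" for u
  proof (rule same_kernel_same_point[OF gr grX[OF assms(10)] grX[OF u]])
    show "k + (n - k) = n" using k_le_n by simp
  qed (use orth[OF assms(10)] orth[OF u] in blast)+
  ultimately show ?thesis using configuration_represents_dual[OF assms(6-10)] by blast
qed

end
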